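(* Let $(W,S)$ be a Coxeter system, let $W_0\subseteq W$ be a torsion-free subgroup of finite index $k$, and let $s\in S$ be such that $sW_0s=W_0$. Write $W=\bigsqcup_{i=1}^k w_iW_0$ with $w_1,\dots,w_k\in W$. Define $m:W\to\mathbb{C}$ as follows: for $g=w_ih$ with $1\le i\le k$ and $h\in W_0$, put $m(g)=1$ if $hK\in H_s^+$ and $m(g)=-1$ if $hK\in H_s^-$, where $H_s^{\pm}$ are the roots associated to $s$ and $K$ is the fundamental chamber in the Davis complex of $W$. Then the Fourier multiplier $T_m$ is bounded on $L_p(\mathcal{L}W)$ for every $1<p<\infty$.
   Context: Coxeter systems. $S$ is a finite set, $(\mathrm{m}_{st})_{s,t\in S}$ is a symmetric matrix with $\mathrm{m}_{ss}=1$ and $\mathrm{m}_{st}\in\{2,3,\dots,\infty\}$ for $s\neq t$, and $W=\langle S: (st)^{\mathrm{m}_{st}}=1\rangle$ (no relation when $\mathrm{m}_{st}=\infty$). $l$ is the word length on $W$ with respect to $S$. It is known that every such $W$ has a torsion-free subgroup of finite index, and hence a normal one. Davis complex. For $T\subseteq S$ let $W_T$ be the subgroup generated by $T$. The Davis complex $\Xi(W,S)$ is the geometric realization of the poset $\{wW_T: w\in W, T\subseteq S, W_T\text{ finite}\}$ ordered by inclusion. The fundamental chamber $K$ is the realization of the subposet $\{W_T: W_T \text{ finite}\}$, the chambers are the translates $wK$ ($w\in W$), and $W$ acts by $g\cdot wK=gwK$. The wall $H_s$ is the set of simplices fixed by $s$; it partitions the chambers into two roots interchanged by $s$, $H_s^+$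 being the one containing $K$ and $H_s^-$ the other one. Explicitly, $gK$ belongs to $H_s^+$ iff $l(g)<l(sg)$ and to $H_s^-$ iff $l(g)>l(sg)$. Fourier multipliers. $\mathcal{L}W\subseteq B(\ell_2(W))$ is the group von Neumann algebra generated by the left regular representation $\lambda$, with its canonical trace $\tau(\lambda(f))=f(1)$; $L_p(\mathcal{L}W)$ is the associated non-commutative $L_p$-space, with norm $\|x\|_p=\tau(|x|^p)^{1/p}$. For bounded $m:W\to\mathbb{C}$, $T_m$ is the linear extension of $\lambda(g)\mapsto m(g)\lambda(g)$; it is bounded on $L_p$ if it extends to a bounded operator on $L_p(\mathcal{L}W)$. *)

theory Defs
  imports
    "HOL-Analysis.Analysis"
    "HOL-Algebra.Left_Coset"
    "HOL-Algebra.Generated_Groups"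
    "HOL-Computational_Algebra.Polynomial"
    "HOL-Library.Extended_Nat"
begin

section \<open>Coxeter systems\<close>

text \<open>A word is a list of signed letters: \<open>(s, True)\<close> stands for the letter \<open>s\<close> and
  \<open>(s, False)\<close> for its formal inverse.\<close>

definition words :: "'a set \<Rightarrow> ('a \<times> bool) list set" where
  "words S = lists (S \<times> UNIV)"

definition word_val :: "('a, 'b) monoid_scheme \<Rightarrow> ('a \<times> bool) list \<Rightarrow> 'a" where
  "word_val G u =
     foldr (\<lambda>(s, b) x. (if b then s else inv\<^bsub>G\<^esub> s) \<otimes>\<^bsub>G\<^esub> x) u \<one>\<^bsub>G\<^esub>"

text \<open>The congruence on words whose quotient is the group \<open>\<langle>S | R\<rangle>\<close>: it is generated by
  the free cancellations and by \<open>r \<sim> []\<close> for every relator \<open>r\<close>.\<close>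

inductive word_equiv ::
  "'a set \<Rightarrow> ('a \<times> bool) list set \<Rightarrow> ('a \<times> bool) list \<Rightarrow> ('a \<times> bool) list \<Rightarrow> bool"
  for S R
where
  refl: "word_equiv S R u u"
| sym: "word_equiv S R u v \<Longrightarrow> word_equiv S R v u"
| trans: "word_equiv S R u v \<Longrightarrow> word_equiv S R v w \<Longrightarrow> word_equiv S R u w"
| cancel: "s \<in> S \<Longrightarrow> word_equiv S R (u @ [(s, b), (s, \<not> b)] @ v) (u @ v)"
| relator: "r \<in> R \<Longrightarrow> word_equiv S R (u @ r @ v) (u @ v)"

definition presented_by ::
  "('a, 'b) monoid_scheme \<Rightarrow> 'a set \<Rightarrow> ('a \<times> bool) list set \<Rightarrow> bool" where
  "presented_by G S R \<longleftrightarrow>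
     group G \<and> S \<subseteq> carrier G \<and> R \<subseteq> words S \<and>
     word_val G ` words S = carrier G \<and>
     (\<forall>u\<in>words S. \<forall>v\<in>words S. word_val G u = word_val G v \<longleftrightarrow> word_equiv S R u v)"

definition coxeter_matrix :: "'a set \<Rightarrow> ('a \<Rightarrow> 'a \<Rightarrow> enat) \<Rightarrow> bool" where
  "coxeter_matrix S M \<longleftrightarrow>
     (\<forall>s\<in>S. M s s = 1) \<and>
     (\<forall>s\<in>S. \<forall>t\<in>S. M s t = M t s) \<and>
     (\<forall>s\<in>S. \<forall>t\<in>S. s \<noteq> t \<longrightarrow> 2 \<le> M s t)"

definition coxeter_relators ::
  "'a set \<Rightarrow> ('a \<Rightarrow> 'a \<Rightarrow> enat) \<Rightarrow> ('a \<times> bool) list set" where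
  "coxeter_relators S M =
     {concat (replicate n [(s, True), (t, True)]) | s t n. s \<in> S \<and> t \<in> S \<and> M s t = enat n}"

definition coxeter_system ::
  "('a, 'b) monoid_scheme \<Rightarrow> 'a set \<Rightarrow> ('a \<Rightarrow> 'a \<Rightarrow> enat) \<Rightarrow> bool" where
  "coxeter_system W S M \<longleftrightarrow>
     finite S \<and> coxeter_matrix S M \<and> presented_by W S (coxeter_relators S M)"

text \<open>Since the generators are involutions, words in the letters \<open>S\<close> suffice.\<close>

definition word_length :: "('a, 'b) monoid_scheme \<Rightarrow> 'a set \<Rightarrow> 'a \<Rightarrow> nat" where
  "word_length W S g =
     (LEAST n. \<exists>u\<in>lists S. length u = n \<and> foldr (\<otimes>\<^bsub>W\<^esub>) u \<one>\<^bsub>W\<^esub> = g)"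

definition torsion_free :: "('a, 'b) monoid_scheme \<Rightarrow> 'a set \<Rightarrow> bool" where
  "torsion_free G H \<longleftrightarrow>
     (\<forall>h\<in>H. \<forall>n::nat. n > 0 \<longrightarrow> h [^]\<^bsub>G\<^esub> n = \<one>\<^bsub>G\<^esub> \<longrightarrow> h = \<one>\<^bsub>G\<^esub>)"


section \<open>The Davis complex\<close>

text \<open>The geometric realization of a poset is represented by its order complex: an abstract
  simplex is a nonempty finite chain. Subcomplexes are sets of simplices.\<close>

definition order_complex :: "'a set set \<Rightarrow> 'a set set set" where
  "order_complex P =
     {\<sigma>. \<sigma> \<noteq> {} \<and> finite \<sigma> \<and> \<sigma> \<subseteq> P \<and> (\<forall>A\<in>\<sigma>. \<forall>B\<in>\<sigma>. A \<subseteq> B \<or> B \<subseteq> A)}"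

definition finite_special_subgroups :: "('a, 'b) monoid_scheme \<Rightarrow> 'a set \<Rightarrow> 'a set set" where
  "finite_special_subgroups W S = {generate W T | T. T \<subseteq> S \<and> finite (generate W T)}"

definition davis_complex :: "('a, 'b) monoid_scheme \<Rightarrow> 'a set \<Rightarrow> 'a set set set" where
  "davis_complex W S =
     order_complex {w <#\<^bsub>W\<^esub> P | w P. w \<in> carrier W \<and> P \<in> finite_special_subgroups W S}"

definition fundamental_chamber :: "('a, 'b) monoid_scheme \<Rightarrow> 'a set \<Rightarrow> 'a set set set" where
  "fundamental_chamber W S =
     {\<sigma> \<in> davis_complex W S. \<sigma> \<subseteq> finite_special_subgroups W S}"

definition act_simplex :: "('a, 'b) monoid_scheme \<Rightarrow> 'a \<Rightarrow> 'a set set \<Rightarrow> 'a set set" where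
  "act_simplex W g \<sigma> = (\<lambda>A. g <#\<^bsub>W\<^esub> A) ` \<sigma>"

definition chamber :: "('a, 'b) monoid_scheme \<Rightarrow> 'a set \<Rightarrow> 'a \<Rightarrow> 'a set set set" where
  "chamber W S g = act_simplex W g ` fundamental_chamber W S"

text \<open>The two roots of the wall of \<open>s\<close>, as sets of chambers, in their explicit description by
  the word length. A chamber determines its group element, because the only singleton coset
  among its vertices is \<open>{g}\<close>.\<close>

definition pos_root :: "('a, 'b) monoid_scheme \<Rightarrow> 'a set \<Rightarrow> 'a \<Rightarrow> 'a set set set set" where
  "pos_root W S s =
     {chamber W S g | g. g \<in> carrier W \<and> word_length W S g < word_length W S (s \<otimes>\<^bsub>W\<^esub> g)}"

definition neg_root :: "('a, 'b) monoid_scheme \<Rightarrow> 'a set \<Rightarrow> 'a \<Rightarrow> 'a set set set set" where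
  "neg_root W S s =
     {chamber W S g | g. g \<in> carrier W \<and> word_length W S g > word_length W S (s \<otimes>\<^bsub>W\<^esub> g)}"


section \<open>The complex Hilbert space of square-summable functions\<close>

typedef 'a ell2 = "{f :: 'a \<Rightarrow> complex. (\<lambda>x. (cmod (f x))\<^sup>2) summable_on UNIV}"
  morphisms ell2_fun Abs_ell2
  by (rule exI[of _ "\<lambda>_. 0"]) simp

setup_lifting type_definition_ell2

lemma ell2_summable: "(\<lambda>x. (cmod (ell2_fun f x))\<^sup>2) summable_on UNIV"
  using ell2_fun by blast

lemma ell2_mult_abs_summable:
  "(\<lambda>x. norm (cnj (ell2_fun f x) * ell2_fun g x)) summable_on UNIV"
proof (rule summable_on_comparison_test)
  show "(\<lambda>x. (cmod (ell2_fun f x))\<^sup>2 + (cmod (ell2_fun g x))\<^sup>2) summable_on UNIV"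
    by (intro summable_on_add ell2_summable)
  fix x
  have "cmod (ell2_fun f x) * cmod (ell2_fun g x)
      \<le> (cmod (ell2_fun f x))\<^sup>2 + (cmod (ell2_fun g x))\<^sup>2"
    using sum_squares_bound[of "cmod (ell2_fun f x)" "cmod (ell2_fun g x)"]
      mult_nonneg_nonneg[OF norm_ge_zero norm_ge_zero, of "ell2_fun f x" "ell2_fun g x"]
    by linarith
  then show "norm (cnj (ell2_fun f x) * ell2_fun g x)
      \<le> (cmod (ell2_fun f x))\<^sup>2 + (cmod (ell2_fun g x))\<^sup>2"
    by (simp add: norm_mult)
qed auto

lemma ell2_mult_summable: "(\<lambda>x. cnj (ell2_fun f x) * ell2_fun g x) summable_on UNIV"
  using ell2_mult_abs_summable by (rule Infinite_Sum.abs_summable_summable)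

lemma ell2_add_closed:
  assumes "(\<lambda>x. (cmod (f x))\<^sup>2) summable_on UNIV" "(\<lambda>x. (cmod (g x))\<^sup>2) summable_on UNIV"
  shows "(\<lambda>x. (cmod (f x + g x))\<^sup>2) summable_on UNIV"
proof (rule summable_on_comparison_test)
  show "(\<lambda>x. 2 * (cmod (f x))\<^sup>2 + 2 * (cmod (g x))\<^sup>2) summable_on UNIV"
    by (intro summable_on_add summable_on_cmult_right assms)
  fix x
  have "(cmod (f x + g x))\<^sup>2 \<le> (cmod (f x) + cmod (g x))\<^sup>2"
    by (intro power_mono norm_triangle_ineq) auto
  also have "\<dots> \<le> 2 * (cmod (f x))\<^sup>2 + 2 * (cmod (g x))\<^sup>2"
    using sum_squares_bound[of "cmod (f x)" "cmod (g x)"] by (simp add: power2_sum)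
  finally show "(cmod (f x + g x))\<^sup>2 \<le> 2 * (cmod (f x))\<^sup>2 + 2 * (cmod (g x))\<^sup>2" .
qed auto

lemma ell2_scale_closed:
  assumes "(\<lambda>x. (cmod (f x))\<^sup>2) summable_on UNIV"
  shows "(\<lambda>x. (cmod (c * f x))\<^sup>2) summable_on UNIV"
  using summable_on_cmult_right[OF assms, of "(cmod c)\<^sup>2"]
  by (simp add: norm_mult power_mult_distrib)

lift_definition scaleC_ell2 :: "complex \<Rightarrow> 'a ell2 \<Rightarrow> 'a ell2" is "\<lambda>c f x. c * f x"
  by (rule ell2_scale_closed)

text \<open>Conjugate-linear in the first argument.\<close>

definition cinner :: "'a ell2 \<Rightarrow> 'a ell2 \<Rightarrow> complex" where
  "cinner f g = (\<Sum>\<^sub>\<infinity>x. cnj (ell2_fun f x) * ell2_fun g x)"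

instantiation ell2 :: (type) real_vector
begin

lift_definition zero_ell2 :: "'a ell2" is "\<lambda>_. 0" by simp

lift_definition plus_ell2 :: "'a ell2 \<Rightarrow> 'a ell2 \<Rightarrow> 'a ell2" is "\<lambda>f g x. f x + g x"
  by (rule ell2_add_closed)

lift_definition uminus_ell2 :: "'a ell2 \<Rightarrow> 'a ell2" is "\<lambda>f x. - f x" by simp

definition minus_ell2 :: "'a ell2 \<Rightarrow> 'a ell2 \<Rightarrow> 'a ell2" where
  "minus_ell2 f g = f + (- g)"

definition scaleR_ell2 :: "real \<Rightarrow> 'a ell2 \<Rightarrow> 'a ell2" where
  "scaleR_ell2 r = scaleC_ell2 (of_real r)"

instance
  by standard
    (unfold minus_ell2_def scaleR_ell2_def, (transfer, simp add: algebra_simps)+)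

end

instantiation ell2 :: (type) real_inner
begin

definition inner_ell2 :: "'a ell2 \<Rightarrow> 'a ell2 \<Rightarrow> real" where
  "inner_ell2 f g = Re (cinner f g)"

definition norm_ell2 :: "'a ell2 \<Rightarrow> real" where
  "norm_ell2 f = sqrt (f \<bullet> f)"

definition dist_ell2 :: "'a ell2 \<Rightarrow> 'a ell2 \<Rightarrow> real" where
  "dist_ell2 f g = norm (f - g)"

definition sgn_ell2 :: "'a ell2 \<Rightarrow> 'a ell2" where
  "sgn_ell2 f = f /\<^sub>R norm f"

definition uniformity_ell2 :: "('a ell2 \<times> 'a ell2) filter" where
  "uniformity_ell2 = (INF e\<in>{0<..}. principal {(f, g). dist f g < e})"

definition open_ell2 :: "'a ell2 set \<Rightarrow> bool" where
  "open_ell2 U = (\<forall>f\<in>U. \<forall>\<^sub>F (f', g) in uniformity. f' = f \<longrightarrow> g \<in> U)"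

instance
proof
  fix f g h :: "'a ell2" and r :: real
  have self: "f \<bullet> f = (\<Sum>\<^sub>\<infinity>x. (cmod (ell2_fun f x))\<^sup>2)" for f :: "'a ell2"
    using infsum_Re[OF ell2_mult_summable[of f f]]
    by (simp add: inner_ell2_def cinner_def cmod_power2) (simp add: power2_eq_square)
  show "dist f g = norm (f - g)"
    by (fact dist_ell2_def)
  show "sgn f = f /\<^sub>R norm f"
    by (fact sgn_ell2_def)
  show "(uniformity :: ('a ell2 \<times> 'a ell2) filter)
      = (INF e\<in>{0<..}. principal {(f, g). dist f g < e})"
    by (fact uniformity_ell2_def)
  show "open U \<longleftrightarrow> (\<forall>f\<in>U. \<forall>\<^sub>F (f', g) in uniformity. f' = f \<longrightarrow> g \<in> U)" for U :: "'a ell2 set"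
    by (fact open_ell2_def)
  show "norm f = sqrt (f \<bullet> f)"
    by (fact norm_ell2_def)
  have "cinner g f = cnj (cinner f g)"
    unfolding cinner_def infsum_cnj[symmetric] by (simp add: mult.commute)
  then show "f \<bullet> g = g \<bullet> f"
    by (simp add: inner_ell2_def)
  have "cinner (f + g) h = cinner f h + cinner g h"
    unfolding cinner_def plus_ell2.rep_eq complex_cnj_add distrib_right
    by (intro infsum_add ell2_mult_summable)
  then show "(f + g) \<bullet> h = f \<bullet> h + g \<bullet> h"
    by (simp add: inner_ell2_def)
  have "cinner (r *\<^sub>R f) g = of_real r * cinner f g"
    unfolding cinner_def scaleR_ell2_def scaleC_ell2.rep_eq
    by (simp add: mult.assoc infsum_cmult_right')
  then show "(r *\<^sub>R f) \<bullet> g = r * (f \<bullet> g)"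
    by (simp add: inner_ell2_def)
  show "0 \<le> f \<bullet> f"
    unfolding self by (rule infsum_nonneg) simp
  show "f \<bullet> f = 0 \<longleftrightarrow> f = 0"
  proof
    assume "f \<bullet> f = 0"
    then have le: "(\<Sum>\<^sub>\<infinity>x. (cmod (ell2_fun f x))\<^sup>2) \<le> 0"
      by (simp only: self)
    have "(cmod (ell2_fun f x))\<^sup>2 = 0" for x
      by (rule nonneg_infsum_le_0D[OF le ell2_summable]) simp_all
    then show "f = 0"
      by (simp add: ell2_fun_inject[symmetric] zero_ell2.rep_eq fun_eq_iff)
  qed (simp add: self zero_ell2.rep_eq)
qed

end

lemma norm_ell2_square: "(norm f)\<^sup>2 = (\<Sum>\<^sub>\<infinity>x. (cmod (ell2_fun f x))\<^sup>2)"
  using infsum_Re[OF ell2_mult_summable[of f f]]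
  unfolding power2_norm_eq_inner[of f] inner_ell2_def cinner_def
  by (simp add: cmod_power2) (simp add: power2_eq_square)

lemma bounded_linear_scaleC_ell2: "bounded_linear (scaleC_ell2 c)"
proof (rule bounded_linear_intro[where K = "cmod c"])
  fix f g :: "'a ell2" and r :: real
  show "scaleC_ell2 c (f + g) = scaleC_ell2 c f + scaleC_ell2 c g"
    by transfer (simp add: algebra_simps)
  show "scaleC_ell2 c (r *\<^sub>R f) = r *\<^sub>R scaleC_ell2 c f"
    unfolding scaleR_ell2_def by transfer (simp add: algebra_simps)
  have "(norm (scaleC_ell2 c f))\<^sup>2 = (\<Sum>\<^sub>\<infinity>x. (cmod c)\<^sup>2 * (cmod (ell2_fun f x))\<^sup>2)"
    unfolding norm_ell2_square by (simp only: scaleC_ell2.rep_eq norm_mult power_mult_distrib)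
  also have "\<dots> = (norm f * cmod c)\<^sup>2"
    by (simp only: infsum_cmult_right' norm_ell2_square power_mult_distrib mult.commute)
  finally have "(norm (scaleC_ell2 c f))\<^sup>2 = (norm f * cmod c)\<^sup>2" .
  then show "norm (scaleC_ell2 c f) \<le> norm f * cmod c"
    using power2_le_imp_le[OF eq_refl] by simp
qed

lift_definition delta :: "'a \<Rightarrow> 'a ell2" is "\<lambda>a x. if x = a then 1 else 0"
proof -
  fix a :: 'a
  have "(\<lambda>x. (cmod (if x = a then 1 else 0))\<^sup>2) summable_on {a}"
    by (rule summable_on_finite) simp
  then show "(\<lambda>x. (cmod (if x = a then 1 else 0))\<^sup>2) summable_on UNIV"
    by (rule summable_on_cong_neutral[THEN iffD1, rotated -1]) auto
qed


section \<open>Operators\<close>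

text \<open>Bounded real-linear maps are the library type of continuous linear maps; complex linearity
  is a side condition.\<close>

type_synonym 'a op = "'a ell2 \<Rightarrow>\<^sub>L 'a ell2"

definition scaleC_op :: "complex \<Rightarrow> 'a op \<Rightarrow> 'a op" where
  "scaleC_op c x = Blinfun (scaleC_ell2 c) o\<^sub>L x"

lemma scaleC_op_apply:
  "blinfun_apply (scaleC_op c x) f = scaleC_ell2 c (blinfun_apply x f)"
  by (simp add: scaleC_op_def bounded_linear_Blinfun_apply[OF bounded_linear_scaleC_ell2])

text \<open>\<open>\<B>(\<ell>\<^sub>2(A))\<close>, where \<open>\<ell>\<^sub>2(A)\<close> is the subspace of functions vanishing outside \<open>A\<close>, and an
  operator on it is extended by \<open>0\<close> to the orthogonal complement.\<close>

definition bounded_ops :: "'a set \<Rightarrow> 'a op set" where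
  "bounded_ops A =
     {x. (\<forall>c f. blinfun_apply x (scaleC_ell2 c f) = scaleC_ell2 c (blinfun_apply x f)) \<and>
         (\<forall>f. \<forall>a. a \<notin> A \<longrightarrow> ell2_fun (blinfun_apply x f) a = 0) \<and>
         (\<forall>f. (\<forall>a\<in>A. ell2_fun f a = 0) \<longrightarrow> blinfun_apply x f = 0)}"

definition adj_op :: "'a op \<Rightarrow> 'a op" where
  "adj_op x = (THE y. \<forall>f g. cinner (blinfun_apply y f) g = cinner f (blinfun_apply x g))"

definition poly_op :: "real poly \<Rightarrow> 'a op \<Rightarrow> 'a op" where
  "poly_op q x = (\<Sum>i\<le>degree q. coeff q i *\<^sub>R (((o\<^sub>L) x ^^ i) id_blinfun))"

text \<open>Continuous functional calculus of a positive operator \<open>x\<close>, whose spectrum lies in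
  \<open>{0..norm x}\<close>, by uniform approximation with polynomials.\<close>

definition fun_calc :: "(real \<Rightarrow> real) \<Rightarrow> 'a op \<Rightarrow> 'a op" where
  "fun_calc \<phi> x =
     (THE y. \<exists>q :: nat \<Rightarrow> real poly.
        uniform_limit {0..norm x} (\<lambda>n. poly (q n)) \<phi> sequentially \<and>
        (\<lambda>n. poly_op (q n) x) \<longlonglongrightarrow> y)"

definition abs_op :: "'a op \<Rightarrow> 'a op" where
  "abs_op x = fun_calc sqrt (adj_op x o\<^sub>L x)"


section \<open>The group von Neumann algebra and its noncommutative \<open>L\<^sub>p\<close>-spaces\<close>

definition left_reg :: "('a, 'b) monoid_scheme \<Rightarrow> 'a \<Rightarrow> 'a op" where
  "left_reg W g =
     Blinfun (\<lambda>f. Abs_ell2 (\<lambda>x. if x \<in> carrier W then ell2_fun f (inv\<^bsub>W\<^esub> g \<otimes>\<^bsub>W\<^esub> x) else 0))"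

lemma left_reg_apply:
  assumes "group W" "g \<in> carrier W"
  shows "ell2_fun (blinfun_apply (left_reg W g) f) x =
    (if x \<in> carrier W then ell2_fun f (inv\<^bsub>W\<^esub> g \<otimes>\<^bsub>W\<^esub> x) else 0)"
proof -
  interpret group W by fact
  define sh where "sh f x = (if x \<in> carrier W then ell2_fun f (inv\<^bsub>W\<^esub> g \<otimes>\<^bsub>W\<^esub> x) else 0)"
    for f :: "'a ell2" and x
  have inj: "inj_on (\<lambda>x. inv\<^bsub>W\<^esub> g \<otimes>\<^bsub>W\<^esub> x) (carrier W)"
    using assms(2) by (intro inj_on_cmult) simp
  have img: "(\<lambda>x. inv\<^bsub>W\<^esub> g \<otimes>\<^bsub>W\<^esub> x) ` carrier W = carrier W"
    using assms(2) by (intro surj_const_mult) simp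
  have on: "(\<lambda>y. (cmod (ell2_fun f y))\<^sup>2) summable_on carrier W" for f :: "'a ell2"
    using summable_on_subset_banach[OF ell2_summable[of f]] by blast
  have "(\<lambda>x. (cmod (ell2_fun f (inv\<^bsub>W\<^esub> g \<otimes>\<^bsub>W\<^esub> x)))\<^sup>2) summable_on carrier W" for f
    using summable_on_reindex[OF inj, of "\<lambda>y. (cmod (ell2_fun f y))\<^sup>2"] on[of f]
    by (simp add: img o_def)
  moreover have "(\<lambda>x. (cmod (sh f x))\<^sup>2) summable_on UNIV \<longleftrightarrow>
      (\<lambda>x. (cmod (ell2_fun f (inv\<^bsub>W\<^esub> g \<otimes>\<^bsub>W\<^esub> x)))\<^sup>2) summable_on carrier W" for f
    by (rule summable_on_cong_neutral) (simp_all add: sh_def)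
  ultimately have sum: "(\<lambda>x. (cmod (sh f x))\<^sup>2) summable_on UNIV" for f
    by blast
  have rep: "ell2_fun (Abs_ell2 (sh f)) = sh f" for f
    using sum by (intro Abs_ell2_inverse) simp
  have eq: "(\<Sum>\<^sub>\<infinity>x. (cmod (sh f x))\<^sup>2) = (\<Sum>\<^sub>\<infinity>y\<in>carrier W. (cmod (ell2_fun f y))\<^sup>2)" for f
  proof -
    have "(\<Sum>\<^sub>\<infinity>x. (cmod (sh f x))\<^sup>2)
        = (\<Sum>\<^sub>\<infinity>x\<in>carrier W. (cmod (ell2_fun f (inv\<^bsub>W\<^esub> g \<otimes>\<^bsub>W\<^esub> x)))\<^sup>2)"
      by (rule infsum_cong_neutral) (simp_all add: sh_def)
    then show ?thesis
      using infsum_reindex[OF inj, of "\<lambda>y. (cmod (ell2_fun f y))\<^sup>2"] by (simp add: img o_def)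
  qed
  have "bounded_linear (\<lambda>f. Abs_ell2 (sh f))"
  proof (rule bounded_linear_intro[where K = 1])
    fix f h :: "'a ell2" and r :: real
    show "Abs_ell2 (sh (f + h)) = Abs_ell2 (sh f) + Abs_ell2 (sh h)"
      by (simp add: ell2_fun_inject[symmetric] rep plus_ell2.rep_eq)
        (auto simp: sh_def plus_ell2.rep_eq)
    show "Abs_ell2 (sh (r *\<^sub>R f)) = r *\<^sub>R Abs_ell2 (sh f)"
      by (simp add: ell2_fun_inject[symmetric] rep scaleR_ell2_def scaleC_ell2.rep_eq)
        (auto simp: sh_def scaleC_ell2.rep_eq)
    have "(norm (Abs_ell2 (sh f)))\<^sup>2 \<le> (norm f)\<^sup>2"
      unfolding norm_ell2_square rep eq
      by (rule infsum_mono2[OF on ell2_summable]) simp_all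
    then show "norm (Abs_ell2 (sh f)) \<le> norm f * 1"
      using power2_le_imp_le[OF _ norm_ge_zero] by simp
  qed
  then have "blinfun_apply (left_reg W g) f = Abs_ell2 (sh f)"
    unfolding left_reg_def sh_def[abs_def] by (simp only: bounded_linear_Blinfun_apply)
  then show ?thesis
    by (simp only: rep) (simp only: sh_def)
qed

definition commutant :: "'a set \<Rightarrow> 'a op set \<Rightarrow> 'a op set" where
  "commutant A X = {y \<in> bounded_ops A. \<forall>x\<in>X. x o\<^sub>L y = y o\<^sub>L x}"

text \<open>The von Neumann algebra generated by the (self-adjoint) set of operators \<open>\<lambda>(g)\<close> is its
  bicommutant.\<close>

definition group_vN :: "('a, 'b) monoid_scheme \<Rightarrow> 'a op set" where
  "group_vN W = commutant (carrier W) (commutant (carrier W) (left_reg W ` carrier W))"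

definition trace_vN :: "('a, 'b) monoid_scheme \<Rightarrow> 'a op \<Rightarrow> complex" where
  "trace_vN W x = cinner (delta \<one>\<^bsub>W\<^esub>) (blinfun_apply x (delta \<one>\<^bsub>W\<^esub>))"

definition lp_norm_vN :: "('a, 'b) monoid_scheme \<Rightarrow> real \<Rightarrow> 'a op \<Rightarrow> real" where
  "lp_norm_vN W p x = Re (trace_vN W (fun_calc (\<lambda>t. t powr p) (abs_op x))) powr (1 / p)"

text \<open>\<open>L\<^sub>p(\<L>W)\<close> is the completion of \<open>\<L>W\<close> with respect to \<open>lp_norm_vN W p\<close>, realized as
  Cauchy sequences modulo null sequences.\<close>

definition lp_cauchy :: "('a, 'b) monoid_scheme \<Rightarrow> real \<Rightarrow> (nat \<Rightarrow> 'a op) set" where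
  "lp_cauchy W p =
     {X. (\<forall>n. X n \<in> group_vN W) \<and>
         (\<forall>e>0. \<exists>N. \<forall>i\<ge>N. \<forall>j\<ge>N. lp_norm_vN W p (X i - X j) < e)}"

definition lp_rel ::
  "('a, 'b) monoid_scheme \<Rightarrow> real \<Rightarrow> ((nat \<Rightarrow> 'a op) \<times> (nat \<Rightarrow> 'a op)) set" where
  "lp_rel W p =
     {(X, Y). X \<in> lp_cauchy W p \<and> Y \<in> lp_cauchy W p \<and>
              (\<lambda>n. lp_norm_vN W p (X n - Y n)) \<longlonglongrightarrow> 0}"

definition Lp :: "('a, 'b) monoid_scheme \<Rightarrow> real \<Rightarrow> (nat \<Rightarrow> 'a op) set set" where
  "Lp W p = lp_cauchy W p // lp_rel W p"

definition Lp_class ::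
  "('a, 'b) monoid_scheme \<Rightarrow> real \<Rightarrow> (nat \<Rightarrow> 'a op) \<Rightarrow> (nat \<Rightarrow> 'a op) set" where
  "Lp_class W p X = lp_rel W p `` {X}"

definition Lp_embed :: "('a, 'b) monoid_scheme \<Rightarrow> real \<Rightarrow> 'a op \<Rightarrow> (nat \<Rightarrow> 'a op) set" where
  "Lp_embed W p x = Lp_class W p (\<lambda>_. x)"

definition Lp_add ::
  "('a, 'b) monoid_scheme \<Rightarrow> real \<Rightarrow> (nat \<Rightarrow> 'a op) set \<Rightarrow> (nat \<Rightarrow> 'a op) set \<Rightarrow>
   (nat \<Rightarrow> 'a op) set" where
  "Lp_add W p \<xi> \<eta> = (\<Union>X\<in>\<xi>. \<Union>Y\<in>\<eta>. Lp_class W p (\<lambda>n. X n + Y n))"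

definition Lp_scale ::
  "('a, 'b) monoid_scheme \<Rightarrow> real \<Rightarrow> complex \<Rightarrow> (nat \<Rightarrow> 'a op) set \<Rightarrow> (nat \<Rightarrow> 'a op) set" where
  "Lp_scale W p c \<xi> = (\<Union>X\<in>\<xi>. Lp_class W p (\<lambda>n. scaleC_op c (X n)))"

definition Lp_norm :: "('a, 'b) monoid_scheme \<Rightarrow> real \<Rightarrow> (nat \<Rightarrow> 'a op) set \<Rightarrow> real" where
  "Lp_norm W p \<xi> = (THE r. \<forall>X\<in>\<xi>. (\<lambda>n. lp_norm_vN W p (X n)) \<longlonglongrightarrow> r)"

definition Lp_bounded_operator ::
  "('a, 'b) monoid_scheme \<Rightarrow> real \<Rightarrow> ((nat \<Rightarrow> 'a op) set \<Rightarrow> (nat \<Rightarrow> 'a op) set) \<Rightarrow> bool" where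
  "Lp_bounded_operator W p T \<longleftrightarrow>
     (\<forall>\<xi>\<in>Lp W p. T \<xi> \<in> Lp W p) \<and>
     (\<forall>\<xi>\<in>Lp W p. \<forall>\<eta>\<in>Lp W p. T (Lp_add W p \<xi> \<eta>) = Lp_add W p (T \<xi>) (T \<eta>)) \<and>
     (\<forall>c. \<forall>\<xi>\<in>Lp W p. T (Lp_scale W p c \<xi>) = Lp_scale W p c (T \<xi>)) \<and>
     (\<exists>C. \<forall>\<xi>\<in>Lp W p. Lp_norm W p (T \<xi>) \<le> C * Lp_norm W p \<xi>)"

definition multiplier_bounded ::
  "('a, 'b) monoid_scheme \<Rightarrow> real \<Rightarrow> ('a \<Rightarrow> complex) \<Rightarrow> bool" where
  "multiplier_bounded W p m \<longleftrightarrow>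
     (\<exists>T. Lp_bounded_operator W p T \<and>
          (\<forall>F f. finite F \<longrightarrow> F \<subseteq> carrier W \<longrightarrow>
             T (Lp_embed W p (\<Sum>g\<in>F. scaleC_op (f g) (left_reg W g))) =
             Lp_embed W p (\<Sum>g\<in>F. scaleC_op (m g * f g) (left_reg W g))))"

end

(* For h in W0 let mu(h) = 1 or -1 according to the side of the wall of s on which hK lies. If g in W0
does not commute with s, then the element g^-1 s g s of W0 is nontrivial, hence of infinite order, so s
and g^-1 s g generate an infinite dihedral group and their walls are disjoint. Such walls divide the
chambers into only three parts, and therefore (mu(g^-1) - mu(h)) (mu(gh) - mu(g)) = 0 for all h in W0;
if g commutes with s, then mu(gh) = mu(g) mu(h). This is Cotlar's identity for mu relative to the
centralizer of s. If C and X are the norms of T_mu on L_p(W0) and L_2p(W0), it gives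
X^2 <= 16 C X + C + 2 C^2, so T_mu is bounded on L_p(W0) for all p = 2^n. Since m is a sum of
k translates of mu by coset representatives, T_m is bounded on L_p(W) for p = 2^n, then for all
p > 2 by complex interpolation, and for 1 < p < 2 by duality because m is real. *)
theory Submission
  imports Defs "HOL-Complex_Analysis.Complex_Analysis" "HOL-Real_Asymp.Real_Asymp"
begin

section \<open>The Hilbert space of square-summable functions\<close>

text \<open>Powers in the norms are defined by polynomial approximation, so the proof stays within
  continuous functional calculus: positivity comes from Bernstein polynomials, Hoelder's inequality
  and interpolation from the three lines theorem for a factorization x = v exp L of a regularized
  modulus. On the centralizer of s Cotlar's condition can fail and \<mu> is multiplicative instead;
  the two cases are separated by the conditional expectation onto the centralizer, which contracts
  every p-norm. The constant 16 is 4 * 2 * 2: the 4 comes from a Hoelder bound obtained by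
  polarization, one 2 from a term and its adjoint, the other 2 from subtracting an expectation.
  Disjointness of the walls is proved with signs: a panel of the wall of s beyond the wall of the
  reflection r would make infinitely many walls separate the chambers of 1 and r, whereas a word
  crosses only finitely many.\<close>

lemma ell2_eqI: "(\<And>a. ell2_fun f a = ell2_fun g a) \<Longrightarrow> f = g"
  by (simp add: ell2_fun_inject[symmetric] fun_eq_iff)

lemma ell2_fun_add: "ell2_fun (f + g) a = ell2_fun f a + ell2_fun g a"
  by transfer simp

lemma ell2_fun_minus: "ell2_fun (- f) a = - ell2_fun f a"
  by transfer simp

lemma ell2_fun_diff: "ell2_fun (f - g) a = ell2_fun f a - ell2_fun g a"
  unfolding minus_ell2_def ell2_fun_add ell2_fun_minus by simp

lemma ell2_fun_scaleC: "ell2_fun (scaleC_ell2 c f) a = c * ell2_fun f a"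
  by transfer simp

lemma ell2_fun_scaleR: "ell2_fun (r *\<^sub>R f) a = of_real r * ell2_fun f a"
  by (simp add: scaleR_ell2_def ell2_fun_scaleC)

lemma ell2_fun_zero: "ell2_fun 0 a = 0"
  by transfer simp

lemma ell2_fun_delta: "ell2_fun (delta a) b = (if b = a then 1 else 0)"
  by transfer simp

lemma ell2_fun_sum: "ell2_fun (\<Sum>i\<in>I. f i) a = (\<Sum>i\<in>I. ell2_fun (f i) a)"
  by (induction I rule: infinite_finite_induct) (simp_all add: ell2_fun_zero ell2_fun_add)

lemmas ell2_fun_simps = ell2_fun_add ell2_fun_minus ell2_fun_diff ell2_fun_scaleC
  ell2_fun_scaleR ell2_fun_zero ell2_fun_delta ell2_fun_sum

lemma cinner_add_right: "cinner f (g + h) = cinner f g + cinner f h"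
  unfolding cinner_def ell2_fun_add distrib_left by (intro infsum_add ell2_mult_summable)

lemma cinner_add_left: "cinner (f + g) h = cinner f h + cinner g h"
  unfolding cinner_def ell2_fun_add complex_cnj_add distrib_right
  by (intro infsum_add ell2_mult_summable)

lemma cinner_scaleC_right: "cinner f (scaleC_ell2 c g) = c * cinner f g"
  unfolding cinner_def ell2_fun_scaleC by (simp add: mult.left_commute infsum_cmult_right')

lemma cinner_scaleC_left: "cinner (scaleC_ell2 c f) g = cnj c * cinner f g"
  unfolding cinner_def ell2_fun_scaleC by (simp add: mult.assoc infsum_cmult_right')

lemma cinner_commute: "cinner g f = cnj (cinner f g)"
  unfolding cinner_def infsum_cnj[symmetric] by (simp add: mult.commute)

lemma scaleR_ell2_scaleC: "r *\<^sub>R f = scaleC_ell2 (of_real r) f"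
  by (simp add: scaleR_ell2_def)

lemma cinner_scaleR_right: "cinner f (r *\<^sub>R g) = of_real r * cinner f g"
  by (simp add: scaleR_ell2_scaleC cinner_scaleC_right)

lemma cinner_zero_right [simp]: "cinner f 0 = 0"
  by (simp add: cinner_def ell2_fun_zero)

lemma cinner_zero_left [simp]: "cinner 0 f = 0"
  by (simp add: cinner_def ell2_fun_zero)

lemma cinner_minus_right: "cinner f (- g) = - cinner f g"
  using cinner_scaleC_right[of f "-1" g] cinner_add_right[of f g "-g"]
  by (metis add.right_inverse add_eq_0_iff cinner_zero_right)

lemma cinner_diff_right: "cinner f (g - h) = cinner f g - cinner f h"
  by (metis ab_group_add_class.ab_diff_conv_add_uminus cinner_add_right cinner_minus_right)

lemma cinner_diff_left: "cinner (g - h) f = cinner g f - cinner h f"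
  by (metis cinner_commute cinner_diff_right complex_cnj_diff)

lemma cinner_delta_left: "cinner (delta a) f = ell2_fun f a"
proof -
  have "cinner (delta a) f = (\<Sum>\<^sub>\<infinity>x\<in>{a}. cnj (ell2_fun (delta a) x) * ell2_fun f x)"
    unfolding cinner_def by (rule infsum_cong_neutral) (auto simp: ell2_fun_delta)
  then show ?thesis
    by (simp add: ell2_fun_delta)
qed

lemma cinner_self: "cinner f f = of_real ((norm f)\<^sup>2)"
proof -
  have "Im (cinner f f) = Im (cnj (cinner f f))"
    by (simp only: cinner_commute[of f f, symmetric])
  then have "Im (cinner f f) = 0"
    by simp
  moreover have "Re (cinner f f) = (norm f)\<^sup>2"
    by (simp add: power2_norm_eq_inner inner_ell2_def)
  ultimately show ?thesis
    by (simp add: complex_eq_iff)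
qed

lemma norm_scaleC_ell2: "norm (scaleC_ell2 c f) = cmod c * norm f"
proof -
  have "complex_of_real ((norm (scaleC_ell2 c f))\<^sup>2) = of_real ((cmod c * norm f)\<^sup>2)"
    unfolding cinner_self[symmetric] cinner_scaleC_left cinner_scaleC_right
    by (simp add: cinner_self power_mult_distrib mult.assoc[symmetric] complex_norm_square[symmetric, unfolded of_real_power])
  then have "(norm (scaleC_ell2 c f))\<^sup>2 = (cmod c * norm f)\<^sup>2"
    by (simp only: of_real_eq_iff)
  then show ?thesis
    by (simp add: power2_eq_iff_nonneg)
qed

text \<open>The unimodular c rotates the phase of \<open>cinner f g\<close> away, which reduces the
  complex inequality to the one for the real inner product.\<close>

lemma cinner_Cauchy_Schwarz: "cmod (cinner f g) \<le> norm f * norm g"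
proof (cases "cinner f g = 0")
  case False
  define c where "c = cnj (sgn (cinner f g))"
  have c: "cmod c = 1"
    using False by (simp add: c_def norm_sgn)
  have "c * cinner f g = of_real (cmod (cinner f g))"
    using complex_norm_square[of "cinner f g"] False
    by (simp add: c_def sgn_eq field_simps power2_eq_square)
  then have "cmod (cinner f g) = f \<bullet> scaleC_ell2 c g"
    by (simp add: inner_ell2_def cinner_scaleC_right)
  also have "\<dots> \<le> norm f * norm (scaleC_ell2 c g)"
    by (rule norm_cauchy_schwarz)
  finally show ?thesis
    by (simp add: norm_scaleC_ell2 c)
qed simp

lemma norm_delta [simp]: "norm (delta a) = 1"
proof -
  have "complex_of_real ((norm (delta a))\<^sup>2) = of_real (1\<^sup>2)"
    using cinner_self[of "delta a"] by (simp add: cinner_delta_left ell2_fun_delta)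
  then have "(norm (delta a))\<^sup>2 = 1\<^sup>2"
    by (simp only: of_real_eq_iff)
  then show ?thesis
    by (subst (asm) power2_eq_iff_nonneg) simp_all
qed

lemma norm_ell2_fun_le: "cmod (ell2_fun f a) \<le> norm f"
  using cinner_Cauchy_Schwarz[of "delta a" f] by (simp add: cinner_delta_left)

text \<open>The device by which vectors are built from coordinates: a uniform bound on finite
  partial sums gives membership in the space and the norm bound at once. Completeness, adjoints and
  multiplication operators all rest on it.\<close>

lemma ell2_bounded_sums:
  fixes h :: "'a \<Rightarrow> complex"
  assumes "\<And>F. finite F \<Longrightarrow> (\<Sum>x\<in>F. (cmod (h x))\<^sup>2) \<le> B\<^sup>2" and "0 \<le> B"
  shows "(\<lambda>x. (cmod (h x))\<^sup>2) summable_on UNIV" and "norm (Abs_ell2 h) \<le> B"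
proof -
  show s: "(\<lambda>x. (cmod (h x))\<^sup>2) summable_on UNIV"
  proof (rule nonneg_bdd_above_summable_on)
    show "bdd_above (sum (\<lambda>x. (cmod (h x))\<^sup>2) ` {F. F \<subseteq> UNIV \<and> finite F})"
      using assms by (intro bdd_aboveI2[of _ _ "B\<^sup>2"]) auto
  qed auto
  have "(norm (Abs_ell2 h))\<^sup>2 = (\<Sum>\<^sub>\<infinity>x. (cmod (h x))\<^sup>2)"
    using s by (simp add: norm_ell2_square Abs_ell2_inverse)
  also have "\<dots> \<le> B\<^sup>2"
    using s assms by (intro infsum_le_finite_sums) auto
  finally show "norm (Abs_ell2 h) \<le> B"
    using assms(2) by (rule power2_le_imp_le)
qed

lemma sum_ell2_le: "finite F \<Longrightarrow> (\<Sum>x\<in>F. (cmod (ell2_fun f x))\<^sup>2) \<le> (norm f)\<^sup>2"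
  unfolding norm_ell2_square
  using finite_sum_le_infsum[OF ell2_summable[of f], of F] by simp

instance ell2 :: (type) banach
proof
  fix X :: "nat \<Rightarrow> 'a ell2"
  assume X: "Cauchy X"
  have "Cauchy (\<lambda>n. ell2_fun (X n) a)" for a
  proof (rule CauchyI)
    fix e :: real assume "0 < e"
    then obtain N where N: "\<forall>m\<ge>N. \<forall>n\<ge>N. norm (X m - X n) < e"
      using X CauchyD by blast
    have "norm (ell2_fun (X m) a - ell2_fun (X n) a) < e" if "m \<ge> N" "n \<ge> N" for m n
      using N that norm_ell2_fun_le[of "X m - X n" a] by (fastforce simp: ell2_fun_diff)
    then show "\<exists>M. \<forall>m\<ge>M. \<forall>n\<ge>M. norm (ell2_fun (X m) a - ell2_fun (X n) a) < e"
      by blast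
  qed
  then have "\<forall>a. \<exists>l. (\<lambda>n. ell2_fun (X n) a) \<longlonglongrightarrow> l"
    by (simp add: Cauchy_convergent_iff convergent_def)
  then obtain h where h: "\<And>a. (\<lambda>n. ell2_fun (X n) a) \<longlonglongrightarrow> h a"
    by metis
  \<comment> \<open>Coordinatewise limits are compared on finite sets, where the limit passes inside
    the sum; the bound does not depend on F.\<close>
  have tail: "(\<Sum>x\<in>F. (cmod (ell2_fun (X m) x - h x))\<^sup>2) \<le> e\<^sup>2"
    if "\<forall>n\<ge>N. norm (X m - X n) < e" "finite F" for m N e F
  proof (rule LIMSEQ_le_const2)
    show "(\<lambda>n. \<Sum>x\<in>F. (cmod (ell2_fun (X m) x - ell2_fun (X n) x))\<^sup>2)
        \<longlonglongrightarrow> (\<Sum>x\<in>F. (cmod (ell2_fun (X m) x - h x))\<^sup>2)"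
      by (intro tendsto_intros h)
    have "(\<Sum>x\<in>F. (cmod (ell2_fun (X m) x - ell2_fun (X n) x))\<^sup>2) \<le> e\<^sup>2" if "n \<ge> N" for n
    proof -
      have "(\<Sum>x\<in>F. (cmod (ell2_fun (X m - X n) x))\<^sup>2) \<le> (norm (X m - X n))\<^sup>2"
        by (rule sum_ell2_le) fact
      also have "\<dots> \<le> e\<^sup>2"
        using \<open>\<forall>n\<ge>N. norm (X m - X n) < e\<close> \<open>n \<ge> N\<close> by (intro power_mono) (auto intro: less_imp_le)
      finally show ?thesis
        by (simp add: ell2_fun_diff)
    qed
    then show "\<exists>N. \<forall>n\<ge>N. (\<Sum>x\<in>F. (cmod (ell2_fun (X m) x - ell2_fun (X n) x))\<^sup>2) \<le> e\<^sup>2"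
      by blast
  qed
  obtain N1 where N1: "\<forall>m\<ge>N1. \<forall>n\<ge>N1. norm (X m - X n) < 1"
    using X CauchyD[of X 1] by auto
  \<comment> \<open>The pointwise limit h is not yet known to be square summable, but
    \<open>X N1 - h\<close> is, so h is recovered as \<open>X N1 - d\<close>.\<close>
  define d where "d = Abs_ell2 (\<lambda>x. ell2_fun (X N1) x - h x)"
  have "(\<lambda>x. (cmod (ell2_fun (X N1) x - h x))\<^sup>2) summable_on UNIV"
    using N1 by (intro ell2_bounded_sums(1)[where B = 1] tail) auto
  then have d: "ell2_fun d x = ell2_fun (X N1) x - h x" for x
    by (simp add: d_def Abs_ell2_inverse)
  define l where "l = X N1 - d"
  have l: "ell2_fun l x = h x" for x
    by (simp add: l_def ell2_fun_diff d)
  have "X \<longlonglongrightarrow> l"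
  proof (rule LIMSEQ_I)
    fix r :: real assume "0 < r"
    then obtain N where N: "\<forall>m\<ge>N. \<forall>n\<ge>N. norm (X m - X n) < r / 2"
      using X CauchyD[of X "r / 2"] by auto
    have "norm (X m - l) < r" if "m \<ge> N" for m
    proof -
      have "norm (Abs_ell2 (\<lambda>x. ell2_fun (X m) x - h x)) \<le> r / 2"
        using N that \<open>0 < r\<close> by (intro ell2_bounded_sums(2) tail[of N]) auto
      moreover have "(\<lambda>x. ell2_fun (X m) x - h x) = ell2_fun (X m - l)"
        by (simp add: fun_eq_iff ell2_fun_diff l)
      ultimately show ?thesis
        using \<open>0 < r\<close> by (simp add: ell2_fun_inverse)
    qed
    then show "\<exists>no. \<forall>n\<ge>no. norm (X n - l) < r"
      by blast
  qed
  then show "convergent X"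
    by (auto simp: convergent_def)
qed

section \<open>The algebra of bounded complex-linear operators\<close>

text \<open>Complex-linear operators get a type of their own so that they form a unital real Banach
  algebra in the sense of the type classes, with powers, limits and \<open>exp\<close>. Complex
  scalars return as the central elements \<open>cS c\<close>.\<close>

typedef 'a cop = "{x :: 'a op. \<forall>c f. blinfun_apply x (scaleC_ell2 c f) = scaleC_ell2 c (blinfun_apply x f)}"
  morphisms op_of Abs_cop
  by (rule exI[of _ 0]) (simp, transfer, simp)

setup_lifting type_definition_cop

lemma scaleC_ell2_add: "scaleC_ell2 c (f + g) = scaleC_ell2 c f + scaleC_ell2 c g"
  by (rule ell2_eqI) (simp add: ell2_fun_simps algebra_simps)

lemma scaleC_ell2_scaleC: "scaleC_ell2 c (scaleC_ell2 d f) = scaleC_ell2 (c * d) f"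
  by (rule ell2_eqI) (simp add: ell2_fun_simps algebra_simps)

lemma scaleC_ell2_diff: "scaleC_ell2 c (f - g) = scaleC_ell2 c f - scaleC_ell2 c g"
  by (rule ell2_eqI) (simp add: ell2_fun_simps algebra_simps)

lemma scaleC_ell2_minus: "scaleC_ell2 c (- f) = - scaleC_ell2 c f"
  by (rule ell2_eqI) (simp add: ell2_fun_simps algebra_simps)

lemma scaleC_ell2_zero [simp]: "scaleC_ell2 c 0 = 0"
  by (rule ell2_eqI) (simp add: ell2_fun_simps algebra_simps)

lemma scaleC_ell2_one [simp]: "scaleC_ell2 1 f = f"
  by (rule ell2_eqI) (simp add: ell2_fun_simps algebra_simps)

instantiation cop :: (type) real_vector
begin

lift_definition zero_cop :: "'a cop" is 0 by simp
lift_definition plus_cop :: "'a cop \<Rightarrow> 'a cop \<Rightarrow> 'a cop" is "(+)"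
  by (simp add: blinfun.add_left scaleC_ell2_add)
lift_definition minus_cop :: "'a cop \<Rightarrow> 'a cop \<Rightarrow> 'a cop" is "(-)"
  by (simp add: blinfun.diff_left scaleC_ell2_diff)
lift_definition uminus_cop :: "'a cop \<Rightarrow> 'a cop" is uminus
  by (simp add: blinfun.minus_left scaleC_ell2_minus)
lift_definition scaleR_cop :: "real \<Rightarrow> 'a cop \<Rightarrow> 'a cop" is scaleR
  by (simp add: blinfun.scaleR_left scaleR_ell2_scaleC scaleC_ell2_scaleC mult.commute)

instance
  by standard (transfer, simp add: algebra_simps)+

end

instantiation cop :: (type) real_normed_algebra_1
begin

lift_definition one_cop :: "'a cop" is id_blinfun by simp
lift_definition times_cop :: "'a cop \<Rightarrow> 'a cop \<Rightarrow> 'a cop" is "(o\<^sub>L)"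
  by simp
lift_definition norm_cop :: "'a cop \<Rightarrow> real" is norm .

definition dist_cop :: "'a cop \<Rightarrow> 'a cop \<Rightarrow> real" where
  "dist_cop x y = norm (x - y)"
definition sgn_cop :: "'a cop \<Rightarrow> 'a cop" where
  "sgn_cop x = x /\<^sub>R norm x"
definition uniformity_cop :: "('a cop \<times> 'a cop) filter" where
  "uniformity_cop = (INF e\<in>{0<..}. principal {(f, g). dist f g < e})"
definition open_cop :: "'a cop set \<Rightarrow> bool" where
  "open_cop U = (\<forall>f\<in>U. \<forall>\<^sub>F (f', g) in uniformity. f' = f \<longrightarrow> g \<in> U)"

instance
proof
  fix a b c :: "'a cop" and r q :: real
  show norm_one: "norm (1 :: 'a cop) = 1"
  proof transfer
    have "norm (id_blinfun :: 'a op) \<ge> 1"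
      using norm_blinfun[of "id_blinfun :: 'a op" "delta undefined"] by simp
    moreover have "norm (id_blinfun :: 'a op) \<le> 1"
      by (rule norm_blinfun_bound) auto
    ultimately show "norm (id_blinfun :: 'a op) = 1"
      by simp
  qed
  show norm_0: "norm a = 0 \<longleftrightarrow> a = 0" for a :: "'a cop"
    by transfer simp
  show "(0 :: 'a cop) \<noteq> 1"
    using norm_one norm_0[of "0 :: 'a cop"] by auto
  show "dist a b = norm (a - b)"
    by (fact dist_cop_def)
  show "sgn a = a /\<^sub>R norm a"
    by (fact sgn_cop_def)
  show "(uniformity :: ('a cop \<times> 'a cop) filter) = (INF e\<in>{0<..}. principal {(f, g). dist f g < e})"
    by (fact uniformity_cop_def)
  show "open U \<longleftrightarrow> (\<forall>f\<in>U. \<forall>\<^sub>F (f', g) in uniformity. f' = f \<longrightarrow> g \<in> U)" for U :: "'a cop set"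
    by (fact open_cop_def)
  show "norm (a * b) \<le> norm a * norm b"
    by transfer (rule norm_blinfun_compose)
  show "norm (a + b) \<le> norm a + norm b"
    by transfer (rule norm_triangle_ineq)
  show "norm (r *\<^sub>R a) = \<bar>r\<bar> * norm a"
    by transfer simp
  show "a * b * c = a * (b * c)" "1 * a = a" "a * 1 = a"
    by (transfer, rule blinfun_eqI, simp)+
  show "(a + b) * c = a * c + b * c" "a * (b + c) = a * b + a * c"
    "r *\<^sub>R a * b = r *\<^sub>R (a * b)" "a * r *\<^sub>R b = r *\<^sub>R (a * b)"
    by (transfer, rule blinfun_eqI, simp add: blinfun.bilinear_simps)+
qed

end

definition app :: "'a cop \<Rightarrow> 'a ell2 \<Rightarrow> 'a ell2" where
  "app x f = blinfun_apply (op_of x) f"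

lemma cop_eqI: "(\<And>f. app x f = app y f) \<Longrightarrow> x = y"
  by (simp add: op_of_inject[symmetric] app_def blinfun_eqI)


lemma app_scaleC_right: "app x (scaleC_ell2 c f) = scaleC_ell2 c (app x f)"
  using op_of[of x] by (simp add: app_def)

lemma app_add_right: "app x (f + g) = app x f + app x g"
  and app_diff_right: "app x (f - g) = app x f - app x g"
  and app_minus_right: "app x (- f) = - app x f"
  and app_scaleR_right: "app x (r *\<^sub>R f) = r *\<^sub>R app x f"
  and app_zero_right [simp]: "app x 0 = 0"
  and app_add: "app (x + y) f = app x f + app y f"
  and app_diff: "app (x - y) f = app x f - app y f"
  and app_minus: "app (- x) f = - app x f"
  and app_scaleR: "app (r *\<^sub>R x) f = r *\<^sub>R app x f"
  and app_zero [simp]: "app 0 f = 0"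
  and app_one [simp]: "app 1 f = f"
  and app_mult: "app (x * y) f = app x (app y f)"
  by (simp_all add: app_def plus_cop.rep_eq minus_cop.rep_eq uminus_cop.rep_eq scaleR_cop.rep_eq
      zero_cop.rep_eq one_cop.rep_eq times_cop.rep_eq blinfun.bilinear_simps)

lemma norm_app: "norm (app x f) \<le> norm x * norm f"
  by (simp add: app_def norm_cop.rep_eq norm_blinfun)

lemma norm_cop_bound: "0 \<le> b \<Longrightarrow> (\<And>f. norm (app x f) \<le> b * norm f) \<Longrightarrow> norm x \<le> b"
  by (simp add: app_def norm_cop.rep_eq norm_blinfun_bound)

lemma app_sum: "app (\<Sum>i\<in>I. x i) f = (\<Sum>i\<in>I. app (x i) f)"
  by (induction I rule: infinite_finite_induct) (simp_all add: app_add)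

lemma app_sum_right: "app x (\<Sum>i\<in>I. f i) = (\<Sum>i\<in>I. app x (f i))"
  by (induction I rule: infinite_finite_induct) (simp_all add: app_add_right)

instance cop :: (type) banach
proof
  fix X :: "nat \<Rightarrow> 'a cop"
  assume X: "Cauchy X"
  have "Cauchy (\<lambda>n. op_of (X n))"
    using X unfolding Cauchy_def dist_norm by (simp add: norm_cop.rep_eq minus_cop.rep_eq)
  then have "convergent (\<lambda>n. op_of (X n))"
    by (rule Cauchy_convergent)
  then obtain y where y: "(\<lambda>n. op_of (X n)) \<longlonglongrightarrow> y"
    unfolding convergent_def ..
  have ap: "(\<lambda>n. blinfun_apply (op_of (X n)) f) \<longlonglongrightarrow> blinfun_apply y f" for f
    by (intro blinfun.tendsto y tendsto_const)
  have "blinfun_apply y (scaleC_ell2 c f) = scaleC_ell2 c (blinfun_apply y f)" for c f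
  proof (rule LIMSEQ_unique[OF ap])
    have "(\<lambda>n. scaleC_ell2 c (blinfun_apply (op_of (X n)) f)) \<longlonglongrightarrow> scaleC_ell2 c (blinfun_apply y f)"
      by (intro bounded_linear.tendsto[OF bounded_linear_scaleC_ell2] ap)
    then show "(\<lambda>n. blinfun_apply (op_of (X n)) (scaleC_ell2 c f)) \<longlonglongrightarrow> scaleC_ell2 c (blinfun_apply y f)"
      by (simp add: app_scaleC_right[unfolded app_def])
  qed
  then have "op_of (Abs_cop y) = y"
    by (simp add: Abs_cop_inverse)
  then have "X \<longlonglongrightarrow> Abs_cop y"
    using y unfolding LIMSEQ_iff by (simp add: norm_cop.rep_eq minus_cop.rep_eq)
  then show "convergent X"
    by (auto simp: convergent_def)
qed

lemma op_of_tendsto: "(\<lambda>n. op_of (X n)) \<longlonglongrightarrow> op_of x \<longleftrightarrow> X \<longlonglongrightarrow> x"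
  unfolding LIMSEQ_iff by (simp add: norm_cop.rep_eq minus_cop.rep_eq)

subsection \<open>Scalars and adjoints\<close>

lift_definition cS :: "complex \<Rightarrow> 'a cop" is "\<lambda>c. Blinfun (scaleC_ell2 c)"
  by (simp add: bounded_linear_Blinfun_apply[OF bounded_linear_scaleC_ell2] scaleC_ell2_scaleC mult.commute)

lemma app_cS: "app (cS c) f = scaleC_ell2 c f"
  by (simp add: app_def cS.rep_eq bounded_linear_Blinfun_apply[OF bounded_linear_scaleC_ell2])

lemma cS_commute: "x * cS c = cS c * x"
  by (rule cop_eqI) (simp add: app_mult app_cS app_scaleC_right)

lemma cS_left_commute: "x * (cS c * y) = cS c * (x * y)"
  by (simp add: mult.assoc[symmetric] cS_commute)

lemma cS_mult: "cS (c * d) = cS c * cS d"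
  by (rule cop_eqI) (simp add: app_mult app_cS scaleC_ell2_scaleC)

lemma cS_add: "cS (c + d) = cS c + cS d"
  by (rule cop_eqI, rule ell2_eqI) (simp add: app_add app_cS ell2_fun_simps algebra_simps)

lemma cS_one [simp]: "cS 1 = 1"
  by (rule cop_eqI) (simp add: app_cS)

lemma cS_zero [simp]: "cS 0 = 0"
  by (rule cop_eqI, rule ell2_eqI) (simp add: app_cS ell2_fun_simps)

lemma cS_of_real: "cS (of_real r) * x = r *\<^sub>R x"
  by (rule cop_eqI) (simp add: app_cS app_mult app_scaleR scaleR_ell2_scaleC)

lemma cS_minus: "cS (- c) = - cS c"
  using cS_add[of c "- c"] by (simp add: add_eq_0_iff)

lemma norm_cS_mult: "norm (cS c * x) \<le> cmod c * norm x"
proof (rule norm_cop_bound)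
  fix f
  show "norm (app (cS c * x) f) \<le> cmod c * norm x * norm f"
    using mult_left_mono[OF norm_app[of x f] norm_ge_zero[of c]]
    by (simp add: app_mult app_cS norm_scaleC_ell2 mult.assoc)
qed simp

lemma bounded_linear_cS: "bounded_linear cS"
proof (rule bounded_linear_intro[where K = 1])
  show "cS (r *\<^sub>R c) = r *\<^sub>R (cS c :: 'a cop)" for r c
    using cS_of_real[of r "cS c :: 'a cop"] by (simp add: cS_mult[symmetric] scaleR_conv_of_real)
  show "norm (cS c :: 'a cop) \<le> norm c * 1" for c
    using norm_cS_mult[of c "1 :: 'a cop"] by simp
qed (rule cS_add)

text \<open>Testing x on the finite vector g whose coordinates are the numbers being summed bounds
  the sum S by ||x|| ||g|| ||f||, while S is also the square of ||g||; one factor ||g|| cancels. The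
  coordinates of the adjoint vector are thereby square summable.\<close>

lemma adj_sum_le:
  assumes "finite F"
  shows "(\<Sum>a\<in>F. (cmod (cinner (app x (delta a)) f))\<^sup>2) \<le> (norm x * norm f)\<^sup>2"
proof -
  define S where "S = (\<Sum>a\<in>F. (cmod (cinner (app x (delta a)) f))\<^sup>2)"
  define g where "g = (\<Sum>a\<in>F. scaleC_ell2 (cinner (app x (delta a)) f) (delta a))"
  have "cinner (\<Sum>a\<in>F. h a) f = (\<Sum>a\<in>F. cinner (h a) f)" for h
    using assms by (induction F) (simp_all add: cinner_add_left)
  then have "cinner (app x g) f = of_real S"
    by (simp add: g_def S_def app_sum_right app_scaleC_right cinner_scaleC_left complex_norm_square
        mult.commute del: of_real_power)
  then have "S \<le> norm (app x g) * norm f"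
    using cinner_Cauchy_Schwarz[of "app x g" f] by (simp add: norm_of_real)
  also have "\<dots> \<le> norm x * norm g * norm f"
    by (intro mult_right_mono norm_app) simp
  finally have le: "S \<le> (norm x * norm f) * norm g"
    by (simp add: mult_ac)
  have g: "ell2_fun g b = (if b \<in> F then cinner (app x (delta b)) f else 0)" for b
    using assms by (simp add: g_def ell2_fun_simps if_distrib[of "\<lambda>t. _ * t"] sum.delta cong: if_cong)
  have "(norm g)\<^sup>2 = (\<Sum>\<^sub>\<infinity>b\<in>F. (cmod (cinner (app x (delta b)) f))\<^sup>2)"
    unfolding norm_ell2_square by (rule infsum_cong_neutral) (auto simp: g)
  then have ng: "(norm g)\<^sup>2 = S"
    using assms by (simp add: S_def)
  show ?thesis
  proof (cases "norm g = 0")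
    case True
    then show ?thesis
      using ng by (simp add: S_def)
  next
    case False
    have "norm g * norm g \<le> (norm x * norm f) * norm g"
      using le ng by (simp add: power2_eq_square)
    then have "norm g \<le> norm x * norm f"
      using False by (simp add: mult_le_cancel_right)
    then have "(norm g)\<^sup>2 \<le> (norm x * norm f)\<^sup>2"
      by (intro power_mono) auto
    then show ?thesis
      using ng by (simp add: S_def)
  qed
qed

text \<open>The coordinate at a is forced: the pairing of \<open>delta a\<close> with the adjoint
  applied to f must be the pairing of \<open>app x (delta a)\<close> with f.\<close>

definition adj_fun :: "'a cop \<Rightarrow> 'a ell2 \<Rightarrow> 'a ell2" where
  "adj_fun x f = Abs_ell2 (\<lambda>a. cinner (app x (delta a)) f)"

lemma ell2_fun_adj_fun: "ell2_fun (adj_fun x f) a = cinner (app x (delta a)) f"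
proof -
  have "(\<lambda>a. (cmod (cinner (app x (delta a)) f))\<^sup>2) summable_on UNIV"
    by (rule ell2_bounded_sums(1)[where B = "norm x * norm f"]) (auto intro: adj_sum_le)
  then show ?thesis
    by (simp add: adj_fun_def Abs_ell2_inverse)
qed

lemma bounded_linear_adj_fun: "bounded_linear (adj_fun x)"
proof (rule bounded_linear_intro[where K = "norm x"])
  show "norm (adj_fun x f) \<le> norm f * norm x" for f
    unfolding adj_fun_def mult.commute[of "norm f"]
    by (rule ell2_bounded_sums(2)) (auto intro: adj_sum_le)
qed (auto intro!: ell2_eqI simp: ell2_fun_adj_fun ell2_fun_simps cinner_add_right cinner_scaleR_right)

lift_definition adj :: "'a cop \<Rightarrow> 'a cop" is "\<lambda>x. Blinfun (adj_fun (Abs_cop x))"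
  by (rule ell2_eqI) (simp add: bounded_linear_Blinfun_apply[OF bounded_linear_adj_fun]
      ell2_fun_adj_fun ell2_fun_simps cinner_scaleC_right)

lemma app_adj: "app (adj x) f = adj_fun x f"
  by (simp add: app_def adj.rep_eq bounded_linear_Blinfun_apply[OF bounded_linear_adj_fun] op_of_inverse)

text \<open>Finitely supported functions are dense, so it suffices to test the defining property of
  the adjoint on them.\<close>

lemma ell2_finite_approx:
  assumes "0 < e"
  obtains F where "finite F" and "norm (f - (\<Sum>a\<in>F. scaleC_ell2 (ell2_fun f a) (delta a))) < e"
proof -
  let ?h = "\<lambda>x. (cmod (ell2_fun f x))\<^sup>2"
  have "(?h has_sum (norm f)\<^sup>2) UNIV"
    unfolding norm_ell2_square by (rule has_sum_infsum[OF ell2_summable])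
  then have "\<forall>\<^sub>F F in finite_subsets_at_top UNIV. dist (sum ?h F) ((norm f)\<^sup>2) < e\<^sup>2"
    using assms by (auto simp: has_sum_def tendsto_iff)
  then obtain F where F: "finite F" "dist (sum ?h F) ((norm f)\<^sup>2) < e\<^sup>2"
    unfolding eventually_finite_subsets_at_top by blast
  let ?g = "f - (\<Sum>a\<in>F. scaleC_ell2 (ell2_fun f a) (delta a))"
  have g: "ell2_fun ?g b = (if b \<in> F then 0 else ell2_fun f b)" for b
    using F(1) by (simp add: ell2_fun_simps if_distrib[of "\<lambda>t. _ * t"] sum.delta cong: if_cong)
  have "(norm ?g)\<^sup>2 = (\<Sum>\<^sub>\<infinity>b\<in>UNIV - F. ?h b)"
    unfolding norm_ell2_square by (rule infsum_cong_neutral) (auto simp: g)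
  also have "\<dots> = (norm f)\<^sup>2 - sum ?h F"
    unfolding norm_ell2_square using F(1)
    by (subst infsum_Diff[OF ell2_summable]) (auto simp: summable_on_finite)
  also have "\<dots> < e\<^sup>2"
    using F(2) by (simp add: dist_real_def)
  finally have "norm ?g < e"
    using assms by (auto intro: power2_less_imp_less)
  with F(1) show ?thesis
    by (rule that)
qed

lemma bounded_linear_cinner_right: "bounded_linear (cinner f)"
proof (rule bounded_linear_intro[where K = "norm f"])
  show "cmod (cinner f g) \<le> norm g * norm f" for g
    using cinner_Cauchy_Schwarz[of f g] by (simp add: mult.commute)
qed (simp_all add: cinner_add_right cinner_scaleR_right scaleR_conv_of_real)

lemma cinner_sum_right: "cinner f (\<Sum>i\<in>I. h i) = (\<Sum>i\<in>I. cinner f (h i))"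
  by (rule linear_sum[OF bounded_linear.linear[OF bounded_linear_cinner_right]])

lemma cinner_app_right: "cinner f (app x g) = cinner (app (adj x) f) g"
proof -
  have delta: "cinner f (app x (delta a)) = cinner (app (adj x) f) (delta a)" for a
    by (subst (1 2) cinner_commute) (simp add: cinner_delta_left app_adj ell2_fun_adj_fun)
  have fin: "cinner f (app x (\<Sum>a\<in>F. scaleC_ell2 (c a) (delta a)))
      = cinner (app (adj x) f) (\<Sum>a\<in>F. scaleC_ell2 (c a) (delta a))" for F c
    by (simp add: app_sum_right cinner_sum_right app_scaleC_right cinner_scaleC_right delta)
  define K where "K = norm f * norm x + norm (app (adj x) f)"
  have "0 \<le> K"
    by (simp add: K_def)
  have "cmod (cinner f (app x g) - cinner (app (adj x) f) g) \<le> e" if "e > 0" for e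
  proof -
    have "e / (K + 1) > 0"
      using that \<open>0 \<le> K\<close> by simp
    then obtain F where "norm (g - (\<Sum>a\<in>F. scaleC_ell2 (ell2_fun g a) (delta a))) < e / (K + 1)"
      by (rule ell2_finite_approx)
    moreover define h where "h = (\<Sum>a\<in>F. scaleC_ell2 (ell2_fun g a) (delta a))"
    ultimately have h: "norm (g - h) < e / (K + 1)"
      by simp
    have "cinner f (app x g) - cinner (app (adj x) f) g = cinner f (app x (g - h)) - cinner (app (adj x) f) (g - h)"
      using fin[of "ell2_fun g" F] by (simp add: h_def app_diff_right cinner_diff_right)
    also have "cmod \<dots> \<le> norm f * norm (app x (g - h)) + norm (app (adj x) f) * norm (g - h)"
      by (rule order_trans[OF norm_triangle_ineq4]) (intro add_mono cinner_Cauchy_Schwarz)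
    also have "\<dots> \<le> K * norm (g - h)"
      using mult_left_mono[OF norm_app[of x "g - h"] norm_ge_zero[of f]]
      by (simp add: K_def algebra_simps)
    also have "\<dots> \<le> (K + 1) * (e / (K + 1))"
      using h by (intro mult_mono) (auto simp: K_def)
    also have "\<dots> = e"
      using \<open>0 \<le> K\<close> by simp
    finally show ?thesis .
  qed
  then have "cmod (cinner f (app x g) - cinner (app (adj x) f) g) \<le> 0"
    by (rule field_le_epsilon[of _ 0, simplified]) auto
  then show ?thesis
    by simp
qed

lemma cinner_app_left: "cinner (app x f) g = cinner f (app (adj x) g)"
  by (subst (1 2) cinner_commute) (simp add: cinner_app_right)

lemma cinner_eqI: "(\<And>g. cinner g f = cinner g h) \<Longrightarrow> f = h"
  using cinner_delta_left by (metis ell2_eqI)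

lemma adj_eqI: "(\<And>f g. cinner f (app x g) = cinner (app y f) g) \<Longrightarrow> adj x = y"
  by (rule cop_eqI, rule cinner_eqI, subst (1 2) cinner_commute) (simp add: cinner_app_right[symmetric])

lemma adj_adj [simp]: "adj (adj x) = x"
  by (rule adj_eqI) (simp add: cinner_app_left)

lemma adj_mult [simp]: "adj (x * y) = adj y * adj x"
  by (rule adj_eqI) (simp add: app_mult cinner_app_right)

lemma adj_add [simp]: "adj (x + y) = adj x + adj y"
  by (rule adj_eqI) (simp add: app_add cinner_app_right cinner_add_right cinner_add_left)

lemma adj_diff [simp]: "adj (x - y) = adj x - adj y"
  by (rule adj_eqI) (simp add: app_diff cinner_app_right cinner_diff_right cinner_diff_left)

lemma adj_cS [simp]: "adj (cS c) = cS (cnj c)"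
  by (rule adj_eqI) (simp add: app_cS cinner_scaleC_left cinner_scaleC_right)

lemma adj_zero [simp]: "adj 0 = 0"
  by (rule adj_eqI) simp

lemma adj_one [simp]: "adj 1 = 1"
  by (rule adj_eqI) simp

lemma adj_scaleR [simp]: "adj (r *\<^sub>R x) = r *\<^sub>R adj x"
  unfolding cS_of_real[symmetric] by (simp add: cS_commute)

lemma adj_power [simp]: "adj (x ^ n) = adj x ^ n"
  by (induction n) (simp_all add: power_commutes)

lemma adj_sum: "adj (\<Sum>i\<in>I. f i) = (\<Sum>i\<in>I. adj (f i))"
  by (induction I rule: infinite_finite_induct) simp_all

lemma norm_app_square: "complex_of_real ((norm (app x f))\<^sup>2) = cinner f (app (adj x * x) f)"
  unfolding cinner_self[symmetric] by (simp add: app_mult cinner_app_left)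

lemma norm_adj_le: "norm (adj x) \<le> norm x"
proof (rule norm_cop_bound)
  fix f
  show "norm (app (adj x) f) \<le> norm x * norm f"
    unfolding app_adj adj_fun_def
    by (rule ell2_bounded_sums(2)) (auto intro: adj_sum_le)
qed simp

lemma norm_adj [simp]: "norm (adj x) = norm x"
  using norm_adj_le[of x] norm_adj_le[of "adj x"] by simp

text \<open>The half of the C*-identity that turns a bound for adj x x into one for x. Contractivity
  of \<open>ppart\<close>, of exp (i y L) and of the translations is obtained this way.\<close>

lemma norm_le_of_adj_mult:
  assumes "0 \<le> c" "norm (adj x * x) \<le> c\<^sup>2"
  shows "norm x \<le> c"
proof (rule norm_cop_bound[OF assms(1)])
  fix f
  have "(norm (app x f))\<^sup>2 = cmod (cinner f (app (adj x * x) f))"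
    unfolding norm_app_square[symmetric] by (simp add: norm_power)
  also have "\<dots> \<le> norm f * (norm (adj x * x) * norm f)"
    by (rule order_trans[OF cinner_Cauchy_Schwarz]) (intro mult_left_mono norm_app norm_ge_zero)
  also have "\<dots> \<le> (c * norm f)\<^sup>2"
    using mult_right_mono[OF assms(2), of "(norm f)\<^sup>2"]
    by (simp add: power2_eq_square mult_ac)
  finally show "norm (app x f) \<le> c * norm f"
    using assms(1) by (auto intro: power2_le_imp_le)
qed

lemma bounded_linear_adj: "bounded_linear adj"
  by (rule bounded_linear_intro[where K = 1]) auto

lemma op_of_adj: "adj_op (op_of x) = op_of (adj x)"
  unfolding adj_op_def
proof (rule the_equality)
  show "\<forall>f g. cinner (blinfun_apply (op_of (adj x)) f) g = cinner f (blinfun_apply (op_of x) g)"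
    unfolding app_def[symmetric] by (simp add: cinner_app_right)
  fix y :: "'a op"
  assume y: "\<forall>f g. cinner (blinfun_apply y f) g = cinner f (blinfun_apply (op_of x) g)"
  show "y = op_of (adj x)"
  proof (rule blinfun_eqI, rule cinner_eqI)
    fix f g
    show "cinner g (blinfun_apply y f) = cinner g (blinfun_apply (op_of (adj x)) f)"
      unfolding app_def[symmetric]
      by (subst (1 2) cinner_commute) (simp add: y cinner_app_right[symmetric] app_def[symmetric])
  qed
qed

section \<open>Polynomial functional calculus\<close>

definition pol :: "real poly \<Rightarrow> 'x::real_algebra_1 \<Rightarrow> 'x" where
  "pol q x = (\<Sum>i\<le>degree q. coeff q i *\<^sub>R x ^ i)"

lemma pol_eq_sum: "degree q \<le> n \<Longrightarrow> pol q x = (\<Sum>i\<le>n. coeff q i *\<^sub>R x ^ i)"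
  unfolding pol_def by (rule sum.mono_neutral_left) (auto simp: coeff_eq_0)

lemma pol_0 [simp]: "pol 0 x = 0"
  by (simp add: pol_def)

lemma pol_pCons [simp]: "pol (pCons a q) x = a *\<^sub>R 1 + x * pol q x"
proof -
  have "pol (pCons a q) x = (\<Sum>i\<le>Suc (degree q). coeff (pCons a q) i *\<^sub>R x ^ i)"
    by (rule pol_eq_sum) (simp add: degree_pCons_le)
  also have "\<dots> = a *\<^sub>R 1 + x * pol q x"
    by (subst sum.atMost_Suc_shift) (simp add: pol_def sum_distrib_left)
  finally show ?thesis .
qed

lemma pol_1 [simp]: "pol 1 x = 1"
  by (simp add: one_pCons)

lemma pol_add [simp]: "pol (p + q) x = pol p x + pol q x"
  using pol_eq_sum[of p "max (degree p) (degree q)" x] pol_eq_sum[of q "max (degree p) (degree q)" x]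
    pol_eq_sum[OF degree_add_le_max[of p q], of x]
  by (simp add: sum.distrib scaleR_left_distrib)

lemma pol_smult [simp]: "pol (smult a p) x = a *\<^sub>R pol p x"
  by (induction p) (simp_all add: scaleR_right_distrib)

lemma pol_uminus [simp]: "pol (- p) x = - pol p x"
  using pol_smult[of "-1" p x] by simp

lemma pol_diff [simp]: "pol (p - q) x = pol p x - pol q x"
  using pol_add[of p "- q" x] by simp

lemma pol_sum: "pol (\<Sum>i\<in>I. p i) x = (\<Sum>i\<in>I. pol (p i) x)"
  by (induction I rule: infinite_finite_induct) simp_all

lemma pol_commute: "x * y = y * x \<Longrightarrow> pol p x * y = y * pol p x"
  by (induction p) (simp_all add: distrib_left distrib_right mult.assoc, simp_all add: mult.assoc[symmetric])

lemma pol_mult [simp]: "pol (p * q) x = pol p x * pol q x"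
  by (induction p) (simp_all add: distrib_right mult.assoc)

lemma pol_power [simp]: "pol (p ^ n) x = pol p x ^ n"
  by (induction n) simp_all

lemma pol_pcompose: "pol (pcompose p q) x = pol p (pol q x)"
  by (induction p) (simp_all add: pcompose_pCons)

lemma adj_pol [simp]: "adj (pol p x) = pol p (adj x)"
  by (induction p) (simp_all add: pol_commute)

subsection \<open>Positive operators\<close>

text \<open>Only the real part of the quadratic form is tested, hence the separate demand of
  self-adjointness.\<close>

definition pos :: "'a cop \<Rightarrow> bool" where
  "pos x \<longleftrightarrow> adj x = x \<and> (\<forall>f. 0 \<le> Re (cinner f (app x f)))"

lemma pos_adj: "pos x \<Longrightarrow> adj x = x"
  by (simp add: pos_def)

lemma pos_one: "pos 1"
  by (simp add: pos_def cinner_self)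

lemma pos_add: "pos x \<Longrightarrow> pos y \<Longrightarrow> pos (x + y)"
  by (simp add: pos_def app_add cinner_add_right)

lemma pos_scaleR: "0 \<le> r \<Longrightarrow> pos x \<Longrightarrow> pos (r *\<^sub>R x)"
  by (simp add: pos_def app_scaleR cinner_scaleR_right)

lemma pos_conj: "pos x \<Longrightarrow> pos (adj y * x * y)"
  by (auto simp: pos_def app_mult cinner_app_right[of _ "adj y"] mult.assoc)

lemma pos_adj_mult: "pos (adj y * y)"
  using pos_conj[OF pos_one] by simp

lemma pos_mult_self: "adj y = y \<Longrightarrow> pos (y * y)"
  using pos_adj_mult[of y] by simp

text \<open>x and y = 1 - x commute. Conjugation by x or by y raises an exponent by 2, so only the
  exponents 0 and 1 remain, and x y = x y x + y x y settles the mixed case.\<close>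

lemma pos_power_mult:
  assumes x: "pos x" and y: "pos y" and xy: "x + y = 1"
  shows "pos (x ^ i * y ^ j)"
proof -
  have y_eq: "y = 1 - x"
    using xy by (simp add: algebra_simps)
  have com: "x * y = y * x"
    by (simp add: y_eq algebra_simps)
  have sa: "adj x = x" "adj y = y"
    using x y by (auto simp: pos_def)
  have xy_pos: "pos (x * y)"
  proof -
    have "x * y = x * y * (x + y)"
      by (simp add: xy)
    also have "\<dots> = x * y * x + y * x * y"
      by (simp add: distrib_left com mult.assoc)
    finally show ?thesis
      using pos_add[OF pos_conj[OF y, of x] pos_conj[OF x, of y]] by (simp add: sa)
  qed
  have cx: "y ^ b * x = x * y ^ b" and cy: "y * x ^ b = x ^ b * y" for b
    by (metis com power_commuting_commutes)+
  have cxx: "x ^ b * (x * z) = x * (x ^ b * z)" for b z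
    by (simp add: mult.assoc[symmetric] power_commutes)
  have cyy: "z * y ^ b * y = z * y * y ^ b" for b z
    by (simp add: mult.assoc power_commutes)
  have x2: "pos (x ^ Suc (Suc i) * y ^ j)" if "pos (x ^ i * y ^ j)" for i j
    using pos_conj[OF that, of x] by (simp add: sa mult.assoc cx cxx)
  have y2: "pos (x ^ i * y ^ Suc (Suc j))" if "pos (x ^ i * y ^ j)" for i j
    using pos_conj[OF that, of y] by (simp add: sa mult.assoc[symmetric] cy cyy)
  have base: "pos (x ^ i * y ^ j)" if "i < 2" "j < 2" for i j
    using that x y xy_pos pos_one by (auto simp: less_2_cases_iff)
  have "pos (x ^ i * y ^ j)" if "j < 2" for i j
    using that
  proof (induction i rule: less_induct)
    case (less i)
    then show ?case
      using base[of i j] x2[of "i - 2" j] less.IH[of "i - 2"] by (cases "i < 2") (auto simp: Suc_diff_Suc numeral_2_eq_2)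
  qed
  then show ?thesis
  proof (induction j rule: less_induct)
    case (less j)
    then show ?case
      using y2[of i "j - 2"] less.IH[of "j - 2"] by (cases "j < 2") (auto simp: Suc_diff_Suc numeral_2_eq_2)
  qed
qed

text \<open>The Bernstein coefficients of \<open>t ^ j\<close> in degree \<open>N\<close>; they are exact, and they converge to the
  values at the nodes \<open>k / N\<close>.\<close>

lemma monom_eq_Bernstein:
  assumes "j \<le> N"
  shows "monom 1 j = (\<Sum>k\<le>N. smult (real (k choose j) / real (N choose j) * real (N choose k))
     ([:0, 1:] ^ k * [:1, -1:] ^ (N - k)))"
proof -
  let ?X = "[:0, 1:] :: real poly" and ?Y = "[:1, -1:] :: real poly"
  have N: "real (N choose j) \<noteq> 0"
    using assms by simp
  have "(\<Sum>k\<le>N. smult (real (k choose j) / real (N choose j) * real (N choose k)) (?X ^ k * ?Y ^ (N - k)))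
     = (\<Sum>k\<in>{j..N}. smult (real (k choose j) / real (N choose j) * real (N choose k)) (?X ^ k * ?Y ^ (N - k)))"
    by (rule sum.mono_neutral_right) (auto simp: binomial_eq_0)
  also have "\<dots> = (\<Sum>i\<le>N - j. smult (real ((i + j) choose j) / real (N choose j) * real (N choose (i + j)))
      (?X ^ (i + j) * ?Y ^ (N - (i + j))))"
    by (rule sum.reindex_bij_witness[of _ "\<lambda>i. i + j" "\<lambda>k. k - j"]) (use assms in auto)
  also have "\<dots> = (\<Sum>i\<le>N - j. ?X ^ j * (of_nat ((N - j) choose i) * ?X ^ i * ?Y ^ (N - j - i)))"
  proof (rule sum.cong)
    fix i
    assume i: "i \<in> {..N - j}"
    then have "(N choose (i + j)) * ((i + j) choose j) = (N choose j) * ((N - j) choose (i + j - j))"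
      using assms by (intro choose_mult) auto
    then have "real (N choose (i + j)) * real ((i + j) choose j) = real (N choose j) * real ((N - j) choose i)"
      by (metis add_diff_cancel_right' of_nat_mult)
    then have "real ((i + j) choose j) / real (N choose j) * real (N choose (i + j)) = real ((N - j) choose i)"
      using N by (simp add: field_simps)
    then show "smult (real ((i + j) choose j) / real (N choose j) * real (N choose (i + j)))
      (?X ^ (i + j) * ?Y ^ (N - (i + j))) = ?X ^ j * (of_nat ((N - j) choose i) * ?X ^ i * ?Y ^ (N - j - i))"
      by (simp add: power_add of_nat_poly mult_ac add.commute diff_diff_add)
  qed simp
  also have "\<dots> = ?X ^ j * (?X + ?Y) ^ (N - j)"
    by (simp only: binomial_ring sum_distrib_left)
  also have "?X + ?Y = 1"
    by (simp add: one_pCons)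
  finally show ?thesis
    by (simp add: monom_altdef)
qed

text \<open>Both terms are products of j factors, (k - i) / (N - i) and k / N, of modulus at most 1.
  The difference of such products is at most the sum of the differences of the factors, each of
  which is at most d / (N - d).\<close>

lemma choose_quotient_bound:
  assumes "j \<le> d" "2 * d < N" "k \<le> N"
  shows "\<bar>real (k choose j) / real (N choose j) - (real k / real N) ^ j\<bar> \<le> real d * (real d / (real N - real d))"
proof -
  have N: "real N - real i > 0" if "i < j" for i
    using assms that by linarith
  have eq: "real (k choose j) / real (N choose j) = (\<Prod>i<j. (real k - real i) / (real N - real i))"
    unfolding binomial_gbinomial gbinomial_prod_rev
    by (simp add: prod_dividef lessThan_atLeast0)
  have eq2: "(real k / real N) ^ j = (\<Prod>i<j. real k / real N)"
    by simp
  have "norm ((\<Prod>i<j. (real k - real i) / (real N - real i)) - (\<Prod>i<j. real k / real N))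
      \<le> (\<Sum>i<j. norm ((real k - real i) / (real N - real i) - real k / real N))"
  proof (rule norm_prod_diff)
    fix i assume "i \<in> {..<j}"
    then have "i < j" by simp
    \<comment> \<open>For k < i the factor is negative; its modulus is still at most 1 because 2 d <
      N.\<close>
    then have "\<bar>real k - real i\<bar> \<le> real N - real i"
      using assms by linarith
    then show "norm ((real k - real i) / (real N - real i)) \<le> 1"
      using N[OF \<open>i < j\<close>] by (simp add: abs_divide)
  qed (use assms in auto)
  also have "\<dots> \<le> (\<Sum>i<j. real d / (real N - real d))"
  proof (rule sum_mono)
    fix i assume "i \<in> {..<j}"
    then have i: "i < j" by simp
    have N0: "real N > 0"
      using assms by simp
    have eqn: "(real k - real i) / (real N - real i) - real k / real N
        = - (real i / (real N - real i) * ((real N - real k) / real N))"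
      using N[OF i] N0 by (simp add: field_simps)
    have T1: "real i / (real N - real i) * ((real N - real k) / real N) \<le> real i / (real N - real i) * 1"
      using N[OF i] N0 assms by (intro mult_left_mono) auto
    have T2: "real i / (real N - real i) \<le> real d / (real N - real d)"
      using i assms by (intro frac_le) auto
    have T0: "0 \<le> real i / (real N - real i) * ((real N - real k) / real N)"
      using N[OF i] N0 assms by (intro mult_nonneg_nonneg) auto
    show "norm ((real k - real i) / (real N - real i) - real k / real N) \<le> real d / (real N - real d)"
      unfolding eqn real_norm_def abs_minus_cancel abs_of_nonneg[OF T0] using T1 T2 by linarith
  qed
  also have "\<dots> \<le> real d * (real d / (real N - real d))"
    using assms unfolding sum_constant card_lessThan by (intro mult_right_mono) auto
  finally show ?thesis
    unfolding eq eq2 by simp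
qed

lemma smult_sum2: "smult c (\<Sum>i\<in>I. p i) = (\<Sum>i\<in>I. smult c (p i))"
  by (induction I rule: infinite_finite_induct) (simp_all add: smult_add_right)

text \<open>Positivity by Bernstein expansion. In degree N the coefficients of q differ from the
  values q(k / N) \<ge> 0 by O(1 / N), while the binomially weighted operators x^k (1 - x)^(N - k)
  are positive and sum to 1. The quadratic form is therefore at least -O(1 / N) times the squared
  norm of f, and N tends to infinity.\<close>

lemma pos_pol_01:
  fixes x :: "'a cop"
  assumes x: "pos x" "pos (1 - x)" and q: "\<And>t. 0 \<le> t \<Longrightarrow> t \<le> 1 \<Longrightarrow> 0 \<le> poly q t"
  shows "pos (pol q x)"
  unfolding pos_def
proof (intro conjI allI)
  show "adj (pol q x) = pol q x"
    using x by (simp add: pos_def)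
  fix f :: "'a ell2"
  define d where "d = Suc (degree q)"
  define C where "C = (\<Sum>j\<le>degree q. \<bar>coeff q j\<bar>)"
  define v where "v y = Re (cinner f (app y f))" for y :: "'a cop"
  have v_sum: "v (\<Sum>i\<in>I. y i) = (\<Sum>i\<in>I. v (y i))" for y and I :: "nat set"
    by (simp add: v_def app_sum cinner_sum_right)
  have v_scaleR: "v (r *\<^sub>R y) = r * v y" for y r
    by (simp add: v_def app_scaleR cinner_scaleR_right)
  have low: "- (C * (real d * (real d / (real N - real d)))) * (norm f)\<^sup>2 \<le> v (pol q x)" if N: "2 * d < N" for N
  proof -
    define e where "e k = smult (real (N choose k)) ([:0, 1:] ^ k * [:1, -1 :: real:] ^ (N - k))" for k
    define b where "b k = (\<Sum>j\<le>degree q. coeff q j * (real (k choose j) / real (N choose j)))" for k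
    have mon: "monom 1 j = (\<Sum>k\<le>N. smult (real (k choose j) / real (N choose j)) (e k))" if "j \<le> degree q" for j
      using monom_eq_Bernstein[of j N] that N by (simp add: e_def d_def)
    have "q = (\<Sum>j\<le>degree q. smult (coeff q j) (monom 1 j))"
      using poly_as_sum_of_monoms[of q] by (simp add: smult_monom)
    also have "\<dots> = (\<Sum>j\<le>degree q. \<Sum>k\<le>N. smult (coeff q j * (real (k choose j) / real (N choose j))) (e k))"
    proof (rule sum.cong)
      fix j assume "j \<in> {..degree q}"
      then have "monom 1 j = (\<Sum>k\<le>N. smult (real (k choose j) / real (N choose j)) (e k))"
        by (intro mon) simp
      then show "smult (coeff q j) (monom 1 j)
          = (\<Sum>k\<le>N. smult (coeff q j * (real (k choose j) / real (N choose j))) (e k))"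
        by (simp only: smult_sum2 smult_smult)
    qed simp
    also have "\<dots> = (\<Sum>k\<le>N. smult (b k) (e k))"
      by (subst sum.swap) (simp add: b_def smult_sum)
    finally have "pol q x = pol (\<Sum>k\<le>N. smult (b k) (e k)) x"
      by (rule arg_cong)
    then have q_eq: "pol q x = (\<Sum>k\<le>N. b k *\<^sub>R pol (e k) x)"
      by (simp only: pol_sum pol_smult)
    have epos: "0 \<le> v (pol (e k) x)" for k
    proof -
      have "pos (x ^ k * (1 - x) ^ (N - k))"
        using x by (intro pos_power_mult) auto
      then have "pos (pol (e k) x)"
        by (auto simp: e_def intro!: pos_scaleR)
      then show ?thesis
        by (simp add: pos_def v_def)
    qed
    have "(\<Sum>k\<le>N. pol (e k) x) = 1"
      using arg_cong[OF monom_eq_Bernstein[of 0 N], of "\<lambda>p. pol p x"]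
      by (simp add: e_def pol_sum monom_0 one_pCons[symmetric])
    then have e_sum: "(\<Sum>k\<le>N. v (pol (e k) x)) = (norm f)\<^sup>2"
      unfolding v_sum[symmetric] by (simp add: v_def cinner_self)
    have b: "- (C * (real d * (real d / (real N - real d)))) \<le> b k" if k: "k \<le> N" for k
    proof -
      have "0 \<le> poly q (real k / real N)"
        using k by (intro q) (auto simp: divide_simps)
      then have "- b k \<le> poly q (real k / real N) - b k"
        by simp
      also have "\<dots> = (\<Sum>j\<le>degree q. coeff q j * ((real k / real N) ^ j - real (k choose j) / real (N choose j)))"
        by (simp add: poly_altdef b_def sum_subtractf right_diff_distrib)
      also have "\<dots> \<le> (\<Sum>j\<le>degree q. \<bar>coeff q j\<bar> * (real d * (real d / (real N - real d))))"
      proof (rule sum_mono)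
        fix j assume "j \<in> {..degree q}"
        then have "\<bar>real (k choose j) / real (N choose j) - (real k / real N) ^ j\<bar> \<le> real d * (real d / (real N - real d))"
          using N k by (intro choose_quotient_bound) (auto simp: d_def)
        then have "\<bar>coeff q j\<bar> * \<bar>(real k / real N) ^ j - real (k choose j) / real (N choose j)\<bar>
            \<le> \<bar>coeff q j\<bar> * (real d * (real d / (real N - real d)))"
          by (intro mult_left_mono) (auto simp: abs_minus_commute)
        then show "coeff q j * ((real k / real N) ^ j - real (k choose j) / real (N choose j))
            \<le> \<bar>coeff q j\<bar> * (real d * (real d / (real N - real d)))"
          unfolding abs_mult[symmetric] by (rule order_trans[OF abs_ge_self])
      qed
      finally show ?thesis
        unfolding C_def sum_distrib_right by linarith
    qed
    have "- (C * (real d * (real d / (real N - real d)))) * (norm f)\<^sup>2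
        = (\<Sum>k\<le>N. - (C * (real d * (real d / (real N - real d)))) * v (pol (e k) x))"
      by (simp only: e_sum[symmetric] sum_distrib_left)
    also have "\<dots> \<le> (\<Sum>k\<le>N. b k * v (pol (e k) x))"
      using b epos by (intro sum_mono mult_right_mono) auto
    also have "\<dots> = v (pol q x)"
      by (simp add: q_eq v_sum v_scaleR)
    finally show ?thesis .
  qed
  have "(\<lambda>N. real d / (real N - real d)) \<longlonglongrightarrow> 0"
    by real_asymp
  then have "(\<lambda>N. - (C * (real d * (real d / (real N - real d)))) * (norm f)\<^sup>2)
      \<longlonglongrightarrow> - (C * (real d * 0)) * (norm f)\<^sup>2"
    by (intro tendsto_intros)
  then have lim: "(\<lambda>N. - (C * (real d * (real d / (real N - real d)))) * (norm f)\<^sup>2) \<longlonglongrightarrow> 0"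
    by simp
  have "0 \<le> v (pol q x)"
  proof (rule LIMSEQ_le_const2[OF lim], intro exI allI impI)
    fix N assume "2 * d + 1 \<le> N"
    then show "- (C * (real d * (real d / (real N - real d)))) * (norm f)\<^sup>2 \<le> v (pol q x)"
      by (intro low) simp
  qed
  then show "0 \<le> Re (cinner f (app (pol q x) f))"
    by (simp add: v_def)
qed

text \<open>The operator inequality a \<le> x \<le> b, in place of the inclusion of the spectrum in
  the interval from a to b.\<close>

definition spec :: "'a cop \<Rightarrow> real \<Rightarrow> real \<Rightarrow> bool" where
  "spec x a b \<longleftrightarrow> pos (x - a *\<^sub>R 1) \<and> pos (b *\<^sub>R 1 - x)"

lemma spec_adj: "spec x a b \<Longrightarrow> adj x = x"
  by (auto simp: spec_def pos_def)

lemma spec_mono: "spec x a b \<Longrightarrow> a' \<le> a \<Longrightarrow> b \<le> b' \<Longrightarrow> spec x a' b'"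
  using pos_add[OF pos_scaleR[OF _ pos_one, of "a - a'"], of "x - a *\<^sub>R 1"]
    pos_add[OF pos_scaleR[OF _ pos_one, of "b' - b"], of "b *\<^sub>R 1 - x"]
  by (simp add: spec_def algebra_simps)

lemma spec_norm:
  assumes "adj x = x" "norm x \<le> K"
  shows "spec x (- K) K"
proof -
  have "\<bar>Re (cinner f (app x f))\<bar> \<le> K * (norm f)\<^sup>2" for f
  proof -
    have "\<bar>Re (cinner f (app x f))\<bar> \<le> norm f * norm (app x f)"
      by (rule order_trans[OF abs_Re_le_cmod cinner_Cauchy_Schwarz])
    also have "\<dots> \<le> norm f * (K * norm f)"
      by (intro mult_left_mono order_trans[OF norm_app] mult_right_mono assms) auto
    finally show ?thesis
      by (simp add: power2_eq_square mult_ac)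
  qed
  note bound = this
  have "0 \<le> Re (cinner f (app x f)) + K * (norm f)\<^sup>2" "Re (cinner f (app x f)) \<le> K * (norm f)\<^sup>2" for f
    using bound[of f] by linarith+
  then show ?thesis
    using assms(1)
    by (simp add: spec_def pos_def app_add app_diff app_scaleR cinner_add_right cinner_diff_right
        cinner_scaleR_right cinner_self add.commute minus_le_iff)
qed

lemma spec_pos: "pos x \<Longrightarrow> norm x \<le> K \<Longrightarrow> spec x 0 K"
  using spec_norm[of x K] by (simp add: spec_def pos_adj)

lemma spec_adj_mult: "norm y \<le> K \<Longrightarrow> spec (adj y * y) 0 (K\<^sup>2)"
  by (rule spec_pos[OF pos_adj_mult])
    (metis norm_adj norm_ge_zero norm_mult_ineq order_trans mult_mono power2_eq_square)

lemma pos_pol: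
  assumes "spec x a b" "a < b" and q: "\<And>t. a \<le> t \<Longrightarrow> t \<le> b \<Longrightarrow> 0 \<le> poly q t"
  shows "pos (pol q x)"
proof -
  define y where "y = (1 / (b - a)) *\<^sub>R (x - a *\<^sub>R 1)"
  have "pos y"
    unfolding y_def using assms by (intro pos_scaleR) (auto simp: spec_def)
  moreover have "1 - y = (1 / (b - a)) *\<^sub>R (b *\<^sub>R 1 - x)"
  proof -
    have "1 - y = (1 / (b - a)) *\<^sub>R ((b - a) *\<^sub>R 1 - (x - a *\<^sub>R 1))"
      using \<open>a < b\<close> by (simp add: y_def scaleR_diff_right)
    then show ?thesis
      by (simp add: scaleR_diff_left)
  qed
  then have "pos (1 - y)"
    using assms by (auto simp: spec_def intro: pos_scaleR)
  ultimately have "pos (pol (pcompose q [:a, b - a:]) y)"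
  proof (rule pos_pol_01)
    fix t :: real
    assume t: "0 \<le> t" "t \<le> 1"
    have "(b - a) * t \<le> (b - a) * 1" "0 \<le> (b - a) * t"
      using t \<open>a < b\<close> by (intro mult_left_mono mult_nonneg_nonneg; simp)+
    then have "0 \<le> poly q (a + (b - a) * t)"
      by (intro q) auto
    then show "0 \<le> poly (pcompose q [:a, b - a:]) t"
      by (simp add: poly_pcompose mult.commute)
  qed
  moreover have "pol [:a, b - a:] y = x"
    using \<open>a < b\<close> by (simp add: y_def)
  ultimately show ?thesis
    by (simp add: pol_pcompose)
qed

lemma norm_le_of_pos:
  assumes "adj z = z" "0 \<le> c" "pos (c\<^sup>2 *\<^sub>R 1 - z * z)"
  shows "norm z \<le> c"
proof (rule norm_cop_bound[OF assms(2)])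
  fix f
  have "(norm (app z f))\<^sup>2 = Re (cinner f (app (z * z) f))"
    using norm_app_square[of z f] assms(1) by (metis Re_complex_of_real)
  also have "\<dots> \<le> (c * norm f)\<^sup>2"
    using assms(3) by (simp add: pos_def app_diff app_scaleR cinner_diff_right cinner_scaleR_right
        cinner_self power_mult_distrib)
  finally show "norm (app z f) \<le> c * norm f"
    using assms(2) by (auto intro: power2_le_imp_le)
qed

text \<open>Positivity of c^2 - q^2 on the interval bounds the square of the self-adjoint operator
  \<open>pol q x\<close>. Through this sup-norm estimate uniform limits of polynomials define
  operators.\<close>

lemma norm_pol_le:
  assumes "spec x a b" "a < b" and q: "\<And>t. a \<le> t \<Longrightarrow> t \<le> b \<Longrightarrow> \<bar>poly q t\<bar> \<le> c"
  shows "norm (pol q x) \<le> c"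
proof (rule norm_le_of_pos)
  show "adj (pol q x) = pol q x"
    using spec_adj[OF assms(1)] by simp
  show c: "0 \<le> c"
    using q[of a] \<open>a < b\<close> by simp
  have "pos (pol ([:c\<^sup>2:] - q * q) x)"
  proof (rule pos_pol[OF assms(1,2)])
    fix t assume "a \<le> t" "t \<le> b"
    then show "0 \<le> poly ([:c\<^sup>2:] - q * q) t"
      using q[of t] c by (simp add: power2_eq_square[symmetric] abs_le_square_iff[symmetric])
  qed
  then show "pos (c\<^sup>2 *\<^sub>R 1 - pol q x * pol q x)"
    by simp
qed

section \<open>Continuous functional calculus\<close>

lemma Weierstrass_poly:
  fixes \<phi> :: "real \<Rightarrow> real"
  assumes "continuous_on {a..b} \<phi>"
  obtains q :: "nat \<Rightarrow> real poly" where "uniform_limit {a..b} (\<lambda>n. poly (q n)) \<phi> sequentially"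
proof -
  have "\<exists>q. \<forall>t\<in>{a..b}. \<bar>\<phi> t - poly q t\<bar> < inverse (Suc n)" for n
  proof -
    obtain g where g: "real_polynomial_function g" "\<And>t. t \<in> {a..b} \<Longrightarrow> \<bar>\<phi> t - g t\<bar> < inverse (Suc n)"
      by (rule Stone_Weierstrass_real_polynomial_function[OF _ assms, of "inverse (Suc n)"]) auto
    obtain c m where cm: "g = (\<lambda>t. \<Sum>i\<le>m. c i * t ^ i)"
      using g(1) unfolding real_polynomial_function_iff_sum by blast
    have "poly (\<Sum>i\<le>m. monom (c i) i) t = g t" for t
      by (simp add: cm poly_sum poly_monom)
    then show ?thesis
      using g(2) by (intro exI[of _ "\<Sum>i\<le>m. monom (c i) i"]) simp
  qed
  then obtain q where q: "\<And>n t. t \<in> {a..b} \<Longrightarrow> \<bar>\<phi> t - poly (q n) t\<bar> < inverse (Suc n)"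
    by metis
  have "uniform_limit {a..b} (\<lambda>n. poly (q n)) \<phi> sequentially"
  proof (rule uniform_limitI)
    fix e :: real assume "0 < e"
    then have "\<forall>\<^sub>F n in sequentially. inverse (real (Suc n)) < e"
      using order_tendstoD(2)[OF LIMSEQ_inverse_real_of_nat] by blast
    then show "\<forall>\<^sub>F n in sequentially. \<forall>t\<in>{a..b}. dist (poly (q n) t) (\<phi> t) < e"
    proof eventually_elim
      case (elim n)
      then show ?case
        using less_trans[OF q[of _ n]] by (auto simp: dist_real_def abs_minus_commute)
    qed
  qed
  then show ?thesis
    by (rule that)
qed

text \<open>The interval is widened by 1 on both sides so that it is nondegenerate for x = 0 too.
  That the choice of the limit does not matter is \<open>fc_tendsto\<close>.\<close>

definition fc :: "(real \<Rightarrow> real) \<Rightarrow> 'a cop \<Rightarrow> 'a cop" where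
  "fc \<phi> x = (SOME y. \<exists>q. uniform_limit {- norm x - 1..norm x + 1} (\<lambda>n. poly (q n)) \<phi> sequentially
     \<and> (\<lambda>n. pol (q n) x) \<longlonglongrightarrow> y)"

lemma pol_Cauchy:
  assumes x: "spec x a b" "a < b" and q: "uniform_limit {a..b} (\<lambda>n. poly (q n)) \<phi> sequentially"
  shows "Cauchy (\<lambda>n. pol (q n) x)"
proof (rule CauchyI)
  fix e :: real assume "0 < e"
  then have "\<forall>\<^sub>F n in sequentially. \<forall>t\<in>{a..b}. dist (poly (q n) t) (\<phi> t) < e / 3"
    using uniform_limitD[OF q, of "e / 3"] by simp
  then obtain N where N: "\<And>n t. n \<ge> N \<Longrightarrow> t \<in> {a..b} \<Longrightarrow> \<bar>poly (q n) t - \<phi> t\<bar> < e / 3"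
    unfolding eventually_sequentially dist_real_def by blast
  have "norm (pol (q m) x - pol (q n) x) < e" if "m \<ge> N" "n \<ge> N" for m n
  proof -
    have "norm (pol (q m - q n) x) \<le> e / 3 + e / 3"
    proof (rule norm_pol_le[OF x])
      fix t assume "a \<le> t" "t \<le> b"
      then show "\<bar>poly (q m - q n) t\<bar> \<le> e / 3 + e / 3"
        using N[of m t] N[of n t] that by (simp add: abs_if split: if_splits)
    qed
    then show ?thesis
      using \<open>0 < e\<close> by simp
  qed
  then show "\<exists>M. \<forall>m\<ge>M. \<forall>n\<ge>M. norm (pol (q m) x - pol (q n) x) < e"
    by blast
qed

lemma pol_diff_tendsto:
  assumes x: "spec x a b" "a < b"
    and q: "uniform_limit {a..b} (\<lambda>n. poly (q n)) \<phi> sequentially"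
    and r: "uniform_limit {a..b} (\<lambda>n. poly (r n)) \<phi> sequentially"
  shows "(\<lambda>n. pol (q n) x - pol (r n) x) \<longlonglongrightarrow> 0"
proof (rule LIMSEQ_I)
  fix e :: real assume "0 < e"
  have "\<forall>\<^sub>F n in sequentially. \<forall>t\<in>{a..b}. dist (poly (q n) t) (\<phi> t) < e / 3"
    "\<forall>\<^sub>F n in sequentially. \<forall>t\<in>{a..b}. dist (poly (r n) t) (\<phi> t) < e / 3"
    using uniform_limitD[OF q, of "e / 3"] uniform_limitD[OF r, of "e / 3"] \<open>0 < e\<close> by simp_all
  then have "\<forall>\<^sub>F n in sequentially. norm (pol (q n) x - pol (r n) x) < e"
  proof eventually_elim
    case (elim n)
    have "norm (pol (q n - r n) x) \<le> e / 3 + e / 3"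
    proof (rule norm_pol_le[OF x])
      fix t assume "a \<le> t" "t \<le> b"
      then have "\<bar>poly (q n) t - \<phi> t\<bar> < e / 3" "\<bar>poly (r n) t - \<phi> t\<bar> < e / 3"
        using elim by (auto simp: dist_real_def)
      then show "\<bar>poly (q n - r n) t\<bar> \<le> e / 3 + e / 3"
        by (simp add: abs_if split: if_splits)
    qed
    then show ?case
      using \<open>0 < e\<close> by simp
  qed
  then show "\<exists>no. \<forall>n\<ge>no. norm (pol (q n) x - pol (r n) x - 0) < e"
    by (simp add: eventually_sequentially)
qed

text \<open>Independence of the interval and of the polynomials: the sequence chosen in the
  definition and the given one are both compared with a third sequence, which approximates on an
  interval containing the other two.\<close>

lemma fc_tendsto:
  assumes x: "spec x a b" "a < b" and \<phi>: "continuous_on UNIV \<phi>"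
    and q: "uniform_limit {a..b} (\<lambda>n. poly (q n)) \<phi> sequentially"
  shows "(\<lambda>n. pol (q n) x) \<longlonglongrightarrow> fc \<phi> x"
proof -
  let ?I = "{- norm x - 1..norm x + 1}"
  have xI: "spec x (- norm x - 1) (norm x + 1)" "- norm x - 1 < norm x + 1"
    using spec_norm[OF spec_adj[OF x(1)], of "norm x + 1"] norm_ge_zero[of x] by (simp_all del: norm_ge_zero)
  have cont: "continuous_on A \<phi>" for A
    using \<phi> continuous_on_subset by blast
  obtain q0 where q0: "uniform_limit ?I (\<lambda>n. poly (q0 n)) \<phi> sequentially"
    by (rule Weierstrass_poly[OF cont])
  then have "\<exists>y q. uniform_limit ?I (\<lambda>n. poly (q n)) \<phi> sequentially \<and> (\<lambda>n. pol (q n) x) \<longlonglongrightarrow> y"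
    using Cauchy_convergent[OF pol_Cauchy[OF xI q0]] unfolding convergent_def by blast
  then have "\<exists>q. uniform_limit ?I (\<lambda>n. poly (q n)) \<phi> sequentially \<and> (\<lambda>n. pol (q n) x) \<longlonglongrightarrow> fc \<phi> x"
    unfolding fc_def by (rule someI_ex)
  then obtain q1 where q1: "uniform_limit ?I (\<lambda>n. poly (q1 n)) \<phi> sequentially" "(\<lambda>n. pol (q1 n) x) \<longlonglongrightarrow> fc \<phi> x"
    by blast
  define A B where "A = min a (- norm x - 1)" and "B = max b (norm x + 1)"
  obtain r where r: "uniform_limit {A..B} (\<lambda>n. poly (r n)) \<phi> sequentially"
    by (rule Weierstrass_poly[OF cont])
  have r1: "uniform_limit ?I (\<lambda>n. poly (r n)) \<phi> sequentially" "uniform_limit {a..b} (\<lambda>n. poly (r n)) \<phi> sequentially"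
    by (rule uniform_limit_on_subset[OF r], auto simp: A_def B_def)+
  have "(\<lambda>n. pol (q1 n) x - (pol (q1 n) x - pol (r n) x) + (pol (q n) x - pol (r n) x)) \<longlonglongrightarrow> fc \<phi> x - 0 + 0"
    by (intro tendsto_intros q1 pol_diff_tendsto[OF xI q1(1) r1(1)] pol_diff_tendsto[OF x q r1(2)])
  then show ?thesis
    by simp
qed

lemma fc_approx:
  assumes "adj x = x" "continuous_on UNIV \<phi>" "norm x < K"
  obtains q where "uniform_limit {-K..K} (\<lambda>n. poly (q n)) \<phi> sequentially" "(\<lambda>n. pol (q n) x) \<longlonglongrightarrow> fc \<phi> x"
proof -
  obtain q where q: "uniform_limit {-K..K} (\<lambda>n. poly (q n)) \<phi> sequentially"
    by (rule Weierstrass_poly[OF continuous_on_subset[OF assms(2)]]) auto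
  moreover have "spec x (-K) K" "-K < K"
    using spec_norm[of x K] assms norm_ge_zero[of x] by (auto simp del: norm_ge_zero)
  ultimately show ?thesis
    using fc_tendsto[OF _ _ assms(2)] that by blast
qed

lemma fc_unique:
  assumes "adj x = x" "continuous_on UNIV \<phi>" "norm x < K"
    and "uniform_limit {-K..K} (\<lambda>n. poly (q n)) \<phi> sequentially" "(\<lambda>n. pol (q n) x) \<longlonglongrightarrow> y"
  shows "fc \<phi> x = y"
proof -
  have "spec x (-K) K" "-K < K"
    using spec_norm[of x K] assms norm_ge_zero[of x] by (auto simp del: norm_ge_zero)
  then show ?thesis
    using fc_tendsto[OF _ _ assms(2,4)] assms(5) LIMSEQ_unique by blast
qed

lemma fc_pol: "adj x = x \<Longrightarrow> fc (poly q) x = pol q x"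
  by (rule fc_unique[where K = "norm x + 1" and q = "\<lambda>n. q"]) (auto intro!: continuous_intros uniform_limitI)

lemma fc_const: "adj x = x \<Longrightarrow> fc (\<lambda>t. c) x = c *\<^sub>R 1"
  using fc_pol[of x "[:c:]"] by (simp add: poly_pCons[abs_def])

lemma fc_id: "adj x = x \<Longrightarrow> fc (\<lambda>t. t) x = x"
  using fc_pol[of x "[:0, 1:]"] by (simp add: poly_pCons[abs_def])

lemma adj_fc [simp]:
  assumes "adj x = x" "continuous_on UNIV \<phi>"
  shows "adj (fc \<phi> x) = fc \<phi> x"
proof -
  obtain q where q: "(\<lambda>n. pol (q n) x) \<longlonglongrightarrow> fc \<phi> x"
    using fc_approx[OF assms, of "norm x + 1"] by auto
  have "(\<lambda>n. adj (pol (q n) x)) \<longlonglongrightarrow> adj (fc \<phi> x)"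
    by (rule bounded_linear.tendsto[OF bounded_linear_adj q])
  then show ?thesis
    using q assms(1) LIMSEQ_unique by auto
qed

lemma uniform_limit_bounded:
  fixes \<phi> :: "real \<Rightarrow> real"
  assumes "continuous_on UNIV \<phi>"
  shows "bounded (\<phi> ` {a..b})"
  by (rule compact_imp_bounded[OF compact_continuous_image])
    (auto intro: continuous_on_subset[OF assms])

lemma fc_add:
  assumes "adj x = x" "continuous_on UNIV \<phi>" "continuous_on UNIV \<psi>"
  shows "fc (\<lambda>t. \<phi> t + \<psi> t) x = fc \<phi> x + fc \<psi> x"
proof -
  obtain q r where "uniform_limit {-(norm x + 1)..norm x + 1} (\<lambda>n. poly (q n)) \<phi> sequentially" "(\<lambda>n. pol (q n) x) \<longlonglongrightarrow> fc \<phi> x"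
    "uniform_limit {-(norm x + 1)..norm x + 1} (\<lambda>n. poly (r n)) \<psi> sequentially" "(\<lambda>n. pol (r n) x) \<longlonglongrightarrow> fc \<psi> x"
    using fc_approx[OF assms(1,2), of "norm x + 1"] fc_approx[OF assms(1,3), of "norm x + 1"] by (metis less_add_one)
  then show ?thesis
    by (intro fc_unique[where K = "norm x + 1" and q = "\<lambda>n. q n + r n"] assms continuous_intros)
      (simp_all add: poly_add[abs_def] uniform_limit_add tendsto_add)
qed

lemma fc_mult:
  assumes "adj x = x" "continuous_on UNIV \<phi>" "continuous_on UNIV \<psi>"
  shows "fc (\<lambda>t. \<phi> t * \<psi> t) x = fc \<phi> x * fc \<psi> x"
proof -
  obtain q r where "uniform_limit {-(norm x + 1)..norm x + 1} (\<lambda>n. poly (q n)) \<phi> sequentially" "(\<lambda>n. pol (q n) x) \<longlonglongrightarrow> fc \<phi> x"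
    "uniform_limit {-(norm x + 1)..norm x + 1} (\<lambda>n. poly (r n)) \<psi> sequentially" "(\<lambda>n. pol (r n) x) \<longlonglongrightarrow> fc \<psi> x"
    using fc_approx[OF assms(1,2), of "norm x + 1"] fc_approx[OF assms(1,3), of "norm x + 1"] by (metis less_add_one)
  then show ?thesis
    by (intro fc_unique[where K = "norm x + 1" and q = "\<lambda>n. q n * r n"] assms continuous_intros)
      (simp_all add: poly_mult[abs_def] uniform_lim_mult uniform_limit_bounded assms tendsto_mult)
qed

lemma fc_scaleR: "adj x = x \<Longrightarrow> continuous_on UNIV \<phi> \<Longrightarrow> fc (\<lambda>t. c * \<phi> t) x = c *\<^sub>R fc \<phi> x"
  using fc_mult[of x "\<lambda>t. c" \<phi>] by (simp add: fc_const)

lemma fc_diff: "adj x = x \<Longrightarrow> continuous_on UNIV \<phi> \<Longrightarrow> continuous_on UNIV \<psi> \<Longrightarrow>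
    fc (\<lambda>t. \<phi> t - \<psi> t) x = fc \<phi> x - fc \<psi> x"
  using fc_add[of x \<phi> "\<lambda>t. -1 * \<psi> t"] fc_scaleR[of x \<psi> "-1"] by (simp add: continuous_intros)

lemma fc_cong:
  assumes x: "spec x a b" "a < b" "continuous_on UNIV \<phi>" "continuous_on UNIV \<psi>"
    and eq: "\<And>t. a \<le> t \<Longrightarrow> t \<le> b \<Longrightarrow> \<phi> t = \<psi> t"
  shows "fc \<phi> x = fc \<psi> x"
proof -
  obtain q where q: "uniform_limit {a..b} (\<lambda>n. poly (q n)) \<phi> sequentially"
    by (rule Weierstrass_poly[OF continuous_on_subset[OF x(3)]]) auto
  then have "uniform_limit {a..b} (\<lambda>n. poly (q n)) \<psi> sequentially"
    by (rule uniform_limit_cong'[THEN iffD1, rotated 2]) (auto simp: eq)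
  then show ?thesis
    using fc_tendsto[OF x(1,2)] x q LIMSEQ_unique by blast
qed

text \<open>A nonnegative function is the square of a continuous one, so the operator is the square
  of a self-adjoint one. The absolute value makes the root continuous on the whole line.\<close>

lemma fc_pos:
  assumes x: "spec x a b" "a < b" "continuous_on UNIV \<phi>"
    and nn: "\<And>t. a \<le> t \<Longrightarrow> t \<le> b \<Longrightarrow> 0 \<le> \<phi> t"
  shows "pos (fc \<phi> x)"
proof -
  have sa: "adj x = x"
    using x(1) by (rule spec_adj)
  have c: "continuous_on UNIV (\<lambda>t. sqrt \<bar>\<phi> t\<bar>)"
    by (intro continuous_intros x)
  have "fc \<phi> x = fc (\<lambda>t. sqrt \<bar>\<phi> t\<bar> * sqrt \<bar>\<phi> t\<bar>) x"
    by (rule fc_cong[OF x(1,2)]) (auto intro!: continuous_intros x simp: nn)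
  also have "\<dots> = fc (\<lambda>t. sqrt \<bar>\<phi> t\<bar>) x * fc (\<lambda>t. sqrt \<bar>\<phi> t\<bar>) x"
    by (rule fc_mult[OF sa c c])
  finally show ?thesis
    using pos_mult_self[OF adj_fc[OF sa c]] by simp
qed

lemma norm_fc_le:
  assumes x: "spec x a b" "a < b" "continuous_on UNIV \<phi>"
    and le: "\<And>t. a \<le> t \<Longrightarrow> t \<le> b \<Longrightarrow> \<bar>\<phi> t\<bar> \<le> c"
  shows "norm (fc \<phi> x) \<le> c"
proof (rule norm_le_of_pos)
  have sa: "adj x = x"
    using x(1) by (rule spec_adj)
  show "adj (fc \<phi> x) = fc \<phi> x"
    using sa x by simp
  show c: "0 \<le> c"
    using le[of a] \<open>a < b\<close> by simp
  have "pos (fc (\<lambda>t. c\<^sup>2 - \<phi> t * \<phi> t) x)"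
  proof (rule fc_pos[OF x(1,2)])
    fix t assume "a \<le> t" "t \<le> b"
    then show "0 \<le> c\<^sup>2 - \<phi> t * \<phi> t"
      using le[of t] c by (simp add: power2_eq_square[symmetric] abs_le_square_iff[symmetric])
  qed (intro continuous_intros x)
  then show "pos (c\<^sup>2 *\<^sub>R 1 - fc \<phi> x * fc \<phi> x)"
    by (simp add: fc_diff fc_mult fc_const sa x continuous_intros)
qed

lemma fc_uniform_tendsto:
  assumes x: "spec x a b" "a < b" "continuous_on UNIV \<phi>" "\<And>n. continuous_on UNIV (\<Phi> n)"
    and lim: "uniform_limit {a..b} \<Phi> \<phi> sequentially"
  shows "(\<lambda>n. fc (\<Phi> n) x) \<longlonglongrightarrow> fc \<phi> x"
proof (rule LIMSEQ_I)
  fix e :: real assume "0 < e"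
  then have "\<forall>\<^sub>F n in sequentially. \<forall>t\<in>{a..b}. dist (\<Phi> n t) (\<phi> t) < e / 2"
    using uniform_limitD[OF lim, of "e / 2"] by simp
  then have "\<forall>\<^sub>F n in sequentially. norm (fc (\<Phi> n) x - fc \<phi> x) < e"
  proof eventually_elim
    case (elim n)
    have "norm (fc (\<lambda>t. \<Phi> n t - \<phi> t) x) \<le> e / 2"
      by (rule norm_fc_le[OF x(1,2)]) (use elim in \<open>auto intro!: continuous_intros x simp: dist_real_def less_imp_le\<close>)
    then show ?case
      using \<open>0 < e\<close> spec_adj[OF x(1)] by (simp add: fc_diff x)
  qed
  then show "\<exists>no. \<forall>n\<ge>no. norm (fc (\<Phi> n) x - fc \<phi> x) < e"
    by (simp add: eventually_sequentially)
qed

lemma fc_pol_comp: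
  assumes "adj x = x" "continuous_on UNIV \<psi>"
  shows "fc (\<lambda>t. poly q (\<psi> t)) x = pol q (fc \<psi> x)"
proof (induction q)
  case 0
  then show ?case
    using assms by (simp add: fc_const)
next
  case (pCons a q)
  then show ?case
    using assms by (simp add: fc_add fc_mult fc_const continuous_intros)
qed

lemma fc_comp:
  assumes x: "adj x = x" "continuous_on UNIV \<phi>" "continuous_on UNIV \<psi>"
  shows "fc \<phi> (fc \<psi> x) = fc (\<lambda>t. \<phi> (\<psi> t)) x"
proof -
  have sa: "adj (fc \<psi> x) = fc \<psi> x"
    using x by simp
  have sx: "spec x (- norm x - 1) (norm x + 1)" "- norm x - 1 < norm x + 1"
    using spec_norm[OF x(1), of "norm x + 1"] norm_ge_zero[of x] by (simp_all del: norm_ge_zero)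
  obtain B where B: "\<And>t. t \<in> {- norm x - 1..norm x + 1} \<Longrightarrow> \<bar>\<psi> t\<bar> \<le> B"
    using uniform_limit_bounded[OF x(3), of "- norm x - 1" "norm x + 1"] unfolding bounded_iff by (metis imageI real_norm_def)
  \<comment> \<open>K has to exceed the values of \<open>\<psi>\<close>, for the composed functions,
    and the norm of \<open>fc \<psi> x\<close>, for the outer calculus.\<close>
  define K where "K = max B (norm (fc \<psi> x)) + 1"
  obtain q where q: "uniform_limit {-K..K} (\<lambda>n. poly (q n)) \<phi> sequentially" "(\<lambda>n. pol (q n) (fc \<psi> x)) \<longlonglongrightarrow> fc \<phi> (fc \<psi> x)"
    by (rule fc_approx[OF sa x(2), of K]) (auto simp: K_def)
  have "(\<lambda>n. fc (\<lambda>t. poly (q n) (\<psi> t)) x) \<longlonglongrightarrow> fc (\<lambda>t. \<phi> (\<psi> t)) x"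
  proof (rule fc_uniform_tendsto[OF sx])
    show "uniform_limit {- norm x - 1..norm x + 1} (\<lambda>n t. poly (q n) (\<psi> t)) (\<lambda>t. \<phi> (\<psi> t)) sequentially"
    proof (rule uniform_limitI)
      fix e :: real assume "0 < e"
      from uniform_limitD[OF q(1) this]
      show "\<forall>\<^sub>F n in sequentially. \<forall>t\<in>{- norm x - 1..norm x + 1}. dist (poly (q n) (\<psi> t)) (\<phi> (\<psi> t)) < e"
      proof eventually_elim
        case (elim n)
        then show ?case
          using B by (fastforce simp: K_def abs_le_iff)
      qed
    qed
    show "continuous_on UNIV (\<lambda>t. \<phi> (\<psi> t))" "continuous_on UNIV (\<lambda>t. poly (q n) (\<psi> t))" for n
      using continuous_on_compose2[OF x(2,3)] by (auto intro!: continuous_intros x)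
  qed
  then show ?thesis
    using q(2) by (simp add: fc_pol_comp x LIMSEQ_unique)
qed

lemma fc_in:
  assumes "adj x = x" "continuous_on UNIV \<phi>"
    and "closed N" "1 \<in> N" "x \<in> N" "\<And>y z. y \<in> N \<Longrightarrow> z \<in> N \<Longrightarrow> y + z \<in> N"
      "\<And>y z. y \<in> N \<Longrightarrow> z \<in> N \<Longrightarrow> y * z \<in> N" "\<And>r y. y \<in> N \<Longrightarrow> r *\<^sub>R y \<in> N"
  shows "fc \<phi> x \<in> N"
proof -
  have "0 \<in> N"
    using assms(8)[OF assms(4), of 0] by simp
  then have "pol q x \<in> N" for q
    by (induction q) (auto intro!: assms)
  moreover obtain q where "(\<lambda>n. pol (q n) x) \<longlonglongrightarrow> fc \<phi> x"
    using fc_approx[OF assms(1,2), of "norm x + 1"] by auto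
  ultimately show ?thesis
    by (rule closed_sequentially[OF \<open>closed N\<close>, of "\<lambda>n. pol (q n) x"])
qed

section \<open>Exponentials and the three lines theorem\<close>

text \<open>Partial sums of the exponential series are polynomials in L and converge uniformly on
  bounded intervals, so the exponential of the Banach algebra is an instance of the functional
  calculus.\<close>

lemma exp_scaleR_eq_fc:
  assumes "adj L = L"
  shows "exp (r *\<^sub>R L) = fc (\<lambda>t. exp (r * t)) L"
proof -
  define q where "q n = (\<Sum>i<n. monom (r ^ i / fact i) i)" for n
  define K where "K = norm L + 1"
  have q: "poly (q n) t = (\<Sum>i<n. (r * t) ^ i /\<^sub>R fact i)" for n t
    by (simp add: q_def poly_sum poly_monom power_mult_distrib divide_inverse mult_ac)
  have "uniform_limit {-K..K} (\<lambda>n t. \<Sum>i<n. (r * t) ^ i /\<^sub>R fact i) (\<lambda>t. exp (r * t)) sequentially"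
    unfolding exp_def
  proof (rule Weierstrass_m_test)
    fix n t assume t: "t \<in> {-K..K}"
    then have "\<bar>r * t\<bar> ^ n \<le> (\<bar>r\<bar> * K) ^ n"
      by (intro power_mono) (auto simp: abs_mult intro!: mult_left_mono)
    then show "norm ((r * t) ^ n /\<^sub>R fact n) \<le> (\<bar>r\<bar> * K) ^ n /\<^sub>R fact n"
      using mult_left_mono[of "\<bar>r * t\<bar> ^ n" "(\<bar>r\<bar> * K) ^ n" "inverse (fact n)"]
      by (simp add: abs_mult power_abs)
  qed (rule summable_exp_generic)
  then have lim: "uniform_limit {-K..K} (\<lambda>n. poly (q n)) (\<lambda>t. exp (r * t)) sequentially"
    by (simp add: q[abs_def])
  have "(\<lambda>n. \<Sum>i<n. (r *\<^sub>R L) ^ i /\<^sub>R fact i) \<longlonglongrightarrow> exp (r *\<^sub>R L)"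
    using exp_converges[of "r *\<^sub>R L"] by (simp add: sums_def)
  moreover have "(\<Sum>i<n. (r *\<^sub>R L) ^ i /\<^sub>R fact i) = pol (q n) L" for n
  proof -
    have "pol (monom c i) L = c *\<^sub>R L ^ i" for c i
      by (simp add: monom_altdef)
    then show ?thesis
      by (simp add: q_def pol_sum scaleR_power divide_inverse mult.commute)
  qed
  ultimately have "(\<lambda>n. pol (q n) L) \<longlonglongrightarrow> exp (r *\<^sub>R L)"
    by simp
  with lim show ?thesis
    by (intro fc_unique[symmetric, OF assms, where K = K]) (auto simp: K_def intro!: continuous_intros)
qed

lemma adj_exp [simp]: "adj (exp x) = exp (adj x)"
proof -
  have "(\<lambda>n. x ^ n /\<^sub>R fact n) sums exp x"
    by (rule exp_converges)
  then have "(\<lambda>n. adj (x ^ n /\<^sub>R fact n)) sums adj (exp x)"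
    by (rule bounded_linear.sums[OF bounded_linear_adj])
  moreover have "(\<lambda>n. adj (x ^ n /\<^sub>R fact n)) sums exp (adj x)"
    using exp_converges[of "adj x"] by simp
  ultimately show ?thesis
    by (rule sums_unique2)
qed

lemma cS_mult_mult: "(cS c * x) * (cS d * y) = cS (c * d) * (x * y)"
  by (simp only: mult.assoc cS_left_commute[of x] cS_mult)

lemma exp_cS_add: "exp (cS (c + d) * L) = exp (cS c * L) * exp (cS d * L)"
proof -
  have "(cS c * L) * (cS d * L) = (cS d * L) * (cS c * L)"
    by (simp only: cS_mult_mult mult.commute[of c d])
  then have "exp (cS c * L + cS d * L) = exp (cS c * L) * exp (cS d * L)"
    by (rule exp_add_commuting)
  then show ?thesis
    by (simp add: cS_add distrib_right)
qed

text \<open>The adjoint is the exponential with the opposite exponent, so the operator is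
  unitary.\<close>

lemma norm_exp_imag:
  assumes "adj L = L"
  shows "norm (exp (cS (\<i> * of_real y) * L)) \<le> 1"
proof (rule norm_le_of_adj_mult)
  have "adj (exp (cS (\<i> * of_real y) * L)) * exp (cS (\<i> * of_real y) * L)
      = exp (cS (- (\<i> * of_real y)) * L) * exp (cS (\<i> * of_real y) * L)"
    using assms by (simp add: cS_commute)
  also have "\<dots> = 1"
    unfolding exp_cS_add[symmetric] by simp
  finally show "norm (adj (exp (cS (\<i> * of_real y) * L)) * exp (cS (\<i> * of_real y) * L)) \<le> 1\<^sup>2"
    by simp
qed simp

lemma norm_exp_minus_bound:
  fixes X :: "'x::{real_normed_algebra_1, banach}"
  shows "norm (exp X - 1 - X) \<le> exp (norm X) - 1 - norm X"
proof -
  have s: "summable (\<lambda>n. inverse (fact (n + 2)) *\<^sub>R (norm X ^ (n + 2)))"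
    using summable_ignore_initial_segment[OF summable_exp_generic[of "norm X"], of 2] by simp
  have "exp X - 1 - X = (\<Sum>n. inverse (fact (n + 2)) *\<^sub>R (X ^ (n + 2)))"
    using exp_first_two_terms[of X] by simp
  also have "norm \<dots> \<le> (\<Sum>n. inverse (fact (n + 2)) *\<^sub>R (norm X ^ (n + 2)))"
  proof (rule norm_suminf_le[OF _ s])
    show "norm (inverse (fact (n + 2)) *\<^sub>R X ^ (n + 2)) \<le> inverse (fact (n + 2)) *\<^sub>R norm X ^ (n + 2)" for n
      using norm_power_ineq[of X "n + 2"] by (auto intro!: mult_left_mono)
  qed
  also have "\<dots> = exp (norm X) - 1 - norm X"
    using exp_first_two_terms[of "norm X"] by simp
  finally show ?thesis .
qed

lemma exp_has_derivative_0:
  "(exp has_derivative (\<lambda>h. h)) (at (0 :: 'x::{real_normed_algebra_1, banach}))"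
proof -
  have "((\<lambda>r::real. (exp r - 1 - r) / r) \<longlongrightarrow> 0) (at_right 0)"
    by real_asymp
  then have lim: "((\<lambda>h::'x. (exp (norm h) - 1 - norm h) / norm h) \<longlongrightarrow> 0) (at 0)"
    by (rule filterlim_compose)
      (auto simp: filterlim_at eventually_at_filter intro!: tendsto_eq_intros)
  have "((\<lambda>h::'x. (exp h - exp 0 - h) /\<^sub>R norm h) \<longlongrightarrow> 0) (at 0)"
  proof (rule Lim_null_comparison[OF _ lim])
    show "\<forall>\<^sub>F h::'x in at 0. norm ((exp h - exp 0 - h) /\<^sub>R norm h) \<le> (exp (norm h) - 1 - norm h) / norm h"
      using norm_exp_minus_bound by (auto simp: divide_inverse mult.commute intro!: always_eventually mult_left_mono)
  qed
  then show ?thesis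
    by (simp add: has_derivative_at_within bounded_linear_ident)
qed

text \<open>All values lie in one commuting family, so the exponential law moves the derivative at 0
  to the point z. The central factor \<open>cS h\<close> in front displays complex linearity in h,
  which holomorphy will need.\<close>

lemma exp_cS_has_derivative:
  "((\<lambda>z. exp (cS (a + b * z) * L)) has_derivative (\<lambda>h. cS h * (cS b * L * exp (cS (a + b * z) * L)))) (at z)"
proof -
  have lin: "bounded_linear (\<lambda>h. cS (b * h) * L)"
    by (rule bounded_linear_mult_left[THEN bounded_linear_compose,
      OF bounded_linear_compose[OF bounded_linear_cS bounded_linear_mult_right]])
  have "((\<lambda>w. cS (b * (w - z)) * L) has_derivative (\<lambda>h. cS (b * h) * L)) (at z)"
  proof -
    have "((\<lambda>w. w - z) has_derivative (\<lambda>h. h)) (at z)"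
      by (auto intro!: derivative_eq_intros)
    then show ?thesis
      by (rule has_derivative_compose[OF _ bounded_linear_imp_has_derivative[OF lin]])
  qed
  moreover have "(exp has_derivative (\<lambda>h. h)) (at (cS (b * (z - z)) * L))"
    using exp_has_derivative_0 by simp
  ultimately have "((\<lambda>w. exp (cS (b * (w - z)) * L)) has_derivative (\<lambda>h. cS (b * h) * L)) (at z)"
    using has_derivative_compose[of "\<lambda>w. cS (b * (w - z)) * L" "\<lambda>h. cS (b * h) * L" z UNIV exp "\<lambda>h. h"] by simp
  then have "((\<lambda>w. exp (cS (b * (w - z)) * L) * exp (cS (a + b * z) * L)) has_derivative
      (\<lambda>h. cS (b * h) * L * exp (cS (a + b * z) * L))) (at z)"
    by (rule has_derivative_mult_left)
  moreover have "exp (cS (b * (w - z)) * L) * exp (cS (a + b * z) * L) = exp (cS (a + b * w) * L)" for w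
    unfolding exp_cS_add[symmetric] by (simp add: algebra_simps)
  moreover have "cS (b * h) * L * exp (cS (a + b * z) * L) = cS h * (cS b * L * exp (cS (a + b * z) * L))" for h
    by (simp only: mult.commute[of b h] cS_mult mult.assoc)
  ultimately show ?thesis
    by simp
qed

text \<open>F is multiplied by exp (e (z^2 - 1)), which has modulus at most 1 on the strip and
  decays with the imaginary part. The maximum principle on a tall rectangle bounds the damped
  function, and then e tends to 0.\<close>

lemma three_lines:
  fixes F :: "complex \<Rightarrow> complex"
  assumes holo: "F holomorphic_on UNIV"
    and bdd: "\<And>z. 0 \<le> Re z \<Longrightarrow> Re z \<le> 1 \<Longrightarrow> cmod (F z) \<le> B"
    and left: "\<And>y. cmod (F (\<i> * of_real y)) \<le> 1"
    and right: "\<And>y. cmod (F (1 + \<i> * of_real y)) \<le> 1"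
    and \<theta>: "0 \<le> \<theta>" "\<theta> \<le> 1"
  shows "cmod (F (of_real \<theta>)) \<le> 1"
proof -
  have B: "0 \<le> B"
    using bdd[of 0] by (auto intro: order_trans[OF norm_ge_zero])
  have eps: "cmod (F (of_real \<theta>)) * exp (e * (\<theta>\<^sup>2 - 1)) \<le> 1" if e: "0 < e" for e
  proof -
    define G where "G z = F z * exp (of_real e * (z\<^sup>2 - 1))" for z
    have G: "cmod (G z) = cmod (F z) * exp (e * ((Re z)\<^sup>2 - (Im z)\<^sup>2 - 1))" for z
      by (simp add: G_def norm_mult Re_power2)
    \<comment> \<open>With this height B \<le> e R \<le> e R^2 \<le> exp (e R^2), so the damping
      beats the bound B on the horizontal edges.\<close>
    define R where "R = 1 + B / e"
    have R: "1 \<le> R"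
      using B e by (simp add: R_def)
    have big: "B * exp (- (e * R\<^sup>2)) \<le> 1"
    proof -
      have "B \<le> e * R"
        using e by (simp add: R_def field_simps)
      also have "e * R \<le> e * R\<^sup>2"
        using R e self_le_power[of R 2] by simp
      also have "\<dots> \<le> exp (e * R\<^sup>2)"
        using exp_ge_add_one_self[of "e * R\<^sup>2"] by linarith
      finally show ?thesis
        by (simp add: exp_minus divide_simps)
    qed
    let ?S = "cbox (Complex 0 (- R)) (Complex 1 R)"
    have holG: "G holomorphic_on UNIV"
      unfolding G_def by (intro holomorphic_intros holo)
    have "norm (G (of_real \<theta>)) \<le> 1"
    proof (rule maximum_modulus_frontier[of G ?S])
      show "G holomorphic_on interior ?S" "continuous_on (closure ?S) G"
        using holG holomorphic_on_subset holomorphic_on_imp_continuous_on by blast+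
      show "bounded ?S"
        by (rule bounded_cbox)
      show "of_real \<theta> \<in> ?S"
        using \<theta> R by (auto simp: in_cbox_complex_iff)
      fix z assume "z \<in> frontier ?S"
      then have "z \<in> ?S - box (Complex 0 (- R)) (Complex 1 R)"
        by (simp add: frontier_cbox)
      then have z: "0 \<le> Re z" "Re z \<le> 1" "- R \<le> Im z" "Im z \<le> R"
        and edge: "Re z = 0 \<or> Re z = 1 \<or> Im z = R \<or> Im z = - R"
        by (auto simp: in_cbox_complex_iff in_box_complex_iff)
      have Re2: "(Re z)\<^sup>2 \<le> 1"
        using z by (simp add: power_le_one)
      show "norm (G z) \<le> 1"
      proof (cases "Re z = 0 \<or> Re z = 1")
        case True
        then have "cmod (F z) \<le> 1"
          using left[of "Im z"] right[of "Im z"] complex_eq[of z] by auto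
        moreover have "exp (e * ((Re z)\<^sup>2 - (Im z)\<^sup>2 - 1)) \<le> 1"
          using e Re2 by (simp add: mult_le_0_iff) (smt (verit) zero_le_power2)
        ultimately show ?thesis
          unfolding G by (intro mult_le_one) auto
      next
        case False
        then have "(Im z)\<^sup>2 = R\<^sup>2"
          using edge by auto
        then have "exp (e * ((Re z)\<^sup>2 - (Im z)\<^sup>2 - 1)) \<le> exp (- (e * R\<^sup>2))"
          using e Re2 mult_left_mono[of "(Re z)\<^sup>2 - 1" 0 e] by (simp add: algebra_simps)
        then have "cmod (G z) \<le> B * exp (- (e * R\<^sup>2))"
          unfolding G using bdd[OF z(1,2)] B by (intro mult_mono) auto
        with big show ?thesis
          by simp
      qed
    qed
    then show ?thesis
      by (simp add: G)
  qed
  have "((\<lambda>e. cmod (F (of_real \<theta>)) * exp (e * (\<theta>\<^sup>2 - 1))) \<longlongrightarrow> cmod (F (of_real \<theta>)) * exp (0 * (\<theta>\<^sup>2 - 1))) (at_right 0)"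
    by (intro tendsto_intros)
  then have "cmod (F (of_real \<theta>)) * exp (0 * (\<theta>\<^sup>2 - 1)) \<le> 1"
    by (rule tendsto_upperbound) (auto simp: eventually_at_filter eps)
  then show ?thesis
    by simp
qed

text \<open>Multiplication by M0^(z - 1) M1^(-z) normalizes both edges to 1; strict positivity of
  the two bounds enters here.\<close>

lemma three_lines_scaled:
  fixes F :: "complex \<Rightarrow> complex"
  assumes holo: "F holomorphic_on UNIV"
    and bdd: "\<And>z. 0 \<le> Re z \<Longrightarrow> Re z \<le> 1 \<Longrightarrow> cmod (F z) \<le> B"
    and left: "\<And>y. cmod (F (\<i> * of_real y)) \<le> M0"
    and right: "\<And>y. cmod (F (1 + \<i> * of_real y)) \<le> M1"
    and M: "0 < M0" "0 < M1"
    and \<theta>: "0 \<le> \<theta>" "\<theta> \<le> 1"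
  shows "cmod (F (of_real \<theta>)) \<le> M0 powr (1 - \<theta>) * M1 powr \<theta>"
proof -
  define E where "E z = exp (- ((1 - z) * of_real (ln M0) + z * of_real (ln M1)))" for z :: complex
  have E: "cmod (E z) = exp (- ((1 - Re z) * ln M0 + Re z * ln M1))" for z
    by (simp add: E_def)
  have "cmod (F (of_real \<theta>) * E (of_real \<theta>)) \<le> 1"
  proof (rule three_lines[OF _ _ _ _ \<theta>])
    show "(\<lambda>z. F z * E z) holomorphic_on UNIV"
      unfolding E_def by (intro holomorphic_intros holo)
    show "cmod (F (\<i> * of_real y) * E (\<i> * of_real y)) \<le> 1" for y
      using left[of y] M by (simp add: norm_mult E exp_minus divide_simps)
    show "cmod (F (1 + \<i> * of_real y) * E (1 + \<i> * of_real y)) \<le> 1" for y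
      using right[of y] M by (simp add: norm_mult E exp_minus divide_simps)
    fix z :: complex assume z: "0 \<le> Re z" "Re z \<le> 1"
    have "- ((1 - Re z) * ln M0 + Re z * ln M1) \<le> \<bar>1 - Re z\<bar> * \<bar>ln M0\<bar> + \<bar>Re z\<bar> * \<bar>ln M1\<bar>"
      unfolding abs_mult[symmetric] by linarith
    also have "\<dots> \<le> 1 * \<bar>ln M0\<bar> + 1 * \<bar>ln M1\<bar>"
      using z by (intro add_mono mult_right_mono) auto
    finally have "cmod (E z) \<le> exp (\<bar>ln M0\<bar> + \<bar>ln M1\<bar>)"
      unfolding E by simp
    then show "cmod (F z * E z) \<le> B * exp (\<bar>ln M0\<bar> + \<bar>ln M1\<bar>)"
      unfolding norm_mult using bdd[OF z] by (intro mult_mono) (auto intro: order_trans[OF norm_ge_zero])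
  qed
  moreover define D where "D = M0 powr (1 - \<theta>) * M1 powr \<theta>"
  moreover have "cmod (E (of_real \<theta>)) = inverse D" "0 < D"
    using M by (simp_all add: E D_def powr_def exp_add[symmetric] exp_minus[symmetric])
  ultimately show ?thesis
    by (simp add: norm_mult field_simps)
qed

section \<open>Noncommutative \<open>L\<^sub>p\<close>-norms of a tracial algebra\<close>

definition tr :: "'a \<Rightarrow> 'a cop \<Rightarrow> complex" where
  "tr e x = cinner (delta e) (app x (delta e))"

lemma tr_add: "tr e (x + y) = tr e x + tr e y"
  by (simp add: tr_def app_add cinner_add_right)

lemma tr_diff: "tr e (x - y) = tr e x - tr e y"
  by (simp add: tr_def app_diff cinner_diff_right)

lemma tr_cS: "tr e (cS c * x) = c * tr e x"
  by (simp add: tr_def app_mult app_cS cinner_scaleC_right)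

lemma tr_scaleR: "tr e (r *\<^sub>R x) = of_real r * tr e x"
  by (simp add: tr_def app_scaleR cinner_scaleR_right)

lemma tr_one [simp]: "tr e 1 = 1"
  by (simp add: tr_def cinner_self)

lemma tr_zero [simp]: "tr e 0 = 0"
  by (simp add: tr_def)

lemma norm_tr: "cmod (tr e x) \<le> norm x"
  using cinner_Cauchy_Schwarz[of "delta e" "app x (delta e)"] norm_app[of x "delta e"]
  by (simp add: tr_def)

lemma bounded_linear_tr: "bounded_linear (tr e)"
  by (rule bounded_linear_intro[where K = 1])
    (simp_all add: tr_add tr_scaleR scaleR_conv_of_real[where 'a = complex] norm_tr)

lemma tr_adj: "tr e (adj x) = cnj (tr e x)"
  unfolding tr_def by (subst cinner_commute) (simp add: cinner_app_left)

lemma tr_pos: "pos x \<Longrightarrow> 0 \<le> Re (tr e x)"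
  by (simp add: tr_def pos_def)

lemma tr_adj_mult: "tr e (adj x * x) = of_real ((norm (app x (delta e)))\<^sup>2)"
  unfolding norm_app_square by (simp add: tr_def)

lemma tr_fc_mono:
  assumes x: "spec x a b" "a < b" and c: "continuous_on UNIV \<phi>" "continuous_on UNIV \<psi>"
    and le: "\<And>t. a \<le> t \<Longrightarrow> t \<le> b \<Longrightarrow> \<phi> t \<le> \<psi> t"
  shows "Re (tr e (fc \<phi> x)) \<le> Re (tr e (fc \<psi> x))"
proof -
  have "pos (fc (\<lambda>t. \<psi> t - \<phi> t) x)"
    using le by (intro fc_pos[OF x] continuous_intros c) auto
  then show ?thesis
    using tr_pos[of "fc \<psi> x - fc \<phi> x" e] spec_adj[OF x(1)] c by (simp add: fc_diff tr_diff)
qed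

section \<open>Regularized moments and the exponential factorization\<close>

lemma continuous_abs_powr [continuous_intros]: "0 < r \<Longrightarrow> continuous_on A (\<lambda>t::real. \<bar>t\<bar> powr r)"
  by (intro continuous_on_powr' continuous_intros) auto

lemma continuous_abs_add_powr [continuous_intros]:
  "0 < (\<epsilon>::real) \<Longrightarrow> continuous_on A (\<lambda>t. (\<bar>t\<bar> + \<epsilon>) powr r)"
  by (intro continuous_on_powr' continuous_intros ballI conjI impI) (auto simp: add_nonneg_eq_0_iff)

text \<open>\<open>ms e p x\<close> is \<open>\<tau>(|x|\<^sup>p)\<close>; \<open>pms\<close> is its regularization \<open>\<tau>((|x|\<^sup>2 + \<epsilon>)\<^sup>p\<^sup>/\<^sup>2)\<close>.\<close>

definition ms :: "'a \<Rightarrow> real \<Rightarrow> 'a cop \<Rightarrow> real" where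
  "ms e p x = Re (tr e (fc (\<lambda>t. \<bar>t\<bar> powr (p / 2)) (adj x * x)))"

definition nrm :: "'a \<Rightarrow> real \<Rightarrow> 'a cop \<Rightarrow> real" where
  "nrm e p x = ms e p x powr (1 / p)"

definition pms :: "'a \<Rightarrow> real \<Rightarrow> real \<Rightarrow> 'a cop \<Rightarrow> real" where
  "pms e p \<epsilon> x = Re (tr e (fc (\<lambda>t. (\<bar>t\<bar> + \<epsilon>) powr (p / 2)) (adj x * x)))"

lemma spec_adj_mult': "spec (adj x * x) 0 ((norm x)\<^sup>2 + 1)" "0 < (norm x)\<^sup>2 + 1"
  using spec_mono[OF spec_adj_mult[of x "norm x"]] by (auto simp: add_nonneg_pos)

lemma ms_nonneg: "0 < p \<Longrightarrow> 0 \<le> ms e p x"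
  unfolding ms_def by (intro tr_pos fc_pos[OF spec_adj_mult'] continuous_intros) auto

lemma nrm_nonneg: "0 \<le> nrm e p x"
  by (simp add: nrm_def)

text \<open>The function under the trace is at least the positive constant \<epsilon>^(p / 2). The
  scaled three lines theorem divides by these moments.\<close>

lemma pms_pos: "0 < p \<Longrightarrow> 0 < \<epsilon> \<Longrightarrow> 0 < pms e p \<epsilon> x"
proof -
  assume p: "0 < p" "0 < \<epsilon>"
  have "Re (tr e (fc (\<lambda>t. \<epsilon> powr (p / 2)) (adj x * x))) \<le> pms e p \<epsilon> x"
    unfolding pms_def using p by (intro tr_fc_mono[OF spec_adj_mult'] continuous_intros powr_mono2) auto
  then show ?thesis
    using p by (simp add: fc_const tr_scaleR) (smt (verit) powr_gt_zero)
qed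

lemma pms_tendsto:
  assumes "0 < p"
  shows "(\<lambda>n. pms e p (inverse (real (Suc n))) x) \<longlonglongrightarrow> ms e p x"
proof -
  define K where "K = (norm x)\<^sup>2 + 1"
  have sp: "spec (adj x * x) 0 K" "0 < K"
    using spec_adj_mult'[of x] by (simp_all add: K_def)
  have "uniform_limit {0..K} (\<lambda>n t. (\<bar>t\<bar> + inverse (real (Suc n))) powr (p / 2)) (\<lambda>t. \<bar>t\<bar> powr (p / 2)) sequentially"
  proof (rule uniform_limitI)
    fix r :: real assume r: "0 < r"
    have "uniformly_continuous_on {0..K + 1} (\<lambda>t. \<bar>t\<bar> powr (p / 2))"
      using assms by (intro compact_uniformly_continuous continuous_intros) auto
    then obtain d where d: "0 < d" "\<And>s t. s \<in> {0..K + 1} \<Longrightarrow> t \<in> {0..K + 1} \<Longrightarrow> dist s t < d \<Longrightarrow>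
        dist (\<bar>s\<bar> powr (p / 2)) (\<bar>t\<bar> powr (p / 2)) < r"
      using r unfolding uniformly_continuous_on_def by metis
    have "\<forall>\<^sub>F n in sequentially. inverse (real (Suc n)) < min d 1"
      using order_tendstoD(2)[OF LIMSEQ_inverse_real_of_nat, of "min d 1"] d(1) by simp
    then show "\<forall>\<^sub>F n in sequentially. \<forall>t\<in>{0..K}.
        dist ((\<bar>t\<bar> + inverse (real (Suc n))) powr (p / 2)) (\<bar>t\<bar> powr (p / 2)) < r"
    proof eventually_elim
      case (elim n)
      show ?case
      proof
        fix t assume t: "t \<in> {0..K}"
        have "0 < inverse (real (Suc n))"
          by simp
        with elim t have "dist (\<bar>t + inverse (real (Suc n))\<bar> powr (p / 2)) (\<bar>t\<bar> powr (p / 2)) < r"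
          by (intro d(2)) (auto simp: dist_real_def simp del: of_nat_Suc)
        moreover have "\<bar>t + inverse (real (Suc n))\<bar> = \<bar>t\<bar> + inverse (real (Suc n))"
          using t by simp
        ultimately show "dist ((\<bar>t\<bar> + inverse (real (Suc n))) powr (p / 2)) (\<bar>t\<bar> powr (p / 2)) < r"
          by (simp only:)
      qed
    qed
  qed
  then have "(\<lambda>n. fc (\<lambda>t. (\<bar>t\<bar> + inverse (real (Suc n))) powr (p / 2)) (adj x * x)) \<longlonglongrightarrow> fc (\<lambda>t. \<bar>t\<bar> powr (p / 2)) (adj x * x)"
    using assms by (intro fc_uniform_tendsto[OF sp] continuous_intros) auto
  then show ?thesis
    unfolding pms_def ms_def by (intro tendsto_Re bounded_linear.tendsto[OF bounded_linear_tr])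
qed

lemma pms_powr_tendsto:
  assumes "1 < p"
  shows "(\<lambda>n. pms e p (inverse (real (Suc n))) x powr (1 / p)) \<longlonglongrightarrow> nrm e p x"
  unfolding nrm_def
proof (rule tendsto_powr2)
  show "(\<lambda>n. pms e p (inverse (real (Suc n))) x) \<longlonglongrightarrow> ms e p x"
    using assms by (intro pms_tendsto) auto
  have "0 \<le> pms e p (inverse (real (Suc n))) x" for n
    using assms by (intro less_imp_le pms_pos) auto
  then show "\<forall>\<^sub>F n in sequentially. 0 \<le> pms e p (inverse (real (Suc n))) x"
    by simp
qed (use assms in \<open>auto intro!: tendsto_const\<close>)

text \<open>The operators \<open>v\<close> and \<open>L\<close> of the factorization \<open>x = v exp L\<close>, where \<open>exp L\<close> is
  \<open>(|x|\<^sup>2 + \<epsilon>)\<^sup>1\<^sup>/\<^sup>2\<close> and \<open>v\<close> is a contraction. It replaces the polar decomposition.\<close>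

definition plog :: "real \<Rightarrow> 'a cop \<Rightarrow> 'a cop" where
  "plog \<epsilon> x = fc (\<lambda>t. ln (\<bar>t\<bar> + \<epsilon>) / 2) (adj x * x)"

definition ppart :: "real \<Rightarrow> 'a cop \<Rightarrow> 'a cop" where
  "ppart \<epsilon> x = x * exp (- plog \<epsilon> x)"

lemma continuous_ln_abs: "0 < \<epsilon> \<Longrightarrow> continuous_on A (\<lambda>t::real. ln (\<bar>t\<bar> + \<epsilon>) / 2)"
  by (intro continuous_intros) (auto simp: add_nonneg_eq_0_iff)

lemma adj_plog: "0 < \<epsilon> \<Longrightarrow> adj (plog \<epsilon> x) = plog \<epsilon> x"
  by (simp add: plog_def continuous_ln_abs)

lemma exp_plog: "0 < \<epsilon> \<Longrightarrow> exp (r *\<^sub>R plog \<epsilon> x) = fc (\<lambda>t. (\<bar>t\<bar> + \<epsilon>) powr (r / 2)) (adj x * x)"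
proof -
  assume e: "0 < \<epsilon>"
  have "exp (r *\<^sub>R plog \<epsilon> x) = fc (\<lambda>t. exp (r * t)) (plog \<epsilon> x)"
    by (rule exp_scaleR_eq_fc[OF adj_plog[OF e]])
  also have "\<dots> = fc (\<lambda>t. exp (r * (ln (\<bar>t\<bar> + \<epsilon>) / 2))) (adj x * x)"
    unfolding plog_def by (rule fc_comp) (auto intro!: continuous_intros continuous_ln_abs e)
  also have "(\<lambda>t. exp (r * (ln (\<bar>t\<bar> + \<epsilon>) / 2))) = (\<lambda>t. (\<bar>t\<bar> + \<epsilon>) powr (r / 2))"
    using e by (auto simp: powr_def fun_eq_iff add_nonneg_eq_0_iff)
  finally show ?thesis .
qed

lemma ppart_mult: "ppart \<epsilon> x * exp (plog \<epsilon> x) = x"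
  unfolding ppart_def mult.assoc using exp_minus_inverse[of "- plog \<epsilon> x"] by simp

text \<open>The product of the adjoint of \<open>ppart \<epsilon> x\<close> with
  \<open>ppart \<epsilon> x\<close> is the function t / (t + \<epsilon>) of adj x x, which stays
  below 1.\<close>

lemma norm_ppart:
  assumes e: "0 < \<epsilon>"
  shows "norm (ppart \<epsilon> x) \<le> 1"
proof (rule norm_le_of_adj_mult)
  let ?g = "\<lambda>t. (\<bar>t\<bar> + \<epsilon>) powr (- 1 / 2)"
  have c: "continuous_on UNIV ?g"
    by (intro continuous_intros e)
  have "exp (- plog \<epsilon> x) = fc ?g (adj x * x)"
    using exp_plog[OF e, of "-1" x] by simp
  then have "adj (ppart \<epsilon> x) * ppart \<epsilon> x = fc ?g (adj x * x) * (adj x * x) * fc ?g (adj x * x)"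
    using c by (simp add: ppart_def mult.assoc)
  also have "\<dots> = fc (\<lambda>t. ?g t * t * ?g t) (adj x * x)"
    using c by (simp add: fc_mult fc_id continuous_intros)
  also have "norm \<dots> \<le> 1"
  proof (rule norm_fc_le[OF spec_adj_mult'])
    show "continuous_on UNIV (\<lambda>t. ?g t * t * ?g t)"
      by (intro continuous_intros c)
    fix t :: real assume "0 \<le> t"
    then have "?g t * t * ?g t = t * (t + \<epsilon>) powr (- 1)"
      by (simp add: powr_add[symmetric] mult.assoc mult.left_commute[of _ t])
    also have "\<dots> = t / (t + \<epsilon>)"
      using \<open>0 \<le> t\<close> e by (simp add: powr_minus_divide)
    finally have eq: "?g t * t * ?g t = t / (t + \<epsilon>)" .
    show "\<bar>?g t * t * ?g t\<bar> \<le> 1"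
      unfolding eq using \<open>0 \<le> t\<close> e by (simp add: divide_simps)
  qed
  finally show "norm (adj (ppart \<epsilon> x) * ppart \<epsilon> x) \<le> 1\<^sup>2"
    by simp
qed simp

section \<open>Analytic families of exponentials under the trace\<close>

lemma norm_exp_cS:
  assumes "adj L = L"
  shows "norm (exp (cS z * L)) \<le> exp (\<bar>Re z\<bar> * norm L)"
proof -
  have "exp (cS z * L) = exp (cS (of_real (Re z)) * L) * exp (cS (\<i> * of_real (Im z)) * L)"
    unfolding exp_cS_add[symmetric] by (simp add: complex_eq[symmetric])
  also have "norm \<dots> \<le> norm (exp (Re z *\<^sub>R L)) * 1"
    unfolding cS_of_real
    by (rule order_trans[OF norm_mult_ineq]) (intro mult_left_mono norm_exp_imag assms norm_ge_zero)
  also have "\<dots> \<le> exp (\<bar>Re z\<bar> * norm L)"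
    using norm_exp[of "Re z *\<^sub>R L"] by simp
  finally show ?thesis .
qed

text \<open>Both derivatives carry the increment as a central factor \<open>cS h\<close>, which can
  be pulled out of the trace; the real derivative is therefore multiplication by a complex
  number.\<close>

lemma holomorphic_tr_exp:
  "(\<lambda>z. tr e (A * exp (cS (a + b * z) * L) * B * exp (cS (c + d * z) * K))) holomorphic_on UNIV"
proof -
  have "(\<lambda>z. tr e (A * exp (cS (a + b * z) * L) * B * exp (cS (c + d * z) * K))) field_differentiable at z" for z
  proof -
    let ?E = "exp (cS (a + b * z) * L)" and ?F = "exp (cS (c + d * z) * K)"
    let ?D = "A * ?E * B * (cS d * K * ?F) + A * (cS b * L * ?E) * B * ?F"
    have "((\<lambda>z. A * exp (cS (a + b * z) * L) * B * exp (cS (c + d * z) * K)) has_derivative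
        (\<lambda>h. A * ?E * B * (cS h * (cS d * K * ?F)) + A * (cS h * (cS b * L * ?E)) * B * ?F)) (at z)"
      by (intro has_derivative_mult has_derivative_mult_left has_derivative_mult_right exp_cS_has_derivative)
    then have "((\<lambda>z. tr e (A * exp (cS (a + b * z) * L) * B * exp (cS (c + d * z) * K))) has_derivative
        (\<lambda>h. tr e (A * ?E * B * (cS h * (cS d * K * ?F)) + A * (cS h * (cS b * L * ?E)) * B * ?F))) (at z)"
      by (rule bounded_linear.has_derivative[OF bounded_linear_tr])
    moreover have "tr e (A * ?E * B * (cS h * (cS d * K * ?F)) + A * (cS h * (cS b * L * ?E)) * B * ?F) = tr e ?D * h" for h
    proof -
      have "A * ?E * B * (cS h * (cS d * K * ?F)) + A * (cS h * (cS b * L * ?E)) * B * ?F = cS h * ?D"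
        by (simp add: cS_left_commute[of _ h] mult.assoc distrib_left)
      then show ?thesis
        by (simp add: tr_cS mult.commute)
    qed
    ultimately show ?thesis
      unfolding field_differentiable_def has_field_derivative_def by auto
  qed
  then show ?thesis
    by (simp add: holomorphic_on_def field_differentiable_at_within)
qed

lemma tr_exp_bounded_on_strip:
  assumes "adj L = L" "adj K = K"
  shows "\<exists>B0. \<forall>z. 0 \<le> Re z \<longrightarrow> Re z \<le> 1 \<longrightarrow>
    cmod (tr e (A * exp (cS (of_real a + of_real b * z) * L) * B * exp (cS (of_real c + of_real d * z) * K))) \<le> B0"
proof -
  define B1 where "B1 = exp ((\<bar>a\<bar> + \<bar>b\<bar>) * norm L)"
  define B2 where "B2 = exp ((\<bar>c\<bar> + \<bar>d\<bar>) * norm K)"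
  have *: "norm (exp (cS (of_real a + of_real b * z) * L)) \<le> exp ((\<bar>a\<bar> + \<bar>b\<bar>) * norm L)"
    if "0 \<le> Re z" "Re z \<le> 1" "adj L = L" for z a b and L :: "'a cop"
  proof -
    have "\<bar>b\<bar> * Re z \<le> \<bar>b\<bar> * 1"
      using that by (intro mult_left_mono) auto
    then have "\<bar>a + b * Re z\<bar> \<le> \<bar>a\<bar> + \<bar>b\<bar>"
      using abs_triangle_ineq[of a "b * Re z"] that(1) by (simp add: abs_mult)
    then have "exp (\<bar>Re (of_real a + of_real b * z)\<bar> * norm L) \<le> exp ((\<bar>a\<bar> + \<bar>b\<bar>) * norm L)"
      by (simp add: mult_right_mono)
    then show ?thesis
      by (rule order_trans[OF norm_exp_cS[OF that(3)]])
  qed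
  have "cmod (tr e (A * exp (cS (of_real a + of_real b * z) * L) * B * exp (cS (of_real c + of_real d * z) * K)))
    \<le> norm A * B1 * norm B * B2" if z: "0 \<le> Re z" "Re z \<le> 1" for z
  proof -
    let ?X = "exp (cS (of_real a + of_real b * z) * L)" and ?Y = "exp (cS (of_real c + of_real d * z) * K)"
    have "norm (A * ?X * B * ?Y) \<le> norm A * norm ?X * norm B * norm ?Y"
      by (intro order_trans[OF norm_mult_ineq] mult_right_mono) auto
    also have "\<dots> \<le> norm A * B1 * norm B * B2"
      unfolding B1_def B2_def using *[OF z assms(1), of a b] *[OF z assms(2), of c d]
      by (intro mult_mono) auto
    finally show ?thesis
      by (rule order_trans[OF norm_tr])
  qed
  then show ?thesis
    by blast
qed

text \<open>The imaginary part of z contributes a unitary that commutes with the rest, so the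
  squared modulus is exp (2 Re z L) and only Re z survives.\<close>

lemma ms_exp:
  assumes "adj L = L" "0 < p"
  shows "ms e p (exp (cS z * L)) = Re (tr e (exp ((p * Re z) *\<^sub>R L)))"
proof -
  have "adj (exp (cS z * L)) * exp (cS z * L) = exp (cS (cnj z + z) * L)"
    unfolding exp_cS_add using assms by (simp add: cS_commute)
  also have "cnj z + z = of_real (2 * Re z)"
    by (simp add: complex_eq_iff)
  also have "exp (cS (of_real (2 * Re z)) * L) = fc (\<lambda>t. exp (2 * Re z * t)) L"
    unfolding cS_of_real by (rule exp_scaleR_eq_fc[OF assms(1)])
  finally have "fc (\<lambda>t. \<bar>t\<bar> powr (p / 2)) (adj (exp (cS z * L)) * exp (cS z * L))
      = fc (\<lambda>t. \<bar>t\<bar> powr (p / 2)) (fc (\<lambda>t. exp (2 * Re z * t)) L)"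
    by (rule arg_cong)
  also have "\<dots> = fc (\<lambda>t. \<bar>exp (2 * Re z * t)\<bar> powr (p / 2)) L"
    using assms by (intro fc_comp continuous_intros) auto
  also have "(\<lambda>t. \<bar>exp (2 * Re z * t)\<bar> powr (p / 2)) = (\<lambda>t. exp ((p * Re z) * t))"
    by (simp add: powr_def mult_ac)
  finally show ?thesis
    unfolding ms_def by (simp add: exp_scaleR_eq_fc[OF assms(1)])
qed

text \<open>Norm closedness is what keeps the continuous functional calculus inside
  \<open>N\<close>. The locale serves twice, for the algebra of the group and for that of a
  subgroup, with the same trace vector \<open>delta e\<close>.\<close>

locale tracial =
  fixes N :: "'a cop set" and e :: 'a
  assumes closed_N: "closed N"
    and one_N: "1 \<in> N"
    and add_N: "x \<in> N \<Longrightarrow> y \<in> N \<Longrightarrow> x + y \<in> N"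
    and mult_N: "x \<in> N \<Longrightarrow> y \<in> N \<Longrightarrow> x * y \<in> N"
    and cS_N: "x \<in> N \<Longrightarrow> cS c * x \<in> N"
    and adj_N: "x \<in> N \<Longrightarrow> adj x \<in> N"
    and trace: "x \<in> N \<Longrightarrow> y \<in> N \<Longrightarrow> tr e (x * y) = tr e (y * x)"
begin

lemma scaleR_N: "x \<in> N \<Longrightarrow> r *\<^sub>R x \<in> N"
  unfolding cS_of_real[symmetric] by (rule cS_N)

lemma minus_N: "x \<in> N \<Longrightarrow> - x \<in> N"
  using scaleR_N[of x "-1"] by simp

lemma diff_N: "x \<in> N \<Longrightarrow> y \<in> N \<Longrightarrow> x - y \<in> N"
  using add_N[OF _ minus_N, of x y] by simp

lemma zero_N: "0 \<in> N"
  using scaleR_N[OF one_N, of 0] by simp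

lemma sum_N: "(\<And>i. i \<in> I \<Longrightarrow> f i \<in> N) \<Longrightarrow> (\<Sum>i\<in>I. f i) \<in> N"
  by (induction I rule: infinite_finite_induct) (auto intro: add_N zero_N)

lemma power_N: "x \<in> N \<Longrightarrow> x ^ n \<in> N"
  by (induction n) (auto intro: one_N mult_N)

lemma pol_N: "x \<in> N \<Longrightarrow> pol q x \<in> N"
  unfolding pol_def by (intro sum_N scaleR_N power_N)

lemma fc_N: "adj x = x \<Longrightarrow> continuous_on UNIV \<phi> \<Longrightarrow> x \<in> N \<Longrightarrow> fc \<phi> x \<in> N"
  by (rule fc_in) (auto intro: closed_N one_N add_N mult_N scaleR_N)

lemma exp_N: "x \<in> N \<Longrightarrow> exp x \<in> N"
  using exp_converges[of x] unfolding sums_def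
  by (rule closed_sequentially[OF closed_N, rotated]) (auto intro!: sum_N scaleR_N power_N)

lemma adj_mult_N: "x \<in> N \<Longrightarrow> adj x * x \<in> N"
  by (intro mult_N adj_N)

lemma plog_N: "0 < \<epsilon> \<Longrightarrow> x \<in> N \<Longrightarrow> plog \<epsilon> x \<in> N"
  unfolding plog_def by (intro fc_N adj_mult_N continuous_ln_abs) simp_all

lemma ppart_N: "0 < \<epsilon> \<Longrightarrow> x \<in> N \<Longrightarrow> ppart \<epsilon> x \<in> N"
  unfolding ppart_def by (intro mult_N exp_N minus_N plog_N)

text \<open>For polynomials this is traciality together with the rule that x times q of adj x x
  equals q of x adj x times x. The general case follows by approximation on one interval that serves
  both operators.\<close>

lemma tr_fc_swap:
  assumes x: "x \<in> N" and c: "continuous_on UNIV \<phi>"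
  shows "tr e (fc \<phi> (adj x * x)) = tr e (fc \<phi> (x * adj x))"
proof -
  have pol: "tr e (pol q (adj x * x)) = tr e (pol q (x * adj x))" for q
  proof (cases q)
    case (pCons a q')
    have *: "x * pol q' (adj x * x) = pol q' (x * adj x) * x"
      by (induction q') (simp_all add: distrib_left distrib_right mult.assoc)
    have "tr e (adj x * x * pol q' (adj x * x)) = tr e (adj x * (pol q' (x * adj x) * x))"
      by (simp only: mult.assoc *)
    also have "\<dots> = tr e (pol q' (x * adj x) * x * adj x)"
      using x by (intro trace adj_N mult_N pol_N)
    also have "\<dots> = tr e (x * adj x * pol q' (x * adj x))"
      using pol_commute[of "x * adj x" "x * adj x" q'] by (simp add: mult.assoc)
    finally show ?thesis
      by (simp add: pCons tr_add)
  qed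
  define K where "K = max (norm (adj x * x)) (norm (x * adj x)) + 1"
  obtain q where q: "uniform_limit {-K..K} (\<lambda>n. poly (q n)) \<phi> sequentially"
    by (rule Weierstrass_poly[OF continuous_on_subset[OF c]]) auto
  have K: "norm (adj x * x) \<le> K" "norm (x * adj x) \<le> K" "0 < K"
    using norm_ge_zero[of "x * adj x"] by (auto simp: K_def simp del: norm_ge_zero)
  then have "spec (adj x * x) (-K) K" "spec (x * adj x) (-K) K" "-K < K"
    using spec_norm[OF _ K(1)] spec_norm[OF _ K(2)] by auto
  then have "(\<lambda>n. pol (q n) (adj x * x)) \<longlonglongrightarrow> fc \<phi> (adj x * x)" "(\<lambda>n. pol (q n) (x * adj x)) \<longlonglongrightarrow> fc \<phi> (x * adj x)"
    using fc_tendsto[OF _ _ c q] by blast+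
  then have "(\<lambda>n. tr e (pol (q n) (adj x * x))) \<longlonglongrightarrow> tr e (fc \<phi> (adj x * x))"
      "(\<lambda>n. tr e (pol (q n) (x * adj x))) \<longlonglongrightarrow> tr e (fc \<phi> (x * adj x))"
    by (auto intro!: bounded_linear.tendsto[OF bounded_linear_tr])
  then show ?thesis
    unfolding pol by (rule LIMSEQ_unique)
qed

lemma ms_adj: "x \<in> N \<Longrightarrow> 0 < p \<Longrightarrow> ms e p (adj x) = ms e p x"
  unfolding ms_def by (simp add: tr_fc_swap continuous_intros)

lemma nrm_adj: "x \<in> N \<Longrightarrow> 0 < p \<Longrightarrow> nrm e p (adj x) = nrm e p x"
  by (simp add: nrm_def ms_adj)

lemma pms_eq: "0 < \<epsilon> \<Longrightarrow> pms e p \<epsilon> x = Re (tr e (exp (p *\<^sub>R plog \<epsilon> x)))"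
  by (simp add: pms_def exp_plog)

text \<open>The exponential splits as u h h with u unitary and h = exp (Re z K / 2) self-adjoint.
  One h is moved around the trace and Cauchy-Schwarz is applied to the vector
  \<open>app h (delta e)\<close>, whose squared norm is the trace of h h.\<close>

lemma tr_exp_edge:
  assumes "A \<in> N" "K \<in> N" "adj K = K"
  shows "cmod (tr e (A * exp (cS z * K))) \<le> norm A * Re (tr e (exp (Re z *\<^sub>R K)))"
proof -
  define h where "h = exp ((Re z / 2) *\<^sub>R K)"
  define u where "u = exp (cS (\<i> * of_real (Im z)) * K)"
  have h: "h \<in> N" "adj h = h" and u: "u \<in> N" "norm u \<le> 1"
    using assms by (auto simp: h_def u_def intro!: exp_N scaleR_N cS_N norm_exp_imag)
  have hh: "h * h = exp (Re z *\<^sub>R K)"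
    unfolding h_def by (subst exp_add_commuting[symmetric]) (simp_all add: scaleR_left_distrib[symmetric])
  have "exp (cS z * K) = u * exp (cS (of_real (Re z)) * K)"
    unfolding u_def exp_cS_add[symmetric] by (simp add: complex_eq[symmetric] add.commute)
  then have "exp (cS z * K) = u * (h * h)"
    by (simp only: cS_of_real hh)
  then have "tr e (A * exp (cS z * K)) = tr e ((A * u * h) * h)"
    by (simp only: mult.assoc)
  also have "\<dots> = tr e (h * (A * u * h))"
    using assms h u by (intro trace mult_N)
  also have "\<dots> = cinner (app h (delta e)) (app (A * u) (app h (delta e)))"
    by (simp add: tr_def app_mult cinner_app_right h)
  also have "cmod \<dots> \<le> norm (app h (delta e)) * (norm (A * u) * norm (app h (delta e)))"
    by (rule order_trans[OF cinner_Cauchy_Schwarz]) (intro mult_left_mono norm_app norm_ge_zero)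
  also have "\<dots> = norm (A * u) * (norm (app h (delta e)))\<^sup>2"
    by (simp add: power2_eq_square)
  also have "(norm (app h (delta e)))\<^sup>2 = Re (tr e (exp (Re z *\<^sub>R K)))"
    using tr_adj_mult[of e h] by (simp add: h hh)
  also have "norm (A * u) * Re (tr e (exp (Re z *\<^sub>R K))) \<le> norm A * Re (tr e (exp (Re z *\<^sub>R K)))"
  proof (rule mult_right_mono)
    show "norm (A * u) \<le> norm A"
      using norm_mult_ineq[of A u] mult_left_mono[OF u(2) norm_ge_zero[of A]] by simp
    show "0 \<le> Re (tr e (exp (Re z *\<^sub>R K)))"
      unfolding hh[symmetric] by (intro tr_pos pos_mult_self h)
  qed
  finally show ?thesis .
qed

text \<open>Three lines for the family in which x is replaced by v exp (p z L) and y by w exp (q (1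
  - z) K). At z = 1 / p it returns x and y; on each edge one exponential is unitary and the other is
  estimated by \<open>tr_exp_edge\<close>. The factor c is carried along for the module bound
  \<open>nrm_mult_left\<close>.\<close>

theorem Hoelder:
  assumes N: "c \<in> N" "x \<in> N" "y \<in> N" and pq: "1 < p" "1 < q" "1 / p + 1 / q = 1"
  shows "cmod (tr e (c * x * y)) \<le> norm c * nrm e p x * nrm e q y"
proof (cases "c = 0")
  case False
  have eps: "cmod (tr e (c * x * y)) \<le> norm c * (pms e p \<epsilon> x powr (1 / p) * pms e q \<epsilon> y powr (1 / q))" if e: "0 < \<epsilon>" for \<epsilon>
  proof -
    define L K v w where "L = plog \<epsilon> x" and "K = plog \<epsilon> y" and "v = ppart \<epsilon> x" and "w = ppart \<epsilon> y"
    have mem: "L \<in> N" "K \<in> N" "v \<in> N" "w \<in> N" and sa: "adj L = L" "adj K = K"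
      and nv: "norm v \<le> 1" "norm w \<le> 1"
      unfolding L_def K_def v_def w_def
      by (rule plog_N ppart_N adj_plog norm_ppart; fact)+
    define F where "F z = tr e (c * v * exp (cS (of_real 0 + of_real p * z) * L) * w * exp (cS (of_real q + of_real (- q) * z) * K))" for z
    have P: "0 < pms e p \<epsilon> x" "0 < pms e q \<epsilon> y"
      using pq e by (auto intro: pms_pos)
    have "\<exists>B. \<forall>z. 0 \<le> Re z \<longrightarrow> Re z \<le> 1 \<longrightarrow> cmod (F z) \<le> B"
      unfolding F_def by (rule tr_exp_bounded_on_strip[OF sa, of e "c * v" 0 p w q "- q"])
    then obtain B where B0: "\<forall>z. 0 \<le> Re z \<longrightarrow> Re z \<le> 1 \<longrightarrow> cmod (F z) \<le> B"
      by (rule exE)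
    have B: "cmod (F z) \<le> B" if "0 \<le> Re z" "Re z \<le> 1" for z
      using B0 that by simp
    have nmul: "norm (a * b) \<le> norm a" if "norm b \<le> 1" for a b :: "'a cop"
      using norm_mult_ineq[of a b] mult_left_mono[OF that norm_ge_zero[of a]] by simp
    have "cmod (F (of_real (1 / p))) \<le> (norm c * pms e q \<epsilon> y) powr (1 - 1 / p) * (norm c * pms e p \<epsilon> x) powr (1 / p)"
    proof (rule three_lines_scaled[OF _ B])
      show "F holomorphic_on UNIV"
        unfolding F_def by (rule holomorphic_tr_exp)
      show "0 < norm c * pms e q \<epsilon> y" "0 < norm c * pms e p \<epsilon> x"
        using P False by auto
      show "0 \<le> 1 / p" "1 / p \<le> 1"
        using pq by auto
    next
      fix y0 :: real
      let ?u = "exp (cS (of_real 0 + of_real p * (\<i> * of_real y0)) * L)"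
      have u: "norm ?u \<le> 1"
        using norm_exp_imag[OF sa(1), of "p * y0"] by (simp add: mult_ac)
      have "cmod (F (\<i> * of_real y0)) \<le> norm (c * v * ?u * w) * Re (tr e (exp (Re (of_real q + of_real (- q) * (\<i> * of_real y0)) *\<^sub>R K)))"
        unfolding F_def using N mem sa by (intro tr_exp_edge mult_N exp_N cS_N)
      also have "\<dots> = norm (c * v * ?u * w) * pms e q \<epsilon> y"
        using e by (simp add: pms_eq K_def)
      also have "\<dots> \<le> norm c * pms e q \<epsilon> y"
        using P by (intro mult_right_mono order_trans[OF nmul[OF nv(2)]] order_trans[OF nmul[OF u]] nmul nv) auto
      finally show "cmod (F (\<i> * of_real y0)) \<le> norm c * pms e q \<epsilon> y" .
    next
      fix y0 :: real
      let ?u = "exp (cS (of_real q + of_real (- q) * (1 + \<i> * of_real y0)) * K)"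
      let ?E = "exp (cS (of_real 0 + of_real p * (1 + \<i> * of_real y0)) * L)"
      have u: "norm ?u \<le> 1"
        using norm_exp_imag[OF sa(2), of "- q * y0"] by (simp add: mult_ac distrib_left)
      \<comment> \<open>On the right edge the non-unitary exponential stands in the middle;
        traciality moves it to the end, where \<open>tr_exp_edge\<close> applies.\<close>
      have "F (1 + \<i> * of_real y0) = tr e ((c * v * ?E) * (w * ?u))"
        unfolding F_def by (simp only: mult.assoc)
      also have "\<dots> = tr e ((w * ?u) * (c * v * ?E))"
        using N mem by (intro trace mult_N exp_N cS_N)
      finally have F: "F (1 + \<i> * of_real y0) = tr e (w * ?u * (c * v) * ?E)"
        by (simp only: mult.assoc)
      have "cmod (F (1 + \<i> * of_real y0)) \<le> norm (w * ?u * (c * v)) * Re (tr e (exp (Re (of_real 0 + of_real p * (1 + \<i> * of_real y0)) *\<^sub>R L)))"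
        unfolding F using N mem sa by (intro tr_exp_edge mult_N exp_N cS_N)
      also have "\<dots> = norm (w * ?u * (c * v)) * pms e p \<epsilon> x"
        using e by (simp add: pms_eq L_def)
      also have "\<dots> \<le> norm c * pms e p \<epsilon> x"
      proof (rule mult_right_mono)
        have "norm (w * ?u * (c * v)) \<le> norm (w * ?u) * norm (c * v)"
          by (rule norm_mult_ineq)
        also have "\<dots> \<le> 1 * norm c"
          using order_trans[OF nmul[OF u, of w] nv(2)] nmul[OF nv(1), of c] by (intro mult_mono) auto
        finally show "norm (w * ?u * (c * v)) \<le> norm c"
          by simp
      qed (use P in simp)
      finally show "cmod (F (1 + \<i> * of_real y0)) \<le> norm c * pms e p \<epsilon> x" .
    qed
    moreover have "F (of_real (1 / p)) = tr e (c * x * y)"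
    proof -
      have pq': "1 - 1 / p = 1 / q"
        using pq(3) by simp
      have "q * (1 - 1 / p) = 1"
        unfolding pq' using pq by simp
      then have "q - q * (1 / p) = 1"
        by (simp add: right_diff_distrib)
      then have "of_real q + of_real (- q) * complex_of_real (1 / p) = 1"
        by (simp only: of_real_mult[symmetric] of_real_add[symmetric] of_real_eq_1_iff)
      then have "F (of_real (1 / p)) = tr e (c * v * exp L * w * exp K)"
        using pq by (simp add: F_def)
      also have "\<dots> = tr e (c * (v * exp L) * (w * exp K))"
        by (simp only: mult.assoc)
      finally show ?thesis
        by (simp add: v_def w_def L_def K_def ppart_mult)
    qed
    moreover have "(norm c * pms e q \<epsilon> y) powr (1 - 1 / p) * (norm c * pms e p \<epsilon> x) powr (1 / p)
        = norm c * (pms e p \<epsilon> x powr (1 / p) * pms e q \<epsilon> y powr (1 / q))"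
    proof -
      have "1 - 1 / p = 1 / q"
        using pq by simp
      moreover have "norm c powr (1 / q) * norm c powr (1 / p) = norm c"
        using pq False by (simp add: powr_add[symmetric] add.commute)
      ultimately show ?thesis
        using P by (simp add: powr_mult)
    qed
    ultimately show ?thesis
      by simp
  qed
  have "(\<lambda>n. norm c * (pms e p (inverse (real (Suc n))) x powr (1 / p) * pms e q (inverse (real (Suc n))) y powr (1 / q)))
      \<longlonglongrightarrow> norm c * (nrm e p x * nrm e q y)"
    using pq by (intro tendsto_intros pms_powr_tendsto)
  then have "cmod (tr e (c * x * y)) \<le> norm c * (nrm e p x * nrm e q y)"
    by (rule LIMSEQ_le_const) (intro exI[of _ 0] allI impI eps, simp)
  then show ?thesis
    by (simp add: mult.assoc)
qed simp

end

text \<open>This is the error made when t^r is replaced by t^r t / (t + \<epsilon>). It is uniform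
  on [0, K] because sqrt (t \<epsilon>) \<le> t + \<epsilon>. For r = p / 2 the condition r > 1 / 2
  is p > 1.\<close>

lemma powr_times_eps_le:
  fixes t \<epsilon> r K :: real
  assumes "0 \<le> t" "t \<le> K" "0 < \<epsilon>" "1 / 2 < r"
  shows "t powr r * (\<epsilon> / (t + \<epsilon>)) \<le> K powr (r - 1 / 2) * sqrt \<epsilon>"
proof (cases "t = 0")
  case False
  then have t: "0 < t"
    using assms by simp
  have "t powr r = t powr (r - 1 / 2) * sqrt t"
    using t by (simp add: powr_add[symmetric] powr_half_sqrt[symmetric])
  then have "t powr r * (\<epsilon> / (t + \<epsilon>)) = t powr (r - 1 / 2) * (sqrt t * \<epsilon> / (t + \<epsilon>))"
    by simp
  also have "\<dots> \<le> K powr (r - 1 / 2) * sqrt \<epsilon>"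
  proof (rule mult_mono)
    show "t powr (r - 1 / 2) \<le> K powr (r - 1 / 2)"
      using assms by (intro powr_mono2) auto
    have "sqrt t * sqrt \<epsilon> \<le> t + \<epsilon>"
      using arith_geo_mean_sqrt[of t \<epsilon>] assms by (simp add: real_sqrt_mult)
    then have "sqrt \<epsilon> * (sqrt t * sqrt \<epsilon>) \<le> sqrt \<epsilon> * (t + \<epsilon>)"
      using assms by (intro mult_left_mono) auto
    moreover have "sqrt \<epsilon> * (sqrt t * sqrt \<epsilon>) = sqrt t * \<epsilon>"
      using assms by simp
    ultimately show "sqrt t * \<epsilon> / (t + \<epsilon>) \<le> sqrt \<epsilon>"
      using t assms by (simp add: pos_divide_le_eq)
  qed (use t assms in auto)
  finally show ?thesis .
qed (use assms in simp)

text \<open>Formally the extremal test element is y = a^(p/2 - 1) adj z with a = adj z z, for which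
  tr (z y) and the q-th moment of y both equal the p-th moment of z. As t^(p/2 - 1) can be singular
  at 0, it is replaced by g(t) = t^(p/2) / (t + \<epsilon>), at a cost of order sqrt \<epsilon>. The
  triangle inequality and the passage from forms to multipliers depend on this converse of
  Hoelder.\<close>

lemma (in tracial) nrm_le_of_dual:
  assumes z: "z \<in> N" and pq: "1 < p" "1 < q" "1 / p + 1 / q = 1" and A: "0 \<le> A"
    and dual: "\<And>y. y \<in> N \<Longrightarrow> cmod (tr e (z * y)) \<le> A * nrm e q y"
  shows "nrm e p z \<le> A"
proof -
  define a where "a = adj z * z"
  define K where "K = (norm z)\<^sup>2 + 1"
  have sp: "spec a 0 K" "0 < K"
    using spec_adj_mult'[of z] by (simp_all add: a_def K_def)
  have sa: "adj a = a"
    by (simp add: a_def)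
  have aN: "a \<in> N"
    using z by (simp add: a_def adj_mult_N)
  define D where "D = K powr (p / 2 - 1 / 2)"
  have main: "ms e p z - D * sqrt \<epsilon> \<le> A * ms e p z powr (1 / q)" if eps: "0 < \<epsilon>" for \<epsilon>
  proof -
    define g where "g t = \<bar>t\<bar> powr (p / 2) / (\<bar>t\<bar> + \<epsilon>)" for t :: real
    have cg: "continuous_on UNIV g"
      unfolding g_def using pq eps by (intro continuous_intros) (auto simp: add_nonneg_eq_0_iff)
    define G where "G = fc g a"
    have G: "G \<in> N" "adj G = G"
      using fc_N[OF sa cg aN] adj_fc[OF sa cg] by (simp_all add: G_def)
    define y where "y = G * adj z"
    have yN: "y \<in> N"
      using G z by (simp add: y_def mult_N adj_N)
    have "tr e (z * y) = tr e (G * adj z * z)"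
      unfolding y_def using G z by (intro trace mult_N adj_N)
    also have "\<dots> = tr e (fc (\<lambda>t. g t * t) a)"
      using cg sa by (simp add: mult.assoc a_def[symmetric] G_def fc_mult fc_id continuous_intros)
    finally have trzy: "tr e (z * y) = tr e (fc (\<lambda>t. g t * t) a)" .
    have "ms e p z - D * sqrt \<epsilon> = Re (tr e (fc (\<lambda>t. \<bar>t\<bar> powr (p / 2) - D * sqrt \<epsilon>) a))"
      using sa pq by (simp add: ms_def a_def fc_diff fc_const tr_diff tr_scaleR continuous_intros)
    also have "\<dots> \<le> Re (tr e (fc (\<lambda>t. g t * t) a))"
    proof (rule tr_fc_mono[OF sp])
      fix t assume t: "0 \<le> t" "t \<le> K"
      have "t powr (p / 2) * (\<epsilon> / (t + \<epsilon>)) \<le> D * sqrt \<epsilon>"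
        unfolding D_def using t eps pq by (intro powr_times_eps_le) auto
      moreover have "t powr (p / 2) * (\<epsilon> / (t + \<epsilon>)) = t powr (p / 2) - g t * t"
        using t eps by (simp add: g_def field_simps)
      ultimately show "\<bar>t\<bar> powr (p / 2) - D * sqrt \<epsilon> \<le> g t * t"
        using t by simp
    qed (use pq in \<open>auto intro!: continuous_intros cg\<close>)
    also have "\<dots> \<le> cmod (tr e (z * y))"
      unfolding trzy by (rule complex_Re_le_cmod)
    also have "\<dots> \<le> A * nrm e q y"
      by (rule dual[OF yN])
    also have "\<dots> \<le> A * ms e p z powr (1 / q)"
    proof (rule mult_left_mono[OF _ A])
      have "ms e q y = ms e q (adj y)"
        using yN pq by (simp add: ms_adj)
      also have "adj (adj y) * adj y = G * a * G"
        by (simp add: y_def G a_def mult.assoc)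
      then have "ms e q (adj y) = Re (tr e (fc (\<lambda>t. \<bar>t\<bar> powr (q / 2)) (G * a * G)))"
        by (simp only: ms_def)
      also have "G * a * G = fc (\<lambda>t. g t * t * g t) a"
        using cg sa by (simp add: G_def fc_mult fc_id continuous_intros)
      also have "fc (\<lambda>t. \<bar>t\<bar> powr (q / 2)) (fc (\<lambda>t. g t * t * g t) a) = fc (\<lambda>t. \<bar>g t * t * g t\<bar> powr (q / 2)) a"
        using cg sa pq by (intro fc_comp continuous_intros) auto
      also have "Re (tr e (fc (\<lambda>t. \<bar>g t * t * g t\<bar> powr (q / 2)) a)) \<le> ms e p z"
        unfolding ms_def a_def[symmetric]
      proof (rule tr_fc_mono[OF sp])
        have "continuous_on UNIV (\<lambda>t. g t * t * g t)"
          by (intro continuous_intros cg)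
        then show "continuous_on UNIV (\<lambda>t. \<bar>g t * t * g t\<bar> powr (q / 2))"
          using continuous_on_compose2[OF continuous_abs_powr[of "q / 2" UNIV]] pq by auto
        show "continuous_on UNIV (\<lambda>t. \<bar>t\<bar> powr (p / 2))"
          using pq by (intro continuous_intros) auto
        fix t assume t: "0 \<le> t" "t \<le> K"
        show "\<bar>g t * t * g t\<bar> powr (q / 2) \<le> \<bar>t\<bar> powr (p / 2)"
        proof (cases "t = 0")
          case False
          with t have t0: "0 < t"
            by simp
          have g: "g t \<le> t powr (p / 2) / t" "0 \<le> g t"
            using t0 eps by (auto simp: g_def intro!: divide_left_mono)
          \<comment> \<open>The exponents match: g(t)^2 t \<le> t^(p - 1) and (p - 1) q / 2 = p / 2,
            so the q-th moment of y is at most the p-th moment of z.\<close>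
          have "g t * t * g t \<le> (t powr (p / 2) / t) * t * (t powr (p / 2) / t)"
            using g t0 by (intro mult_mono) auto
          also have "\<dots> = t powr (p - 1)"
            using t0 by (simp add: powr_add[symmetric] powr_diff)
          finally have "\<bar>g t * t * g t\<bar> powr (q / 2) \<le> (t powr (p - 1)) powr (q / 2)"
            using g t0 pq by (intro powr_mono2) auto
          also have "(p - 1) * (q / 2) = p / 2"
            using pq by (simp add: field_simps)
          then have "(t powr (p - 1)) powr (q / 2) = t powr (p / 2)"
            by (simp only: powr_powr)
          finally show ?thesis
            using t0 by simp
        qed simp
      qed
      finally have "ms e q y \<le> ms e p z" .
      then show "nrm e q y \<le> ms e p z powr (1 / q)"
        unfolding nrm_def using pq by (intro powr_mono2 ms_nonneg) auto
    qed
    finally show ?thesis .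
  qed
  have "((\<lambda>\<epsilon>. ms e p z - D * sqrt \<epsilon>) \<longlongrightarrow> ms e p z - D * sqrt 0) (at_right 0)"
    by (intro tendsto_intros)
  then have "ms e p z - D * sqrt 0 \<le> A * ms e p z powr (1 / q)"
    by (rule tendsto_upperbound) (auto simp: eventually_at_filter main)
  then have le: "ms e p z \<le> A * ms e p z powr (1 / q)"
    by simp
  show ?thesis
  proof (cases "ms e p z = 0")
    case False
    then have m: "0 < ms e p z"
      using ms_nonneg[of p e z] pq by simp
    have "ms e p z powr (1 / p) * ms e p z powr (1 / q) = ms e p z"
      using m pq by (simp add: powr_add[symmetric])
    then have "ms e p z powr (1 / p) * ms e p z powr (1 / q) \<le> A * ms e p z powr (1 / q)"
      using le by simp
    then show ?thesis
      unfolding nrm_def using m by (simp add: mult_le_cancel_right)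
  qed (simp add: nrm_def A)
qed

section \<open>Norm properties, bounded convergence and interpolation\<close>

context tracial
begin

lemma conj_exponent:
  assumes "1 < p"
  obtains q :: real where "1 < q" "1 / p + 1 / q = 1"
  by (rule that[of "p / (p - 1)"]) (use assms in \<open>auto simp: field_simps\<close>)

lemma nrm_triangle:
  assumes "x \<in> N" "y \<in> N" "1 < p"
  shows "nrm e p (x + y) \<le> nrm e p x + nrm e p y"
proof -
  obtain q where q: "1 < q" "1 / p + 1 / q = 1"
    using conj_exponent[OF assms(3)] .
  show ?thesis
  proof (rule nrm_le_of_dual[OF add_N[OF assms(1,2)] assms(3) q])
    fix z assume z: "z \<in> N"
    have "tr e ((x + y) * z) = tr e (1 * x * z) + tr e (1 * y * z)"
      by (simp add: distrib_right tr_add)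
    also have "cmod \<dots> \<le> cmod (tr e (1 * x * z)) + cmod (tr e (1 * y * z))"
      by (rule norm_triangle_ineq)
    also have "\<dots> \<le> norm (1 :: 'a cop) * nrm e p x * nrm e q z + norm (1 :: 'a cop) * nrm e p y * nrm e q z"
      by (intro add_mono Hoelder one_N assms z q)
    finally show "cmod (tr e ((x + y) * z)) \<le> (nrm e p x + nrm e p y) * nrm e q z"
      by (simp add: distrib_right)
  qed (simp add: nrm_nonneg)
qed

lemma nrm_mult_left:
  assumes "c \<in> N" "x \<in> N" "1 < p"
  shows "nrm e p (c * x) \<le> norm c * nrm e p x"
proof -
  obtain q where q: "1 < q" "1 / p + 1 / q = 1"
    using conj_exponent[OF assms(3)] .
  show ?thesis
    using assms q by (intro nrm_le_of_dual[OF mult_N] Hoelder) (auto simp: nrm_nonneg)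
qed

lemma nrm_cS:
  assumes "x \<in> N" "1 < p"
  shows "nrm e p (cS a * x) \<le> cmod a * nrm e p x"
proof -
  have "nrm e p (cS a * x) \<le> norm (cS a * 1 :: 'a cop) * nrm e p x"
    using nrm_mult_left[OF cS_N[OF one_N] assms] by simp
  also have "\<dots> \<le> cmod a * nrm e p x"
    using norm_cS_mult[of a "1 :: 'a cop"] by (intro mult_right_mono) (auto simp: nrm_nonneg)
  finally show ?thesis .
qed

lemma nrm_uminus:
  assumes "x \<in> N" "1 < p"
  shows "nrm e p (- x) = nrm e p x"
  using nrm_cS[OF assms, of "-1"] nrm_cS[OF minus_N[OF assms(1)] assms(2), of "-1"]
  by (simp add: cS_minus)

lemma nrm_diff:
  assumes "x \<in> N" "y \<in> N" "1 < p"
  shows "nrm e p (x - y) \<le> nrm e p x + nrm e p y"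
  using nrm_triangle[OF assms(1) minus_N[OF assms(2)] assms(3)] nrm_uminus[OF assms(2,3)] by simp

lemma nrm_zero: "1 < p \<Longrightarrow> nrm e p 0 = 0"
  using nrm_cS[OF one_N, of p 0] nrm_nonneg[of e p 0] by simp

lemma nrm_sum:
  assumes "\<And>i. i \<in> I \<Longrightarrow> f i \<in> N" "1 < p"
  shows "nrm e p (\<Sum>i\<in>I. f i) \<le> (\<Sum>i\<in>I. nrm e p (f i))"
  using assms(1)
proof (induction I rule: infinite_finite_induct)
  case (insert i I)
  then have "nrm e p (f i + (\<Sum>i\<in>I. f i)) \<le> nrm e p (f i) + nrm e p (\<Sum>i\<in>I. f i)"
    by (intro nrm_triangle sum_N assms(2)) auto
  also have "\<dots> \<le> nrm e p (f i) + (\<Sum>i\<in>I. nrm e p (f i))"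
    using insert by simp
  finally show ?case
    using insert by simp
qed (simp_all add: nrm_zero assms)

lemma nrm_diff_abs:
  assumes "x \<in> N" "y \<in> N" "1 < p"
  shows "\<bar>nrm e p x - nrm e p y\<bar> \<le> nrm e p (x - y)"
  using nrm_triangle[OF diff_N[OF assms(1,2)] assms(2,3)] nrm_triangle[OF diff_N[OF assms(2,1)] assms(1,3)]
    nrm_uminus[OF diff_N[OF assms(1,2)] assms(3)] by simp

text \<open>By \<open>tr_fc_swap\<close> the p-th moment of x adj x is the 2 p-th moment of x. This
  is how an identity for h adj h in the p-norm bounds h in the 2 p-norm.\<close>

lemma nrm_mult_adj:
  assumes "x \<in> N" "0 < p"
  shows "nrm e p (x * adj x) = (nrm e (2 * p) x)\<^sup>2"
proof -
  have sa: "adj (x * adj x) = x * adj x"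
    by simp
  have "adj (x * adj x) * (x * adj x) = fc (\<lambda>t. t * t) (x * adj x)"
    by (simp add: fc_mult fc_id)
  then have "ms e p (x * adj x) = Re (tr e (fc (\<lambda>t. \<bar>t\<bar> powr (p / 2)) (fc (\<lambda>t. t * t) (x * adj x))))"
    by (simp only: ms_def)
  also have "fc (\<lambda>t. \<bar>t\<bar> powr (p / 2)) (fc (\<lambda>t. t * t) (x * adj x)) = fc (\<lambda>t. \<bar>t * t\<bar> powr (p / 2)) (x * adj x)"
    using assms by (intro fc_comp continuous_intros) auto
  also have "(\<lambda>t::real. \<bar>t * t\<bar> powr (p / 2)) = (\<lambda>t. \<bar>t\<bar> powr (2 * p / 2))"
  proof
    fix t :: real
    have "\<bar>t * t\<bar> powr (p / 2) = \<bar>t\<bar> powr (p / 2) * \<bar>t\<bar> powr (p / 2)"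
      by (simp only: abs_mult powr_mult abs_ge_zero)
    then show "\<bar>t * t\<bar> powr (p / 2) = \<bar>t\<bar> powr (2 * p / 2)"
      by (simp add: powr_add[symmetric])
  qed
  also have "tr e (fc (\<lambda>t. \<bar>t\<bar> powr (2 * p / 2)) (x * adj x)) = tr e (fc (\<lambda>t. \<bar>t\<bar> powr (2 * p / 2)) (adj x * x))"
    using assms by (intro tr_fc_swap[symmetric] continuous_intros) auto
  finally have "ms e p (x * adj x) = ms e (2 * p) x"
    by (simp only: ms_def)
  moreover have "ms e (2 * p) x powr (1 / p) = (ms e (2 * p) x powr (1 / (2 * p)))\<^sup>2"
    using assms ms_nonneg[of "2 * p" e x] by (simp add: power2_eq_square powr_add[symmetric])
  ultimately show ?thesis
    by (simp add: nrm_def)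
qed

lemma nrm_2: "nrm e 2 x = norm (app x (delta e))"
proof -
  have "fc (\<lambda>t. \<bar>t\<bar> powr (2 / 2)) (adj x * x) = fc (\<lambda>t. t) (adj x * x)"
    by (rule fc_cong[OF spec_adj_mult']) (auto intro!: continuous_intros simp: powr_one)
  then have "ms e 2 x = (norm (app x (delta e)))\<^sup>2"
    by (simp add: ms_def fc_id tr_adj_mult)
  then show ?thesis
    by (simp add: nrm_def powr_half_sqrt)
qed

text \<open>On norm bounded sets the 2-norm controls every p-norm: on [0, K'] the function t^(p/2)
  is at most r / 2 + C t, where the constant takes care of t \<le> t0 and the linear term of t >
  t0.\<close>

lemma nrm_tendsto_0:
  assumes bdd: "\<And>n. norm (z n) \<le> K" and lim: "(\<lambda>n. nrm e 2 (z n)) \<longlonglongrightarrow> 0" and p: "1 < p"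
  shows "(\<lambda>n. nrm e p (z n)) \<longlonglongrightarrow> 0"
proof -
  define K' where "K' = K\<^sup>2 + 1"
  have K': "0 < K'" and sp: "spec (adj (z n) * z n) 0 K'" for n
    using spec_mono[OF spec_adj_mult[OF bdd[of n]], of 0 K'] by (auto simp: K'_def add_nonneg_pos)
  have ms0: "(\<lambda>n. ms e p (z n)) \<longlonglongrightarrow> 0"
  proof (rule LIMSEQ_I)
    fix r :: real assume r: "0 < r"
    define t0 where "t0 = (r / 2) powr (2 / p)"
    have t0: "0 < t0" "t0 powr (p / 2) = r / 2"
      using r p by (simp_all add: t0_def powr_powr)
    define C where "C = K' powr (p / 2) / t0"
    have C: "0 < C"
      using K' t0 by (simp add: C_def)
    have bound: "ms e p (z n) \<le> r / 2 + C * (nrm e 2 (z n))\<^sup>2" for n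
    proof -
      have "ms e p (z n) \<le> Re (tr e (fc (\<lambda>t. r / 2 + C * t) (adj (z n) * z n)))"
        unfolding ms_def
      proof (rule tr_fc_mono[OF sp K'])
        fix t assume t: "0 \<le> t" "t \<le> K'"
        show "\<bar>t\<bar> powr (p / 2) \<le> r / 2 + C * t"
        proof (cases "t \<le> t0")
          case True
          then have "t powr (p / 2) \<le> t0 powr (p / 2)"
            using t p by (intro powr_mono2) auto
          then show ?thesis
            using t C t0 by (simp add: add_increasing2)
        next
          case False
          have "t powr (p / 2) \<le> K' powr (p / 2)"
            using t p by (intro powr_mono2) auto
          also have "\<dots> = C * t0"
            using t0 by (simp add: C_def)
          also have "\<dots> \<le> C * t"
            using False C by simp
          finally show ?thesis
            using t r by simp
        qed
      qed (use p in \<open>auto intro!: continuous_intros\<close>)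
      then show ?thesis
        by (simp add: fc_add fc_const fc_scaleR fc_id tr_add tr_scaleR tr_adj_mult nrm_2 continuous_intros)
    qed
    have "(\<lambda>n. C * (nrm e 2 (z n))\<^sup>2) \<longlonglongrightarrow> C * 0\<^sup>2"
      by (intro tendsto_intros lim)
    then have "\<forall>\<^sub>F n in sequentially. C * (nrm e 2 (z n))\<^sup>2 < r / 2"
      using r by (intro order_tendstoD(2)) auto
    then have "\<forall>\<^sub>F n in sequentially. norm (ms e p (z n) - 0) < r"
    proof eventually_elim
      case (elim n)
      then show ?case
        using bound[of n] ms_nonneg[of p e "z n"] p by simp
    qed
    then show "\<exists>no. \<forall>n\<ge>no. norm (ms e p (z n) - 0) < r"
      by (simp add: eventually_sequentially)
  qed
  have "(\<lambda>n. ms e p (z n) powr (1 / p)) \<longlonglongrightarrow> 0 powr (1 / p)"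
    by (rule tendsto_powr2[OF ms0]) (use p in \<open>auto simp: ms_nonneg\<close>)
  then show ?thesis
    by (simp add: nrm_def)
qed

text \<open>Contractivity removes \<open>ppart\<close>, and \<open>ms_exp\<close> leaves only Re z.
  On the two edges of the strip this gives the bounds that interpolation needs.\<close>

lemma nrm_ppart_exp:
  assumes "x \<in> N" "0 < \<epsilon>" "1 < r"
  shows "nrm e r (ppart \<epsilon> x * exp (cS z * plog \<epsilon> x)) \<le> pms e (r * Re z) \<epsilon> x powr (1 / r)"
proof -
  have "nrm e r (ppart \<epsilon> x * exp (cS z * plog \<epsilon> x)) \<le> norm (ppart \<epsilon> x) * nrm e r (exp (cS z * plog \<epsilon> x))"
    using assms by (intro nrm_mult_left ppart_N exp_N cS_N plog_N)
  also have "\<dots> \<le> 1 * nrm e r (exp (cS z * plog \<epsilon> x))"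
    using norm_ppart[OF assms(2)] by (intro mult_right_mono) (auto simp: nrm_nonneg)
  also have "\<dots> = pms e (r * Re z) \<epsilon> x powr (1 / r)"
    using assms by (simp add: nrm_def ms_exp adj_plog pms_eq)
  finally show ?thesis .
qed

text \<open>x and y are both deformed along analytic families whose edge norms are powers of the
  original moments. M may lie outside \<open>N\<close>, as multiplication operators do. With one
  constant C at both ends the interpolated constant is C^(1 - \<theta>) C^\<theta> = C.\<close>

lemma Riesz_Thorin:
  assumes b0: "\<And>x y. x \<in> N \<Longrightarrow> y \<in> N \<Longrightarrow> cmod (tr e (y * M * x)) \<le> C * nrm e p0 x * nrm e q0 y"
    and b1: "\<And>x y. x \<in> N \<Longrightarrow> y \<in> N \<Longrightarrow> cmod (tr e (y * M * x)) \<le> C * nrm e p1 x * nrm e q1 y"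
    and C: "0 < C"
    and pq: "1 < p0" "1 < q0" "1 / p0 + 1 / q0 = 1" "1 < p1" "1 < q1" "1 / p1 + 1 / q1 = 1"
      "1 < p" "1 < q" "1 / p + 1 / q = 1"
    and \<theta>: "0 \<le> \<theta>" "\<theta> \<le> 1" "1 / p = (1 - \<theta>) / p0 + \<theta> / p1"
    and N: "x \<in> N" "y \<in> N"
  shows "cmod (tr e (y * M * x)) \<le> C * nrm e p x * nrm e q y"
proof -
  have \<theta>q: "1 / q = (1 - \<theta>) / q0 + \<theta> / q1"
  proof -
    have "1 / q = 1 - 1 / p" "1 / q0 = 1 - 1 / p0" "1 / q1 = 1 - 1 / p1"
      using pq by simp_all
    then have "(1 - \<theta>) / q0 + \<theta> / q1 = (1 - \<theta>) * (1 - 1 / p0) + \<theta> * (1 - 1 / p1)"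
      by (metis mult.right_neutral times_divide_eq_right)
    also have "\<dots> = 1 - ((1 - \<theta>) / p0 + \<theta> / p1)"
      by (simp add: algebra_simps)
    finally show ?thesis
      using \<theta>(3) \<open>1 / q = 1 - 1 / p\<close> by simp
  qed
  have eps: "cmod (tr e (y * M * x)) \<le> C * (pms e p \<epsilon> x powr (1 / p)) * (pms e q \<epsilon> y powr (1 / q))" if e: "0 < \<epsilon>" for \<epsilon>
  proof -
    define P Q where "P = pms e p \<epsilon> x" and "Q = pms e q \<epsilon> y"
    have P: "0 < P" "0 < Q"
      using pq e by (auto simp: P_def Q_def intro!: pms_pos)
    define L K v w where "L = plog \<epsilon> x" and "K = plog \<epsilon> y" and "v = ppart \<epsilon> x" and "w = ppart \<epsilon> y"
    have sa: "adj L = L" "adj K = K"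
      unfolding L_def K_def by (rule adj_plog[OF e])+
    \<comment> \<open>Affine exponents: for x they are p / p0 at z = 0, p / p1 at z = 1 and 1 at z =
      \<theta>, where the family returns x; likewise for y.\<close>
    define a0 a1 b0 b1 where "a0 = p / p0" and "a1 = p / p1 - p / p0" and "b0 = q / q0" and "b1 = q / q1 - q / q0"
    define F where "F z = tr e (w * exp (cS (of_real b0 + of_real b1 * z) * K) * (M * v) * exp (cS (of_real a0 + of_real a1 * z) * L))" for z
    have "\<exists>B. \<forall>z. 0 \<le> Re z \<longrightarrow> Re z \<le> 1 \<longrightarrow> cmod (F z) \<le> B"
      unfolding F_def by (rule tr_exp_bounded_on_strip[OF sa(2,1)])
    then obtain B where B0: "\<forall>z. 0 \<le> Re z \<longrightarrow> Re z \<le> 1 \<longrightarrow> cmod (F z) \<le> B"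
      by (rule exE)
    have F_eq: "F z = tr e ((w * exp (cS (of_real b0 + of_real b1 * z) * K)) * M * (v * exp (cS (of_real a0 + of_real a1 * z) * L)))" for z
      unfolding F_def by (simp only: mult.assoc)
    have memN: "w * exp (cS c * K) \<in> N" "v * exp (cS c * L) \<in> N" for c
      unfolding w_def v_def K_def L_def using N e by (auto intro!: mult_N ppart_N exp_N cS_N plog_N)
    have edge: "C * nrm e r (v * exp (cS c * L)) * nrm e r' (w * exp (cS d * K)) \<le> C * P powr (1 / r) * Q powr (1 / r')"
      if "1 < r" "1 < r'" "Re c = p / r" "Re d = q / r'" for r r' c d
    proof -
      have "nrm e r (v * exp (cS c * L)) \<le> P powr (1 / r)" "nrm e r' (w * exp (cS d * K)) \<le> Q powr (1 / r')"
        using nrm_ppart_exp[OF N(1) e that(1), of c] nrm_ppart_exp[OF N(2) e that(2), of d] that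
        by (simp_all add: P_def Q_def v_def w_def L_def K_def)
      then show ?thesis
        using C by (intro mult_mono mult_nonneg_nonneg) (auto simp: nrm_nonneg)
    qed
    have "cmod (F (of_real \<theta>)) \<le> (C * P powr (1 / p0) * Q powr (1 / q0)) powr (1 - \<theta>) * (C * P powr (1 / p1) * Q powr (1 / q1)) powr \<theta>"
    proof (rule three_lines_scaled)
      show "F holomorphic_on UNIV"
        unfolding F_def by (rule holomorphic_tr_exp)
      show "cmod (F z) \<le> B" if "0 \<le> Re z" "Re z \<le> 1" for z
        using B0 that by simp
      show "0 < C * P powr (1 / p0) * Q powr (1 / q0)" "0 < C * P powr (1 / p1) * Q powr (1 / q1)"
        using C P by auto
      show "cmod (F (\<i> * of_real t)) \<le> C * P powr (1 / p0) * Q powr (1 / q0)" for t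
        unfolding F_eq by (rule order_trans[OF assms(1)[OF memN(2,1)] edge]) (use pq in \<open>auto simp: a0_def b0_def\<close>)
      show "cmod (F (1 + \<i> * of_real t)) \<le> C * P powr (1 / p1) * Q powr (1 / q1)" for t
        unfolding F_eq by (rule order_trans[OF assms(2)[OF memN(2,1)] edge]) (use pq in \<open>auto simp: a0_def b0_def a1_def b1_def\<close>)
    qed (use \<theta> in auto)
    also have "F (of_real \<theta>) = tr e (y * M * x)"
    proof -
      have "a0 + a1 * \<theta> = p * ((1 - \<theta>) / p0 + \<theta> / p1)"
        by (simp add: a0_def a1_def algebra_simps diff_divide_distrib)
      then have 1: "a0 + a1 * \<theta> = 1"
        using pq unfolding \<theta>(3)[symmetric] by simp
      have "b0 + b1 * \<theta> = q * ((1 - \<theta>) / q0 + \<theta> / q1)"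
        by (simp add: b0_def b1_def algebra_simps diff_divide_distrib)
      then have 2: "b0 + b1 * \<theta> = 1"
        using pq unfolding \<theta>q[symmetric] by simp
      have "F (of_real \<theta>) = tr e ((w * exp (cS (of_real (b0 + b1 * \<theta>)) * K)) * M * (v * exp (cS (of_real (a0 + a1 * \<theta>)) * L)))"
        unfolding F_eq by simp
      then show ?thesis
        by (simp add: 1 2 w_def v_def K_def L_def ppart_mult)
    qed
    also have "(C * P powr (1 / p0) * Q powr (1 / q0)) powr (1 - \<theta>) * (C * P powr (1 / p1) * Q powr (1 / q1)) powr \<theta>
        = (C powr (1 - \<theta>) * C powr \<theta>) * (P powr ((1 - \<theta>) / p0) * P powr (\<theta> / p1)) * (Q powr ((1 - \<theta>) / q0) * Q powr (\<theta> / q1))"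
      using C P by (simp add: powr_mult powr_powr)
    also have "\<dots> = C * P powr (1 / p) * Q powr (1 / q)"
      unfolding powr_add[symmetric] \<theta>(3) \<theta>q using C by simp
    finally show ?thesis
      by (simp add: P_def Q_def)
  qed
  have "(\<lambda>n. C * (pms e p (inverse (real (Suc n))) x powr (1 / p)) * (pms e q (inverse (real (Suc n))) y powr (1 / q)))
      \<longlonglongrightarrow> C * nrm e p x * nrm e q y"
    using pq by (intro tendsto_intros pms_powr_tendsto)
  then show ?thesis
    by (rule LIMSEQ_le_const) (intro exI[of _ 0] allI impI eps, simp)
qed

end

lemma (in tracial) nrm_mult_right:
  assumes "c \<in> N" "x \<in> N" "1 < p"
  shows "nrm e p (x * c) \<le> nrm e p x * norm c"
proof -
  have "nrm e p (x * c) = nrm e p (adj c * adj x)"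
    using nrm_adj[OF mult_N[OF assms(2,1)], of p] assms(3) by simp
  also have "\<dots> \<le> norm (adj c) * nrm e p (adj x)"
    using assms by (intro nrm_mult_left adj_N)
  finally show ?thesis
    using nrm_adj[OF assms(2), of p] assms(3) by (simp add: mult.commute)
qed

section \<open>Kaplansky density\<close>

lemma continuous_inverse_square: "continuous_on A (\<lambda>t::real. 1 / (1 + t * t))"
  by (intro continuous_intros) (auto simp: add_nonneg_eq_0_iff)

text \<open>The function of Kaplansky's density argument: it maps the line into [-1, 1] and is
  Lipschitz for the 2-norm as an operator function, so it brings approximants of uncontrolled norm
  back to norm at most 1.\<close>

definition kap :: "real \<Rightarrow> real" where
  "kap t = 2 * (t * (1 / (1 + t * t)))"

lemma continuous_kap: "continuous_on A kap"
  unfolding kap_def by (intro continuous_intros continuous_inverse_square)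

lemma abs_le_one_plus_square: "\<bar>t\<bar> \<le> (1 + t * t) / (2::real)"
  using zero_le_power2[of "\<bar>t\<bar> - 1"] by (simp add: power2_eq_square algebra_simps abs_mult_self_eq)

lemma abs_kap_le: "\<bar>kap t\<bar> \<le> 1"
  using abs_le_one_plus_square[of t] by (simp add: kap_def abs_mult divide_simps add_nonneg_pos)

text \<open>A right inverse of \<open>kap\<close> on [-1, 1]; the absolute value under the root
  keeps it continuous on the whole line.\<close>

definition kap_inv :: "real \<Rightarrow> real" where
  "kap_inv t = t / (1 + sqrt \<bar>1 - t * t\<bar>)"

lemma continuous_kap_inv: "continuous_on A kap_inv"
  unfolding kap_inv_def by (intro continuous_intros) (auto simp: add_nonneg_eq_0_iff)

lemma kap_kap_inv:
  assumes "\<bar>t\<bar> \<le> 1"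
  shows "kap (kap_inv t) = t"
proof -
  define r where "r = sqrt \<bar>1 - t * t\<bar>"
  have "t * t \<le> 1"
    using assms by (simp add: abs_le_square_iff[of t 1, simplified] power2_eq_square)
  then have r: "r * r = 1 - t * t" "0 \<le> r"
    by (simp_all add: r_def)
  have "1 + kap_inv t * kap_inv t = ((1 + r) * (1 + r) + t * t) / ((1 + r) * (1 + r))"
    using r by (simp add: kap_inv_def r_def[symmetric] divide_simps)
  also have "(1 + r) * (1 + r) + t * t = 2 * (1 + r)"
    using r by (simp add: algebra_simps)
  also have "2 * (1 + r) / ((1 + r) * (1 + r)) = 2 / (1 + r)"
    using r by (simp add: divide_simps)
  finally have "kap (kap_inv t) = 2 * (t / (1 + r) * (1 / (2 / (1 + r))))"
    by (simp add: kap_def kap_inv_def r_def[symmetric])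
  then show ?thesis
    using r by (simp add: divide_simps)
qed

text \<open>The axioms do not put 1 in D: in the group ring the element \<open>lam G \<one>\<close>
  is the projection onto the functions supported on the carrier. Density is asked in the
  2-norm.\<close>

locale dense_subalgebra = tracial +
  fixes D :: "'a cop set"
  assumes D_N: "D \<subseteq> N"
    and D_add: "x \<in> D \<Longrightarrow> y \<in> D \<Longrightarrow> x + y \<in> D"
    and D_mult: "x \<in> D \<Longrightarrow> y \<in> D \<Longrightarrow> x * y \<in> D"
    and D_cS: "x \<in> D \<Longrightarrow> cS c * x \<in> D"
    and D_adj: "x \<in> D \<Longrightarrow> adj x \<in> D"
    and D_dense: "x \<in> N \<Longrightarrow> 0 < r \<Longrightarrow> \<exists>c\<in>D. nrm e 2 (c - x) < r"
begin

lemma D_scaleR: "x \<in> D \<Longrightarrow> r *\<^sub>R x \<in> D"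
  unfolding cS_of_real[symmetric] by (rule D_cS)

lemma D_mult_pol: "c \<in> D \<Longrightarrow> c * pol q c \<in> D"
proof (induction q)
  case 0
  then show ?case
    using D_scaleR[of c 0] by simp
next
  case (pCons a q)
  then show ?case
    by (simp add: distrib_left D_add D_mult D_scaleR)
qed

lemma kap_approx:
  assumes c: "c \<in> D" "adj c = c" and r: "0 < r"
  shows "\<exists>d\<in>D. norm (d - fc kap c) < r"
proof -
  obtain q where q: "uniform_limit {-(norm c + 1)..norm c + 1} (\<lambda>n. poly (q n)) kap sequentially" "(\<lambda>n. pol (q n) c) \<longlonglongrightarrow> fc kap c"
    by (rule fc_approx[OF c(2) continuous_kap, of "norm c + 1"]) simp_all
  have "(\<lambda>n. poly (q n) 0) \<longlonglongrightarrow> kap 0"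
    by (rule tendsto_uniform_limitI[OF q(1)]) (use norm_ge_zero[of c] in \<open>simp del: norm_ge_zero\<close>)
  then have "(\<lambda>n. pol (q n) c - poly (q n) 0 *\<^sub>R 1) \<longlonglongrightarrow> fc kap c - kap 0 *\<^sub>R 1"
    by (intro tendsto_intros q(2))
  then have "\<forall>\<^sub>F n in sequentially. norm (pol (q n) c - poly (q n) 0 *\<^sub>R 1 - fc kap c) < r"
    using r by (auto simp: kap_def tendsto_iff dist_norm)
  then obtain n where "norm (pol (q n) c - poly (q n) 0 *\<^sub>R 1 - fc kap c) < r"
    unfolding eventually_sequentially by blast
  moreover have "pol (q n) c - poly (q n) 0 *\<^sub>R 1 \<in> D"
  proof (cases "q n")
    case (pCons a q')
    then show ?thesis
      using D_mult_pol[OF c(1), of q'] by simp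
  qed
  ultimately show ?thesis
    by blast
qed

text \<open>With R(t) = 1 / (1 + t^2), the difference c R(c) - y R(y) equals R(c) (c - y) R(y) + c
  R(c) (y - c) y R(y). All outer factors are contractions, so each summand costs the 2-norm of c -
  y, and the factor 2 in \<open>kap\<close> makes 4.\<close>

lemma nrm_2_kap_diff:
  assumes "c \<in> N" "y \<in> N" "adj c = c" "adj y = y"
  shows "nrm e 2 (fc kap c - fc kap y) \<le> 4 * nrm e 2 (c - y)"
proof -
  let ?R = "\<lambda>x::'a cop. fc (\<lambda>t. 1 / (1 + t * t)) x"
  have kap: "fc kap x = 2 *\<^sub>R (x * ?R x)" and R1: "?R x * (1 + x * x) = 1" "(1 + x * x) * ?R x = 1"
    and com: "?R x * x = x * ?R x" if "adj x = x" for x :: "'a cop"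
  proof -
    have eq: "fc (\<lambda>t. 1 / (1 + t * t) * (1 + t * t)) x = 1"
    proof -
      have "1 / (1 + t * t) * (1 + t * t) = (1::real)" for t
        by (simp add: add_nonneg_eq_0_iff)
      then show ?thesis
        using that by (simp only: fc_const) simp
    qed
    have "fc (\<lambda>t. 1 + t * t) x = 1 + x * x"
      using that by (simp add: fc_add fc_mult fc_const fc_id continuous_intros)
    moreover have c2: "continuous_on UNIV (\<lambda>t::real. 1 + t * t)"
      by (intro continuous_intros)
    ultimately show "?R x * (1 + x * x) = 1" "(1 + x * x) * ?R x = 1"
      using fc_mult[OF that continuous_inverse_square c2] fc_mult[OF that c2 continuous_inverse_square] eq
      by (simp_all add: mult.commute)
    show "?R x * x = x * ?R x"
      using fc_mult[OF that continuous_inverse_square, of "\<lambda>t. t"] fc_mult[OF that _ continuous_inverse_square, of "\<lambda>t. t"]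
      by (simp add: fc_id that mult.commute)
    show "fc kap x = 2 *\<^sub>R (x * ?R x)"
    proof -
      have "fc kap x = 2 *\<^sub>R fc (\<lambda>t. t * (1 / (1 + t * t))) x"
        unfolding kap_def[abs_def]
        by (rule fc_scaleR[OF that]) (intro continuous_on_mult continuous_on_id continuous_inverse_square)
      also have "fc (\<lambda>t. t * (1 / (1 + t * t))) x = fc (\<lambda>t. t) x * ?R x"
        by (rule fc_mult[OF that continuous_on_id continuous_inverse_square])
      finally show ?thesis
        by (simp only: fc_id[OF that])
    qed
  qed
  have NR: "?R c \<in> N" "?R y \<in> N"
    using assms by (auto intro!: fc_N continuous_inverse_square)
  have nR: "norm (?R x) \<le> 1" "norm (x * ?R x) \<le> 1" if "adj x = x" for x :: "'a cop"
  proof -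
    have sp: "spec x (- norm x - 1) (norm x + 1)" "- norm x - 1 < norm x + 1"
      using spec_norm[OF that, of "norm x + 1"] norm_ge_zero[of x] by (simp_all del: norm_ge_zero)
    show "norm (?R x) \<le> 1"
      by (rule norm_fc_le[OF sp continuous_inverse_square]) (auto simp: divide_simps add_nonneg_pos add_nonneg_eq_0_iff)
    have "norm (fc kap x) \<le> 1"
      by (rule norm_fc_le[OF sp continuous_kap abs_kap_le])
    then show "norm (x * ?R x) \<le> 1"
      using kap[OF that] by simp
  qed
  have "fc kap c - fc kap y = 2 *\<^sub>R (c * ?R c - y * ?R y)"
    using assms kap by (simp add: scaleR_diff_right)
  also have "c * ?R c - y * ?R y = ?R c * c * ((1 + y * y) * ?R y) - (?R c * (1 + c * c)) * y * ?R y"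
    using assms by (simp only: R1 com mult_1_right mult_1_left)
  also have "\<dots> = ?R c * (c - y) * ?R y + (?R c * c) * (y - c) * (y * ?R y)"
    by (simp add: algebra_simps)
  finally have eq: "fc kap c - fc kap y = 2 *\<^sub>R (?R c * (c - y) * ?R y + (?R c * c) * (y - c) * (y * ?R y))" .
  have part: "nrm e 2 (A * z * B) \<le> nrm e 2 z" if "A \<in> N" "B \<in> N" "z \<in> N" "norm A \<le> 1" "norm B \<le> 1" for A B z
  proof -
    have "nrm e 2 (A * z * B) \<le> nrm e 2 (A * z) * norm B"
      using that by (intro nrm_mult_right mult_N) auto
    also have "\<dots> \<le> (norm A * nrm e 2 z) * norm B"
      using that by (intro mult_right_mono nrm_mult_left) auto
    also have "\<dots> \<le> (1 * nrm e 2 z) * 1"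
      using that by (intro mult_mono) (auto simp: nrm_nonneg)
    finally show ?thesis
      by simp
  qed
  have cy: "c - y \<in> N" "y - c \<in> N"
    using assms by (auto intro: diff_N)
  have "nrm e 2 (?R c * (c - y) * ?R y + (?R c * c) * (y - c) * (y * ?R y))
      \<le> nrm e 2 (?R c * (c - y) * ?R y) + nrm e 2 ((?R c * c) * (y - c) * (y * ?R y))"
    using assms NR cy by (intro nrm_triangle mult_N) auto
  also have "\<dots> \<le> nrm e 2 (c - y) + nrm e 2 (y - c)"
    using assms NR cy nR com by (intro add_mono part mult_N) auto
  also have "nrm e 2 (y - c) = nrm e 2 (c - y)"
    using nrm_uminus[OF cy(1), of 2] by simp
  finally have *: "nrm e 2 (?R c * (c - y) * ?R y + (?R c * c) * (y - c) * (y * ?R y)) \<le> 2 * nrm e 2 (c - y)"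
    by simp
  have "nrm e 2 (cS (of_real 2) * (?R c * (c - y) * ?R y + (?R c * c) * (y - c) * (y * ?R y)))
      \<le> cmod (of_real 2) * nrm e 2 (?R c * (c - y) * ?R y + (?R c * c) * (y - c) * (y * ?R y))"
    using assms NR cy by (intro nrm_cS add_N mult_N) auto
  also have "\<dots> \<le> 2 * (2 * nrm e 2 (c - y))"
    using * by simp
  finally show ?thesis
    unfolding eq cS_of_real[of 2] by simp
qed

text \<open>x is written as kap of y, and y is approximated in the 2-norm by a self-adjoint c of D
  without norm control. Then kap of c has norm at most 1 and is still close to x, and a polynomial
  in c approximates it in norm. The slack in that last step makes the bound 2 instead of 1.\<close>

lemma Kaplansky_contraction:
  assumes x: "x \<in> N" "adj x = x" "norm x \<le> 1" and r: "0 < r"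
  shows "\<exists>d\<in>D. norm d \<le> 2 \<and> nrm e 2 (d - x) < r"
proof -
  define y where "y = fc kap_inv x"
  have y: "y \<in> N" "adj y = y"
    using x by (auto simp: y_def continuous_kap_inv intro!: fc_N)
  have "fc kap y = fc (\<lambda>t. kap (kap_inv t)) x"
    unfolding y_def by (rule fc_comp[OF x(2) continuous_kap continuous_kap_inv])
  also have "\<dots> = fc (\<lambda>t. t) x"
    by (rule fc_cong[OF spec_norm[OF x(2,3)]])
      (auto intro!: continuous_on_compose2[OF continuous_kap continuous_kap_inv] continuous_intros kap_kap_inv)
  finally have ky: "fc kap y = x"
    using x by (simp add: fc_id)
  \<comment> \<open>The Lipschitz constant 4 turns r / 8 into r / 2; the other half of r is left for
    the polynomial approximation.\<close>
  obtain c0 where c0: "c0 \<in> D" "nrm e 2 (c0 - y) < r / 8"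
    using D_dense[OF y(1), of "r / 8"] r by auto
  define c where "c = (1 / 2) *\<^sub>R (c0 + adj c0)"
  have c: "c \<in> D" "adj c = c"
    using c0 by (simp_all add: c_def D_scaleR D_add D_adj add.commute)
  have cN: "c \<in> N" "c0 \<in> N"
    using c c0 D_N by auto
  have "nrm e 2 (c - y) \<le> nrm e 2 (c0 - y)"
  proof -
    have "c - y = cS (of_real (1 / 2)) * ((c0 - y) + adj (c0 - y))"
      unfolding cS_of_real using y by (simp add: c_def algebra_simps scaleR_2[symmetric])
    then have "nrm e 2 (c - y) \<le> cmod (of_real (1 / 2)) * nrm e 2 ((c0 - y) + adj (c0 - y))"
      using cN y by (simp only:) (intro nrm_cS add_N adj_N diff_N, auto)
    also have "\<dots> \<le> cmod (of_real (1 / 2)) * (nrm e 2 (c0 - y) + nrm e 2 (adj (c0 - y)))"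
      using cN y by (intro mult_left_mono nrm_triangle adj_N diff_N) auto
    also have "\<dots> = nrm e 2 (c0 - y)"
      using nrm_adj[OF diff_N[OF cN(2) y(1)], of 2] by simp
    finally show ?thesis .
  qed
  then have "nrm e 2 (fc kap c - x) < r / 2"
    using nrm_2_kap_diff[OF cN(1) y(1) c(2) y(2)] c0(2) by (simp add: ky)
  moreover obtain d where d: "d \<in> D" "norm (d - fc kap c) < min 1 (r / 2)"
    using kap_approx[OF c, of "min 1 (r / 2)"] r by auto
  moreover have "nrm e 2 (d - fc kap c) \<le> norm (d - fc kap c)"
    unfolding nrm_2 using norm_app[of "d - fc kap c" "delta e"] by simp
  moreover have kN: "fc kap c \<in> N"
    using c cN by (intro fc_N continuous_kap)
  moreover have "nrm e 2 ((d - fc kap c) + (fc kap c - x)) \<le> nrm e 2 (d - fc kap c) + nrm e 2 (fc kap c - x)"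
    using d D_N kN x by (intro nrm_triangle diff_N) auto
  moreover have "norm (fc kap c) \<le> 1"
    by (rule norm_fc_le[OF spec_norm[OF c(2), of "norm c + 1"] _ continuous_kap abs_kap_le])
      (use norm_ge_zero[of c] in \<open>simp_all del: norm_ge_zero\<close>)
  then have "norm d \<le> 2"
    using norm_triangle_ineq[of "d - fc kap c" "fc kap c"] d(2) by simp
  ultimately show ?thesis
    by (intro bexI[of _ d]) auto
qed

text \<open>Scaling reduces a self-adjoint element to a contraction, and a general x is split into
  real and imaginary parts. The point is that the approximants stay norm bounded.\<close>

lemma Kaplansky:
  assumes "x \<in> N"
  shows "\<exists>c K. (\<forall>n. c n \<in> D) \<and> (\<forall>n. norm (c n - x) \<le> K) \<and> (\<lambda>n. nrm e 2 (c n - x)) \<longlonglongrightarrow> 0"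
proof -
  have sa: "\<exists>d\<in>D. norm d \<le> 2 * (norm x + 1) \<and> nrm e 2 (d - x) < r"
    if x: "x \<in> N" "adj x = x" and r: "0 < r" for x r
  proof -
    define s where "s = norm x + 1"
    have s: "0 < s" "1 \<le> s"
      by (simp_all add: s_def add_nonneg_pos)
    have "norm ((1 / s) *\<^sub>R x) \<le> 1"
      using s by (simp add: s_def)
    then obtain d where d: "d \<in> D" "norm d \<le> 2" "nrm e 2 (d - (1 / s) *\<^sub>R x) < r / s"
      using Kaplansky_contraction[of "(1 / s) *\<^sub>R x" "r / s"] x r s by (auto simp: scaleR_N)
    have "s *\<^sub>R d - x = cS (of_real s) * (d - (1 / s) *\<^sub>R x)"
      unfolding cS_of_real using s by (simp add: scaleR_diff_right)
    then have "nrm e 2 (s *\<^sub>R d - x) \<le> cmod (of_real s) * nrm e 2 (d - (1 / s) *\<^sub>R x)"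
      using d x D_N by (simp only:) (intro nrm_cS diff_N scaleR_N, auto)
    also have "\<dots> < s * (r / s)"
      using mult_strict_left_mono[OF d(3) s(1)] s by simp
    finally have "nrm e 2 (s *\<^sub>R d - x) < r"
      using s by simp
    moreover have "norm (s *\<^sub>R d) \<le> 2 * s"
      using d s by (simp add: mult.commute)
    ultimately show ?thesis
      using d unfolding s_def by (intro bexI[of _ "(norm x + 1) *\<^sub>R d"] conjI D_scaleR)
  qed
  define a where "a = (1 / 2) *\<^sub>R (x + adj x)"
  define b where "b = cS (- \<i> / 2) * (x - adj x)"
  have x_eq: "x = a + cS \<i> * b"
  proof -
    have "cS \<i> * b = cS (of_real (1 / 2)) * (x - adj x)"
      by (simp add: b_def mult.assoc[symmetric] cS_mult[symmetric])
    then show ?thesis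
      unfolding cS_of_real by (simp add: a_def scaleR_add_right[symmetric] scaleR_2[symmetric])
  qed
  have "adj b = cS (\<i> / 2) * (adj x - x)"
    by (simp add: b_def cS_commute[of "adj x - x"])
  moreover have "b = cS (\<i> / 2) * (adj x - x)"
    by (simp add: b_def cS_minus algebra_simps)
  ultimately have "adj b = b"
    by simp
  moreover have "adj a = a"
    by (simp add: a_def add.commute)
  moreover have "a \<in> N" "b \<in> N"
    using assms by (auto simp: a_def b_def intro!: scaleR_N add_N adj_N cS_N diff_N)
  ultimately have ab: "a \<in> N" "b \<in> N" "adj a = a" "adj b = b"
    by auto
  have "\<exists>d\<in>D. norm d \<le> 2 * (norm a + 1) + 2 * (norm b + 1) \<and> nrm e 2 (d - x) < inverse (real (Suc n))" for n
  proof -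
    define r where "r = inverse (real (Suc n)) / 2"
    have r: "0 < r"
      by (simp add: r_def)
    obtain d1 where d1: "d1 \<in> D" "norm d1 \<le> 2 * (norm a + 1)" "nrm e 2 (d1 - a) < r"
      using sa[OF ab(1,3) r] by blast
    obtain d2 where d2: "d2 \<in> D" "norm d2 \<le> 2 * (norm b + 1)" "nrm e 2 (d2 - b) < r"
      using sa[OF ab(2,4) r] by blast
    have mem: "d1 - a \<in> N" "d2 - b \<in> N"
      using d1 d2 ab D_N by (auto intro: diff_N)
    have "norm (d1 + cS \<i> * d2) \<le> 2 * (norm a + 1) + 2 * (norm b + 1)"
      using norm_triangle_ineq[of d1 "cS \<i> * d2"] norm_cS_mult[of \<i> d2] d1(2) d2(2) by simp
    moreover have "nrm e 2 (d1 + cS \<i> * d2 - x) < r + r"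
    proof -
      have "d1 + cS \<i> * d2 - x = (d1 - a) + cS \<i> * (d2 - b)"
        by (subst x_eq) (simp add: algebra_simps)
      then have "nrm e 2 (d1 + cS \<i> * d2 - x) \<le> nrm e 2 (d1 - a) + nrm e 2 (cS \<i> * (d2 - b))"
        using mem by (simp only:) (intro nrm_triangle cS_N, auto)
      also have "\<dots> \<le> nrm e 2 (d1 - a) + cmod \<i> * nrm e 2 (d2 - b)"
        using mem by (intro add_left_mono nrm_cS) auto
      finally show ?thesis
        using d1(3) d2(3) by simp
    qed
    ultimately show ?thesis
      using d1(1) d2(1) by (intro bexI[of _ "d1 + cS \<i> * d2"]) (auto simp: r_def D_add D_cS)
  qed
  then have "\<forall>n. \<exists>d. d \<in> D \<and> norm d \<le> 2 * (norm a + 1) + 2 * (norm b + 1) \<and> nrm e 2 (d - x) < inverse (real (Suc n))"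
    by (simp only: Bex_def) simp
  from choice[OF this] obtain c where "\<forall>n. c n \<in> D \<and> norm (c n) \<le> 2 * (norm a + 1) + 2 * (norm b + 1)
      \<and> nrm e 2 (c n - x) < inverse (real (Suc n))"
    by (rule exE)
  then have c: "c n \<in> D" "norm (c n) \<le> 2 * (norm a + 1) + 2 * (norm b + 1)"
    "nrm e 2 (c n - x) < inverse (real (Suc n))" for n
    by simp_all
  have "norm (c n - x) \<le> 2 * (norm a + 1) + 2 * (norm b + 1) + norm x" for n
    using norm_triangle_ineq4[of "c n" x] c(2)[of n] by simp
  moreover have "(\<lambda>n. nrm e 2 (c n - x)) \<longlonglongrightarrow> 0"
  proof (rule tendsto_sandwich[OF _ _ tendsto_const LIMSEQ_inverse_real_of_nat])
    show "\<forall>\<^sub>F n in sequentially. nrm e 2 (c n - x) \<le> inverse (real (Suc n))"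
      using c(3) by (intro always_eventually allI less_imp_le)
  qed (simp add: nrm_nonneg)
  ultimately show ?thesis
    using c(1) by (intro exI conjI allI)
qed

text \<open>One sequence serves all exponents at once, being norm bounded and convergent in the
  2-norm. The limit argument for forms uses it for p and for 2 together.\<close>

lemma Kaplansky_Lp:
  assumes "x \<in> N"
  shows "\<exists>c. (\<forall>n. c n \<in> D) \<and> (\<forall>p>1. (\<lambda>n. nrm e p (c n - x)) \<longlonglongrightarrow> 0)"
proof -
  obtain c K where "\<forall>n. c n \<in> D" and c: "\<forall>n. norm (c n - x) \<le> K" "(\<lambda>n. nrm e 2 (c n - x)) \<longlonglongrightarrow> 0"
    using Kaplansky[OF assms] by (elim exE conjE)
  moreover have "(\<lambda>n. nrm e p (c n - x)) \<longlonglongrightarrow> 0" if "1 < p" for p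
    by (rule nrm_tendsto_0[OF _ c(2) that]) (use c(1) in blast)
  ultimately show ?thesis
    by (intro exI[of _ c] conjI allI impI) simp_all
qed

end

section \<open>Comparison with the norms of the definitions\<close>

lemma poly_op_op_of: "poly_op q (op_of x) = op_of (pol q x)"
proof -
  have pw: "((o\<^sub>L) (op_of x) ^^ i) id_blinfun = op_of (x ^ i)" for i
    by (induction i) (simp_all add: one_cop.rep_eq times_cop.rep_eq)
  have sum: "op_of (\<Sum>i\<in>I. f i) = (\<Sum>i\<in>I. op_of (f i))" for f :: "nat \<Rightarrow> 'a cop" and I
    by (induction I rule: infinite_finite_induct) (simp_all add: zero_cop.rep_eq plus_cop.rep_eq)
  show ?thesis
    by (simp add: poly_op_def pol_def sum scaleR_cop.rep_eq pw)
qed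

text \<open>Agreement on the half line is what lets \<open>t powr p\<close> be traded for a function
  continuous on the whole line. For x = 0 the interval of the definition shrinks to a point, which
  the strict inequality in \<open>fc_tendsto\<close> excludes; hence the separate case.\<close>

lemma fun_calc_op_of:
  assumes x: "pos x" and \<phi>: "continuous_on UNIV \<phi>" and eq: "\<And>t. 0 \<le> t \<Longrightarrow> \<psi> t = \<phi> t"
  shows "fun_calc \<psi> (op_of x) = op_of (fc \<phi> x)"
proof -
  have sa: "adj x = x"
    using x by (rule pos_adj)
  have lim: "(\<lambda>n. pol (q n) x) \<longlonglongrightarrow> fc \<phi> x"
    if q: "uniform_limit {0..norm x} (\<lambda>n. poly (q n)) \<phi> sequentially" for q
  proof (cases "norm x = 0")
    case True
    then have [simp]: "x = 0"
      by simp
    have "pol r (0 :: 'a cop) = poly r 0 *\<^sub>R 1" for r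
      by (cases r) simp
    moreover have "fc \<phi> (0 :: 'a cop) = \<phi> 0 *\<^sub>R 1"
    proof -
      have "fc \<phi> (fc (\<lambda>t. 0) (0 :: 'a cop)) = fc (\<lambda>t. \<phi> 0) 0"
        by (rule fc_comp) (auto intro: \<phi> continuous_intros)
      then show ?thesis
        by (simp add: fc_const)
    qed
    moreover have "(\<lambda>n. poly (q n) 0) \<longlonglongrightarrow> \<phi> 0"
      by (rule tendsto_uniform_limitI[OF q]) simp
    ultimately show ?thesis
      by (auto intro!: tendsto_intros)
  next
    case False
    then have "0 < norm x"
      by simp
    then show ?thesis
      by (intro fc_tendsto[OF spec_pos[OF x order_refl] _ \<phi> q])
  qed
  have uni: "uniform_limit {0..norm x} (\<lambda>n. poly (q n)) \<psi> sequentially \<longleftrightarrow>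
      uniform_limit {0..norm x} (\<lambda>n. poly (q n)) \<phi> sequentially" for q
    by (rule uniform_limit_cong') (auto simp: eq)
  have nx: "norm (op_of x) = norm x"
    by (simp add: norm_cop.rep_eq)
  show ?thesis
    unfolding fun_calc_def nx uni poly_op_op_of
  proof (rule the_equality)
    obtain q where q: "uniform_limit {0..norm x} (\<lambda>n. poly (q n)) \<phi> sequentially"
      by (rule Weierstrass_poly[OF continuous_on_subset[OF \<phi>]]) auto
    then show "\<exists>q. uniform_limit {0..norm x} (\<lambda>n. poly (q n)) \<phi> sequentially \<and>
        (\<lambda>n. op_of (pol (q n) x)) \<longlonglongrightarrow> op_of (fc \<phi> x)"
      unfolding op_of_tendsto using lim[OF q] by (intro exI[of _ q] conjI)
  next
    fix y assume "\<exists>q. uniform_limit {0..norm x} (\<lambda>n. poly (q n)) \<phi> sequentially \<and>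
        (\<lambda>n. op_of (pol (q n) x)) \<longlonglongrightarrow> y"
    then obtain q where q: "uniform_limit {0..norm x} (\<lambda>n. poly (q n)) \<phi> sequentially"
        "(\<lambda>n. op_of (pol (q n) x)) \<longlonglongrightarrow> y"
      by blast
    have "(\<lambda>n. op_of (pol (q n) x)) \<longlonglongrightarrow> op_of (fc \<phi> x)"
      unfolding op_of_tendsto by (rule lim[OF q(1)])
    then show "y = op_of (fc \<phi> x)"
      by (rule LIMSEQ_unique[OF q(2)])
  qed
qed

text \<open>The square root of adj x x followed by the p-th power composes to its power p / 2. Facts
  about \<open>nrm\<close> thereby become facts about the given norm.\<close>

lemma lp_norm_op_of:
  assumes "0 < p"
  shows "lp_norm_vN W p (op_of x) = nrm \<one>\<^bsub>W\<^esub> p x"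
proof -
  define a where "a = adj x * x"
  have a: "pos a" "adj a = a" "spec a 0 ((norm x)\<^sup>2 + 1)" "0 < (norm x)\<^sup>2 + 1"
    using spec_adj_mult'[of x] by (simp_all add: a_def pos_adj_mult)
  have c: "continuous_on UNIV (\<lambda>t. sqrt t)"
    by (intro continuous_intros)
  have "abs_op (op_of x) = fun_calc sqrt (op_of a)"
    by (simp add: abs_op_def op_of_adj a_def times_cop.rep_eq)
  also have "\<dots> = op_of (fc sqrt a)"
    by (rule fun_calc_op_of[OF a(1) c]) simp
  finally have "fun_calc (\<lambda>t. t powr p) (abs_op (op_of x)) = fun_calc (\<lambda>t. t powr p) (op_of (fc sqrt a))"
    by simp
  also have "\<dots> = op_of (fc (\<lambda>t. \<bar>t\<bar> powr p) (fc sqrt a))"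
    by (rule fun_calc_op_of[OF fc_pos[OF a(3,4) c] continuous_abs_powr[OF assms]]) auto
  also have "fc (\<lambda>t. \<bar>t\<bar> powr p) (fc sqrt a) = fc (\<lambda>t. \<bar>sqrt t\<bar> powr p) a"
    by (rule fc_comp[OF a(2) continuous_abs_powr[OF assms] c])
  also have "\<dots> = fc (\<lambda>t. \<bar>t\<bar> powr (p / 2)) a"
  proof (rule fc_cong[OF a(3,4)])
    show "continuous_on UNIV (\<lambda>t. \<bar>sqrt t\<bar> powr p)"
      by (rule continuous_on_compose2[OF continuous_abs_powr[OF assms, of UNIV] c]) simp
    fix t :: real assume "0 \<le> t"
    then show "\<bar>sqrt t\<bar> powr p = \<bar>t\<bar> powr (p / 2)"
      by (simp add: powr_half_sqrt[symmetric] powr_powr)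
  qed (use assms in \<open>auto intro!: continuous_intros\<close>)
  finally show ?thesis
    by (simp add: lp_norm_vN_def trace_vN_def nrm_def ms_def tr_def app_def a_def)
qed

section \<open>Group von Neumann algebras and their multipliers\<close>

text \<open>Right translations are the left translations of the opposite group, so facts about
  \<open>lam\<close> apply to both.\<close>

definition opp :: "('a, 'b) monoid_scheme \<Rightarrow> ('a, 'b) monoid_scheme" where
  "opp W = W\<lparr>mult := \<lambda>a b. b \<otimes>\<^bsub>W\<^esub> a\<rparr>"

lemma opp_simps [simp]: "carrier (opp W) = carrier W" "\<one>\<^bsub>opp W\<^esub> = \<one>\<^bsub>W\<^esub>" "a \<otimes>\<^bsub>opp W\<^esub> b = b \<otimes>\<^bsub>W\<^esub> a"
  by (simp_all add: opp_def)

lemma group_opp: "group W \<Longrightarrow> group (opp W)"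
proof -
  assume "group W"
  then interpret group W .
  show ?thesis
    by (rule groupI) (auto simp: m_assoc intro: r_inv l_inv_ex r_inv_ex)
qed

lemma inv_opp: "group W \<Longrightarrow> g \<in> carrier W \<Longrightarrow> inv\<^bsub>opp W\<^esub> g = inv\<^bsub>W\<^esub> g"
  using group.inv_equality[OF group_opp, of W "inv\<^bsub>W\<^esub> g" g]
  by (simp add: group.r_inv group.inv_closed)

definition lam :: "('a, 'b) monoid_scheme \<Rightarrow> 'a \<Rightarrow> 'a cop" where
  "lam W g = Abs_cop (left_reg W g)"

lemma op_of_lam:
  assumes "group W" "g \<in> carrier W"
  shows "op_of (lam W g) = left_reg W g"
proof -
  have "blinfun_apply (left_reg W g) (scaleC_ell2 c f) = scaleC_ell2 c (blinfun_apply (left_reg W g) f)" for c f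
    by (rule ell2_eqI) (simp add: left_reg_apply[OF assms] ell2_fun_scaleC)
  then show ?thesis
    by (simp add: lam_def Abs_cop_inverse)
qed

lemma app_lam:
  assumes "group W" "g \<in> carrier W"
  shows "ell2_fun (app (lam W g) f) x = (if x \<in> carrier W then ell2_fun f (inv\<^bsub>W\<^esub> g \<otimes>\<^bsub>W\<^esub> x) else 0)"
  by (simp add: app_def op_of_lam[OF assms] left_reg_apply[OF assms])

lemma app_lam_opp:
  assumes "group W" "g \<in> carrier W"
  shows "ell2_fun (app (lam (opp W) g) f) x = (if x \<in> carrier W then ell2_fun f (x \<otimes>\<^bsub>W\<^esub> inv\<^bsub>W\<^esub> g) else 0)"
  using app_lam[OF group_opp[OF assms(1)], of g f x] assms by (simp add: inv_opp)

text \<open>Multiplication by \<mu> on square-summable functions, which is how a multiplier acts on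
  the vector \<open>app x (delta \<one>)\<close>. It is used for \<mu> bounded by 1.\<close>

definition Mop :: "('a \<Rightarrow> complex) \<Rightarrow> 'a cop" where
  "Mop \<mu> = Abs_cop (Blinfun (\<lambda>f. Abs_ell2 (\<lambda>x. \<mu> x * ell2_fun f x)))"

lemma app_Mop:
  assumes \<mu>: "\<And>x. cmod (\<mu> x) \<le> 1"
  shows "ell2_fun (app (Mop \<mu>) f) x = \<mu> x * ell2_fun f x"
proof -
  define h where "h f x = \<mu> x * ell2_fun f x" for f x
  have fin: "(\<Sum>x\<in>F. (cmod (h f x))\<^sup>2) \<le> (norm f)\<^sup>2" if "finite F" for f F
  proof -
    have "cmod (h f x) \<le> cmod (ell2_fun f x)" for x
      using mult_right_mono[OF \<mu>[of x] norm_ge_zero[of "ell2_fun f x"]] by (simp add: h_def norm_mult)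
    then have "(\<Sum>x\<in>F. (cmod (h f x))\<^sup>2) \<le> (\<Sum>x\<in>F. (cmod (ell2_fun f x))\<^sup>2)"
      by (intro sum_mono power_mono) auto
    also have "\<dots> \<le> (norm f)\<^sup>2"
      by (rule sum_ell2_le[OF that])
    finally show ?thesis .
  qed
  have rep: "ell2_fun (Abs_ell2 (h f)) = h f" for f
    using ell2_bounded_sums(1)[of "h f" "norm f"] fin by (simp add: Abs_ell2_inverse)
  have bl: "bounded_linear (\<lambda>f. Abs_ell2 (h f))"
  proof (rule bounded_linear_intro[where K = 1])
    show "norm (Abs_ell2 (h f)) \<le> norm f * 1" for f
      using ell2_bounded_sums(2)[of "h f" "norm f"] fin by simp
  qed (auto intro!: ell2_eqI simp: rep ell2_fun_simps, auto simp: h_def ell2_fun_simps algebra_simps)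
  have "Mop \<mu> = Abs_cop (Blinfun (\<lambda>f. Abs_ell2 (h f)))"
    by (simp add: Mop_def h_def[abs_def])
  moreover have "blinfun_apply (Blinfun (\<lambda>f. Abs_ell2 (h f))) (scaleC_ell2 c g) =
      scaleC_ell2 c (blinfun_apply (Blinfun (\<lambda>f. Abs_ell2 (h f))) g)" for c g
    unfolding bounded_linear_Blinfun_apply[OF bl]
    by (rule ell2_eqI) (simp add: rep ell2_fun_simps, simp add: h_def ell2_fun_simps)
  ultimately have "app (Mop \<mu>) f = Abs_ell2 (h f)"
    by (simp add: app_def Abs_cop_inverse bounded_linear_Blinfun_apply[OF bl])
  then show ?thesis
    by (simp only: rep) (simp only: h_def)
qed

lemma norm_Mop:
  assumes \<mu>: "\<And>x. cmod (\<mu> x) \<le> 1"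
  shows "norm (Mop \<mu>) \<le> 1"
proof (rule norm_cop_bound)
  fix f
  have "(\<Sum>x\<in>F. (cmod (\<mu> x * ell2_fun f x))\<^sup>2) \<le> (norm f)\<^sup>2" if "finite F" for F
  proof -
    have "cmod (\<mu> x * ell2_fun f x) \<le> cmod (ell2_fun f x)" for x
      using mult_right_mono[OF \<mu>[of x] norm_ge_zero[of "ell2_fun f x"]] by (simp add: norm_mult)
    then have "(\<Sum>x\<in>F. (cmod (\<mu> x * ell2_fun f x))\<^sup>2) \<le> (\<Sum>x\<in>F. (cmod (ell2_fun f x))\<^sup>2)"
      by (intro sum_mono power_mono) auto
    also have "\<dots> \<le> (norm f)\<^sup>2"
      by (rule sum_ell2_le[OF that])
    finally show ?thesis .
  qed
  then have "norm (Abs_ell2 (\<lambda>x. \<mu> x * ell2_fun f x)) \<le> norm f"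
    by (intro ell2_bounded_sums(2)) auto
  moreover have "(\<lambda>x. \<mu> x * ell2_fun f x) = ell2_fun (app (Mop \<mu>) f)"
    by (simp add: app_Mop \<mu> fun_eq_iff)
  ultimately show "norm (app (Mop \<mu>) f) \<le> 1 * norm f"
    by (simp add: ell2_fun_inverse)
qed simp

lemma adj_Mop:
  assumes \<mu>: "\<And>x. cmod (\<mu> x) \<le> 1"
  shows "adj (Mop \<mu>) = Mop (\<lambda>x. cnj (\<mu> x))"
  by (rule adj_eqI) (simp add: cinner_def app_Mop \<mu> mult_ac)

section \<open>Fourier coefficients and traciality\<close>

context group
begin

lemma inv_mult_cancel: "g \<in> carrier G \<Longrightarrow> x \<in> carrier G \<Longrightarrow> inv g \<otimes> (g \<otimes> x) = x"
    and mult_inv_cancel: "g \<in> carrier G \<Longrightarrow> x \<in> carrier G \<Longrightarrow> g \<otimes> (inv g \<otimes> x) = x"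
    and mult_mult_inv_cancel: "g \<in> carrier G \<Longrightarrow> x \<in> carrier G \<Longrightarrow> (x \<otimes> g) \<otimes> inv g = x"
    and mult_inv_mult_cancel: "g \<in> carrier G \<Longrightarrow> x \<in> carrier G \<Longrightarrow> (x \<otimes> inv g) \<otimes> g = x"
  by (simp_all add: m_assoc[symmetric]) (simp_all add: m_assoc)

text \<open>The commutant of the right translations is taken on the whole Hilbert space so that the
  ambient 1 belongs to it. The trace vector is supported on the carrier, so what acts beyond the
  carrier is invisible to the norms.\<close>

definition vN :: "'a cop set" where
  "vN = {x. \<forall>g\<in>carrier G. x * lam (opp G) g = lam (opp G) g * x}"

text \<open>Fourier coefficients: for x in \<open>vN\<close> the vector
  \<open>app x (delta \<one>)\<close> determines x on functions supported on the carrier, by right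
  translation.\<close>

definition hat :: "'a cop \<Rightarrow> 'a \<Rightarrow> complex" where
  "hat x g = ell2_fun (app x (delta \<one>)) g"

lemma hat_add: "hat (x + y) g = hat x g + hat y g"
  and hat_diff: "hat (x - y) g = hat x g - hat y g"
  and hat_cS: "hat (cS c * x) g = c * hat x g"
  and hat_zero [simp]: "hat 0 g = 0"
  by (simp_all add: hat_def app_add app_diff app_mult app_cS ell2_fun_simps)

lemma hat_sum: "hat (\<Sum>i\<in>I. f i) g = (\<Sum>i\<in>I. hat (f i) g)"
  by (simp add: hat_def app_sum ell2_fun_sum)

lemma app_lam_delta:
  assumes "g \<in> carrier G" "h \<in> carrier G"
  shows "app (lam G g) (delta h) = delta (g \<otimes> h)"
proof (rule ell2_eqI)
  fix x
  have "x \<in> carrier G \<Longrightarrow> inv g \<otimes> x = h \<longleftrightarrow> x = g \<otimes> h"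
    using assms by (metis inv_mult_cancel mult_inv_cancel)
  then show "ell2_fun (app (lam G g) (delta h)) x = ell2_fun (delta (g \<otimes> h)) x"
    using assms by (auto simp: app_lam[OF is_group] ell2_fun_delta)
qed

lemma app_ror_delta:
  assumes "g \<in> carrier G" "h \<in> carrier G"
  shows "app (lam (opp G) g) (delta h) = delta (h \<otimes> g)"
proof (rule ell2_eqI)
  fix x
  have "x \<in> carrier G \<Longrightarrow> x \<otimes> inv g = h \<longleftrightarrow> x = h \<otimes> g"
    using assms by (metis mult_mult_inv_cancel mult_inv_mult_cancel)
  then show "ell2_fun (app (lam (opp G) g) (delta h)) x = ell2_fun (delta (h \<otimes> g)) x"
    using assms by (auto simp: app_lam_opp[OF is_group] ell2_fun_delta)
qed

lemma lam_mult: "g \<in> carrier G \<Longrightarrow> h \<in> carrier G \<Longrightarrow> lam G g * lam G h = lam G (g \<otimes> h)"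
  by (rule cop_eqI, rule ell2_eqI) (simp add: app_mult app_lam[OF is_group] inv_mult_group m_assoc)

lemma lam_ror_commute:
  "g \<in> carrier G \<Longrightarrow> h \<in> carrier G \<Longrightarrow> lam G g * lam (opp G) h = lam (opp G) h * lam G g"
  by (rule cop_eqI, rule ell2_eqI) (simp add: app_mult app_lam[OF is_group] app_lam_opp[OF is_group] m_assoc)

lemma lam_N: "g \<in> carrier G \<Longrightarrow> lam G g \<in> vN"
  by (simp add: vN_def lam_ror_commute)

lemma infsum_carrier:
  assumes "\<And>x. x \<notin> carrier G \<Longrightarrow> f x = (0::complex)"
  shows "infsum f UNIV = infsum f (carrier G)"
  by (rule infsum_cong_neutral) (use assms in auto)

lemma adj_lam:
  assumes g: "g \<in> carrier G"
  shows "adj (lam G g) = lam G (inv g)"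
proof (rule adj_eqI)
  fix f h
  have "cinner f (app (lam G g) h) = (\<Sum>\<^sub>\<infinity>x\<in>carrier G. cnj (ell2_fun f x) * ell2_fun h (inv g \<otimes> x))"
    unfolding cinner_def
    by (subst infsum_carrier) (auto simp: app_lam[OF is_group g] intro!: infsum_cong)
  moreover have "(\<Sum>\<^sub>\<infinity>x\<in>carrier G. cnj (ell2_fun f x) * ell2_fun h (inv g \<otimes> x))
      = (\<Sum>\<^sub>\<infinity>x\<in>carrier G. cnj (ell2_fun f (g \<otimes> x)) * ell2_fun h x)"
  proof (rule infsum_reindex_bij_witness[of _ "\<lambda>x. g \<otimes> x" "\<lambda>x. inv g \<otimes> x"])
  qed (use g in \<open>auto simp: inv_mult_cancel mult_inv_cancel\<close>)
  moreover have "cinner (app (lam G (inv g)) f) h = (\<Sum>\<^sub>\<infinity>x\<in>carrier G. cnj (ell2_fun f (g \<otimes> x)) * ell2_fun h x)"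
    unfolding cinner_def using g
    by (subst infsum_carrier) (auto simp: app_lam[OF is_group] intro!: infsum_cong)
  ultimately show "cinner f (app (lam G g) h) = cinner (app (lam G (inv g)) f) h"
    by simp
qed

lemma adj_ror:
  assumes g: "g \<in> carrier G"
  shows "adj (lam (opp G) g) = lam (opp G) (inv g)"
  using group.adj_lam[OF group_opp[OF is_group], of g] g by (simp add: inv_opp[OF is_group])

lemma hat_outside:
  assumes "x \<in> vN" "g \<notin> carrier G"
  shows "hat x g = 0"
proof -
  have "app x (delta \<one>) = app x (app (lam (opp G) \<one>) (delta \<one>))"
    by (simp add: app_ror_delta)
  also have "\<dots> = app (lam (opp G) \<one>) (app x (delta \<one>))"
    using assms(1) by (simp add: vN_def app_mult[symmetric])
  finally show ?thesis
    using assms(2) app_lam_opp[OF is_group one_closed, of "app x (delta \<one>)" g] by (simp add: hat_def)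
qed

lemma app_delta:
  assumes "x \<in> vN" "h \<in> carrier G"
  shows "app x (delta h) = app (lam (opp G) h) (app x (delta \<one>))"
proof -
  have "app x (delta h) = app x (app (lam (opp G) h) (delta \<one>))"
    using assms by (simp add: app_ror_delta)
  then show ?thesis
    using assms by (simp add: vN_def app_mult[symmetric])
qed

lemma adj_vN: "x \<in> vN \<Longrightarrow> adj x \<in> vN"
  unfolding vN_def
proof (intro CollectI ballI)
  fix g assume x: "x \<in> {x. \<forall>g\<in>carrier G. x * lam (opp G) g = lam (opp G) g * x}" and g: "g \<in> carrier G"
  then have "adj (x * lam (opp G) (inv g)) = adj (lam (opp G) (inv g) * x)"
    by simp
  then show "adj x * lam (opp G) g = lam (opp G) g * adj x"
    using g by (simp add: adj_ror)
qed

lemma hat_adj: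
  assumes x: "x \<in> vN" and g: "g \<in> carrier G"
  shows "hat (adj x) g = cnj (hat x (inv g))"
proof -
  have "hat (adj x) g = cnj (cinner (app (adj x) (delta \<one>)) (delta g))"
    by (simp add: hat_def cinner_delta_left[symmetric] cinner_commute[of "delta g"])
  also have "cinner (app (adj x) (delta \<one>)) (delta g) = cinner (delta \<one>) (app x (delta g))"
    by (simp add: cinner_app_right)
  also have "\<dots> = ell2_fun (app (lam (opp G) g) (app x (delta \<one>))) \<one>"
    by (simp add: app_delta[OF x g] cinner_delta_left)
  also have "\<dots> = hat x (inv g)"
    using g by (simp add: app_lam_opp[OF is_group] hat_def)
  finally show ?thesis .
qed

text \<open>The convolution formula at the identity. Substituting the inverse of g exchanges x and
  y, which yields traciality.\<close>

lemma tr_mult: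
  assumes x: "x \<in> vN" and y: "y \<in> vN"
  shows "tr \<one> (x * y) = (\<Sum>\<^sub>\<infinity>g\<in>carrier G. hat x (inv g) * hat y g)"
proof -
  have "tr \<one> (x * y) = cinner (app (adj x) (delta \<one>)) (app y (delta \<one>))"
    by (simp add: tr_def app_mult cinner_app_right)
  also have "\<dots> = (\<Sum>\<^sub>\<infinity>g. cnj (hat (adj x) g) * hat y g)"
    by (simp add: cinner_def hat_def)
  also have "\<dots> = (\<Sum>\<^sub>\<infinity>g\<in>carrier G. cnj (hat (adj x) g) * hat y g)"
    using y by (intro infsum_carrier) (simp add: hat_outside)
  also have "\<dots> = (\<Sum>\<^sub>\<infinity>g\<in>carrier G. hat x (inv g) * hat y g)"
    using x by (intro infsum_cong) (simp add: hat_adj)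
  finally show ?thesis .
qed

lemma tr_commute:
  assumes x: "x \<in> vN" and y: "y \<in> vN"
  shows "tr \<one> (x * y) = tr \<one> (y * x)"
  unfolding tr_mult[OF x y] tr_mult[OF y x]
  by (rule infsum_reindex_bij_witness[of _ "\<lambda>g. inv g" "\<lambda>g. inv g"]) (auto simp: mult.commute)

lemma closed_commutant: "closed {x :: 'a cop. x * y = y * x}"
  by (intro closed_Collect_eq continuous_intros)

lemma tracial_vN: "tracial vN \<one>"
proof
  have "vN = (\<Inter>g\<in>carrier G. {x. x * lam (opp G) g = lam (opp G) g * x})"
    by (auto simp: vN_def)
  then show "closed vN"
    by (auto intro!: closed_INT closed_commutant)
  show "1 \<in> vN"
    by (simp add: vN_def)
  fix x y c
  assume x: "x \<in> vN"
  show "cS c * x \<in> vN"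
    using x by (simp add: vN_def cS_left_commute mult.assoc)
  show "adj x \<in> vN"
    by (rule adj_vN[OF x])
  assume y: "y \<in> vN"
  show "x + y \<in> vN"
    using x y by (simp add: vN_def algebra_simps)
  show "x * y \<in> vN"
    using x y by (simp add: vN_def mult.assoc) (simp add: mult.assoc[symmetric])
  show "tr \<one> (x * y) = tr \<one> (y * x)"
    by (rule tr_commute[OF x y])
qed

end

sublocale group \<subseteq> vN: tracial vN \<one>
  by (rule tracial_vN)

section \<open>The group ring and its multipliers\<close>

context group
begin

definition CW :: "'a cop set" where
  "CW = {\<Sum>g\<in>F. cS (f g) * lam G g | F f. finite F \<and> F \<subseteq> carrier G}"

definition supp :: "'a cop \<Rightarrow> 'a set" where
  "supp x = {g. hat x g \<noteq> 0}"

text \<open>Defined through Fourier coefficients, hence independent of how a sum is written; it is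
  used on \<open>CW\<close>, where the support is finite.\<close>

definition Tm :: "('a \<Rightarrow> complex) \<Rightarrow> 'a cop \<Rightarrow> 'a cop" where
  "Tm \<mu> x = (\<Sum>g\<in>supp x. cS (\<mu> g * hat x g) * lam G g)"

lemma CW_I: "finite F \<Longrightarrow> F \<subseteq> carrier G \<Longrightarrow> (\<Sum>g\<in>F. cS (f g) * lam G g) \<in> CW"
  unfolding CW_def by blast

lemma hat_lam: "g \<in> carrier G \<Longrightarrow> hat (lam G g) h = (if h = g then 1 else 0)"
  by (simp add: hat_def app_lam_delta ell2_fun_delta)

lemma hat_CW:
  assumes "finite F" "F \<subseteq> carrier G"
  shows "hat (\<Sum>g\<in>F. cS (f g) * lam G g) h = (if h \<in> F then f h else 0)"
proof -
  have "hat (\<Sum>g\<in>F. cS (f g) * lam G g) h = (\<Sum>g\<in>F. if h = g then f g else 0)"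
    unfolding hat_sum hat_cS using assms by (intro sum.cong) (auto simp: hat_lam)
  then show ?thesis
    using assms by simp
qed

lemma CW_expand:
  assumes x: "x \<in> CW" and F: "finite F" "supp x \<subseteq> F" "F \<subseteq> carrier G"
  shows "x = (\<Sum>g\<in>F. cS (hat x g) * lam G g)" and "Tm \<mu> x = (\<Sum>g\<in>F. cS (\<mu> g * hat x g) * lam G g)"
proof -
  show "Tm \<mu> x = (\<Sum>g\<in>F. cS (\<mu> g * hat x g) * lam G g)"
    unfolding Tm_def using F by (intro sum.mono_neutral_left) (auto simp: supp_def)
  obtain F' f where x_eq: "x = (\<Sum>g\<in>F'. cS (f g) * lam G g)" and F': "finite F'" "F' \<subseteq> carrier G"
    using x unfolding CW_def by blast
  have h: "hat x g = (if g \<in> F' then f g else 0)" for g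
    unfolding x_eq by (rule hat_CW[OF F'])
  have "x = (\<Sum>g\<in>F'. cS (hat x g) * lam G g)"
    by (subst x_eq, rule sum.cong) (simp_all add: h)
  also have "\<dots> = (\<Sum>g\<in>F' \<union> F. cS (hat x g) * lam G g)"
    using F F' by (intro sum.mono_neutral_left) (auto simp: h)
  also have "\<dots> = (\<Sum>g\<in>F. cS (hat x g) * lam G g)"
  proof (rule sum.mono_neutral_right)
    have "hat x g = 0" if "g \<notin> F" for g
      using F(2) that by (auto simp: supp_def)
    then show "\<forall>g\<in>F' \<union> F - F. cS (hat x g) * lam G g = 0"
      by simp
  qed (use F F' in auto)
  finally show "x = (\<Sum>g\<in>F. cS (hat x g) * lam G g)" .
qed

lemma supp_CW:
  assumes "x \<in> CW"
  shows "finite (supp x)" "supp x \<subseteq> carrier G"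
proof -
  obtain F f where x: "x = (\<Sum>g\<in>F. cS (f g) * lam G g)" and F: "finite F" "F \<subseteq> carrier G"
    using assms unfolding CW_def by blast
  have "supp x \<subseteq> F"
    unfolding supp_def x using F by (auto simp: hat_CW)
  then show "finite (supp x)" "supp x \<subseteq> carrier G"
    using F finite_subset by auto
qed

lemma CW_vN: "x \<in> CW \<Longrightarrow> x \<in> vN"
  unfolding CW_def by (auto intro!: vN.sum_N vN.cS_N lam_N)

lemma CW_add: "x \<in> CW \<Longrightarrow> y \<in> CW \<Longrightarrow> x + y \<in> CW"
  and Tm_add: "x \<in> CW \<Longrightarrow> y \<in> CW \<Longrightarrow> Tm \<mu> (x + y) = Tm \<mu> x + Tm \<mu> y"
proof -
  assume xy: "x \<in> CW" "y \<in> CW"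
  let ?F = "supp x \<union> supp y"
  have F: "finite ?F" "?F \<subseteq> carrier G"
    using supp_CW[OF xy(1)] supp_CW[OF xy(2)] by auto
  have "x + y = (\<Sum>g\<in>?F. cS (hat x g) * lam G g) + (\<Sum>g\<in>?F. cS (hat y g) * lam G g)"
    using CW_expand(1)[OF xy(1) F(1) _ F(2)] CW_expand(1)[OF xy(2) F(1) _ F(2)] by auto
  also have "\<dots> = (\<Sum>g\<in>?F. cS (hat x g + hat y g) * lam G g)"
    by (simp add: sum.distrib[symmetric] cS_add distrib_right)
  finally show mem: "x + y \<in> CW"
    using CW_I[OF F] by simp
  have "supp (x + y) \<subseteq> ?F"
    by (auto simp: supp_def hat_add)
  then have "Tm \<mu> (x + y) = (\<Sum>g\<in>?F. cS (\<mu> g * hat (x + y) g) * lam G g)"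
    by (rule CW_expand(2)[OF mem F(1) _ F(2)])
  also have "\<dots> = (\<Sum>g\<in>?F. cS (\<mu> g * hat x g) * lam G g) + (\<Sum>g\<in>?F. cS (\<mu> g * hat y g) * lam G g)"
    by (simp add: hat_add sum.distrib[symmetric] cS_add distrib_right distrib_left)
  also have "\<dots> = Tm \<mu> x + Tm \<mu> y"
    using CW_expand(2)[OF xy(1) F(1) _ F(2)] CW_expand(2)[OF xy(2) F(1) _ F(2)] by auto
  finally show "Tm \<mu> (x + y) = Tm \<mu> x + Tm \<mu> y" .
qed

lemma CW_cS: "x \<in> CW \<Longrightarrow> cS c * x \<in> CW"
  and Tm_cS: "x \<in> CW \<Longrightarrow> Tm \<mu> (cS c * x) = cS c * Tm \<mu> x"
proof -
  assume x: "x \<in> CW"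
  note F = supp_CW[OF x]
  have "cS c * x = cS c * (\<Sum>g\<in>supp x. cS (hat x g) * lam G g)"
    using CW_expand(1)[OF x F(1) _ F(2)] by simp
  also have "\<dots> = (\<Sum>g\<in>supp x. cS (c * hat x g) * lam G g)"
    by (simp add: sum_distrib_left cS_mult mult.assoc)
  finally show mem: "cS c * x \<in> CW"
    using CW_I[OF F] by simp
  have "supp (cS c * x) \<subseteq> supp x"
    by (auto simp: supp_def hat_cS)
  then have "Tm \<mu> (cS c * x) = (\<Sum>g\<in>supp x. cS (\<mu> g * hat (cS c * x) g) * lam G g)"
    by (rule CW_expand(2)[OF mem F(1) _ F(2)])
  also have "\<dots> = cS c * Tm \<mu> x"
    by (simp only: Tm_def hat_cS sum_distrib_left mult.left_commute[of _ c] cS_mult[of c] mult.assoc)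
  finally show "Tm \<mu> (cS c * x) = cS c * Tm \<mu> x" .
qed

lemma lam_CW: "g \<in> carrier G \<Longrightarrow> lam G g \<in> CW"
  using CW_I[of "{g}" "\<lambda>_. 1"] by simp

lemma zero_CW: "0 \<in> CW"
  using CW_I[of "{}"] by simp

lemma Tm_zero [simp]: "Tm \<mu> 0 = 0"
  by (simp add: Tm_def supp_def)

lemma CW_sum: "(\<And>i. i \<in> I \<Longrightarrow> x i \<in> CW) \<Longrightarrow> (\<Sum>i\<in>I. x i) \<in> CW"
  by (induction I rule: infinite_finite_induct) (auto intro: zero_CW CW_add)

lemma Tm_sum: "(\<And>i. i \<in> I \<Longrightarrow> x i \<in> CW) \<Longrightarrow> Tm \<mu> (\<Sum>i\<in>I. x i) = (\<Sum>i\<in>I. Tm \<mu> (x i))"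
  by (induction I rule: infinite_finite_induct) (auto simp: Tm_add CW_sum)

lemma Tm_lam: "g \<in> carrier G \<Longrightarrow> Tm \<mu> (lam G g) = cS (\<mu> g) * lam G g"
  by (simp add: Tm_def supp_def hat_lam)

lemma Tm_sum_lam:
  assumes "\<And>i. i \<in> I \<Longrightarrow> \<gamma> i \<in> carrier G"
  shows "Tm \<mu> (\<Sum>i\<in>I. cS (c i) * lam G (\<gamma> i)) = (\<Sum>i\<in>I. cS (\<mu> (\<gamma> i) * c i) * lam G (\<gamma> i))"
proof -
  have "Tm \<mu> (\<Sum>i\<in>I. cS (c i) * lam G (\<gamma> i)) = (\<Sum>i\<in>I. Tm \<mu> (cS (c i) * lam G (\<gamma> i)))"
    using assms by (intro Tm_sum CW_cS lam_CW) auto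
  also have "\<dots> = (\<Sum>i\<in>I. cS (\<mu> (\<gamma> i) * c i) * lam G (\<gamma> i))"
    using assms by (intro sum.cong) (simp_all add: Tm_cS lam_CW Tm_lam cS_mult mult.commute[of "\<mu> _"] mult.assoc)
  finally show ?thesis .
qed

lemma Tm_CW: "x \<in> CW \<Longrightarrow> Tm \<mu> x \<in> CW"
  unfolding Tm_def by (intro CW_I supp_CW)

lemma hat_Tm: "x \<in> CW \<Longrightarrow> hat (Tm \<mu> x) g = \<mu> g * hat x g"
  unfolding Tm_def by (subst hat_CW[OF supp_CW]) (auto simp: supp_def)

lemma CW_mult: "x \<in> CW \<Longrightarrow> y \<in> CW \<Longrightarrow> x * y \<in> CW"
proof -
  assume xy: "x \<in> CW" "y \<in> CW"
  note F = supp_CW[OF xy(1)] supp_CW[OF xy(2)]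
  have lam_lam: "(cS a * lam G g) * (cS b * lam G h) \<in> CW" if "g \<in> carrier G" "h \<in> carrier G" for a b g h
    unfolding cS_mult_mult using that by (simp add: lam_mult CW_cS lam_CW)
  have "(\<Sum>g\<in>supp x. cS (hat x g) * lam G g) * (\<Sum>g\<in>supp y. cS (hat y g) * lam G g) \<in> CW"
    unfolding sum_product using F by (intro CW_sum lam_lam) auto
  then show ?thesis
    using CW_expand(1)[OF xy(1) F(1) order_refl F(2)] CW_expand(1)[OF xy(2) F(3) order_refl F(4)] by simp
qed

lemma CW_adj: "x \<in> CW \<Longrightarrow> adj x \<in> CW"
proof -
  assume x: "x \<in> CW"
  note F = supp_CW[OF x]
  have "adj (\<Sum>g\<in>supp x. cS (hat x g) * lam G g) \<in> CW"
    unfolding adj_sum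
  proof (rule CW_sum)
    fix g assume "g \<in> supp x"
    then have "adj (cS (hat x g) * lam G g) = cS (cnj (hat x g)) * lam G (inv g)"
      using F by (simp add: subset_iff adj_lam cS_commute[of "lam G (inv g)"])
    then show "adj (cS (hat x g) * lam G g) \<in> CW"
      using F \<open>g \<in> supp x\<close> by (auto intro!: CW_cS lam_CW)
  qed
  then show ?thesis
    using CW_expand(1)[OF x F(1) order_refl F(2)] by simp
qed

text \<open>Truncation of the Fourier series of y. It converges in the 2-norm without control of the
  operator norm, which is why Kaplansky's theorem has to follow.\<close>

lemma CW_dense:
  assumes y: "y \<in> vN" and r: "0 < r"
  shows "\<exists>c\<in>CW. nrm \<one> 2 (c - y) < r"
proof -
  let ?f = "app y (delta \<one>)"
  obtain F where F: "finite F" "norm (?f - (\<Sum>a\<in>F. scaleC_ell2 (ell2_fun ?f a) (delta a))) < r"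
    by (rule ell2_finite_approx[OF r])
  let ?F = "F \<inter> carrier G"
  have F': "finite ?F" "?F \<subseteq> carrier G"
    using F by auto
  define c where "c = (\<Sum>g\<in>?F. cS (hat y g) * lam G g)"
  have "app c (delta \<one>) = (\<Sum>a\<in>F. scaleC_ell2 (ell2_fun ?f a) (delta a))"
  proof (rule ell2_eqI)
    fix a
    have "ell2_fun (app c (delta \<one>)) a = hat c a"
      by (simp add: hat_def)
    also have "\<dots> = (if a \<in> F then hat y a else 0)"
      unfolding c_def hat_CW[OF F'] using hat_outside[OF y, of a] by auto
    also have "\<dots> = ell2_fun (\<Sum>a\<in>F. scaleC_ell2 (ell2_fun ?f a) (delta a)) a"
      using F(1) by (simp add: ell2_fun_simps hat_def if_distrib[of "\<lambda>t. _ * t"] sum.delta cong: if_cong)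
    finally show "ell2_fun (app c (delta \<one>)) a = ell2_fun (\<Sum>a\<in>F. scaleC_ell2 (ell2_fun ?f a) (delta a)) a" .
  qed
  then have "nrm \<one> 2 (c - y) < r"
    using F(2) by (simp add: vN.nrm_2 app_diff norm_minus_commute)
  moreover have "c \<in> CW"
    unfolding c_def by (rule CW_I[OF F'])
  ultimately show ?thesis
    by blast
qed

end

sublocale group \<subseteq> CW: dense_subalgebra vN \<one> CW
  by unfold_locales (auto intro: CW_vN CW_add CW_mult CW_cS CW_adj CW_dense)

context group
begin

subsection \<open>Multipliers as bilinear forms\<close>

text \<open>\<open>Tm \<mu> x\<close> and \<open>Mop \<mu> * x\<close> agree on
  \<open>delta \<one>\<close>, although \<open>Mop \<mu>\<close> in general lies outside the
  algebra. The multiplier becomes a form with a fixed bounded middle factor, defined for all x of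
  \<open>vN\<close>.\<close>

lemma tr_Tm:
  assumes x: "x \<in> CW" and \<mu>: "\<And>g. cmod (\<mu> g) \<le> 1"
  shows "tr \<one> (y * Tm \<mu> x) = tr \<one> (y * Mop \<mu> * x)"
proof -
  have "app (Tm \<mu> x) (delta \<one>) = app (Mop \<mu>) (app x (delta \<one>))"
    by (rule ell2_eqI) (use hat_Tm[OF x, of \<mu>] in \<open>simp add: hat_def app_Mop \<mu>\<close>)
  then show ?thesis
    by (simp add: tr_def app_mult)
qed

definition form_bounded :: "('a \<Rightarrow> complex) \<Rightarrow> real \<Rightarrow> real \<Rightarrow> real \<Rightarrow> bool" where
  "form_bounded \<mu> C p q \<longleftrightarrow>
     (\<forall>x\<in>vN. \<forall>y\<in>vN. cmod (tr \<one> (y * Mop \<mu> * x)) \<le> C * nrm \<one> p x * nrm \<one> q y)"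

text \<open>Restricting the support to a subgroup A lets multipliers of the subgroup be treated
  inside the algebra of the whole group, with the same norms.\<close>

definition Tm_bounded :: "'a set \<Rightarrow> ('a \<Rightarrow> complex) \<Rightarrow> real \<Rightarrow> real \<Rightarrow> bool" where
  "Tm_bounded A \<mu> C p \<longleftrightarrow> (\<forall>x\<in>CW. supp x \<subseteq> A \<longrightarrow> nrm \<one> p (Tm \<mu> x) \<le> C * nrm \<one> p x)"

lemma Tm_bounded_of_form:
  assumes \<mu>: "\<And>g. cmod (\<mu> g) \<le> 1" and "form_bounded \<mu> C p q" "0 \<le> C"
    and pq: "1 < p" "1 < q" "1 / p + 1 / q = 1"
  shows "Tm_bounded A \<mu> C p"
  unfolding Tm_bounded_def
proof (intro ballI impI)
  fix x assume x: "x \<in> CW"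
  show "nrm \<one> p (Tm \<mu> x) \<le> C * nrm \<one> p x"
  proof (rule vN.nrm_le_of_dual[OF _ pq])
    show "Tm \<mu> x \<in> vN"
      using x by (intro CW_vN Tm_CW)
    then show "cmod (tr \<one> (Tm \<mu> x * y)) \<le> C * nrm \<one> p x * nrm \<one> q y" if y: "y \<in> vN" for y
      using assms(2) x y CW_vN by (simp add: tr_commute[of "Tm \<mu> x" y] tr_Tm \<mu> form_bounded_def)
    show "0 \<le> C * nrm \<one> p x"
      using assms(3) by (simp add: nrm_nonneg)
  qed
qed

text \<open>The deformations used in interpolation leave the group ring, so the bound must hold on
  all of \<open>vN\<close>. The form is continuous in x for the 2-norm and the right side for the
  p-norm; Kaplansky approximation gives both convergences.\<close>

lemma form_bounded_of_Tm:
  assumes \<mu>: "\<And>g. cmod (\<mu> g) \<le> 1" and bdd: "Tm_bounded UNIV \<mu> C p" and C: "0 \<le> C"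
    and pq: "1 < p" "1 < q" "1 / p + 1 / q = 1"
  shows "form_bounded \<mu> C p q"
  unfolding form_bounded_def
proof (intro ballI)
  fix x y assume x: "x \<in> vN" and y: "y \<in> vN"
  obtain c where "\<forall>n. c n \<in> CW" "\<forall>p>1. (\<lambda>n. nrm \<one> p (c n - x)) \<longlonglongrightarrow> 0"
    using CW.Kaplansky_Lp[OF x] by (elim exE conjE)
  then have c: "c n \<in> CW" "1 < p \<Longrightarrow> (\<lambda>n. nrm \<one> p (c n - x)) \<longlonglongrightarrow> 0" for n p
    by simp_all
  have cN: "c n \<in> vN" for n
    by (rule CW_vN[OF c(1)])
  have le: "cmod (tr \<one> (y * Mop \<mu> * c n)) \<le> C * nrm \<one> p (c n) * nrm \<one> q y" for n
  proof -
    have "cmod (tr \<one> (y * Mop \<mu> * c n)) = cmod (tr \<one> (1 * Tm \<mu> (c n) * y))"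
      using CW_vN[OF Tm_CW[OF c(1)]] y by (simp add: tr_Tm[symmetric] c \<mu> tr_commute[of y])
    also have "\<dots> \<le> norm (1 :: 'a cop) * nrm \<one> p (Tm \<mu> (c n)) * nrm \<one> q y"
      using CW_vN[OF Tm_CW[OF c(1)]] y pq by (intro vN.Hoelder vN.one_N)
    also have "\<dots> \<le> norm (1 :: 'a cop) * (C * nrm \<one> p (c n)) * nrm \<one> q y"
      using bdd c(1) by (intro mult_right_mono mult_left_mono) (auto simp: nrm_nonneg Tm_bounded_def)
    finally show ?thesis
      by simp
  qed
  have lim1: "(\<lambda>n. nrm \<one> r (c n)) \<longlonglongrightarrow> nrm \<one> r x" if "1 < r" for r
  proof (rule LIMSEQ_I)
    fix e :: real assume "0 < e"
    then have "\<forall>\<^sub>F n in sequentially. nrm \<one> r (c n - x) < e"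
      using order_tendstoD(2)[OF c(2)[OF that], of e] by simp
    then have "\<forall>\<^sub>F n in sequentially. norm (nrm \<one> r (c n) - nrm \<one> r x) < e"
    proof eventually_elim
      case (elim n)
      then show ?case
        using vN.nrm_diff_abs[OF cN[of n] x that] by simp
    qed
    then show "\<exists>no. \<forall>n\<ge>no. norm (nrm \<one> r (c n) - nrm \<one> r x) < e"
      by (simp add: eventually_sequentially)
  qed
  have "(\<lambda>n. app (c n - x) (delta \<one>)) \<longlonglongrightarrow> 0"
    using c(2)[of 2] by (subst tendsto_norm_zero_iff[symmetric]) (simp add: vN.nrm_2)
  then have "(\<lambda>n. app (c n) (delta \<one>)) \<longlonglongrightarrow> app x (delta \<one>)"
    by (simp add: app_diff LIM_zero_iff)
  then have "(\<lambda>n. cinner (app (adj (y * Mop \<mu>)) (delta \<one>)) (app (c n) (delta \<one>)))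
      \<longlonglongrightarrow> cinner (app (adj (y * Mop \<mu>)) (delta \<one>)) (app x (delta \<one>))"
    by (rule bounded_linear.tendsto[OF bounded_linear_cinner_right])
  then have lim2: "(\<lambda>n. cmod (tr \<one> (y * Mop \<mu> * c n))) \<longlonglongrightarrow> cmod (tr \<one> (y * Mop \<mu> * x))"
    unfolding tr_def app_mult[of "y * Mop \<mu>"] cinner_app_right by (rule tendsto_norm)
  have lim3: "(\<lambda>n. C * nrm \<one> p (c n) * nrm \<one> q y) \<longlonglongrightarrow> C * nrm \<one> p x * nrm \<one> q y"
    by (intro tendsto_intros lim1 pq)
  show "cmod (tr \<one> (y * Mop \<mu> * x)) \<le> C * nrm \<one> p x * nrm \<one> q y"
    by (rule LIMSEQ_le[OF lim2 lim3]) (use le in blast)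
qed

text \<open>Taking adjoints exchanges x and y. As \<mu> is real, \<open>Mop \<mu>\<close> is
  self-adjoint, so the form keeps its shape while p and q change places.\<close>

lemma form_bounded_dual:
  assumes \<mu>: "\<And>g. cmod (\<mu> g) \<le> 1" "\<And>g. cnj (\<mu> g) = \<mu> g" and b: "form_bounded \<mu> C p q" and pq: "0 < p" "0 < q"
  shows "form_bounded \<mu> C q p"
  unfolding form_bounded_def
proof (intro ballI)
  fix x y assume x: "x \<in> vN" and y: "y \<in> vN"
  have "cmod (tr \<one> (y * Mop \<mu> * x)) = cmod (tr \<one> (adj (y * Mop \<mu> * x)))"
    by (simp only: tr_adj complex_mod_cnj)
  also have "adj (y * Mop \<mu> * x) = adj x * Mop \<mu> * adj y"
    using \<mu> by (simp add: adj_Mop mult.assoc)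
  also have "cmod (tr \<one> (adj x * Mop \<mu> * adj y)) \<le> C * nrm \<one> p (adj y) * nrm \<one> q (adj x)"
    using b x y adj_vN by (simp add: form_bounded_def)
  finally show "cmod (tr \<one> (y * Mop \<mu> * x)) \<le> C * nrm \<one> q x * nrm \<one> p y"
    using x y pq by (simp add: vN.nrm_adj mult_ac)
qed

lemma Tm_bounded_2:
  assumes \<mu>: "\<And>g. cmod (\<mu> g) \<le> 1"
  shows "Tm_bounded A \<mu> 1 2"
  unfolding Tm_bounded_def
proof (intro ballI impI)
  fix x assume x: "x \<in> CW"
  have "app (Tm \<mu> x) (delta \<one>) = app (Mop \<mu>) (app x (delta \<one>))"
    by (rule ell2_eqI) (use hat_Tm[OF x, of \<mu>] in \<open>simp add: hat_def app_Mop \<mu>\<close>)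
  also have "norm \<dots> \<le> norm (Mop \<mu>) * norm (app x (delta \<one>))"
    by (rule norm_app)
  also have "\<dots> \<le> 1 * norm (app x (delta \<one>))"
    using norm_Mop[OF \<mu>] by (intro mult_right_mono) auto
  finally show "nrm \<one> 2 (Tm \<mu> x) \<le> 1 * nrm \<one> 2 x"
    by (simp add: vN.nrm_2)
qed

lemma Tm_bounded_of_powers_of_2:
  assumes \<mu>: "\<And>g. cmod (\<mu> g) \<le> 1" "\<And>g. cnj (\<mu> g) = \<mu> g"
    and pow: "\<And>n. \<exists>C. Tm_bounded UNIV \<mu> C (2 ^ Suc n)" and p: "1 < p"
  shows "\<exists>C. Tm_bounded UNIV \<mu> C p"
proof -
  have big: "\<exists>C>0. form_bounded \<mu> C p q" if p: "2 \<le> p" and q: "1 < q" "1 / p + 1 / q = 1" for p q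
  proof -
    obtain n where n: "p < 2 ^ n"
      using real_arch_pow[of 2 p] by auto
    define P :: real where "P = 2 ^ Suc n"
    have P: "p < P"
      using n p by (simp add: P_def)
    obtain C0 where C0: "Tm_bounded UNIV \<mu> C0 P"
      using pow[of n] unfolding P_def by blast
    \<comment> \<open>The interpolation theorem takes one constant for both end points, and 1 serves
      the exponent 2.\<close>
    define C where "C = max 1 C0"
    have C: "1 \<le> C" "C0 \<le> C"
      by (simp_all add: C_def)
    have mono: "Tm_bounded UNIV \<mu> C r" if "Tm_bounded UNIV \<mu> c r" "c \<le> C" for c r
      unfolding Tm_bounded_def
    proof (intro ballI impI)
      fix x assume "x \<in> CW" "supp x \<subseteq> UNIV"
      then have "nrm \<one> r (Tm \<mu> x) \<le> c * nrm \<one> r x"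
        using that(1) by (simp add: Tm_bounded_def)
      also have "\<dots> \<le> C * nrm \<one> r x"
        by (rule mult_right_mono[OF that(2) nrm_nonneg])
      finally show "nrm \<one> r (Tm \<mu> x) \<le> C * nrm \<one> r x" .
    qed
    obtain Q where Q: "1 < Q" "1 / P + 1 / Q = 1"
      using vN.conj_exponent[of P] P p by auto
    have fP: "form_bounded \<mu> C P Q"
      using P p Q C by (intro form_bounded_of_Tm mono[OF C0] \<mu>) auto
    have f2: "form_bounded \<mu> C 2 2"
      using C by (intro form_bounded_of_Tm mono[OF Tm_bounded_2] \<mu>) auto
    \<comment> \<open>The solution of 1 / p = (1 - \<theta>) / 2 + \<theta> / P.\<close>
    define \<theta> where "\<theta> = (1 / 2 - 1 / p) / (1 / 2 - 1 / P)"
    have d: "0 < 1 / 2 - 1 / P"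
      using P p by (simp add: field_simps)
    have \<theta>1: "0 \<le> \<theta>"
      using d p unfolding \<theta>_def by (intro divide_nonneg_pos) (auto simp: field_simps)
    have "1 / 2 - 1 / p \<le> 1 / 2 - 1 / P"
      using P p by (simp add: frac_le)
    then have \<theta>2: "\<theta> \<le> 1"
      unfolding \<theta>_def by (simp only: divide_le_eq_1_pos[OF d])
    have "a / c * c = a" if "0 < c" for a c :: real
      using that by simp
    from this[OF d] have \<theta>_eq: "\<theta> * (1 / 2 - 1 / P) = 1 / 2 - 1 / p"
      unfolding \<theta>_def .
    have "(1 - \<theta>) / 2 + \<theta> / P = 1 / 2 - \<theta> * (1 / 2 - 1 / P)"
      by (simp add: algebra_simps diff_divide_distrib)
    then have \<theta>3: "1 / p = (1 - \<theta>) / 2 + \<theta> / P"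
      unfolding \<theta>_eq by simp
    have "form_bounded \<mu> C p q"
      unfolding form_bounded_def
    proof (intro ballI)
      fix x y assume N: "x \<in> vN" "y \<in> vN"
      show "cmod (tr \<one> (y * Mop \<mu> * x)) \<le> C * nrm \<one> p x * nrm \<one> q y"
      proof (rule vN.Riesz_Thorin[of "Mop \<mu>" C 2 2 P Q p q \<theta>])
        show "cmod (tr \<one> (y * Mop \<mu> * x)) \<le> C * nrm \<one> 2 x * nrm \<one> 2 y" if "x \<in> vN" "y \<in> vN" for x y
          using f2 that by (simp add: form_bounded_def)
        show "cmod (tr \<one> (y * Mop \<mu> * x)) \<le> C * nrm \<one> P x * nrm \<one> Q y" if "x \<in> vN" "y \<in> vN" for x y
          using fP that by (simp add: form_bounded_def)
      qed (use N P p q Q C \<theta>1 \<theta>2 \<theta>3 in simp_all)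
    qed
    then show ?thesis
      using C by (intro exI[of _ C]) auto
  qed
  obtain q where q: "1 < q" "1 / p + 1 / q = 1"
    by (rule vN.conj_exponent[OF p])
  have "\<exists>C. 0 < C \<and> form_bounded \<mu> C p q"
  proof (cases "2 \<le> p")
    case False
    then have "1 / 2 \<le> 1 / p"
      using p by (simp add: field_simps)
    then have "1 / q \<le> 1 / 2"
      using q by linarith
    then have "2 \<le> q"
      using q by (simp add: field_simps)
    then obtain C where C: "0 < C" "form_bounded \<mu> C q p"
      using big[of q p] p q by (auto simp: add.commute)
    have "form_bounded \<mu> C p q"
      by (rule form_bounded_dual[OF \<mu> C(2)]) (use p q in auto)
    then show ?thesis
      using C by (intro exI conjI)
  qed (use big q in auto)
  then obtain C where C: "0 < C" "form_bounded \<mu> C p q"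
    by (elim exE conjE)
  have "Tm_bounded UNIV \<mu> C p"
    using C p q by (intro Tm_bounded_of_form \<mu>) auto
  then show ?thesis
    by (rule exI)
qed

end

context group
begin

subsection \<open>Conditional expectations\<close>

lemma norm_indicator_le: "cmod (indicator A g) \<le> 1"
  by (simp add: indicator_def)

lemma app_Mop_indicator: "ell2_fun (app (Mop (indicator A)) f) x = indicator A x * ell2_fun f x"
  by (rule app_Mop[OF norm_indicator_le])

lemma adj_Mop_indicator: "adj (Mop (indicator A)) = Mop (indicator A)"
proof -
  have "(\<lambda>g. cnj (indicator A g)) = indicator A"
    by (auto simp: indicator_def)
  then show ?thesis
    by (simp add: adj_Mop[OF norm_indicator_le])
qed

text \<open>Commuting with the projection onto functions supported on H singles out a closed
  subalgebra that contains the translations by H; it stands for the algebra of H.\<close>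

definition vN_sub :: "'a set \<Rightarrow> 'a cop set" where
  "vN_sub H = {x \<in> vN. x * Mop (indicator H) = Mop (indicator H) * x}"

lemma tracial_vN_sub: "tracial (vN_sub H) \<one>"
proof
  let ?P = "Mop (indicator H)"
  note sa = adj_Mop_indicator
  have "vN_sub H = vN \<inter> {x. x * ?P = ?P * x}"
    by (auto simp: vN_sub_def)
  then show "closed (vN_sub H)"
    by (simp add: closed_Int vN.closed_N closed_commutant)
  show "1 \<in> vN_sub H"
    by (simp add: vN_sub_def vN.one_N)
  fix x y c
  assume x: "x \<in> vN_sub H"
  show "cS c * x \<in> vN_sub H"
    using x by (simp add: vN_sub_def vN.cS_N cS_left_commute mult.assoc)
  have "adj (x * ?P) = adj (?P * x)"
    using x by (simp add: vN_sub_def)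
  then show "adj x \<in> vN_sub H"
    using x by (simp add: vN_sub_def adj_vN sa)
  assume y: "y \<in> vN_sub H"
  show "x + y \<in> vN_sub H"
    using x y by (simp add: vN_sub_def vN.add_N algebra_simps)
  have "x * y * ?P = ?P * (x * y)"
  proof -
    have "x * y * ?P = x * (?P * y)"
      using y by (simp add: vN_sub_def mult.assoc)
    also have "\<dots> = ?P * x * y"
      using x by (simp add: vN_sub_def mult.assoc[symmetric])
    finally show ?thesis
      by (simp add: mult.assoc)
  qed
  then show "x * y \<in> vN_sub H"
    using x y by (simp add: vN_sub_def vN.mult_N)
  show "tr \<one> (x * y) = tr \<one> (y * x)"
    using x y by (simp add: vN_sub_def tr_commute)
qed

lemma lam_vN_sub:
  assumes H: "subgroup H G" and g: "g \<in> H"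
  shows "lam G g \<in> vN_sub H"
proof -
  interpret H: subgroup H G by fact
  have "lam G g * Mop (indicator H) = Mop (indicator H) * lam G g"
  proof (rule cop_eqI, rule ell2_eqI)
    fix f x
    have gG: "g \<in> carrier G"
      using g by (rule H.mem_carrier)
    have "inv g \<otimes> x \<in> H \<longleftrightarrow> x \<in> H" if x: "x \<in> carrier G"
    proof
      assume "inv g \<otimes> x \<in> H"
      with g have "g \<otimes> (inv g \<otimes> x) \<in> H"
        by (rule H.m_closed)
      then show "x \<in> H"
        by (simp only: mult_inv_cancel[OF gG x])
    next
      assume "x \<in> H"
      with H.m_inv_closed[OF g] show "inv g \<otimes> x \<in> H"
        by (rule H.m_closed)
    qed
    then show "ell2_fun (app (lam G g * Mop (indicator H)) f) x = ell2_fun (app (Mop (indicator H) * lam G g) f) x"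
      by (simp add: app_mult app_lam[OF is_group gG] app_Mop_indicator indicator_def)
  qed
  then show ?thesis
    using H.mem_carrier[OF g] by (simp add: vN_sub_def lam_N)
qed

text \<open>The truncated element lies in \<open>vN_sub H\<close>, so it is tested only against y
  there. For such y the truncation is invisible under the trace, because the projection commutes
  with y and fixes \<open>delta \<one>\<close>. Hoelder in the larger algebra then bounds the
  pairing by x itself.\<close>

lemma nrm_expectation:
  assumes H: "subgroup H G" and x: "x \<in> CW" and p: "1 < p"
  shows "nrm \<one> p (Tm (indicator H) x) \<le> nrm \<one> p x"
proof -
  interpret H: subgroup H G by fact
  interpret S: tracial "vN_sub H" \<one>
    by (rule tracial_vN_sub)
  obtain q where q: "1 < q" "1 / p + 1 / q = 1"
    by (rule vN.conj_exponent[OF p])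
  have "Tm (indicator H) x \<in> vN_sub H"
    unfolding Tm_def
  proof (rule S.sum_N)
    fix g assume g: "g \<in> supp x"
    show "cS (indicator H g * hat x g) * lam G g \<in> vN_sub H"
      by (cases "g \<in> H") (auto simp: S.zero_N intro!: S.cS_N lam_vN_sub[OF H])
  qed
  then show ?thesis
  proof (rule S.nrm_le_of_dual[OF _ p q nrm_nonneg])
    fix y assume y: "y \<in> vN_sub H"
    let ?P = "Mop (indicator H :: 'a \<Rightarrow> complex)"
    have yN: "y \<in> vN"
      using y by (simp add: vN_sub_def)
    have P\<delta>: "app ?P (delta \<one>) = delta \<one>"
      by (rule ell2_eqI) (simp add: app_Mop_indicator ell2_fun_delta)
    have "tr \<one> (Tm (indicator H) x * y) = tr \<one> (y * ?P * x)"
      using CW_vN[OF Tm_CW[OF x]] yN by (simp add: tr_commute[of _ y] tr_Tm[OF x norm_indicator_le])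
    also have "y * ?P * x = ?P * (y * x)"
      using y by (simp add: vN_sub_def mult.assoc[symmetric])
    also have "tr \<one> \<dots> = tr \<one> (y * x)"
      by (simp add: tr_def app_mult[of ?P] cinner_app_right adj_Mop_indicator P\<delta>)
    also have "\<dots> = tr \<one> (1 * x * y)"
      using yN CW_vN[OF x] by (simp add: tr_commute[of y])
    also have "cmod \<dots> \<le> norm (1 :: 'a cop) * nrm \<one> p x * nrm \<one> q y"
      using p q yN CW_vN[OF x] by (intro vN.Hoelder vN.one_N)
    finally show "cmod (tr \<one> (Tm (indicator H) x * y)) \<le> nrm \<one> p x * nrm \<one> q y"
      by simp
  qed
qed

section \<open>The Cotlar identity\<close>

text \<open>Hoelder by polarization: 4 u adj v is the sum over c = 1, -1, i, -i of c times the
  product of u + c v with its own adjoint, and each such product is measured by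
  \<open>nrm_mult_adj\<close>. If both 2 p-norms are at most s, the bound is (s + s)^2, whence the
  factor 4.\<close>

lemma nrm_mult_adj_le:
  assumes x: "x \<in> vN" "y \<in> vN" and p: "1 < p"
  shows "nrm \<one> p (x * adj y) \<le> 4 * (nrm \<one> (2 * p) x * nrm \<one> (2 * p) y)"
proof -
  define A B where "A = nrm \<one> (2 * p) x" and "B = nrm \<one> (2 * p) y"
  have AB: "0 \<le> A" "0 \<le> B"
    by (simp_all add: A_def B_def nrm_nonneg)
  have p2: "1 < 2 * p" "0 < p"
    using p by auto
  have sq: "nrm \<one> p ((u + cS c * v) * adj (u + cS c * v)) \<le> (a + b)\<^sup>2"
    if "u \<in> vN" "v \<in> vN" "cmod c = 1" "nrm \<one> (2 * p) u \<le> a" "nrm \<one> (2 * p) v \<le> b" for u v c a b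
  proof -
    have "nrm \<one> (2 * p) (u + cS c * v) \<le> nrm \<one> (2 * p) u + nrm \<one> (2 * p) (cS c * v)"
      using that p2 by (intro vN.nrm_triangle vN.cS_N)
    also have "\<dots> \<le> a + b"
      using vN.nrm_cS[OF that(2) p2(1), of c] that by simp
    finally have "(nrm \<one> (2 * p) (u + cS c * v))\<^sup>2 \<le> (a + b)\<^sup>2"
      by (intro power_mono nrm_nonneg)
    then show ?thesis
      using that p2 by (simp add: vN.nrm_mult_adj vN.add_N vN.cS_N del: adj_add)
  qed
  have pol: "nrm \<one> p (u * adj v) \<le> (a + b)\<^sup>2"
    if uv: "u \<in> vN" "v \<in> vN" "nrm \<one> (2 * p) u \<le> a" "nrm \<one> (2 * p) v \<le> b" for u v a b
  proof -
    define Q where "Q c = (u + cS c * v) * adj (u + cS c * v)" for c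
    have Q_eq: "Q c = u * adj u + cS (cnj c) * (u * adj v) + cS c * (v * adj u) + cS (c * cnj c) * (v * adj v)" for c
    proof -
      have "(u + cS c * v) * (adj u + adj v * cS (cnj c))
          = u * adj u + u * adj v * cS (cnj c) + cS c * (v * adj u) + cS c * (v * adj v * cS (cnj c))"
        by (simp add: distrib_left distrib_right mult.assoc)
      moreover have "u * adj v * cS (cnj c) = cS (cnj c) * (u * adj v)" "v * adj v * cS (cnj c) = cS (cnj c) * (v * adj v)"
        by (rule cS_commute)+
      ultimately show ?thesis
        by (simp add: Q_def cS_mult mult.assoc)
    qed
    define R where "R = Q 1 + cS (-1) * Q (-1) + (cS \<i> * Q \<i> + cS (- \<i>) * Q (- \<i>))"
    have "R = cS 4 * (u * adj v)"
    proof -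
      have sc: "cS a * (cS b * z) = cS (a * b) * z" "cS a * z + cS b * z = cS (a + b) * z" for a b :: complex and z :: "'a cop"
        by (simp_all add: cS_mult mult.assoc cS_add distrib_right)
      define z1 z2 z3 z4 where "z1 = u * adj u" and "z2 = u * adj v" and "z3 = v * adj u" and "z4 = v * adj v"
      have four: "R = (cS 1 * z1 + cS (-1) * z1 + (cS \<i> * z1 + cS (- \<i>) * z1))
          + (cS 1 * z2 + cS 1 * z2 + (cS 1 * z2 + cS 1 * z2))
          + (cS 1 * z3 + cS 1 * z3 + (cS (-1) * z3 + cS (-1) * z3))
          + (cS 1 * z4 + cS (-1) * z4 + (cS \<i> * z4 + cS (- \<i>) * z4))"
        unfolding R_def Q_eq z1_def[symmetric] z2_def[symmetric] z3_def[symmetric] z4_def[symmetric]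
        by (simp add: distrib_left sc(1) add_ac)
      show ?thesis
        unfolding four sc(2) z2_def by simp
    qed
    then have "u * adj v = cS (1 / 4) * R"
      by (simp add: mult.assoc[symmetric] cS_mult[symmetric])
    moreover have QN: "Q c \<in> vN" for c
      using uv by (simp add: Q_def vN.mult_N vN.add_N vN.cS_N vN.adj_N del: adj_add)
    then have RN: "R \<in> vN"
      unfolding R_def by (intro vN.add_N vN.cS_N)
    ultimately have "nrm \<one> p (u * adj v) \<le> cmod (1 / 4) * nrm \<one> p R"
      using p by (simp only:) (rule vN.nrm_cS)
    also have "nrm \<one> p R \<le> 4 * (a + b)\<^sup>2"
    proof -
      have one: "nrm \<one> p (cS d * Q c) \<le> (a + b)\<^sup>2" if "cmod c = 1" "cmod d = 1" for c d
        using vN.nrm_cS[OF QN p, of d c] sq[OF uv(1,2) that(1) uv(3,4)] that(2) by (simp add: Q_def)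
      have "nrm \<one> p R \<le> nrm \<one> p (Q 1 + cS (-1) * Q (-1)) + nrm \<one> p (cS \<i> * Q \<i> + cS (- \<i>) * Q (- \<i>))"
        unfolding R_def using p by (intro vN.nrm_triangle vN.add_N vN.cS_N QN)
      also have "\<dots> \<le> (nrm \<one> p (Q 1) + nrm \<one> p (cS (-1) * Q (-1))) + (nrm \<one> p (cS \<i> * Q \<i>) + nrm \<one> p (cS (- \<i>) * Q (- \<i>)))"
        using p by (intro add_mono vN.nrm_triangle vN.cS_N QN)
      also have "\<dots> \<le> 4 * (a + b)\<^sup>2"
        using one[of 1 1] one[of "-1" "-1"] one[of \<i> \<i>] one[of "- \<i>" "- \<i>"] by simp
      finally show ?thesis .
    qed
    finally show ?thesis
      by simp
  qed
  text \<open>Rescaling \<open>x\<close> and \<open>y\<close> in opposite directions turns \<open>(A + B)\<^sup>2\<close> into \<open>4 A B\<close>.\<close>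
  have eps: "nrm \<one> p (x * adj y) \<le> 4 * ((A + \<epsilon>) * (B + \<epsilon>))" if e: "0 < \<epsilon>" for \<epsilon>
  proof -
    define a b where "a = A + \<epsilon>" and "b = B + \<epsilon>"
    have ab: "0 < a" "0 < b" "A \<le> a" "B \<le> b"
      using AB e by (auto simp: a_def b_def)
    define s where "s = sqrt (a * b)"
    have s: "0 < s" "s * s = a * b"
      using ab by (simp_all add: s_def)
    have u: "nrm \<one> (2 * p) (cS (of_real (s / a)) * x) \<le> s"
    proof -
      have "nrm \<one> (2 * p) (cS (of_real (s / a)) * x) \<le> (s / a) * A"
        using vN.nrm_cS[OF x(1) p2(1), of "of_real (s / a)"] s ab by (simp add: A_def norm_divide)
      also have "\<dots> \<le> (s / a) * a"
        using s ab by (intro mult_left_mono) auto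
      finally show ?thesis
        using ab by simp
    qed
    have v: "nrm \<one> (2 * p) (cS (of_real (s / b)) * y) \<le> s"
    proof -
      have "nrm \<one> (2 * p) (cS (of_real (s / b)) * y) \<le> (s / b) * B"
        using vN.nrm_cS[OF x(2) p2(1), of "of_real (s / b)"] s ab by (simp add: B_def norm_divide)
      also have "\<dots> \<le> (s / b) * b"
        using s ab by (intro mult_left_mono) auto
      finally show ?thesis
        using ab by simp
    qed
    have "(cS (of_real (s / a)) * x) * adj (cS (of_real (s / b)) * y) = ((s / a) * (s / b)) *\<^sub>R (x * adj y)"
    proof -
      have "(cS (of_real (s / a)) * x) * adj (cS (of_real (s / b)) * y) = ((s / a) *\<^sub>R x) * adj ((s / b) *\<^sub>R y)"
        by (simp only: cS_of_real)
      then show ?thesis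
        by simp
    qed
    also have "(s / a) * (s / b) = 1"
      using s ab by simp
    finally have "x * adj y = (cS (of_real (s / a)) * x) * adj (cS (of_real (s / b)) * y)"
      by simp
    then have "nrm \<one> p (x * adj y) \<le> (s + s)\<^sup>2"
      using pol[OF _ _ u v] x by (simp add: vN.cS_N del: adj_mult)
    then show ?thesis
      using s by (simp add: power2_eq_square a_def b_def)
  qed
  have "((\<lambda>\<epsilon>. 4 * ((A + \<epsilon>) * (B + \<epsilon>))) \<longlongrightarrow> 4 * ((A + 0) * (B + 0))) (at_right 0)"
    by (intro tendsto_intros)
  then have "nrm \<one> p (x * adj y) \<le> 4 * ((A + 0) * (B + 0))"
    by (rule tendsto_lowerbound) (auto simp: eventually_at_filter eps)
  then show ?thesis
    by (simp add: A_def B_def)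
qed

end

section \<open>Cotlar's identity at the level of kernels\<close>

context group
begin

text \<open>All operators in the identity have this shape: x adj x with its pairs of coefficients
  weighted by a kernel \<kappa>. Multipliers, adjoints and sums act on the kernel alone, so an
  operator identity reduces to one between kernels.\<close>

definition dsum :: "'a set \<Rightarrow> ('a \<Rightarrow> complex) \<Rightarrow> ('a \<Rightarrow> 'a \<Rightarrow> complex) \<Rightarrow> 'a cop" where
  "dsum F f \<kappa> = (\<Sum>(a, b)\<in>F \<times> F. cS (\<kappa> a b * (f a * cnj (f b))) * lam G (a \<otimes> inv b))"

lemma dsum_CW: "finite F \<Longrightarrow> F \<subseteq> carrier G \<Longrightarrow> dsum F f \<kappa> \<in> CW"
  unfolding dsum_def by (intro CW_sum) (auto intro!: CW_cS lam_CW)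

lemma dsum_cong: "(\<And>a b. a \<in> F \<Longrightarrow> b \<in> F \<Longrightarrow> \<kappa> a b = \<kappa>' a b) \<Longrightarrow> dsum F f \<kappa> = dsum F f \<kappa>'"
  unfolding dsum_def by (intro sum.cong) auto

lemma dsum_add: "dsum F f \<kappa> + dsum F f \<kappa>' = dsum F f (\<lambda>a b. \<kappa> a b + \<kappa>' a b)"
  by (simp add: dsum_def sum.distrib[symmetric] case_prod_beta distrib_right cS_add)

lemma dsum_diff: "dsum F f \<kappa> - dsum F f \<kappa>' = dsum F f (\<lambda>a b. \<kappa> a b - \<kappa>' a b)"
proof -
  have "dsum F f (\<lambda>a b. \<kappa> a b - \<kappa>' a b) + dsum F f \<kappa>' = dsum F f \<kappa>"
    by (simp add: dsum_add)
  then show ?thesis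
    by (simp add: algebra_simps)
qed

lemma Tm_dsum:
  assumes "F \<subseteq> carrier G"
  shows "Tm \<mu> (dsum F f \<kappa>) = dsum F f (\<lambda>a b. \<mu> (a \<otimes> inv b) * \<kappa> a b)"
proof -
  have "Tm \<mu> (dsum F f \<kappa>) = Tm \<mu> (\<Sum>i\<in>F \<times> F. cS (\<kappa> (fst i) (snd i) * (f (fst i) * cnj (f (snd i)))) * lam G (fst i \<otimes> inv (snd i)))"
    by (simp add: dsum_def case_prod_beta)
  also have "\<dots> = (\<Sum>i\<in>F \<times> F. cS (\<mu> (fst i \<otimes> inv (snd i)) * (\<kappa> (fst i) (snd i) * (f (fst i) * cnj (f (snd i))))) * lam G (fst i \<otimes> inv (snd i)))"
    using assms by (intro Tm_sum_lam) (auto simp: subset_iff)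
  finally show ?thesis
    by (simp add: dsum_def case_prod_beta mult.assoc)
qed

lemma adj_dsum:
  assumes "F \<subseteq> carrier G"
  shows "adj (dsum F f \<kappa>) = dsum F f (\<lambda>a b. cnj (\<kappa> b a))"
proof -
  have "adj (dsum F f \<kappa>) = (\<Sum>(a, b)\<in>F \<times> F. cS (cnj (\<kappa> a b) * (f b * cnj (f a))) * lam G (b \<otimes> inv a))"
    unfolding dsum_def adj_sum
  proof (rule sum.cong, goal_cases)
    case (2 i)
    then obtain a b where i: "i = (a, b)" "a \<in> carrier G" "b \<in> carrier G"
      using assms by auto
    have "adj (lam G (a \<otimes> inv b)) = lam G (b \<otimes> inv a)"
      using i by (simp add: adj_lam inv_mult_group)
    then show ?case
      by (simp add: i(1) cS_commute[of "lam G (b \<otimes> inv a)"] mult.commute[of "f b"])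
  qed simp
  also have "\<dots> = (\<Sum>(a, b)\<in>F \<times> F. cS (cnj (\<kappa> b a) * (f a * cnj (f b))) * lam G (a \<otimes> inv b))"
    by (rule sum.reindex_bij_witness[of _ prod.swap prod.swap]) auto
  finally show ?thesis
    by (simp add: dsum_def)
qed

lemma mult_adj_dsum:
  assumes "F \<subseteq> carrier G"
  shows "(\<Sum>a\<in>F. cS (\<mu> a * f a) * lam G a) * adj (\<Sum>b\<in>F. cS (\<nu> b * f b) * lam G b)
    = dsum F f (\<lambda>a b. \<mu> a * cnj (\<nu> b))"
proof -
  have "(cS (\<mu> a * f a) * lam G a) * adj (cS (\<nu> b * f b) * lam G b)
      = cS (\<mu> a * cnj (\<nu> b) * (f a * cnj (f b))) * lam G (a \<otimes> inv b)" if "a \<in> F" "b \<in> F" for a b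
  proof -
    have ab: "a \<in> carrier G" "b \<in> carrier G"
      using that assms by auto
    have "adj (cS (\<nu> b * f b) * lam G b) = cS (cnj (\<nu> b * f b)) * lam G (inv b)"
      using ab by (simp add: adj_lam cS_commute[of "lam G (inv b)"])
    then have "(cS (\<mu> a * f a) * lam G a) * adj (cS (\<nu> b * f b) * lam G b)
        = cS ((\<mu> a * f a) * cnj (\<nu> b * f b)) * lam G (a \<otimes> inv b)"
      using ab by (simp only: cS_mult_mult lam_mult inv_closed)
    then show ?thesis
      by (simp add: mult_ac)
  qed
  then show ?thesis
    unfolding adj_sum sum_product dsum_def sum.cartesian_product
    by (intro sum.cong) auto
qed

lemma supp_dsum:
  assumes "subgroup H G" "F \<subseteq> H"
  shows "supp (dsum F f \<kappa>) \<subseteq> H"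
proof
  interpret H: subgroup H G by fact
  fix g assume "g \<in> supp (dsum F f \<kappa>)"
  then have "(\<Sum>(a, b)\<in>F \<times> F. hat (cS (\<kappa> a b * (f a * cnj (f b))) * lam G (a \<otimes> inv b)) g) \<noteq> 0"
    by (simp add: supp_def dsum_def hat_sum case_prod_beta)
  then obtain i where i: "i \<in> F \<times> F" "(case i of (a, b) \<Rightarrow> hat (cS (\<kappa> a b * (f a * cnj (f b))) * lam G (a \<otimes> inv b)) g) \<noteq> 0"
    by (rule sum.not_neutral_contains_not_neutral)
  obtain a b where ab_eq: "i = (a, b)"
    by (cases i)
  have ab: "a \<in> H" "b \<in> H" "a \<in> carrier G" "b \<in> carrier G"
    using i(1) assms(2) H.subset by (auto simp: ab_eq)
  have "hat (lam G (a \<otimes> inv b)) g \<noteq> 0"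
    using i(2) by (auto simp: ab_eq hat_cS)
  then have "g = a \<otimes> inv b"
    using ab by (simp add: hat_lam split: if_splits)
  with ab show "g \<in> H"
    by simp
qed

text \<open>If X > F, then b F^2 is at most b F X and one factor X cancels; otherwise the added 1 in
  the constant is enough.\<close>

lemma quadratic_bound:
  fixes X F a b :: real
  assumes "X\<^sup>2 \<le> a * (F * X) + b * F\<^sup>2" "0 \<le> a" "0 \<le> b" "0 \<le> X" "0 \<le> F"
  shows "X \<le> (a + b + 1) * F"
proof (cases "X \<le> F")
  case True
  have "F * 1 \<le> F * (a + b + 1)"
    using assms by (intro mult_left_mono) auto
  with True show ?thesis
    by (simp add: mult.commute)
next
  case False
  have "b * F\<^sup>2 \<le> b * (F * X)"
    using False assms by (intro mult_left_mono) (auto simp: power2_eq_square intro!: mult_left_mono)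
  then have "X * X \<le> ((a + b) * F) * X"
    using assms(1) by (simp add: power2_eq_square algebra_simps)
  then have "X \<le> (a + b) * F"
    using False assms by (simp add: mult_le_cancel_right)
  then show ?thesis
    using assms by (simp add: distrib_right)
qed

text \<open>Kernels are compared at c = a b^-1. On K, \<mu>(a) = \<mu>(c) \<mu>(b) and \<mu>(b)^2 =
  1 give \<mu>(a) \<mu>(b) = \<mu>(c), the kernel of \<open>Tm \<mu> u\<close>. Off K, the vanishing
  product with g = c and h = b expands to the kernel of Y. The indicator of K selects the
  case.\<close>

lemma Cotlar_identity:
  fixes f \<mu> :: "'a \<Rightarrow> complex"
  assumes F: "F \<subseteq> H" and H: "subgroup H G"
    and re: "\<And>g. g \<in> H \<Longrightarrow> cnj (\<mu> g) = \<mu> g" "\<And>g. g \<in> H \<Longrightarrow> \<mu> g * \<mu> g = 1"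
    and A: "\<And>g h. g \<in> H \<Longrightarrow> g \<notin> K \<Longrightarrow> h \<in> H \<Longrightarrow> (\<mu> (inv g) - \<mu> h) * (\<mu> (g \<otimes> h) - \<mu> g) = 0"
    and B: "\<And>g h. g \<in> H \<Longrightarrow> g \<in> K \<Longrightarrow> h \<in> H \<Longrightarrow> \<mu> (g \<otimes> h) = \<mu> g * \<mu> h"
  defines "u \<equiv> dsum F f (\<lambda>a b. 1)" and "v \<equiv> dsum F f (\<lambda>a b. \<mu> b)"
  defines "Y \<equiv> Tm \<mu> v + adj (Tm \<mu> v) - Tm \<mu> (adj (Tm \<mu> u))"
  shows "dsum F f (\<lambda>a b. \<mu> a * \<mu> b) = Tm (indicator K) (Tm \<mu> u) + (Y - Tm (indicator K) Y)"
proof -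
  interpret H: subgroup H G by fact
  have FG: "F \<subseteq> carrier G"
    using F H.subset by blast
  have Y: "Y = dsum F f (\<lambda>a b. \<mu> (a \<otimes> inv b) * \<mu> b + cnj (\<mu> (b \<otimes> inv a) * \<mu> a) - \<mu> (a \<otimes> inv b) * cnj (\<mu> (b \<otimes> inv a)))"
    by (simp add: Y_def u_def v_def Tm_dsum[OF FG] adj_dsum[OF FG] dsum_add dsum_diff)
  show ?thesis
    unfolding Y u_def Tm_dsum[OF FG] dsum_diff dsum_add
  proof (rule dsum_cong)
    fix a b assume "a \<in> F" "b \<in> F"
    then have ab: "a \<in> H" "b \<in> H" "a \<in> carrier G" "b \<in> carrier G"
      using F FG by auto
    define c where "c = a \<otimes> inv b"
    have c: "c \<in> H" "inv c \<in> H" "c \<otimes> b = a" "b \<otimes> inv a = inv c"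
      using ab by (auto simp: c_def mult_inv_mult_cancel inv_mult_group)
    have "\<mu> a * \<mu> b = \<mu> c" if "c \<in> K"
      using B[OF c(1) that ab(2)] re(2)[OF ab(2)] by (simp add: c mult.assoc)
    moreover have "\<mu> a * \<mu> b = \<mu> c * \<mu> b + \<mu> (inv c) * \<mu> a - \<mu> c * \<mu> (inv c)" if "c \<notin> K"
      using A[OF c(1) that ab(2)] by (simp add: c algebra_simps)
    ultimately show "\<mu> a * \<mu> b = indicator K (a \<otimes> inv b) * (\<mu> (a \<otimes> inv b) * 1) +
        (\<mu> (a \<otimes> inv b) * \<mu> b + cnj (\<mu> (b \<otimes> inv a) * \<mu> a) - \<mu> (a \<otimes> inv b) * cnj (\<mu> (b \<otimes> inv a)) -
         indicator K (a \<otimes> inv b) * (\<mu> (a \<otimes> inv b) * \<mu> b + cnj (\<mu> (b \<otimes> inv a) * \<mu> a) - \<mu> (a \<otimes> inv b) * cnj (\<mu> (b \<otimes> inv a))))"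
      unfolding c_def[symmetric] c(4) complex_cnj_mult re(1)[OF c(2)] re(1)[OF ab(1)]
      by (cases "c \<in> K") simp_all
  qed
qed

text \<open>Let N and X be the 2 p-norms of x and h. \<open>Tm \<mu> v\<close> and its adjoint cost
  4 C N X each and the iterated multiplier C^2 N^2; subtracting the expectation of Y doubles these
  costs, and the term on K adds C N^2. The quadratic inequality then bounds X by a multiple of
  N.\<close>

lemma Cotlar_step:
  assumes H: "subgroup H G" and K: "subgroup K G"
    and re: "\<And>g. g \<in> H \<Longrightarrow> cnj (\<mu> g) = \<mu> g" "\<And>g. g \<in> H \<Longrightarrow> \<mu> g * \<mu> g = 1"
    and A: "\<And>g h. g \<in> H \<Longrightarrow> g \<notin> K \<Longrightarrow> h \<in> H \<Longrightarrow> (\<mu> (inv g) - \<mu> h) * (\<mu> (g \<otimes> h) - \<mu> g) = 0"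
    and B: "\<And>g h. g \<in> H \<Longrightarrow> g \<in> K \<Longrightarrow> h \<in> H \<Longrightarrow> \<mu> (g \<otimes> h) = \<mu> g * \<mu> h"
    and bdd: "Tm_bounded H \<mu> C p" "0 \<le> C" and p: "1 < p"
  shows "Tm_bounded H \<mu> (16 * C + (C + 2 * (C * C)) + 1) (2 * p)"
  unfolding Tm_bounded_def
proof (intro ballI impI)
  interpret H: subgroup H G by fact
  fix x assume x: "x \<in> CW" "supp x \<subseteq> H"
  define F where "F = supp x"
  have F: "finite F" "F \<subseteq> H" "F \<subseteq> carrier G"
    using supp_CW[OF x(1)] x(2) by (auto simp: F_def)
  define f where "f = hat x"
  define h where "h = Tm \<mu> x"
  have mem: "x \<in> vN" "h \<in> vN"
    using x by (auto simp: h_def intro!: CW_vN Tm_CW)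
  have x_eq: "x = (\<Sum>a\<in>F. cS (1 * f a) * lam G a)" and h_eq: "h = (\<Sum>a\<in>F. cS (\<mu> a * f a) * lam G a)"
    using CW_expand(1)[OF x(1) F(1) _ F(3)] by (simp_all add: F_def f_def h_def Tm_def)
  have cnj_mu: "cnj (\<mu> b) = \<mu> b" if "b \<in> F" for b
    using re(1) F that by blast
  define u where "u = dsum F f (\<lambda>a b. 1)"
  define v where "v = dsum F f (\<lambda>a b. \<mu> b)"
  have u: "x * adj x = u"
    unfolding x_eq u_def mult_adj_dsum[OF F(3)] by simp
  have "x * adj h = dsum F f (\<lambda>a b. 1 * cnj (\<mu> b))"
    unfolding x_eq h_eq by (rule mult_adj_dsum[OF F(3)])
  also have "\<dots> = v"
    unfolding v_def by (rule dsum_cong) (simp add: cnj_mu)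
  finally have v: "x * adj h = v" .
  have "h * adj h = dsum F f (\<lambda>a b. \<mu> a * cnj (\<mu> b))"
    unfolding h_eq by (rule mult_adj_dsum[OF F(3)])
  also have "\<dots> = dsum F f (\<lambda>a b. \<mu> a * \<mu> b)"
    by (rule dsum_cong) (simp add: cnj_mu)
  finally have hh: "h * adj h = dsum F f (\<lambda>a b. \<mu> a * \<mu> b)" .
  define Y where "Y = Tm \<mu> v + adj (Tm \<mu> v) - Tm \<mu> (adj (Tm \<mu> u))"
  have id: "h * adj h = Tm (indicator K) (Tm \<mu> u) + (Y - Tm (indicator K) Y)"
    unfolding hh Y_def u_def v_def by (rule Cotlar_identity[OF F(2) H re A B])
  have uv: "u \<in> CW" "v \<in> CW" "supp u \<subseteq> H" "supp v \<subseteq> H"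
    using F by (auto simp: u_def v_def intro!: dsum_CW dest!: subsetD[OF supp_dsum[OF H]])
  have w: "adj (Tm \<mu> u) \<in> CW" "supp (adj (Tm \<mu> u)) \<subseteq> H"
    unfolding u_def Tm_dsum[OF F(3)] adj_dsum[OF F(3)] using F by (auto intro!: dsum_CW dest!: subsetD[OF supp_dsum[OF H]])
  have cw: "Tm \<mu> u \<in> CW" "Tm \<mu> v \<in> CW" "adj (Tm \<mu> v) \<in> CW" "Tm \<mu> (adj (Tm \<mu> u)) \<in> CW"
    using uv w by (auto intro!: Tm_CW CW_adj)
  have bd: "nrm \<one> p (Tm \<mu> z) \<le> C * nrm \<one> p z" if "z \<in> CW" "supp z \<subseteq> H" for z
    using bdd that by (simp add: Tm_bounded_def)
  define N where "N = nrm \<one> (2 * p) x"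
  define X where "X = nrm \<one> (2 * p) h"
  have nu: "nrm \<one> p u = N\<^sup>2"
    unfolding u[symmetric] N_def using mem p by (intro vN.nrm_mult_adj) auto
  have nv: "nrm \<one> p v \<le> 4 * (N * X)"
    unfolding v[symmetric] N_def X_def using mem p by (intro nrm_mult_adj_le)
  have X2: "X\<^sup>2 = nrm \<one> p (h * adj h)"
    unfolding X_def using mem p by (intro vN.nrm_mult_adj[symmetric]) auto
  have n1: "nrm \<one> p (Tm \<mu> u) \<le> C * N\<^sup>2"
    using bd[OF uv(1,3)] by (simp add: nu)
  have n2: "nrm \<one> p (Tm \<mu> v) \<le> C * (4 * (N * X))"
    using bd[OF uv(2,4)] mult_left_mono[OF nv bdd(2)] by simp
  have n3: "nrm \<one> p (adj (Tm \<mu> v)) \<le> C * (4 * (N * X))"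
    using n2 CW_vN[OF cw(2)] p by (simp add: vN.nrm_adj)
  have "nrm \<one> p (Tm \<mu> (adj (Tm \<mu> u))) \<le> C * nrm \<one> p (adj (Tm \<mu> u))"
    by (rule bd[OF w])
  also have "nrm \<one> p (adj (Tm \<mu> u)) = nrm \<one> p (Tm \<mu> u)"
    using CW_vN[OF cw(1)] p by (simp add: vN.nrm_adj)
  also have "C * nrm \<one> p (Tm \<mu> u) \<le> C * (C * N\<^sup>2)"
    by (rule mult_left_mono[OF n1 bdd(2)])
  finally have n4: "nrm \<one> p (Tm \<mu> (adj (Tm \<mu> u))) \<le> C * (C * N\<^sup>2)" .
  have YCW: "Y \<in> CW"
  proof -
    have "Y = Tm \<mu> v + adj (Tm \<mu> v) + cS (-1) * Tm \<mu> (adj (Tm \<mu> u))"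
      by (simp add: Y_def cS_minus)
    then show ?thesis
      using cw by (simp add: CW_add CW_cS)
  qed
  have "nrm \<one> p Y \<le> nrm \<one> p (Tm \<mu> v) + nrm \<one> p (adj (Tm \<mu> v)) + nrm \<one> p (Tm \<mu> (adj (Tm \<mu> u)))"
    unfolding Y_def using vN.nrm_diff[OF vN.add_N[OF CW_vN[OF cw(2)] CW_vN[OF cw(3)]] CW_vN[OF cw(4)] p]
      vN.nrm_triangle[OF CW_vN[OF cw(2)] CW_vN[OF cw(3)] p] by linarith
  then have nY: "nrm \<one> p Y \<le> 8 * (C * (N * X)) + C * (C * N\<^sup>2)"
    using n2 n3 n4 by linarith
  have "nrm \<one> p (h * adj h) \<le> nrm \<one> p (Tm (indicator K) (Tm \<mu> u)) + (nrm \<one> p Y + nrm \<one> p (Tm (indicator K) Y))"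
  proof -
    have m: "Tm (indicator K) (Tm \<mu> u) \<in> vN" "Y \<in> vN" "Tm (indicator K) Y \<in> vN"
      using cw YCW by (auto intro!: CW_vN Tm_CW)
    show ?thesis
      unfolding id using vN.nrm_triangle[OF m(1) vN.diff_N[OF m(2,3)] p] vN.nrm_diff[OF m(2,3) p] by linarith
  qed
  also have "\<dots> \<le> C * N\<^sup>2 + 2 * (8 * (C * (N * X)) + C * (C * N\<^sup>2))"
  proof -
    note a = order_trans[OF nrm_expectation[OF K cw(1) p] n1]
    note b = order_trans[OF nrm_expectation[OF K YCW p] nY]
    show ?thesis
      using add_mono[OF a add_mono[OF nY b]] by simp
  qed
  finally have "X\<^sup>2 \<le> (16 * C) * (N * X) + (C + 2 * (C * C)) * N\<^sup>2"
    unfolding X2 by (simp add: algebra_simps)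
  then have "X \<le> (16 * C + (C + 2 * (C * C)) + 1) * N"
    by (rule quadratic_bound) (use bdd in \<open>auto simp: N_def X_def nrm_nonneg\<close>)
  then show "nrm \<one> (2 * p) (Tm \<mu> x) \<le> (16 * C + (C + 2 * (C * C)) + 1) * nrm \<one> (2 * p) x"
    by (simp add: X_def N_def h_def)
qed

lemma Cotlar_powers_of_2:
  assumes H: "subgroup H G" and K: "subgroup K G"
    and \<mu>: "\<And>g. cmod (\<mu> g) \<le> 1"
    and re: "\<And>g. g \<in> H \<Longrightarrow> cnj (\<mu> g) = \<mu> g" "\<And>g. g \<in> H \<Longrightarrow> \<mu> g * \<mu> g = 1"
    and A: "\<And>g h. g \<in> H \<Longrightarrow> g \<notin> K \<Longrightarrow> h \<in> H \<Longrightarrow> (\<mu> (inv g) - \<mu> h) * (\<mu> (g \<otimes> h) - \<mu> g) = 0"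
    and B: "\<And>g h. g \<in> H \<Longrightarrow> g \<in> K \<Longrightarrow> h \<in> H \<Longrightarrow> \<mu> (g \<otimes> h) = \<mu> g * \<mu> h"
  shows "\<exists>C\<ge>0. Tm_bounded H \<mu> C (2 ^ Suc n)"
proof (induction n)
  case 0
  then show ?case
    using Tm_bounded_2[OF \<mu>, of H] by (intro exI[of _ 1]) simp
next
  case (Suc n)
  then obtain C where C: "0 \<le> C" "Tm_bounded H \<mu> C (2 ^ Suc n)"
    by (elim exE conjE)
  have "(1::real) < 2 ^ Suc n"
    by (rule one_less_power) auto
  from Cotlar_step[OF H K re A B C(2,1) this] C(1)
  show ?case
    by (intro exI[of _ "16 * C + (C + 2 * (C * C)) + 1"]) simp
qed

text \<open>\<open>Tm m x\<close> is the sum over i of the translate by w(i) of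
  \<open>Tm \<mu>\<close> applied to the expectation onto H of the translate of x by the inverse of
  w(i). Translations and expectations are contractions, so each coset costs C.\<close>

lemma Tm_bounded_cosets:
  fixes w :: "nat \<Rightarrow> 'a"
  assumes H: "subgroup H G" and w: "\<And>i. i \<in> I \<Longrightarrow> w i \<in> carrier G" and I: "finite I"
    and unique: "\<And>g. g \<in> carrier G \<Longrightarrow> \<exists>!i. i \<in> I \<and> inv (w i) \<otimes> g \<in> H"
    and m: "\<And>i h. i \<in> I \<Longrightarrow> h \<in> H \<Longrightarrow> m (w i \<otimes> h) = \<mu> h"
    and bdd: "Tm_bounded H \<mu> C p" "0 \<le> C" and p: "1 < p"
  shows "Tm_bounded UNIV m (real (card I) * C) p"
  unfolding Tm_bounded_def
proof (intro ballI impI)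
  interpret H: subgroup H G by fact
  fix x assume x: "x \<in> CW"
  define F where "F = supp x"
  have F: "finite F" "F \<subseteq> carrier G"
    using supp_CW[OF x] by (auto simp: F_def)
  have x_eq: "x = (\<Sum>g\<in>F. cS (hat x g) * lam G g)"
    using CW_expand(1)[OF x F(1) _ F(2)] by (simp add: F_def)
  define z where "z i = Tm (indicator H) (lam G (inv (w i)) * x)" for i
  have lx: "lam G (inv (w i)) * x \<in> CW" "z i \<in> CW" "supp (z i) \<subseteq> H" if "i \<in> I" for i
  proof -
    show 1: "lam G (inv (w i)) * x \<in> CW"
      using w[OF that] x by (intro CW_mult lam_CW) auto
    then show "z i \<in> CW"
      unfolding z_def by (rule Tm_CW)
    show "supp (z i) \<subseteq> H"
      using hat_Tm[OF 1, of "indicator H"] by (auto simp: supp_def z_def indicator_def split: if_splits)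
  qed
  have part: "lam G (w i) * Tm \<mu> (z i) = (\<Sum>g\<in>F. cS (\<mu> (inv (w i) \<otimes> g) * indicator H (inv (w i) \<otimes> g) * hat x g) * lam G g)"
    if i: "i \<in> I" for i
  proof -
    have wi: "w i \<in> carrier G" "inv (w i) \<in> carrier G"
      using w[OF i] by auto
    have "lam G (inv (w i)) * x = (\<Sum>g\<in>F. cS (hat x g) * lam G (inv (w i) \<otimes> g))"
      by (subst x_eq, unfold sum_distrib_left, rule sum.cong)
        (use F wi in \<open>auto simp: cS_left_commute[of "lam G (inv (w i))"] lam_mult subset_iff\<close>)
    then have "Tm \<mu> (z i) = (\<Sum>g\<in>F. cS (\<mu> (inv (w i) \<otimes> g) * (indicator H (inv (w i) \<otimes> g) * hat x g)) * lam G (inv (w i) \<otimes> g))"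
      unfolding z_def using F wi by (simp add: Tm_sum_lam subset_iff)
    then have "lam G (w i) * Tm \<mu> (z i) = lam G (w i) * (\<Sum>g\<in>F. cS (\<mu> (inv (w i) \<otimes> g) * (indicator H (inv (w i) \<otimes> g) * hat x g)) * lam G (inv (w i) \<otimes> g))"
      by simp
    also have "\<dots> = (\<Sum>g\<in>F. cS (\<mu> (inv (w i) \<otimes> g) * (indicator H (inv (w i) \<otimes> g) * hat x g)) * lam G g)"
      unfolding sum_distrib_left
      by (rule sum.cong) (use F wi in \<open>auto simp: cS_left_commute[of "lam G (w i)"] lam_mult subset_iff mult_inv_cancel\<close>)
    finally show ?thesis
      by (simp add: mult.assoc)
  qed
  have "Tm m x = (\<Sum>g\<in>F. cS (m g * hat x g) * lam G g)"
    by (simp add: Tm_def F_def)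
  also have "\<dots> = (\<Sum>g\<in>F. \<Sum>i\<in>I. cS (\<mu> (inv (w i) \<otimes> g) * indicator H (inv (w i) \<otimes> g) * hat x g) * lam G g)"
  proof (rule sum.cong)
    fix g assume "g \<in> F"
    then have g: "g \<in> carrier G"
      using F by auto
    obtain j where j: "j \<in> I" "inv (w j) \<otimes> g \<in> H" and uj: "\<forall>i. i \<in> I \<and> inv (w i) \<otimes> g \<in> H \<longrightarrow> i = j"
      using unique[OF g] unfolding Ex1_def by (elim exE conjE)
    have "(\<Sum>i\<in>I. cS (\<mu> (inv (w i) \<otimes> g) * indicator H (inv (w i) \<otimes> g) * hat x g) * lam G g)
        = (\<Sum>i\<in>{j}. cS (\<mu> (inv (w i) \<otimes> g) * indicator H (inv (w i) \<otimes> g) * hat x g) * lam G g)"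
    proof (rule sum.mono_neutral_right[OF I])
      have "indicator H (inv (w i) \<otimes> g) = (0 :: complex)" if "i \<in> I - {j}" for i
        using uj that by (auto simp: indicator_def)
      then show "\<forall>i\<in>I - {j}. cS (\<mu> (inv (w i) \<otimes> g) * indicator H (inv (w i) \<otimes> g) * hat x g) * lam G g = 0"
        by simp
    qed (use j in simp)
    also have "\<dots> = cS (\<mu> (inv (w j) \<otimes> g) * hat x g) * lam G g"
      using j by simp
    also have "\<mu> (inv (w j) \<otimes> g) = m g"
      using m[OF j] g w[OF j(1)] by (simp add: mult_inv_cancel)
    finally show "cS (m g * hat x g) * lam G g
        = (\<Sum>i\<in>I. cS (\<mu> (inv (w i) \<otimes> g) * indicator H (inv (w i) \<otimes> g) * hat x g) * lam G g)"
      by simp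
  qed simp
  also have "\<dots> = (\<Sum>i\<in>I. lam G (w i) * Tm \<mu> (z i))"
    by (subst sum.swap) (simp add: part)
  finally have "nrm \<one> p (Tm m x) = nrm \<one> p (\<Sum>i\<in>I. lam G (w i) * Tm \<mu> (z i))"
    by simp
  also have "\<dots> \<le> (\<Sum>i\<in>I. nrm \<one> p (lam G (w i) * Tm \<mu> (z i)))"
    using w lx p by (intro vN.nrm_sum vN.mult_N lam_N CW_vN Tm_CW) auto
  also have "\<dots> \<le> (\<Sum>i\<in>I. C * nrm \<one> p x)"
  proof (rule sum_mono)
    fix i assume i: "i \<in> I"
    have wi: "w i \<in> carrier G" "inv (w i) \<in> carrier G"
      using w[OF i] by auto
    have unit: "nrm \<one> p (lam G g * y) \<le> nrm \<one> p y" if "g \<in> carrier G" "y \<in> vN" for g y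
    proof -
      have "norm (lam G g) \<le> 1"
      proof (rule norm_le_of_adj_mult)
        have "lam G \<one> * lam G \<one> = lam G \<one>"
          by (simp add: lam_mult)
        \<comment> \<open>\<open>lam G \<one>\<close> restricts functions to the carrier, so its
          contractivity is checked coordinatewise.\<close>
        have "norm (app (lam G \<one>) f) \<le> norm f" for f
        proof -
          have "norm (Abs_ell2 (ell2_fun (app (lam G \<one>) f))) \<le> norm f"
          proof (rule ell2_bounded_sums(2))
            fix A :: "'a set" assume "finite A"
            have "(\<Sum>x\<in>A. (cmod (ell2_fun (app (lam G \<one>) f) x))\<^sup>2) \<le> (\<Sum>x\<in>A. (cmod (ell2_fun f x))\<^sup>2)"
              by (rule sum_mono) (simp add: app_lam[OF is_group])
            also have "\<dots> \<le> (norm f)\<^sup>2"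
              by (rule sum_ell2_le) fact
            finally show "(\<Sum>x\<in>A. (cmod (ell2_fun (app (lam G \<one>) f) x))\<^sup>2) \<le> (norm f)\<^sup>2" .
          qed simp
          then show ?thesis
            by (simp add: ell2_fun_inverse)
        qed
        then have "norm (lam G \<one>) \<le> 1"
          by (intro norm_cop_bound) auto
        then show "norm (adj (lam G g) * lam G g) \<le> 1\<^sup>2"
          using that by (simp add: adj_lam lam_mult)
      qed simp
      then have "norm (lam G g) * nrm \<one> p y \<le> 1 * nrm \<one> p y"
        by (intro mult_right_mono nrm_nonneg)
      with vN.nrm_mult_left[OF lam_N[OF that(1)] that(2) p] show ?thesis
        by simp
    qed
    have "nrm \<one> p (lam G (w i) * Tm \<mu> (z i)) \<le> nrm \<one> p (Tm \<mu> (z i))"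
      using wi lx[OF i] by (intro unit CW_vN Tm_CW)
    also have "\<dots> \<le> C * nrm \<one> p (z i)"
      using bdd(1) lx[OF i] by (simp add: Tm_bounded_def)
    also have "\<dots> \<le> C * nrm \<one> p (lam G (inv (w i)) * x)"
      unfolding z_def using nrm_expectation[OF H lx(1)[OF i] p] bdd(2) by (intro mult_left_mono)
    also have "\<dots> \<le> C * nrm \<one> p x"
      using unit[OF wi(2) CW_vN[OF x]] bdd(2) by (intro mult_left_mono)
    finally show "nrm \<one> p (lam G (w i) * Tm \<mu> (z i)) \<le> C * nrm \<one> p x" .
  qed
  finally show "nrm \<one> p (Tm m x) \<le> real (card I) * C * nrm \<one> p x"
    by (simp add: mult.assoc)
qed

end

section \<open>Walls in Coxeter groups\<close>

locale coxeter = group W for W (structure) +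
  fixes S :: "'a set" and M :: "'a \<Rightarrow> 'a \<Rightarrow> enat"
  assumes cox: "coxeter_system W S M"
begin

lemma pres: "presented_by W S (coxeter_relators S M)"
  using cox by (simp add: coxeter_system_def)

lemma S_carrier: "a \<in> S \<Longrightarrow> a \<in> carrier W"
  using pres by (auto simp: presented_by_def)

lemma val_Nil [simp]: "word_val W [] = \<one>"
  by (simp add: word_val_def)

lemma val_Cons [simp]: "word_val W ((a, b) # u) = (if b then a else inv a) \<otimes> word_val W u"
  by (simp add: word_val_def)

lemma words_Nil [simp]: "[] \<in> words S"
  by (simp add: words_def)

lemma words_Cons [simp]: "(a, b) # u \<in> words S \<longleftrightarrow> a \<in> S \<and> u \<in> words S"
  by (auto simp: words_def)

lemma words_append [simp]: "u @ v \<in> words S \<longleftrightarrow> u \<in> words S \<and> v \<in> words S"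
  by (auto simp: words_def)

lemma val_carrier: "u \<in> words S \<Longrightarrow> word_val W u \<in> carrier W"
  by (induction u) (auto simp: S_carrier)

lemma val_append: "u \<in> words S \<Longrightarrow> v \<in> words S \<Longrightarrow> word_val W (u @ v) = word_val W u \<otimes> word_val W v"
  by (induction u) (auto simp: S_carrier val_carrier m_assoc)

lemma val_eq_iff:
  "u \<in> words S \<Longrightarrow> v \<in> words S \<Longrightarrow>
    word_val W u = word_val W v \<longleftrightarrow> word_equiv S (coxeter_relators S M) u v"
  using pres unfolding presented_by_def by blast

lemma val_relator:
  assumes "r \<in> coxeter_relators S M"
  shows "r \<in> words S" "word_val W r = \<one>"
proof -
  show r: "r \<in> words S"
    using pres assms by (auto simp: presented_by_def)
  have "word_equiv S (coxeter_relators S M) ([] @ r @ []) ([] @ [])"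
    by (rule word_equiv.relator[OF assms])
  then have "word_val W r = word_val W []"
    using val_eq_iff[OF r words_Nil] by simp
  then show "word_val W r = \<one>"
    by simp
qed

lemma sq: "a \<in> S \<Longrightarrow> a \<otimes> a = \<one>"
proof -
  assume a: "a \<in> S"
  then have "M a a = 1"
    using cox by (simp add: coxeter_system_def coxeter_matrix_def)
  then have "M a a = enat 1"
    by (simp add: one_enat_def)
  then have "concat (replicate 1 [(a, True), (a, True)]) \<in> coxeter_relators S M"
    using a unfolding coxeter_relators_def by blast
  from val_relator(2)[OF this] show ?thesis
    using S_carrier[OF a] by simp
qed

lemma inv_S: "a \<in> S \<Longrightarrow> inv a = a"
  using sq S_carrier by (metis inv_equality)

lemma S_cancel: "a \<in> S \<Longrightarrow> x \<in> carrier W \<Longrightarrow> a \<otimes> (a \<otimes> x) = x"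
  using sq S_carrier by (simp add: m_assoc[symmetric])

lemma S_cancel_right: "a \<in> S \<Longrightarrow> x \<in> carrier W \<Longrightarrow> (x \<otimes> a) \<otimes> a = x"
  using sq S_carrier by (simp add: m_assoc)

section \<open>The sign cocycle of reflections\<close>

definition ind :: "'a \<Rightarrow> 'a \<Rightarrow> int" where
  "ind a x = (if x = a then - 1 else 1)"

lemma ind_sq [simp]: "ind a x * ind a x = 1"
  by (simp add: ind_def)

text \<open>For a reflection x this is the parity of the number of times the gallery spelled by the
  word crosses the wall of x; after the first letter a the rest is seen through conjugation by a.
  These are the signs in the classical action of W on signed reflections.\<close>

fun sg :: "('a \<times> bool) list \<Rightarrow> 'a \<Rightarrow> int" where
  "sg [] x = 1"
| "sg ((a, b) # u) x = ind a x * sg u (a \<otimes> x \<otimes> a)"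

lemma sg_append:
  "u \<in> words S \<Longrightarrow> x \<in> carrier W \<Longrightarrow>
    sg (u @ v) x = sg u x * sg v (inv (word_val W u) \<otimes> x \<otimes> word_val W u)"
proof (induction u arbitrary: x)
  case Nil
  then show ?case
    by simp
next
  case (Cons l u)
  obtain a b where l: "l = (a, b)"
    by (cases l)
  have a: "a \<in> S" "a \<in> carrier W" "u \<in> words S" "word_val W u \<in> carrier W"
    using Cons.prems by (auto simp: l S_carrier val_carrier)
  have "inv (word_val W u) \<otimes> (a \<otimes> x \<otimes> a) \<otimes> word_val W u = inv (a \<otimes> word_val W u) \<otimes> x \<otimes> (a \<otimes> word_val W u)"
    using a Cons.prems(2) by (simp add: inv_mult_group inv_S m_assoc)
  then show ?case
    using Cons.IH[of "a \<otimes> x \<otimes> a"] a Cons.prems by (simp add: l inv_S)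
qed

lemma ind_conj:
  assumes "g \<in> carrier W" "a \<in> carrier W" "x \<in> carrier W"
  shows "ind a (inv g \<otimes> x \<otimes> g) = ind (g \<otimes> a \<otimes> inv g) x"
proof -
  have "inv g \<otimes> x \<otimes> g = a \<longleftrightarrow> x = g \<otimes> a \<otimes> inv g"
  proof
    assume "inv g \<otimes> x \<otimes> g = a"
    then have "g \<otimes> a \<otimes> inv g = g \<otimes> (inv g \<otimes> x \<otimes> g) \<otimes> inv g"
      by simp
    also have "\<dots> = (g \<otimes> inv g) \<otimes> x \<otimes> (g \<otimes> inv g)"
      using assms by (simp only: m_assoc m_closed inv_closed)
    finally show "x = g \<otimes> a \<otimes> inv g"
      using assms by simp
  next
    assume "x = g \<otimes> a \<otimes> inv g"
    then have "inv g \<otimes> x \<otimes> g = (inv g \<otimes> g) \<otimes> a \<otimes> (inv g \<otimes> g)"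
      using assms by (simp only: m_assoc m_closed inv_closed)
    then show "inv g \<otimes> x \<otimes> g = a"
      using assms by simp
  qed
  then show ?thesis
    by (simp add: ind_def)
qed

text \<open>The walls crossed by the gallery \<open>(s t)\<^sup>n\<close> are those of \<open>(s t)\<^sup>j s\<close> for \<open>j < 2 n\<close>.\<close>

lemma sg_replicate:
  assumes a: "a \<in> S" "b \<in> S" and x: "x \<in> carrier W"
  shows "sg (concat (replicate n [(a, True), (b, True)])) x = (\<Prod>j<2 * n. ind ((a \<otimes> b) [^] j \<otimes> a) x)"
  using x
proof (induction n arbitrary: x)
  case (Suc n)
  let ?c = "a \<otimes> b"
  have car: "a \<in> carrier W" "b \<in> carrier W" "?c \<in> carrier W"
    using a by (auto simp: S_carrier)
  have inv_c: "inv ?c = b \<otimes> a"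
    using a car by (simp add: inv_mult_group inv_S)
  have ac: "a \<otimes> inv ?c = ?c \<otimes> a"
    using a car by (simp add: inv_c m_assoc)
  have step: "ind (?c [^] j \<otimes> a) (inv ?c \<otimes> x \<otimes> ?c) = ind (?c [^] Suc (Suc j) \<otimes> a) x" for j
  proof -
    have "?c \<otimes> (?c [^] j \<otimes> a) \<otimes> inv ?c = ?c \<otimes> ?c [^] j \<otimes> (a \<otimes> inv ?c)"
      using car by (simp only: m_assoc m_closed nat_pow_closed inv_closed)
    also have "?c \<otimes> ?c [^] j = ?c [^] Suc j"
      by (rule nat_pow_Suc2[symmetric, OF car(3)])
    also have "?c [^] Suc j \<otimes> (a \<otimes> inv ?c) = (?c [^] Suc j \<otimes> ?c) \<otimes> a"
      unfolding ac using car by (simp only: m_assoc m_closed nat_pow_closed)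
    also have "?c [^] Suc j \<otimes> ?c = ?c [^] Suc (Suc j)"
      by (rule nat_pow_Suc[symmetric])
    finally show ?thesis
      using ind_conj[of ?c "?c [^] j \<otimes> a" x] car Suc.prems by simp
  qed
  have 1: "ind b (a \<otimes> x \<otimes> a) = ind (?c [^] Suc 0 \<otimes> a) x"
    using ind_conj[of a b x] a car Suc.prems by (simp add: inv_S)
  have 2: "b \<otimes> (a \<otimes> x \<otimes> a) \<otimes> b = inv ?c \<otimes> x \<otimes> ?c"
    using car Suc.prems by (simp add: inv_c m_assoc)
  have "sg (concat (replicate (Suc n) [(a, True), (b, True)])) x
      = ind a x * (ind b (a \<otimes> x \<otimes> a) * sg (concat (replicate n [(a, True), (b, True)])) (b \<otimes> (a \<otimes> x \<otimes> a) \<otimes> b))"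
    by simp
  also have "\<dots> = ind (?c [^] (0::nat) \<otimes> a) x * (ind (?c [^] Suc 0 \<otimes> a) x *
      (\<Prod>j<2 * n. ind (?c [^] Suc (Suc j) \<otimes> a) x))"
    unfolding 1 2 using Suc.IH[of "inv ?c \<otimes> x \<otimes> ?c"] car Suc.prems by (simp add: step del: nat_pow_Suc)
  also have "\<dots> = (\<Prod>j<Suc (Suc (2 * n)). ind (?c [^] j \<otimes> a) x)"
    by (simp only: prod.lessThan_Suc_shift comp_def)
  finally show ?case
    by simp
qed simp

text \<open>The relation (a b)^n = 1 makes the 2 n reflections met along the relator periodic with
  period n, so every wall is crossed an even number of times.\<close>

lemma sg_relator:
  assumes r: "r \<in> coxeter_relators S M" and x: "x \<in> carrier W"
  shows "sg r x = 1"
proof -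
  obtain a b n where ab: "a \<in> S" "b \<in> S" and r_eq: "r = concat (replicate n [(a, True), (b, True)])"
    using r unfolding coxeter_relators_def by blast
  let ?c = "a \<otimes> b"
  have c: "?c \<in> carrier W" "a \<in> carrier W"
    using ab by (auto simp: S_carrier)
  have "word_val W (concat (replicate k [(a, True), (b, True)])) = ?c [^] k" for k
  proof (induction k)
    case (Suc k)
    then show ?case
      using nat_pow_Suc2[OF c(1), of k] ab c by (simp add: S_carrier m_assoc)
  qed simp
  then have "?c [^] n = \<one>"
    using val_relator(2)[OF r] by (simp add: r_eq)
  then have per: "?c [^] (j + n) = ?c [^] j" for j
    using c by (simp add: nat_pow_mult[symmetric])
  have "sg r x = (\<Prod>j\<in>{..<n + n}. ind (?c [^] j \<otimes> a) x)"
    unfolding r_eq sg_replicate[OF ab x] by (simp add: mult_2)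
  also have "{..<n + n} = {..<n} \<union> {n..<n + n}"
    by auto
  also have "(\<Prod>j\<in>{..<n} \<union> {n..<n + n}. ind (?c [^] j \<otimes> a) x)
      = (\<Prod>j<n. ind (?c [^] j \<otimes> a) x) * (\<Prod>j\<in>{n..<n + n}. ind (?c [^] j \<otimes> a) x)"
    by (rule prod.union_disjoint) auto
  also have "(\<Prod>j\<in>{n..<n + n}. ind (?c [^] j \<otimes> a) x) = (\<Prod>j<n. ind (?c [^] j \<otimes> a) x)"
    using prod.shift_bounds_nat_ivl[of "\<lambda>j. ind (?c [^] j \<otimes> a) x" 0 n n]
    by (simp add: per lessThan_atLeast0)
  also have "(\<Prod>j<n. ind (?c [^] j \<otimes> a) x) * (\<Prod>j<n. ind (?c [^] j \<otimes> a) x) = 1"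
    by (simp add: prod.distrib[symmetric])
  finally show ?thesis .
qed

text \<open>Cancellations and relators leave the parities unchanged. As words of equal value are
  equivalent by the presentation, the signs depend on the group element only.\<close>

lemma sg_word_equiv:
  assumes "word_equiv S (coxeter_relators S M) u v"
  shows "(u \<in> words S \<longleftrightarrow> v \<in> words S) \<and>
    (u \<in> words S \<longrightarrow> word_val W u = word_val W v \<and> (\<forall>x\<in>carrier W. sg u x = sg v x))"
  using assms
proof (induction rule: word_equiv.induct)
  case (cancel a u b v)
  have "sg (u @ [(a, b), (a, \<not> b)] @ v) x = sg (u @ v) x" if u: "u \<in> words S" "v \<in> words S" and x: "x \<in> carrier W" for x
  proof -
    define y where "y = inv (word_val W u) \<otimes> x \<otimes> word_val W u"
    have y: "y \<in> carrier W"
      using u x by (simp add: y_def val_carrier)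
    have "ind a (a \<otimes> y \<otimes> a) = ind a y"
      using ind_conj[of a a y] y cancel S_carrier[OF cancel] sq[OF cancel] by (simp add: inv_S)
    moreover have "a \<otimes> (a \<otimes> y \<otimes> a) \<otimes> a = y"
      using y S_carrier[OF cancel] cancel by (simp add: m_assoc[symmetric] sq S_cancel_right)
    ultimately have "sg ([(a, b), (a, \<not> b)] @ v) y = sg v y"
      by (simp add: mult.assoc[symmetric])
    then show ?thesis
      using u x by (simp add: sg_append y_def[symmetric] del: sg.simps append.simps)
  qed
  moreover have "word_val W (u @ [(a, b), (a, \<not> b)] @ v) = word_val W (u @ v)" if "u \<in> words S" "v \<in> words S"
    using that cancel by (simp add: val_append inv_S S_cancel val_carrier)
  ultimately show ?case
    using cancel by auto
next
  case (relator r u v)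
  note r = val_relator[OF relator]
  have "sg (u @ r @ v) x = sg (u @ v) x" if u: "u \<in> words S" "v \<in> words S" and x: "x \<in> carrier W" for x
  proof -
    define y where "y = inv (word_val W u) \<otimes> x \<otimes> word_val W u"
    have y: "y \<in> carrier W"
      using u x by (simp add: y_def val_carrier)
    have "sg (r @ v) y = sg v y"
      using r y sg_append[OF r(1) y, of v] sg_relator[OF relator y] by simp
    then show ?thesis
      using u x r by (simp add: sg_append y_def[symmetric])
  qed
  moreover have "word_val W (u @ r @ v) = word_val W (u @ v)" if "u \<in> words S" "v \<in> words S"
    using that r by (simp add: val_append val_carrier)
  ultimately show ?case
    using r by auto
qed auto

text \<open>\<open>sep g x\<close> is \<open>-1\<close> if the wall of the reflection \<open>x\<close> separates the fundamental chamber from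
  its translate by \<open>g\<close>, and \<open>1\<close> otherwise.\<close>

definition sep :: "'a \<Rightarrow> 'a \<Rightarrow> int" where
  "sep g = sg (SOME u. u \<in> words S \<and> word_val W u = g)"

lemma sep_val:
  assumes "u \<in> words S" "x \<in> carrier W"
  shows "sep (word_val W u) x = sg u x"
proof -
  define v where "v = (SOME v. v \<in> words S \<and> word_val W v = word_val W u)"
  have "v \<in> words S \<and> word_val W v = word_val W u"
    unfolding v_def by (rule someI[of _ u]) (use assms in simp)
  moreover from this have "word_equiv S (coxeter_relators S M) v u"
    using val_eq_iff[of v u] assms by simp
  ultimately have "sg v x = sg u x"
    using sg_word_equiv assms by blast
  then show ?thesis
    by (simp add: sep_def v_def)
qed

lemma ex_word:
  assumes "g \<in> carrier W"
  shows "\<exists>u\<in>words S. word_val W u = g"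
proof -
  have "g \<in> word_val W ` words S"
    using pres assms by (simp add: presented_by_def)
  then show ?thesis
    by auto
qed

lemma sep_mult:
  assumes "g \<in> carrier W" "h \<in> carrier W" "x \<in> carrier W"
  shows "sep (g \<otimes> h) x = sep g x * sep h (inv g \<otimes> x \<otimes> g)"
proof -
  obtain u v where "u \<in> words S" "v \<in> words S" "word_val W u = g" "word_val W v = h"
    using ex_word assms by blast
  moreover have "inv g \<otimes> x \<otimes> g \<in> carrier W"
    using assms by simp
  ultimately show ?thesis
    using sep_val[of "u @ v" x] sep_val[of u x] sep_val[of v "inv g \<otimes> x \<otimes> g"] assms
    by (simp add: val_append sg_append)
qed

lemma sep_one [simp]: "x \<in> carrier W \<Longrightarrow> sep \<one> x = 1"
  using sep_val[of "[]" x] by simp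

lemma sep_S: "a \<in> S \<Longrightarrow> x \<in> carrier W \<Longrightarrow> sep a x = ind a x"
  using sep_val[of "[(a, True)]" x] S_carrier by simp

lemma sg_cases: "sg u x = 1 \<or> sg u x = - 1"
proof (induction u arbitrary: x)
  case (Cons l u)
  obtain a b where l: "l = (a, b)"
    by (cases l)
  show ?case
    using Cons[of "a \<otimes> x \<otimes> a"] by (auto simp: l ind_def)
qed simp

lemma sep_cases: "sep g x = 1 \<or> sep g x = - 1"
  unfolding sep_def by (rule sg_cases)

lemma sep_inv:
  assumes "g \<in> carrier W" "x \<in> carrier W"
  shows "sep (inv g) (inv g \<otimes> x \<otimes> g) = sep g x"
  using sep_mult[OF assms(1) inv_closed[OF assms(1)] assms(2)] assms sep_cases[of g x]
    sep_cases[of "inv g" "inv g \<otimes> x \<otimes> g"] by auto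

text \<open>Each letter of a word adds at most one wall. An infinite family of separating walls will
  be contradicted by this finiteness.\<close>

lemma finite_sep:
  assumes "g \<in> carrier W"
  shows "finite {x \<in> carrier W. sep g x = - 1}"
proof -
  obtain u where u: "u \<in> words S" "word_val W u = g"
    using ex_word[OF assms] by blast
  have "finite {x \<in> carrier W. sg u x = - 1}"
    using u(1)
  proof (induction u)
    case (Cons l u)
    obtain a b where l: "l = (a, b)"
      by (cases l)
    have a: "a \<in> S" "u \<in> words S"
      using Cons.prems by (auto simp: l)
    have "{x \<in> carrier W. sg (l # u) x = - 1} \<subseteq> {a} \<union> (\<lambda>y. a \<otimes> y \<otimes> a) ` {y \<in> carrier W. sg u y = - 1}"
    proof
      fix x assume x: "x \<in> {x \<in> carrier W. sg (l # u) x = - 1}"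
      show "x \<in> {a} \<union> (\<lambda>y. a \<otimes> y \<otimes> a) ` {y \<in> carrier W. sg u y = - 1}"
      proof (cases "x = a")
        case False
        then have "sg u (a \<otimes> x \<otimes> a) = - 1"
          using x by (simp add: l ind_def)
        moreover have "x = a \<otimes> (a \<otimes> x \<otimes> a) \<otimes> a"
          using x a S_carrier[OF a(1)] by (simp add: m_assoc[symmetric] sq S_cancel_right)
        ultimately show ?thesis
          using x S_carrier[OF a(1)] by blast
      qed simp
    qed
    moreover have "finite ({a} \<union> (\<lambda>y. a \<otimes> y \<otimes> a) ` {y \<in> carrier W. sg u y = - 1})"
      using Cons.IH[OF a(2)] by simp
    ultimately show ?case
      by (rule finite_subset)
  qed simp
  moreover have "{x \<in> carrier W. sep g x = - 1} = {x \<in> carrier W. sg u x = - 1}"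
    using sep_val[OF u(1)] u(2) by auto
  ultimately show ?thesis
    by simp
qed

subsection \<open>Word length\<close>

abbreviation pval :: "'a list \<Rightarrow> 'a" where
  "pval u \<equiv> foldr (\<otimes>) u \<one>"

definition posw :: "'a list \<Rightarrow> ('a \<times> bool) list" where
  "posw = map (\<lambda>a. (a, True))"

lemma posw_words: "u \<in> lists S \<Longrightarrow> posw u \<in> words S"
  by (induction u) (auto simp: posw_def)

lemma val_posw: "u \<in> lists S \<Longrightarrow> word_val W (posw u) = pval u"
  by (induction u) (auto simp: posw_def)

lemma pval_carrier: "u \<in> lists S \<Longrightarrow> pval u \<in> carrier W"
  using val_posw val_carrier posw_words by metis

lemma ex_pword:
  assumes "g \<in> carrier W"
  shows "\<exists>u\<in>lists S. pval u = g"
proof -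
  obtain u where u: "u \<in> words S" "word_val W u = g"
    using ex_word[OF assms] by blast
  have "map fst u \<in> lists S"
    using u(1) by (force simp: words_def)
  moreover have "pval (map fst u) = word_val W u"
    using u(1) by (induction u) (auto simp: inv_S)
  ultimately show ?thesis
    using u(2) by (intro bexI[of _ "map fst u"]) simp_all
qed

lemma word_length_le: "u \<in> lists S \<Longrightarrow> word_length W S (pval u) \<le> length u"
  unfolding word_length_def by (rule Least_le) blast

lemma word_length_attained:
  assumes "g \<in> carrier W"
  shows "\<exists>u\<in>lists S. length u = word_length W S g \<and> pval u = g"
proof -
  have "\<exists>n. \<exists>u\<in>lists S. length u = n \<and> pval u = g"
    using ex_pword[OF assms] by blast
  then show ?thesis
    unfolding word_length_def by (rule LeastI_ex)
qed

text \<open>The exchange condition: reflecting the end of the gallery in x amounts to deleting the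
  letter at which the gallery crosses the wall of x.\<close>

lemma exchange:
  assumes "u \<in> lists S" "x \<in> carrier W" "sg (posw u) x = - 1"
  shows "\<exists>v\<in>lists S. length v < length u \<and> pval v = x \<otimes> pval u"
  using assms
proof (induction u arbitrary: x rule: list.induct)
  case (Cons a u)
  have a: "a \<in> S" "a \<in> carrier W" "u \<in> lists S" "pval u \<in> carrier W"
    using Cons.prems(1) by (auto simp: S_carrier pval_carrier)
  show ?case
  proof (cases "x = a")
    case True
    then show ?thesis
      using a by (intro bexI[of _ u]) (simp_all add: S_cancel)
  next
    case False
    then have "sg (posw u) (a \<otimes> x \<otimes> a) = - 1"
      using Cons.prems(3) by (simp add: posw_def ind_def)
    then obtain v where v: "v \<in> lists S" "length v < length u" "pval v = a \<otimes> x \<otimes> a \<otimes> pval u"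
      using Cons.IH[of "a \<otimes> x \<otimes> a"] a Cons.prems(2) by auto
    have "a \<otimes> (a \<otimes> x \<otimes> a \<otimes> pval u) = x \<otimes> (a \<otimes> pval u)"
      using a Cons.prems(2) by (simp add: m_assoc S_cancel)
    with v a show ?thesis
      by (intro bexI[of _ "a # v"]) simp_all
  qed
qed (simp add: posw_def)

text \<open>A shortest word of g crosses the wall of a, and the exchange condition shortens it.
  Together with the opposite case this matches the roots, defined by length, with the two values of
  \<open>sep\<close>.\<close>

lemma word_length_less:
  assumes a: "a \<in> S" and g: "g \<in> carrier W" and sep: "sep g a = - 1"
  shows "word_length W S (a \<otimes> g) < word_length W S g"
proof -
  obtain u where u: "u \<in> lists S" "length u = word_length W S g" "pval u = g"
    using word_length_attained[OF g] by blast
  have "sg (posw u) a = - 1"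
    using sep_val[OF posw_words[OF u(1)] S_carrier[OF a]] sep by (simp add: val_posw u)
  then obtain v where v: "v \<in> lists S" "length v < length u" "pval v = a \<otimes> g"
    using exchange[OF u(1) S_carrier[OF a]] u(3) by blast
  then show ?thesis
    using word_length_le[OF v(1)] u(2) by simp
qed

lemma word_length_greater:
  assumes a: "a \<in> S" and g: "g \<in> carrier W" and sep: "sep g a = 1"
  shows "word_length W S g < word_length W S (a \<otimes> g)"
proof -
  have "sep (a \<otimes> g) a = - 1"
    using sep_mult[of a g a] a S_carrier[OF a] g sep by (simp add: sep_S ind_def inv_S sq)
  then have "word_length W S (a \<otimes> (a \<otimes> g)) < word_length W S (a \<otimes> g)"
    using a S_carrier[OF a] g by (intro word_length_less) auto
  then show ?thesis
    using a g by (simp add: S_cancel)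
qed

end

section \<open>Two walls whose reflections generate an infinite dihedral group\<close>

locale infinite_dihedral = coxeter +
  fixes s r :: 'a
  assumes s: "s \<in> S" and r: "r \<in> carrier W" and rr: "r \<otimes> r = \<one>" and sep_rr: "sep r r = - 1"
    and inf: "0 < k \<Longrightarrow> (s \<otimes> r) [^] (k::nat) \<noteq> \<one>"
begin

text \<open>\<open>cp\<close> are the rotations and \<open>tt\<close> the reflections of the
  dihedral group generated by s and r, with s = \<open>tt 0\<close> and r = \<open>tt (- 1)\<close>.
  Conjugation acts on the indices of reflections by affine maps that preserve parity.\<close>

definition cp :: "int \<Rightarrow> 'a" where "cp k = (s \<otimes> r) [^] k"
definition tt :: "int \<Rightarrow> 'a" where "tt k = cp k \<otimes> s"

lemma sc: "s \<in> carrier W"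
  using s by (rule S_carrier)

lemma ss: "s \<otimes> s = \<one>"
  using s by (rule sq)

lemma cp_carrier [simp]: "cp k \<in> carrier W"
  using sc r by (simp add: cp_def)

lemma tt_carrier [simp]: "tt k \<in> carrier W"
  using sc by (simp add: tt_def)

lemma cp_0 [simp]: "cp 0 = \<one>"
  by (simp add: cp_def)

lemma cp_mult [simp]: "cp i \<otimes> cp j = cp (i + j)"
  using sc r by (simp add: cp_def int_pow_mult)

lemma inv_cp [simp]: "inv (cp k) = cp (- k)"
  using sc r by (simp add: cp_def int_pow_neg)

lemma tt_0: "tt 0 = s"
  using sc by (simp add: tt_def)

lemma inv_c: "inv (s \<otimes> r) = r \<otimes> s"
  using sc r ss rr by (intro inv_equality) (simp_all add: m_assoc, simp add: m_assoc[symmetric])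

lemma s_cp_nat: "s \<otimes> (s \<otimes> r) [^] n = inv ((s \<otimes> r) [^] (n::nat)) \<otimes> s"
proof (induction n)
  case (Suc n)
  let ?c = "s \<otimes> r"
  have c: "?c \<in> carrier W" "r \<in> carrier W" "s \<in> carrier W"
    using sc r by auto
  have "s \<otimes> ?c = inv ?c \<otimes> s"
    using c ss by (simp add: inv_c m_assoc) (simp add: m_assoc[symmetric])
  then have *: "inv ?c \<otimes> s = s \<otimes> ?c"
    by simp
  have "s \<otimes> ?c [^] Suc n = (s \<otimes> ?c [^] n) \<otimes> ?c"
    using c by (simp add: m_assoc)
  also have "\<dots> = inv (?c [^] n) \<otimes> (s \<otimes> ?c)"
    using c by (simp only: Suc.IH m_assoc inv_closed nat_pow_closed)
  also have "\<dots> = (inv (?c [^] n) \<otimes> inv ?c) \<otimes> s"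
    using c by (simp only: *[symmetric] m_assoc inv_closed nat_pow_closed)
  also have "inv (?c [^] n) \<otimes> inv ?c = inv (?c \<otimes> ?c [^] n)"
    using c by (simp add: inv_mult_group)
  also have "?c \<otimes> ?c [^] n = ?c [^] Suc n"
    using c by (simp only: nat_pow_Suc2)
  finally show ?case .
qed (simp add: sc)

lemma s_cp: "s \<otimes> cp k = cp (- k) \<otimes> s"
proof (cases "0 \<le> k")
  case True
  then obtain n where k: "k = int n"
    using zero_le_imp_eq_int by blast
  have "cp (- k) = inv ((s \<otimes> r) [^] n)"
    using sc r by (simp add: cp_def k int_pow_neg int_pow_int)
  moreover have "cp k = (s \<otimes> r) [^] n"
    by (simp add: cp_def k int_pow_int)
  ultimately show ?thesis
    using s_cp_nat[of n] by simp
next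
  case False
  define n where "n = nat (- k)"
  have k: "k = - int n"
    using False by (simp add: n_def)
  have 1: "cp k = inv ((s \<otimes> r) [^] n)"
    using sc r by (simp add: cp_def k int_pow_neg int_pow_int)
  have 2: "cp (- k) = (s \<otimes> r) [^] n"
    by (simp add: cp_def k int_pow_int)
  have "cp (- k) \<otimes> s = s \<otimes> (s \<otimes> cp (- k)) \<otimes> s"
    using sc by (simp add: m_assoc[symmetric] ss)
  also have "\<dots> = s \<otimes> (cp k \<otimes> s) \<otimes> s"
    using s_cp_nat[of n] by (simp only: 1 2)
  also have "\<dots> = s \<otimes> cp k"
    using sc by (simp add: m_assoc ss)
  finally show ?thesis
    by simp
qed

lemma cp_tt [simp]: "cp i \<otimes> tt j = tt (i + j)"
  using sc by (simp add: tt_def m_assoc[symmetric])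

lemma tt_cp [simp]: "tt i \<otimes> cp j = tt (i - j)"
proof -
  have "tt i \<otimes> cp j = cp i \<otimes> (s \<otimes> cp j)"
    using sc by (simp add: tt_def m_assoc)
  then show ?thesis
    using sc by (simp add: s_cp tt_def m_assoc[symmetric])
qed

lemma tt_tt [simp]: "tt i \<otimes> tt j = cp (i - j)"
proof -
  have "tt i \<otimes> tt j = (tt i \<otimes> cp j) \<otimes> s"
    using sc by (simp only: tt_def[of j] m_assoc tt_carrier cp_carrier)
  also have "\<dots> = cp (i - j) \<otimes> (s \<otimes> s)"
    using sc by (simp only: tt_cp) (simp add: tt_def m_assoc)
  finally show ?thesis
    by (simp add: ss)
qed

lemma inv_tt [simp]: "inv (tt k) = tt k"
  by (rule inv_equality) simp_all

lemma cp_inj: "cp i = cp j \<longleftrightarrow> i = j"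
proof -
  have *: "cp k \<noteq> \<one>" if "0 < k" for k
    using inf[of "nat k"] that int_pow_int[of W "s \<otimes> r" "nat k"] by (simp add: cp_def)
  have **: "i \<le> j" if "cp i = cp j" for i j
  proof (rule ccontr)
    assume "\<not> i \<le> j"
    moreover have "cp (i - j) = \<one>"
      using cp_mult[of i "- j"] cp_mult[of j "- j"] that by simp
    ultimately show False
      using *[of "i - j"] by simp
  qed
  then show ?thesis
    by (metis order_antisym)
qed

lemma tt_inj: "tt i = tt j \<longleftrightarrow> i = j"
  using sc by (simp add: tt_def cp_inj)

lemma r_eq: "r = tt (- 1)"
proof -
  have "cp (- 1) = inv (s \<otimes> r)"
    using sc r by (simp add: cp_def int_pow_neg)
  then show ?thesis
    using sc r by (simp add: tt_def inv_c m_assoc ss)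
qed

lemma conj_s: "inv s \<otimes> tt k \<otimes> s = tt (- k)"
proof -
  have "inv (tt 0) \<otimes> tt k \<otimes> tt 0 = tt (- k)"
    by simp
  then show ?thesis
    by (simp only: tt_0)
qed

lemma conj_s_cp: "inv (cp i) \<otimes> s \<otimes> cp i = tt (2 * (- i))"
proof -
  have "inv (cp i) \<otimes> tt 0 \<otimes> cp i = tt (2 * (- i))"
    by simp
  then show ?thesis
    by (simp only: tt_0)
qed

lemma conj_s_tt: "inv (tt i) \<otimes> s \<otimes> tt i = tt (2 * i)"
proof -
  have "inv (tt i) \<otimes> tt 0 \<otimes> tt i = tt (2 * i)"
    by simp
  then show ?thesis
    by (simp only: tt_0)
qed

lemma tt_eq_s: "tt k = s \<longleftrightarrow> k = 0"
  using tt_inj[of k 0] by (simp only: tt_0)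

lemma sep_s: "x \<in> carrier W \<Longrightarrow> sep s x = (if x = s then - 1 else 1)"
  using sep_S[OF s] by (simp add: ind_def)

lemma sep_append_letter:
  assumes "g \<in> carrier W" "a \<in> S" "x \<in> carrier W"
  shows "sep (g \<otimes> a) x = sep g x * (if x = g \<otimes> a \<otimes> inv g then - 1 else 1)"
  using sep_mult[OF assms(1) S_carrier[OF assms(2)] assms(3)] sep_S[OF assms(2), of "inv g \<otimes> x \<otimes> g"]
    ind_conj[OF assms(1) S_carrier[OF assms(2)] assms(3)] assms
  by (simp add: ind_def)

text \<open>Only the walls of the dihedral subgroup matter: with respect to them, every chamber looks
  like a chamber of the subgroup.\<close>

lemma dihedral_state:
  assumes "w \<in> carrier W"
  shows "\<exists>x. (x \<in> range cp \<or> x \<in> range tt) \<and> (\<forall>k. sep w (tt k) = sep x (tt k))"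
proof -
  \<comment> \<open>The word is reversed so that the induction appends a letter on the right, which
    is a move to an adjacent chamber.\<close>
  have "\<exists>x. (x \<in> range cp \<or> x \<in> range tt) \<and> (\<forall>k. sep (word_val W (rev u)) (tt k) = sep x (tt k))"
    if "u \<in> words S" for u
    using that
  proof (induction u)
    case Nil
    have "\<one> \<in> range cp"
      by (rule range_eqI[of _ cp 0]) simp
    then show ?case
      by (intro exI[of _ \<one>]) simp
  next
    case (Cons l u)
    obtain a b where l: "l = (a, b)"
      by (cases l)
    have a: "a \<in> S" "a \<in> carrier W" "u \<in> words S" and ru: "rev u \<in> words S"
      using Cons.prems S_carrier by (auto simp: l words_def)
    define w where "w = word_val W (rev u)"
    have w: "w \<in> carrier W"
      using ru by (simp add: w_def val_carrier)
    have wa: "word_val W (rev (l # u)) = w \<otimes> a"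
      using ru a by (simp add: l val_append w_def inv_S)
    obtain x where x: "x \<in> range cp \<or> x \<in> range tt" and "\<forall>k. sep w (tt k) = sep x (tt k)"
      using Cons.IH[OF a(3)] unfolding w_def by (elim exE conjE)
    then have xk: "sep w (tt k) = sep x (tt k)" for k
      by simp
    show ?case
    proof (cases "w \<otimes> a \<otimes> inv w \<in> range tt")
      case False
      then have "tt k \<noteq> w \<otimes> a \<otimes> inv w" for k
        using rangeI[of tt k] by (intro notI) simp
      then have "sep (w \<otimes> a) (tt k) = sep x (tt k)" for k
        using sep_append_letter[OF w a(1) tt_carrier[of k]] xk by simp
      then show ?thesis
        unfolding wa using x by blast
    next
      case True
      then obtain j where j: "w \<otimes> a \<otimes> inv w = tt j"
        by auto
      have xc: "x \<in> carrier W"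
        using x by auto
      \<comment> \<open>Crossing the wall of \<open>tt j\<close> is left multiplication by
        \<open>tt j\<close>, a move that can be imitated on x.\<close>
      have "w \<otimes> a = (w \<otimes> a \<otimes> inv w) \<otimes> w"
        using w a by (simp add: m_assoc)
      then have wa2: "w \<otimes> a = tt j \<otimes> w"
        by (simp only: j)
      have "sep (tt j \<otimes> w) (tt k) = sep (tt j \<otimes> x) (tt k)" for k
        using sep_mult[OF tt_carrier[of j] w tt_carrier[of k]] sep_mult[OF tt_carrier[of j] xc tt_carrier[of k]] xk
        by simp
      moreover have "tt j \<otimes> x \<in> range cp \<or> tt j \<otimes> x \<in> range tt"
        using x by auto
      ultimately show ?thesis
        unfolding wa wa2 by blast
    qed
  qed
  moreover obtain u where "u \<in> words S" "word_val W u = w"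
    using ex_word[OF assms] by blast
  ultimately show ?thesis
    using \<open>u \<in> words S\<close> by (metis in_listsI in_lists_conv_set rev_rev_ident set_rev words_def)
qed

text \<open>Whenever the gallery is about to cross the wall of r, the rest of it is reflected back;
  the disjunction on w' records the parity of the reflections made. The folded gallery stays beyond
  the wall of r, so the change of side with respect to s happens there, at a panel of the wall of
  s.\<close>

lemma fold_gallery:
  assumes "u \<in> lists S" "w \<in> carrier W" "w' \<in> carrier W" "sep w r = - 1" "sep w' r = - 1"
    and "w' = w \<otimes> pval u \<or> w' = r \<otimes> w \<otimes> pval u" and "sep w s \<noteq> sep w' s"
  shows "\<exists>y a. y \<in> carrier W \<and> a \<in> S \<and> sep y r = - 1 \<and> s \<otimes> y = y \<otimes> a"
  using assms
proof (induction u arbitrary: w rule: list.induct)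
  case Nil
  have "w' \<noteq> w"
    using Nil.prems by auto
  then have "w' = r \<otimes> w"
    using Nil.prems r by simp
  then have "sep w' r = 1"
    using sep_mult[OF r Nil.prems(2) r] Nil.prems(4) sep_rr r rr by (simp add: m_assoc inv_equality[OF rr r r])
  then show ?case
    using Nil.prems(5) by simp
next
  case (Cons a u)
  have a: "a \<in> S" "a \<in> carrier W" "u \<in> lists S" "pval u \<in> carrier W"
    using Cons.prems(1) by (auto simp: S_carrier pval_carrier)
  note w = Cons.prems(2)
  have conj: "g \<otimes> w = w \<otimes> a" if "g = w \<otimes> a \<otimes> inv w" for g
    using w a unfolding that by (simp add: m_assoc)
  show ?case
  proof (cases "r = w \<otimes> a \<otimes> inv w")
    case True
    then have rw: "r \<otimes> w = w \<otimes> a"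
      by (rule conj)
    have "w \<otimes> pval (a # u) = r \<otimes> w \<otimes> pval u"
      unfolding rw using w a by (simp add: m_assoc)
    moreover have "r \<otimes> w \<otimes> pval (a # u) = w \<otimes> pval u"
    proof -
      have "r \<otimes> w \<otimes> pval (a # u) = (w \<otimes> a) \<otimes> (a \<otimes> pval u)"
        using rw by simp
      then show ?thesis
        using w a by (simp add: m_assoc S_cancel)
    qed
    ultimately show ?thesis
      using Cons.prems a by (intro Cons.IH[of w]) auto
  next
    case False
    then have sr: "sep (w \<otimes> a) r = - 1"
      using sep_append_letter[OF w a(1) r] Cons.prems(4) by simp
    show ?thesis
    proof (cases "s = w \<otimes> a \<otimes> inv w")
      case True
      then have "s \<otimes> w = w \<otimes> a"
        by (rule conj)
      then show ?thesis
        using w a Cons.prems(4) by blast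
    next
      case False
      then have "sep (w \<otimes> a) s = sep w s"
        using sep_append_letter[OF w a(1) sc] by simp
      moreover have "w \<otimes> pval (a # u) = (w \<otimes> a) \<otimes> pval u" "r \<otimes> w \<otimes> pval (a # u) = r \<otimes> (w \<otimes> a) \<otimes> pval u"
        using w a r by (simp_all add: m_assoc)
      ultimately show ?thesis
        using Cons.prems a w sr by (intro Cons.IH[of "w \<otimes> a"]) auto
    qed
  qed
qed

text \<open>The dihedral element x that imitates y makes j = x^-1 s x cross a single dihedral wall,
  as a simple reflection would, although j differs from s. Then j s = \<open>cp (2 * m)\<close>
  crosses no dihedral wall of odd index, its powers d satisfy r d = d^-1 r, and comparing signs
  makes infinitely many walls separate the chambers of 1 and r.\<close>

lemma no_crossing_panel:
  assumes y: "y \<in> carrier W" "a \<in> S" "sep y r = - 1" "s \<otimes> y = y \<otimes> a"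
  shows False
proof -
  obtain x where x: "x \<in> range cp \<or> x \<in> range tt" and "\<forall>k. sep y (tt k) = sep x (tt k)"
    using dihedral_state[OF y(1)] by (elim exE conjE)
  then have xk: "sep y (tt k) = sep x (tt k)" for k
    by simp
  have xc: "x \<in> carrier W"
    using x by auto
  define j where "j = inv x \<otimes> s \<otimes> x"
  have s_eq: "y \<otimes> a \<otimes> inv y = s"
  proof -
    have "y \<otimes> a \<otimes> inv y = s \<otimes> y \<otimes> inv y"
      using y(4) by simp
    then show ?thesis
      using y(1) sc by (simp add: m_assoc)
  qed
  \<comment> \<open>Passing from y to s y = y a crosses the wall of s only; transported to x, this
    describes the walls crossed by j.\<close>
  have key: "sep j (inv x \<otimes> tt k \<otimes> x) = (if tt k = s then - 1 else 1)" for k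
  proof -
    have xj: "s \<otimes> x = x \<otimes> j"
      using xc sc by (simp add: j_def m_assoc[symmetric])
    have jc: "j \<in> carrier W"
      using xc sc by (simp add: j_def)
    have "sep y (tt k) * (if tt k = s then - 1 else 1) = sep (s \<otimes> y) (tt k)"
      unfolding y(4) sep_append_letter[OF y(1,2) tt_carrier] s_eq ..
    also have "\<dots> = sep (s \<otimes> x) (tt k)"
      using sep_mult[OF sc y(1) tt_carrier[of k]] sep_mult[OF sc xc tt_carrier[of k]] conj_s[of k]
      by (simp add: xk)
    also have "\<dots> = sep x (tt k) * sep j (inv x \<otimes> tt k \<otimes> x)"
      unfolding xj by (rule sep_mult[OF xc jc tt_carrier])
    finally show ?thesis
      using sep_cases[of y "tt k"] xk[of k] by auto
  qed
  \<comment> \<open>The chambers of 1 and s lie on the near side of the wall of r, whereas y, and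
    hence x, lies beyond it.\<close>
  have x_ne: "x \<noteq> \<one>" "x \<noteq> s"
  proof -
    have "sep x r = - 1"
      using xk[of "- 1"] y(3) by (simp add: r_eq[symmetric])
    moreover have "s \<noteq> r"
      using tt_inj[of 0 "- 1"] tt_0 r_eq by auto
    ultimately show "x \<noteq> \<one>" "x \<noteq> s"
      using r sep_s[OF r] by auto
  qed
  obtain m where jm: "j = tt (2 * m)" and m: "m \<noteq> 0"
    and key': "\<And>k. sep j (tt k) = (if k = 2 * m then - 1 else 1)"
  proof -
    consider i where "x = cp i" | i where "x = tt i"
      using x by auto
    then show ?thesis
    proof cases
      case 1
      have "j = tt (2 * (- i))"
        unfolding j_def 1 by (rule conj_s_cp)
      moreover have "- i \<noteq> 0"
        using x_ne(1) 1 by auto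
      moreover have "sep j (tt k) = (if k = 2 * (- i) then - 1 else 1)" for k
        using key[of "k + 2 * i"] by (simp add: 1 tt_eq_s)
      ultimately show ?thesis
        by (rule that)
    next
      case 2
      have "j = tt (2 * i)"
        unfolding j_def 2 by (rule conj_s_tt)
      moreover have "i \<noteq> 0"
        using x_ne(2) 2 tt_0 by auto
      moreover have "sep j (tt k) = (if k = 2 * i then - 1 else 1)" for k
        using key[of "2 * i - k"] by (simp add: 2 tt_eq_s)
      ultimately show ?thesis
        by (rule that)
    qed
  qed
  \<comment> \<open>Each of the factors \<open>tt (2 * m)\<close> and \<open>tt 0\<close> crosses
    one dihedral wall, of even index, and conjugation preserves parity.\<close>
  have d1: "sep (cp (2 * m)) (tt k) = 1" if "odd k" for k
  proof -
    have "cp (2 * m) = tt (2 * m) \<otimes> tt 0"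
      by simp
    moreover have "sep (tt (2 * m) \<otimes> tt 0) (tt k) = sep (tt (2 * m)) (tt k) * sep (tt 0) (inv (tt (2 * m)) \<otimes> tt k \<otimes> tt (2 * m))"
      by (rule sep_mult) simp_all
    moreover have "sep (tt (2 * m)) (tt k) = 1"
      using key'[of k] that jm by auto
    moreover have "sep (tt 0) (inv (tt (2 * m)) \<otimes> tt k \<otimes> tt (2 * m)) = 1"
      using that sep_s[OF tt_carrier, of "4 * m - k"] tt_inj[of "4 * m - k" 0] by (auto simp: tt_0)
    ultimately show ?thesis
      by simp
  qed
  have dn: "sep (cp (2 * m * int n)) (tt k) = 1" if "odd k" for n k
    using that
  proof (induction n arbitrary: k)
    case (Suc n)
    have "cp (2 * m * int (Suc n)) = cp (2 * m) \<otimes> cp (2 * m * int n)"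
      by (simp add: algebra_simps)
    also have "sep (cp (2 * m) \<otimes> cp (2 * m * int n)) (tt k)
        = sep (cp (2 * m)) (tt k) * sep (cp (2 * m * int n)) (inv (cp (2 * m)) \<otimes> tt k \<otimes> cp (2 * m))"
      by (rule sep_mult) simp_all
    also have "inv (cp (2 * m)) \<otimes> tt k \<otimes> cp (2 * m) = tt (k - 4 * m)"
      by simp
    finally show ?case
      using Suc d1 by simp
  qed simp
  \<comment> \<open>Both sides of r d = d^-1 r are evaluated at the wall of r, whose index -1 is
    odd; at odd indices d and its inverse have sign 1.\<close>
  have all: "sep r (tt (4 * m * int n - 1)) = - 1" for n
  proof -
    define d where "d = cp (2 * m * int n)"
    have d: "d \<in> carrier W" "inv d \<in> carrier W"
      by (simp_all add: d_def)
    have sd: "sep d (tt k) = 1" if "odd k" for k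
      unfolding d_def by (rule dn[OF that])
    have inv_d: "sep (inv d) (tt k) = 1" if "odd k" for k
    proof -
      have "inv d \<otimes> tt (k + 4 * m * int n) \<otimes> d = tt k"
        by (simp add: d_def)
      then show ?thesis
        using sep_inv[OF d(1) tt_carrier, of "k + 4 * m * int n"] sd[of "k + 4 * m * int n"] that by simp
    qed
    have "tt (- 1) \<otimes> d = inv d \<otimes> tt (- 1)"
      by (simp add: d_def tt_inj)
    then have rd: "r \<otimes> d = inv d \<otimes> r"
      by (simp only: r_eq[symmetric])
    have "sep (r \<otimes> d) r = sep r r * sep d (inv r \<otimes> r \<otimes> r)"
      by (rule sep_mult[OF r d(1) r])
    then have "sep (r \<otimes> d) r = - 1"
      using sd[of "- 1"] r sep_rr by (simp add: r_eq[symmetric])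
    moreover have "sep (inv d \<otimes> r) r = sep (inv d) r * sep r (inv (inv d) \<otimes> r \<otimes> inv d)"
      by (rule sep_mult[OF d(2) r r])
    moreover have "sep (inv d) r = 1"
      using inv_d[of "- 1"] by (simp add: r_eq[symmetric])
    moreover have "inv (inv d) \<otimes> tt (- 1) \<otimes> inv d = tt (4 * m * int n - 1)"
      by (simp add: d_def tt_inj)
    then have "inv (inv d) \<otimes> r \<otimes> inv d = tt (4 * m * int n - 1)"
      by (simp only: r_eq[symmetric])
    ultimately show ?thesis
      unfolding rd by simp
  qed
  have "inj (\<lambda>n. tt (4 * m * int n - 1))"
    using m by (auto simp: inj_def tt_inj)
  then have "infinite (range (\<lambda>n. tt (4 * m * int n - 1)))"
    by (rule range_inj_infinite)
  moreover have "range (\<lambda>n. tt (4 * m * int n - 1)) \<subseteq> {x \<in> carrier W. sep r x = - 1}"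
    using all by auto
  ultimately show False
    using finite_sep[OF r] finite_subset by blast
qed

lemma same_side:
  assumes w: "w1 \<in> carrier W" "w2 \<in> carrier W" "sep w1 r = - 1" "sep w2 r = - 1"
  shows "sep w1 s = sep w2 s"
proof (rule ccontr)
  assume ne: "sep w1 s \<noteq> sep w2 s"
  obtain u where u: "u \<in> lists S" "pval u = inv w1 \<otimes> w2"
    using ex_pword[of "inv w1 \<otimes> w2"] w by auto
  have "w2 = w1 \<otimes> pval u"
    using w u by (simp add: m_assoc[symmetric])
  then have "\<exists>y a. y \<in> carrier W \<and> a \<in> S \<and> sep y r = - 1 \<and> s \<otimes> y = y \<otimes> a"
    using fold_gallery[OF u(1) w(1,2,3,4)] ne by blast
  then show False
    using no_crossing_panel by blast
qed

end

section \<open>From disjoint walls to the sign condition\<close>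

context coxeter
begin

text \<open>The gallery of g^-1 a g goes out and returns symmetrically: the signs of its two halves
  agree and cancel, and the middle letter contributes -1.\<close>

lemma sep_conj:
  assumes g: "g \<in> carrier W" and a: "a \<in> S"
  shows "sep (inv g \<otimes> a \<otimes> g) (inv g \<otimes> a \<otimes> g) = - 1"
proof -
  define x where "x = inv g \<otimes> a \<otimes> g"
  have ac: "a \<in> carrier W"
    using a by (rule S_carrier)
  have x: "x \<in> carrier W"
    using g ac by (simp add: x_def)
  have gx: "g \<otimes> x \<otimes> inv g = a"
    using g ac by (simp add: x_def m_assoc) (simp add: m_assoc[symmetric])
  have "sep (inv g \<otimes> (a \<otimes> g)) x = sep (inv g) x * sep (a \<otimes> g) (inv (inv g) \<otimes> x \<otimes> inv g)"
    using g ac x by (intro sep_mult) auto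
  also have "inv (inv g) \<otimes> x \<otimes> inv g = a"
    using g gx by simp
  also have "sep (a \<otimes> g) a = sep a a * sep g (inv a \<otimes> a \<otimes> a)"
    by (rule sep_mult[OF ac g ac])
  also have "inv a \<otimes> a \<otimes> a = a"
    using ac by simp
  also have "sep a a = - 1"
    using sep_S[OF a ac] by (simp add: ind_def)
  also have "sep (inv g) x = sep g a"
    using sep_inv[OF g ac] by (simp add: x_def)
  finally have "sep x x = - (sep g a * sep g a)"
    using g ac by (simp add: x_def m_assoc)
  then show ?thesis
    using sep_cases[of g a] by (auto simp: x_def)
qed

text \<open>If \<open>g\<close> does not commute with \<open>s\<close>, the walls of \<open>s\<close> and \<open>g\<^sup>-\<^sup>1 s g\<close> are disjoint, since their
  product is a nontrivial element of the torsion-free group \<open>H\<close>.\<close>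

lemma Cotlar_condition:
  assumes H: "subgroup H W" "torsion_free W H" and s: "s \<in> S" and norm: "\<And>h. h \<in> H \<Longrightarrow> s \<otimes> h \<otimes> s \<in> H"
    and g: "g \<in> H" and ns: "g \<otimes> s \<noteq> s \<otimes> g" and h: "h \<in> carrier W"
  shows "sep (inv g) s = sep h s \<or> sep (g \<otimes> h) s = sep g s"
proof (rule disjCI)
  assume ne: "sep (g \<otimes> h) s \<noteq> sep g s"
  interpret H: subgroup H W by (rule H)
  have car: "g \<in> carrier W" "s \<in> carrier W" "inv g \<in> carrier W"
    using g s by (auto simp: S_carrier)
  define r where "r = inv g \<otimes> s \<otimes> g"
  have rc: "r \<in> carrier W"
    using car by (simp add: r_def)
  have rr: "r \<otimes> r = \<one>"
  proof -
    have "r \<otimes> r = inv g \<otimes> (s \<otimes> (g \<otimes> inv g) \<otimes> s) \<otimes> g"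
      using car by (simp only: r_def m_assoc m_closed)
    then show ?thesis
      using car by (simp add: sq[OF s] m_assoc)
  qed
  have rs: "r \<noteq> s"
  proof
    assume "r = s"
    then have "g \<otimes> s = g \<otimes> (inv g \<otimes> s \<otimes> g)"
      by (simp add: r_def)
    also have "\<dots> = s \<otimes> g"
      using car by (simp add: m_assoc[symmetric])
    finally show False
      using ns by simp
  qed
  have srH: "s \<otimes> r \<in> H"
  proof -
    have "s \<otimes> r = (s \<otimes> inv g \<otimes> s) \<otimes> g"
      using car by (simp add: r_def m_assoc)
    then show ?thesis
      using norm[OF H.m_inv_closed[OF g]] g by simp
  qed
  have sr: "s \<otimes> r \<noteq> \<one>"
  proof
    assume "s \<otimes> r = \<one>"
    then have "s \<otimes> (s \<otimes> r) = s"
      using car by simp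
    then show False
      using rs S_cancel[OF s rc] by simp
  qed
  interpret infinite_dihedral W S M s r
  proof unfold_locales
    show "s \<in> S" "r \<in> carrier W" "r \<otimes> r = \<one>"
      by fact+
    show "sep r r = - 1"
      unfolding r_def by (rule sep_conj[OF car(1) s])
    show "(s \<otimes> r) [^] k \<noteq> \<one>" if "0 < k" for k :: nat
      using H(2) srH sr that by (auto simp: torsion_free_def)
  qed
  \<comment> \<open>A change of sign from g to g h thus means that h lies beyond the wall of r, on
    which side all chambers agree about s.\<close>
  have "sep (g \<otimes> h) s = sep g s * sep h r"
    using sep_mult[OF car(1) h car(2)] by (simp add: r_def)
  then have hr: "sep h r = - 1"
    using ne sep_cases[of h r] by auto
  have grg: "g \<otimes> r \<otimes> inv g = s"
    using car by (simp add: r_def m_assoc) (simp add: m_assoc[symmetric])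
  \<comment> \<open>The chambers of g^-1 and g^-1 s are adjacent across the wall of r, so exactly
    one of them lies beyond it; since r differs from s, both lie on the same side of the wall of
    s.\<close>
  define w where "w = (if sep (inv g) r = - 1 then inv g else inv g \<otimes> s)"
  have ginv: "sep (inv g \<otimes> s) x = sep (inv g) x * sep s (g \<otimes> x \<otimes> inv g)" if "x \<in> carrier W" for x
    using sep_mult[OF car(3) car(2) that] car by simp
  have gsg: "g \<otimes> s \<otimes> inv g \<noteq> s"
  proof
    assume "g \<otimes> s \<otimes> inv g = s"
    then have "g \<otimes> s \<otimes> inv g \<otimes> g = s \<otimes> g"
      by simp
    then show False
      using ns car by (simp add: m_assoc)
  qed
  have "sep w r = - 1" "sep w s = sep (inv g) s" "w \<in> carrier W"
    using ginv[OF rc] ginv[OF car(2)] sep_cases[of "inv g" r] grg gsg car sep_s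
    by (auto simp: w_def)
  then show "sep (inv g) s = sep h s"
    using same_side[of w h] h hr by simp
qed

end

section \<open>Bounded operators on the completion\<close>

text \<open>The seminorm properties and the dense subspace D on which an operator is given are all
  that the passage to the completion draws on.\<close>

locale Lp_space =
  fixes W :: "('a, 'b) monoid_scheme" and p :: real and D :: "'a op set"
  assumes V_add: "x \<in> group_vN W \<Longrightarrow> y \<in> group_vN W \<Longrightarrow> x + y \<in> group_vN W"
    and V_diff: "x \<in> group_vN W \<Longrightarrow> y \<in> group_vN W \<Longrightarrow> x - y \<in> group_vN W"
    and V_scale: "x \<in> group_vN W \<Longrightarrow> scaleC_op c x \<in> group_vN W"
    and n_nonneg: "0 \<le> lp_norm_vN W p x"
    and n_zero: "lp_norm_vN W p 0 = 0"
    and n_add: "x \<in> group_vN W \<Longrightarrow> y \<in> group_vN W \<Longrightarrow> lp_norm_vN W p (x + y) \<le> lp_norm_vN W p x + lp_norm_vN W p y"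
    and n_sym: "x \<in> group_vN W \<Longrightarrow> y \<in> group_vN W \<Longrightarrow> lp_norm_vN W p (x - y) = lp_norm_vN W p (y - x)"
    and n_scale: "x \<in> group_vN W \<Longrightarrow> lp_norm_vN W p (scaleC_op c x) \<le> cmod c * lp_norm_vN W p x"
    and D_V: "D \<subseteq> group_vN W"
    and D_add: "x \<in> D \<Longrightarrow> y \<in> D \<Longrightarrow> x + y \<in> D"
    and D_diff: "x \<in> D \<Longrightarrow> y \<in> D \<Longrightarrow> x - y \<in> D"
    and D_scale: "x \<in> D \<Longrightarrow> scaleC_op c x \<in> D"
    and D_dense: "x \<in> group_vN W \<Longrightarrow> 0 < e \<Longrightarrow> \<exists>c\<in>D. lp_norm_vN W p (c - x) < e"
begin

abbreviation "\<nu> \<equiv> lp_norm_vN W p"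
abbreviation "V \<equiv> group_vN W"
abbreviation "Cau \<equiv> lp_cauchy W p"
abbreviation "cls \<equiv> Lp_class W p"

lemma n_diff: "x \<in> V \<Longrightarrow> y \<in> V \<Longrightarrow> z \<in> V \<Longrightarrow> \<nu> (x - z) \<le> \<nu> (x - y) + \<nu> (y - z)"
  using n_add[OF V_diff V_diff, of x y y z] by simp

lemma n_abs_diff:
  assumes "x \<in> V" "y \<in> V"
  shows "\<bar>\<nu> x - \<nu> y\<bar> \<le> \<nu> (x - y)"
  using n_add[OF V_diff[OF assms] assms(2)] n_add[OF V_diff[OF assms(2,1)] assms(1)] n_sym[OF assms] by simp

lemma scaleC_op_diff: "scaleC_op c (x - y) = scaleC_op c x - scaleC_op c y"
  by (rule blinfun_eqI) (simp add: scaleC_op_apply blinfun.diff_left scaleC_ell2_diff)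

lemma Cau_V: "X \<in> Cau \<Longrightarrow> X n \<in> V"
  by (simp add: lp_cauchy_def)

lemma CauI:
  assumes "\<And>n. X n \<in> V" "\<And>e. 0 < e \<Longrightarrow> \<exists>N. \<forall>i\<ge>N. \<forall>j\<ge>N. \<nu> (X i - X j) < e"
  shows "X \<in> Cau"
  using assms by (simp add: lp_cauchy_def)

lemma CauD:
  assumes "X \<in> Cau" "0 < e"
  shows "\<exists>N. \<forall>i\<ge>N. \<forall>j\<ge>N. \<nu> (X i - X j) < e"
  using assms by (simp add: lp_cauchy_def)

lemma relI: "X \<in> Cau \<Longrightarrow> Y \<in> Cau \<Longrightarrow> (\<lambda>n. \<nu> (X n - Y n)) \<longlonglongrightarrow> 0 \<Longrightarrow> (X, Y) \<in> lp_rel W p"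
  by (simp add: lp_rel_def)

lemma relD: "(X, Y) \<in> lp_rel W p \<Longrightarrow> X \<in> Cau \<and> Y \<in> Cau \<and> (\<lambda>n. \<nu> (X n - Y n)) \<longlonglongrightarrow> 0"
  by (simp add: lp_rel_def)

lemma null_bound:
  assumes "\<And>n. 0 \<le> f n" "\<And>n. f n \<le> (g n :: real)" "g \<longlonglongrightarrow> 0"
  shows "f \<longlonglongrightarrow> 0"
  by (rule tendsto_sandwich[OF _ _ tendsto_const assms(3)]) (use assms in simp_all)

lemma rel_refl: "X \<in> Cau \<Longrightarrow> (X, X) \<in> lp_rel W p"
  by (simp add: lp_rel_def n_zero)

lemma rel_sym:
  assumes "(X, Y) \<in> lp_rel W p"
  shows "(Y, X) \<in> lp_rel W p"
proof -
  note XY = relD[OF assms]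
  have "(\<lambda>n. \<nu> (Y n - X n)) = (\<lambda>n. \<nu> (X n - Y n))"
    using XY by (intro ext n_sym Cau_V) auto
  with XY show ?thesis
    by (intro relI) auto
qed

lemma rel_trans:
  assumes "(X, Y) \<in> lp_rel W p" "(Y, Z) \<in> lp_rel W p"
  shows "(X, Z) \<in> lp_rel W p"
proof -
  note XY = relD[OF assms(1)] and YZ = relD[OF assms(2)]
  have "(\<lambda>n. \<nu> (X n - Y n) + \<nu> (Y n - Z n)) \<longlonglongrightarrow> 0"
    using tendsto_add[of "\<lambda>n. \<nu> (X n - Y n)" 0 sequentially "\<lambda>n. \<nu> (Y n - Z n)" 0] XY YZ by simp
  then have "(\<lambda>n. \<nu> (X n - Z n)) \<longlonglongrightarrow> 0"
    by (rule null_bound[rotated 2]) (use XY YZ in \<open>auto intro: n_nonneg n_diff Cau_V\<close>)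
  with XY YZ show ?thesis
    by (intro relI) auto
qed

lemma cls_iff: "Y \<in> cls X \<longleftrightarrow> (X, Y) \<in> lp_rel W p"
  by (simp add: Lp_class_def)

lemma cls_eq:
  assumes XY: "(X, Y) \<in> lp_rel W p"
  shows "cls X = cls Y"
proof (rule Set.set_eqI)
  fix Z
  show "Z \<in> cls X \<longleftrightarrow> Z \<in> cls Y"
    unfolding cls_iff using rel_trans[OF XY, of Z] rel_trans[OF rel_sym[OF XY], of Z] by (rule iffI[rotated])
qed

lemma cls_self: "X \<in> Cau \<Longrightarrow> X \<in> cls X"
  by (simp add: cls_iff rel_refl)

lemma Lp_eq: "Lp W p = cls ` Cau"
  by (auto simp: Lp_def quotient_def Lp_class_def)

lemma Cau_add:
  assumes "X \<in> Cau" "Y \<in> Cau"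
  shows "(\<lambda>n. X n + Y n) \<in> Cau"
proof (rule CauI)
  show "X n + Y n \<in> V" for n
    using assms by (intro V_add Cau_V)
  fix e :: real assume "0 < e"
  then have e: "0 < e / 2"
    by simp
  obtain N1 where N1: "\<forall>i\<ge>N1. \<forall>j\<ge>N1. \<nu> (X i - X j) < e / 2"
    using CauD[OF assms(1) e] by (rule exE)
  obtain N2 where N2: "\<forall>i\<ge>N2. \<forall>j\<ge>N2. \<nu> (Y i - Y j) < e / 2"
    using CauD[OF assms(2) e] by (rule exE)
  have "\<nu> (X i + Y i - (X j + Y j)) < e" if "max N1 N2 \<le> i" "max N1 N2 \<le> j" for i j
  proof -
    have "\<nu> ((X i - X j) + (Y i - Y j)) \<le> \<nu> (X i - X j) + \<nu> (Y i - Y j)"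
      using assms by (intro n_add V_diff Cau_V)
    then show ?thesis
      using N1[rule_format, of i j] N2[rule_format, of i j] that by (simp add: add_diff_add)
  qed
  then show "\<exists>N. \<forall>i\<ge>N. \<forall>j\<ge>N. \<nu> (X i + Y i - (X j + Y j)) < e"
    by blast
qed

lemma Cau_lipschitz:
  assumes X: "X \<in> Cau" and Y: "\<And>n. Y n \<in> V" and le: "\<And>i j. \<nu> (Y i - Y j) \<le> C * \<nu> (X i - X j)"
  shows "Y \<in> Cau"
proof (rule CauI[OF Y])
  fix e :: real assume e: "0 < e"
  define K where "K = \<bar>C\<bar> + 1"
  have K: "0 < K" "C \<le> K"
    by (simp_all add: K_def)
  have "0 < e / K"
    using e K by simp
  from CauD[OF X this] obtain N where N: "\<forall>i\<ge>N. \<forall>j\<ge>N. \<nu> (X i - X j) < e / K"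
    by (rule exE)
  have "\<nu> (Y i - Y j) < e" if "N \<le> i" "N \<le> j" for i j
  proof -
    have "\<nu> (Y i - Y j) \<le> K * \<nu> (X i - X j)"
      by (rule order_trans[OF le mult_right_mono[OF K(2) n_nonneg]])
    also have "\<dots> < K * (e / K)"
      using N[rule_format, OF that] K by (intro mult_strict_left_mono)
    finally show ?thesis
      using K by simp
  qed
  then show "\<exists>N. \<forall>i\<ge>N. \<forall>j\<ge>N. \<nu> (Y i - Y j) < e"
    by blast
qed

lemma Cau_scale:
  assumes "X \<in> Cau"
  shows "(\<lambda>n. scaleC_op c (X n)) \<in> Cau"
proof (rule Cau_lipschitz[OF assms])
  show "\<nu> (scaleC_op c (X i) - scaleC_op c (X j)) \<le> cmod c * \<nu> (X i - X j)" for i j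
    unfolding scaleC_op_diff[symmetric] using assms by (intro n_scale V_diff Cau_V)
qed (use assms in \<open>intro V_scale Cau_V\<close>)

lemma add_cls:
  assumes "X \<in> Cau" "Y \<in> Cau"
  shows "Lp_add W p (cls X) (cls Y) = cls (\<lambda>n. X n + Y n)"
proof -
  have "cls (\<lambda>n. X' n + Y' n) = cls (\<lambda>n. X n + Y n)" if "X' \<in> cls X" "Y' \<in> cls Y" for X' Y'
  proof (rule cls_eq, rule relI)
    note X' = relD[OF that(1)[unfolded cls_iff]] and Y' = relD[OF that(2)[unfolded cls_iff]]
    show "(\<lambda>n. X' n + Y' n) \<in> Cau" "(\<lambda>n. X n + Y n) \<in> Cau"
      using X' Y' by (auto intro: Cau_add)
    have "(\<lambda>n. \<nu> (X n - X' n) + \<nu> (Y n - Y' n)) \<longlonglongrightarrow> 0"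
      using tendsto_add[of "\<lambda>n. \<nu> (X n - X' n)" 0 sequentially "\<lambda>n. \<nu> (Y n - Y' n)" 0] X' Y' by simp
    then show "(\<lambda>n. \<nu> (X' n + Y' n - (X n + Y n))) \<longlonglongrightarrow> 0"
    proof (rule null_bound[rotated 2])
      fix n
      have m: "X n \<in> V" "X' n \<in> V" "Y n \<in> V" "Y' n \<in> V"
        using X' Y' by (auto intro: Cau_V)
      have "\<nu> ((X' n - X n) + (Y' n - Y n)) \<le> \<nu> (X' n - X n) + \<nu> (Y' n - Y n)"
        using m by (intro n_add V_diff)
      then show "\<nu> (X' n + Y' n - (X n + Y n)) \<le> \<nu> (X n - X' n) + \<nu> (Y n - Y' n)"
        using n_sym[OF m(1,2)] n_sym[OF m(3,4)] by (simp add: add_diff_add)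
    qed (rule n_nonneg)
  qed
  then show ?thesis
    unfolding Lp_add_def using cls_self[OF assms(1)] cls_self[OF assms(2)] by blast
qed

lemma scale_cls:
  assumes "X \<in> Cau"
  shows "Lp_scale W p c (cls X) = cls (\<lambda>n. scaleC_op c (X n))"
proof -
  have "cls (\<lambda>n. scaleC_op c (X' n)) = cls (\<lambda>n. scaleC_op c (X n))" if "X' \<in> cls X" for X'
  proof (rule cls_eq, rule relI)
    note X' = relD[OF rel_sym[OF that[unfolded cls_iff]]]
    show "(\<lambda>n. scaleC_op c (X' n)) \<in> Cau" "(\<lambda>n. scaleC_op c (X n)) \<in> Cau"
      using X' by (auto intro: Cau_scale)
    have "(\<lambda>n. cmod c * \<nu> (X' n - X n)) \<longlonglongrightarrow> 0"
      by (rule tendsto_mult_right_zero) (use X' in simp)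
    then show "(\<lambda>n. \<nu> (scaleC_op c (X' n) - scaleC_op c (X n))) \<longlonglongrightarrow> 0"
    proof (rule null_bound[rotated 2])
      fix n
      have "X' n - X n \<in> V"
        using X' by (intro V_diff Cau_V) auto
      then show "\<nu> (scaleC_op c (X' n) - scaleC_op c (X n)) \<le> cmod c * \<nu> (X' n - X n)"
        unfolding scaleC_op_diff[symmetric] by (rule n_scale)
    qed (rule n_nonneg)
  qed
  then show ?thesis
    unfolding Lp_scale_def using cls_self[OF assms] by blast
qed

lemma norm_cls:
  assumes X: "X \<in> Cau"
  shows "(\<lambda>n. \<nu> (X n)) \<longlonglongrightarrow> Lp_norm W p (cls X)"
proof -
  have "Cauchy (\<lambda>n. \<nu> (X n))"
  proof (rule CauchyI)
    fix e :: real assume "0 < e"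
    from CauD[OF X this] obtain N where N: "\<forall>i\<ge>N. \<forall>j\<ge>N. \<nu> (X i - X j) < e"
      by (rule exE)
    have "norm (\<nu> (X i) - \<nu> (X j)) < e" if "N \<le> i" "N \<le> j" for i j
      using n_abs_diff[OF Cau_V[OF X] Cau_V[OF X], of i j] N[rule_format, OF that] by simp
    then show "\<exists>N. \<forall>i\<ge>N. \<forall>j\<ge>N. norm (\<nu> (X i) - \<nu> (X j)) < e"
      by blast
  qed
  then obtain r where r: "(\<lambda>n. \<nu> (X n)) \<longlonglongrightarrow> r"
    using Cauchy_convergent convergent_def by blast
  have all: "(\<lambda>n. \<nu> (Y n)) \<longlonglongrightarrow> r" if "Y \<in> cls X" for Y
  proof -
    note Y = relD[OF rel_sym[OF that[unfolded cls_iff]]]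
    have "(\<lambda>n. \<nu> (Y n) - \<nu> (X n)) \<longlonglongrightarrow> 0"
    proof (rule tendsto_rabs_zero_cancel, rule null_bound)
      show "\<bar>\<nu> (Y n) - \<nu> (X n)\<bar> \<le> \<nu> (Y n - X n)" for n
        using Y by (intro n_abs_diff Cau_V) auto
      show "(\<lambda>n. \<nu> (Y n - X n)) \<longlonglongrightarrow> 0"
        using Y by simp
    qed simp
    from tendsto_add[OF this r] show ?thesis
      by simp
  qed
  have "Lp_norm W p (cls X) = r"
    unfolding Lp_norm_def
  proof (rule the_equality)
    show "\<forall>Y\<in>cls X. (\<lambda>n. \<nu> (Y n)) \<longlonglongrightarrow> r"
      using all by blast
    fix r' assume "\<forall>Y\<in>cls X. (\<lambda>n. \<nu> (Y n)) \<longlonglongrightarrow> r'"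
    then have "(\<lambda>n. \<nu> (X n)) \<longlonglongrightarrow> r'"
      using cls_self[OF X] by blast
    then show "r' = r"
      by (rule LIMSEQ_unique[OF _ r])
  qed
  with r show ?thesis
    by simp
qed

text \<open>The n-th term is moved into D by less than 1 / (n + 1), which affects neither the Cauchy
  property nor the class.\<close>

lemma dense_representative:
  assumes X: "X \<in> Cau"
  shows "\<exists>c. c \<in> cls X \<and> (\<forall>n. c n \<in> D)"
proof -
  have "\<forall>n. \<exists>d. d \<in> D \<and> \<nu> (d - X n) < inverse (real (Suc n))"
  proof
    fix n
    show "\<exists>d. d \<in> D \<and> \<nu> (d - X n) < inverse (real (Suc n))"
      using D_dense[OF Cau_V[OF X], of "inverse (real (Suc n))" n] by (auto simp: Bex_def)
  qed
  from choice[OF this] obtain c where "\<forall>n. c n \<in> D \<and> \<nu> (c n - X n) < inverse (real (Suc n))"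
    by (rule exE)
  then have c: "c n \<in> D" "\<nu> (c n - X n) < inverse (real (Suc n))" for n
    by simp_all
  have cV: "c n \<in> V" for n
    using c(1) D_V by blast
  have lim: "(\<lambda>n. \<nu> (c n - X n)) \<longlonglongrightarrow> 0"
    by (rule null_bound[OF n_nonneg _ LIMSEQ_inverse_real_of_nat]) (rule less_imp_le[OF c(2)])
  have "c \<in> Cau"
  proof (rule CauI[OF cV])
    fix e :: real assume "0 < e"
    then have e: "0 < e / 3"
      by simp
    obtain N1 where N1: "\<forall>i\<ge>N1. \<forall>j\<ge>N1. \<nu> (X i - X j) < e / 3"
      using CauD[OF X e] by (rule exE)
    have "\<forall>\<^sub>F n in sequentially. \<nu> (c n - X n) < e / 3"
      using order_tendstoD(2)[OF lim e] .
    then obtain N2 where N2: "\<And>n. N2 \<le> n \<Longrightarrow> \<nu> (c n - X n) < e / 3"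
      unfolding eventually_sequentially by blast
    have "\<nu> (c i - c j) < e" if "max N1 N2 \<le> i" "max N1 N2 \<le> j" for i j
    proof -
      have "\<nu> (c i - c j) \<le> \<nu> (c i - X i) + \<nu> (X i - c j)"
        by (rule n_diff[OF cV Cau_V[OF X] cV])
      also have "\<nu> (X i - c j) \<le> \<nu> (X i - X j) + \<nu> (X j - c j)"
        by (rule n_diff[OF Cau_V[OF X] Cau_V[OF X] cV])
      finally show ?thesis
        using N1[rule_format, of i j] N2[of i] N2[of j] that n_sym[OF cV Cau_V[OF X], of j j] by simp
    qed
    then show "\<exists>N. \<forall>i\<ge>N. \<forall>j\<ge>N. \<nu> (c i - c j) < e"
      by blast
  qed
  then have "(X, c) \<in> lp_rel W p"
    by (rule rel_sym[OF relI[OF _ X lim]])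
  then show ?thesis
    using c(1) by (intro exI[of _ c]) (simp add: cls_iff)
qed

text \<open>T is controlled on D only, so U picks a representative sequence with values in D and
  applies T termwise. The Lipschitz bound makes the resulting class independent of the
  choice.\<close>

lemma bounded_extension:
  assumes T_D: "\<And>x. x \<in> D \<Longrightarrow> T x \<in> D"
    and T_add: "\<And>x y. x \<in> D \<Longrightarrow> y \<in> D \<Longrightarrow> T (x + y) = T x + T y"
    and T_scale: "\<And>c x. x \<in> D \<Longrightarrow> T (scaleC_op c x) = scaleC_op c (T x)"
    and T_bdd: "\<And>x. x \<in> D \<Longrightarrow> \<nu> (T x) \<le> C * \<nu> x"
  shows "\<exists>U. Lp_bounded_operator W p U \<and> (\<forall>x\<in>D. U (Lp_embed W p x) = Lp_embed W p (T x))"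
proof -
  define pick where "pick \<xi> = (SOME c. c \<in> \<xi> \<and> (\<forall>n. c n \<in> D))" for \<xi> :: "(nat \<Rightarrow> 'a op) set"
  define U where "U \<xi> = cls (\<lambda>n. T (pick \<xi> n))" for \<xi>
  have T_diff: "T x - T y = T (x - y)" if "x \<in> D" "y \<in> D" for x y
    using T_add[OF D_diff[OF that] that(2)] by (simp add: algebra_simps)
  have T_Cau: "(\<lambda>n. T (c n)) \<in> Cau" if "c \<in> Cau" "\<And>n. c n \<in> D" for c
  proof (rule Cau_lipschitz[OF that(1)])
    show "T (c n) \<in> V" for n
      using T_D[OF that(2)] D_V by blast
    show "\<nu> (T (c i) - T (c j)) \<le> C * \<nu> (c i - c j)" for i j
      unfolding T_diff[OF that(2) that(2)] by (rule T_bdd[OF D_diff[OF that(2) that(2)]])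
  qed
  have U_cls: "U (cls X) = cls (\<lambda>n. T (c n))" if X: "X \<in> Cau" and c: "c \<in> cls X" "\<And>n. c n \<in> D" for X c
  proof -
    define d where "d = pick (cls X)"
    have "d \<in> cls X \<and> (\<forall>n. d n \<in> D)"
      unfolding d_def pick_def by (rule someI_ex[OF dense_representative[OF X]])
    then have d: "d \<in> cls X" "\<And>n. d n \<in> D"
      by auto
    have rel: "(d, c) \<in> lp_rel W p"
      by (rule rel_trans[OF rel_sym[OF d(1)[unfolded cls_iff]] c(1)[unfolded cls_iff]])
    note cd = relD[OF rel]
    have "(\<lambda>n. C * \<nu> (d n - c n)) \<longlonglongrightarrow> 0"
      by (rule tendsto_mult_right_zero) (use cd in simp)
    then have "(\<lambda>n. \<nu> (T (d n) - T (c n))) \<longlonglongrightarrow> 0"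
    proof (rule null_bound[rotated 2])
      show "\<nu> (T (d n) - T (c n)) \<le> C * \<nu> (d n - c n)" for n
        unfolding T_diff[OF d(2) c(2)] by (rule T_bdd[OF D_diff[OF d(2) c(2)]])
    qed (rule n_nonneg)
    then have "((\<lambda>n. T (d n)), (\<lambda>n. T (c n))) \<in> lp_rel W p"
      using cd c(2) d(2) by (intro relI T_Cau) auto
    then show ?thesis
      unfolding U_def d_def by (rule cls_eq)
  qed
  have good: "\<exists>c. c \<in> Cau \<and> (\<forall>n. c n \<in> D) \<and> \<xi> = cls c" if xi: "\<xi> \<in> Lp W p" for \<xi>
  proof -
    obtain X where X: "X \<in> Cau" "\<xi> = cls X"
      using xi unfolding Lp_eq by (rule imageE)
    obtain c where "c \<in> cls X" "\<forall>n. c n \<in> D"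
      using dense_representative[OF X(1)] by (elim exE conjE)
    with X have Xc: "X \<in> Cau" "\<xi> = cls X" "c \<in> cls X" "\<forall>n. c n \<in> D"
      by simp_all
    then have "\<xi> = cls c" "c \<in> Cau"
      using cls_eq[of X c] relD[of X c] by (simp_all add: cls_iff)
    with Xc show ?thesis
      by (intro exI[of _ c]) simp
  qed
  have U_good: "U (cls c) = cls (\<lambda>n. T (c n))" if "c \<in> Cau" "\<forall>n. c n \<in> D" for c
    using that by (intro U_cls cls_self) auto
  have "Lp_bounded_operator W p U"
    unfolding Lp_bounded_operator_def
  proof (intro conjI ballI allI exI[of _ C])
    fix \<xi> assume "\<xi> \<in> Lp W p"
    from good[OF this] obtain c where c: "c \<in> Cau" "\<forall>n. c n \<in> D" "\<xi> = cls c"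
      by (elim exE conjE)
    have Tc: "(\<lambda>n. T (c n)) \<in> Cau"
      using c by (intro T_Cau) auto
    show "U \<xi> \<in> Lp W p"
      unfolding c(3) U_good[OF c(1,2)] Lp_eq using Tc by (rule imageI)
    show "U (Lp_scale W p a \<xi>) = Lp_scale W p a (U \<xi>)" for a
    proof -
      have "(\<lambda>n. scaleC_op a (c n)) \<in> Cau" "\<forall>n. scaleC_op a (c n) \<in> D"
        using c by (auto intro: Cau_scale D_scale)
      then show ?thesis
        using c unfolding c(3) by (simp add: scale_cls U_good T_scale Tc)
    qed
    have l1: "(\<lambda>n. \<nu> (T (c n))) \<longlonglongrightarrow> Lp_norm W p (U \<xi>)"
      unfolding c(3) U_good[OF c(1,2)] by (rule norm_cls[OF Tc])
    have l2: "(\<lambda>n. C * \<nu> (c n)) \<longlonglongrightarrow> C * Lp_norm W p \<xi>"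
      unfolding c(3) by (intro tendsto_intros norm_cls c(1))
    show "Lp_norm W p (U \<xi>) \<le> C * Lp_norm W p \<xi>"
      by (rule LIMSEQ_le[OF l1 l2]) (use c(2) T_bdd in blast)
    fix \<eta> assume "\<eta> \<in> Lp W p"
    from good[OF this] obtain d where d: "d \<in> Cau" "\<forall>n. d n \<in> D" "\<eta> = cls d"
      by (elim exE conjE)
    have Td: "(\<lambda>n. T (d n)) \<in> Cau"
      using d by (intro T_Cau) auto
    have "(\<lambda>n. c n + d n) \<in> Cau" "\<forall>n. c n + d n \<in> D"
      using c d by (auto intro: Cau_add D_add)
    then show "U (Lp_add W p \<xi> \<eta>) = Lp_add W p (U \<xi>) (U \<eta>)"
      using c d unfolding c(3) d(3) by (simp add: add_cls U_good T_add Tc Td)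
  qed
  moreover have "U (Lp_embed W p x) = Lp_embed W p (T x)" if x: "x \<in> D" for x
  proof -
    have "(\<lambda>n. x) \<in> Cau"
      by (rule CauI) (use x D_V n_zero in auto)
    then show ?thesis
      unfolding Lp_embed_def using x by (intro U_good) auto
  qed
  ultimately show ?thesis
    by blast
qed

end

section \<open>The group von Neumann algebra as an instance\<close>

context group
begin

lemma op_of_scaleC: "scaleC_op c (op_of x) = op_of (cS c * x)"
  by (rule blinfun_eqI) (simp add: scaleC_op_apply app_def[symmetric] app_mult app_cS)

lemma op_of_sum: "op_of (\<Sum>i\<in>I. f i) = (\<Sum>i\<in>I. op_of (f i))"
  by (induction I rule: infinite_finite_induct) (simp_all add: zero_cop.rep_eq plus_cop.rep_eq)

lemma ror_commutant:
  assumes h: "h \<in> carrier G"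
  shows "op_of (lam (opp G) h) \<in> commutant (carrier G) (left_reg G ` carrier G)"
proof -
  have "op_of (lam (opp G) h) \<in> bounded_ops (carrier G)"
    unfolding bounded_ops_def
  proof (intro CollectI conjI allI impI)
    show "blinfun_apply (op_of (lam (opp G) h)) (scaleC_ell2 c f) = scaleC_ell2 c (blinfun_apply (op_of (lam (opp G) h)) f)" for c f
      unfolding app_def[symmetric] by (rule app_scaleC_right)
    show "ell2_fun (blinfun_apply (op_of (lam (opp G) h)) f) a = 0" if "a \<notin> carrier G" for f a
      unfolding app_def[symmetric] using that by (simp add: app_lam_opp[OF is_group h])
    show "blinfun_apply (op_of (lam (opp G) h)) f = 0" if "\<forall>a\<in>carrier G. ell2_fun f a = 0" for f
      unfolding app_def[symmetric] using that h
      by (intro ell2_eqI) (simp add: app_lam_opp[OF is_group h] ell2_fun_zero)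
  qed
  moreover have "left_reg G g o\<^sub>L op_of (lam (opp G) h) = op_of (lam (opp G) h) o\<^sub>L left_reg G g" if "g \<in> carrier G" for g
    unfolding op_of_lam[OF is_group that, symmetric] times_cop.rep_eq[symmetric]
    using lam_ror_commute[OF that h] by (rule arg_cong)
  ultimately show ?thesis
    by (simp add: commutant_def)
qed

text \<open>Right translations lie in the commutant of the left ones, so an element of the
  bicommutant commutes with them. This places it in \<open>vN\<close>, where the norm estimates
  hold.\<close>

lemma group_vN_op_of:
  assumes "X \<in> group_vN G"
  obtains x where "x \<in> vN" "X = op_of x"
proof -
  have lin: "X \<in> bounded_ops (carrier G)" and com: "\<And>h. h \<in> carrier G \<Longrightarrow>
      op_of (lam (opp G) h) o\<^sub>L X = X o\<^sub>L op_of (lam (opp G) h)"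
    using assms ror_commutant by (auto simp: group_vN_def commutant_def[of _ "commutant _ _"])
  define x where "x = Abs_cop X"
  have x: "op_of x = X"
    using lin by (simp add: x_def Abs_cop_inverse bounded_ops_def)
  have "x * lam (opp G) h = lam (opp G) h * x" if "h \<in> carrier G" for h
    using com[OF that] by (simp add: op_of_inject[symmetric] times_cop.rep_eq x)
  then show ?thesis
    using x by (intro that[of x]) (simp_all add: vN_def)
qed

lemma bounded_ops_add: "x \<in> bounded_ops A \<Longrightarrow> y \<in> bounded_ops A \<Longrightarrow> x + y \<in> bounded_ops A"
  by (simp add: bounded_ops_def blinfun.add_left scaleC_ell2_add ell2_fun_add)

lemma bounded_ops_scaleC: "x \<in> bounded_ops A \<Longrightarrow> scaleC_op c x \<in> bounded_ops A"
  by (simp add: bounded_ops_def scaleC_op_apply scaleC_ell2_scaleC ell2_fun_scaleC mult.commute)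

lemma commutant_add: "x \<in> commutant A X \<Longrightarrow> y \<in> commutant A X \<Longrightarrow> x + y \<in> commutant A X"
  by (simp add: commutant_def bounded_ops_add
      bounded_bilinear.add_left[OF bounded_bilinear_blinfun_compose]
      bounded_bilinear.add_right[OF bounded_bilinear_blinfun_compose])

lemma commutant_scaleC:
  assumes "X \<subseteq> bounded_ops A" "x \<in> commutant A X"
  shows "scaleC_op c x \<in> commutant A X"
proof -
  have "y o\<^sub>L scaleC_op c x = scaleC_op c x o\<^sub>L y" if y: "y \<in> X" for y
  proof (rule blinfun_eqI)
    fix f
    have "y o\<^sub>L x = x o\<^sub>L y"
      using assms(2) y by (simp add: commutant_def)
    then have "blinfun_apply y (blinfun_apply x f) = blinfun_apply x (blinfun_apply y f)"
      by (metis blinfun_apply_blinfun_compose)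
    moreover have "blinfun_apply y (scaleC_ell2 c g) = scaleC_ell2 c (blinfun_apply y g)" for g
      using assms(1) y by (auto simp: bounded_ops_def)
    ultimately show "blinfun_apply (y o\<^sub>L scaleC_op c x) f = blinfun_apply (scaleC_op c x o\<^sub>L y) f"
      by (simp add: scaleC_op_apply)
  qed
  then show ?thesis
    using assms(2) by (simp add: commutant_def bounded_ops_scaleC)
qed

lemma group_vN_add: "x \<in> group_vN G \<Longrightarrow> y \<in> group_vN G \<Longrightarrow> x + y \<in> group_vN G"
  unfolding group_vN_def by (rule commutant_add)

lemma group_vN_scaleC: "x \<in> group_vN G \<Longrightarrow> scaleC_op c x \<in> group_vN G"
  unfolding group_vN_def by (rule commutant_scaleC) (auto simp: commutant_def)

lemma group_vN_diff: "x \<in> group_vN G \<Longrightarrow> y \<in> group_vN G \<Longrightarrow> x - y \<in> group_vN G"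
proof -
  assume xy: "x \<in> group_vN G" "y \<in> group_vN G"
  have "scaleC_op (- 1) y = - y"
    by (rule blinfun_eqI, rule ell2_eqI) (simp add: scaleC_op_apply ell2_fun_simps blinfun.minus_left)
  then show ?thesis
    using group_vN_add[OF xy(1) group_vN_scaleC[OF xy(2), of "- 1"]] by simp
qed

lemma lam_group_vN:
  assumes g: "g \<in> carrier G"
  shows "op_of (lam G g) \<in> group_vN G"
proof -
  have "op_of (lam G g) \<in> bounded_ops (carrier G)"
    unfolding bounded_ops_def
  proof (intro CollectI conjI allI impI)
    show "blinfun_apply (op_of (lam G g)) (scaleC_ell2 c f) = scaleC_ell2 c (blinfun_apply (op_of (lam G g)) f)" for c f
      unfolding app_def[symmetric] by (rule app_scaleC_right)
    show "ell2_fun (blinfun_apply (op_of (lam G g)) f) a = 0" if "a \<notin> carrier G" for f a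
      unfolding app_def[symmetric] using that by (simp add: app_lam[OF is_group g])
    show "blinfun_apply (op_of (lam G g)) f = 0" if "\<forall>a\<in>carrier G. ell2_fun f a = 0" for f
      unfolding app_def[symmetric] using that g
      by (intro ell2_eqI) (simp add: app_lam[OF is_group g] ell2_fun_zero)
  qed
  then show ?thesis
    unfolding group_vN_def op_of_lam[OF is_group g] using g by (simp add: commutant_def)
qed

lemma CW_group_vN: "x \<in> CW \<Longrightarrow> op_of x \<in> group_vN G"
proof -
  assume x: "x \<in> CW"
  have zero: "0 \<in> group_vN G"
    using group_vN_diff[OF lam_group_vN[OF one_closed] lam_group_vN[OF one_closed]] by simp
  have "(\<Sum>g\<in>F. scaleC_op (f g) (op_of (lam G g))) \<in> group_vN G" if "F \<subseteq> carrier G" for F f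
    using that by (induction F rule: infinite_finite_induct)
      (auto simp: zero intro!: group_vN_add group_vN_scaleC lam_group_vN)
  then show ?thesis
    using x by (auto simp: CW_def op_of_sum op_of_scaleC)
qed

lemma Lp_space_group:
  assumes p: "1 < p"
  shows "Lp_space G p (op_of ` CW)"
proof
  have p0: "0 < p"
    using p by simp
  note lp = lp_norm_op_of[OF p0, of G]
  have lp_add: "lp_norm_vN G p (op_of x + op_of y) = nrm \<one> p (x + y)" for x y :: "'a cop"
    unfolding plus_cop.rep_eq[symmetric] by (rule lp)
  have lp_diff: "lp_norm_vN G p (op_of x - op_of y) = nrm \<one> p (x - y)" for x y :: "'a cop"
    unfolding minus_cop.rep_eq[symmetric] by (rule lp)
  fix X Y :: "'a op" and c
  show "X + Y \<in> group_vN G" "X - Y \<in> group_vN G" if "X \<in> group_vN G" "Y \<in> group_vN G"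
    using that by (auto intro: group_vN_add group_vN_diff)
  show "scaleC_op c X \<in> group_vN G" if "X \<in> group_vN G"
    using that by (rule group_vN_scaleC)
  show "0 \<le> lp_norm_vN G p X"
    by (simp add: lp_norm_vN_def)
  show "lp_norm_vN G p 0 = 0"
    using lp[of 0] vN.nrm_zero[OF p] by (simp add: zero_cop.rep_eq)
  show "lp_norm_vN G p (X + Y) \<le> lp_norm_vN G p X + lp_norm_vN G p Y"
    "lp_norm_vN G p (X - Y) = lp_norm_vN G p (Y - X)" if XY: "X \<in> group_vN G" "Y \<in> group_vN G"
  proof -
    obtain x where x: "x \<in> vN" "X = op_of x"
      by (rule group_vN_op_of[OF XY(1)])
    obtain y where y: "y \<in> vN" "Y = op_of y"
      by (rule group_vN_op_of[OF XY(2)])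
    show "lp_norm_vN G p (X + Y) \<le> lp_norm_vN G p X + lp_norm_vN G p Y"
      unfolding x(2) y(2) lp_add lp by (rule vN.nrm_triangle[OF x(1) y(1) p])
    show "lp_norm_vN G p (X - Y) = lp_norm_vN G p (Y - X)"
      unfolding x(2) y(2) lp_diff using vN.nrm_uminus[OF vN.diff_N[OF x(1) y(1)] p] by simp
  qed
  show "lp_norm_vN G p (scaleC_op c X) \<le> cmod c * lp_norm_vN G p X" if X: "X \<in> group_vN G"
  proof -
    obtain x where x: "x \<in> vN" "X = op_of x"
      by (rule group_vN_op_of[OF X])
    show ?thesis
      unfolding x(2) op_of_scaleC lp by (rule vN.nrm_cS[OF x(1) p])
  qed
  show "op_of ` CW \<subseteq> group_vN G"
    using CW_group_vN by auto
  show "X + Y \<in> op_of ` CW" "X - Y \<in> op_of ` CW" if XY: "X \<in> op_of ` CW" "Y \<in> op_of ` CW"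
  proof -
    obtain x where x: "X = op_of x" "x \<in> CW"
      using XY(1) by (rule imageE)
    obtain y where y: "Y = op_of y" "y \<in> CW"
      using XY(2) by (rule imageE)
    show "X + Y \<in> op_of ` CW"
      unfolding x(1) y(1) plus_cop.rep_eq[symmetric] by (intro imageI CW_add x(2) y(2))
    have eq: "x - y = x + cS (- 1) * y"
      by (simp add: cS_minus)
    have "x - y \<in> CW"
      unfolding eq by (rule CW_add[OF x(2) CW_cS[OF y(2)]])
    then show "X - Y \<in> op_of ` CW"
      unfolding x(1) y(1) minus_cop.rep_eq[symmetric] by (rule imageI)
  qed
  show "scaleC_op c X \<in> op_of ` CW" if X: "X \<in> op_of ` CW"
  proof -
    obtain x where x: "X = op_of x" "x \<in> CW"
      using X by (rule imageE)
    show ?thesis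
      unfolding x(1) op_of_scaleC by (intro imageI CW_cS x(2))
  qed
  show "\<exists>c\<in>op_of ` CW. lp_norm_vN G p (c - X) < e" if X: "X \<in> group_vN G" and e: "0 < e" for e
  proof -
    obtain x where x: "x \<in> vN" "X = op_of x"
      by (rule group_vN_op_of[OF X])
    obtain c where c: "\<forall>n. c n \<in> CW" "\<forall>p>1. (\<lambda>n. nrm \<one> p (c n - x)) \<longlonglongrightarrow> 0"
      using CW.Kaplansky_Lp[OF x(1)] by (elim exE conjE)
    have "\<forall>\<^sub>F n in sequentially. nrm \<one> p (c n - x) < e"
      using order_tendstoD(2)[OF c(2)[rule_format, OF p] e] .
    then obtain n where n: "nrm \<one> p (c n - x) < e"
      unfolding eventually_sequentially by blast
    show ?thesis
      by (rule bexI[of _ "op_of (c n)"]) (use n c(1) in \<open>simp_all add: x(2) lp_diff\<close>)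
  qed
qed

text \<open>m enters through its values on the carrier, so a function \<mu> normalized elsewhere can
  stand in for it.\<close>

lemma multiplier_bounded_of_Tm:
  assumes p: "1 < p" and bdd: "Tm_bounded UNIV \<mu> C p" and eq: "\<And>g. g \<in> carrier G \<Longrightarrow> m g = \<mu> g"
  shows "multiplier_bounded G p m"
proof -
  interpret Lp: Lp_space G p "op_of ` CW"
    by (rule Lp_space_group[OF p])
  have p0: "0 < p"
    using p by simp
  define T where "T X = op_of (Tm \<mu> (Abs_cop X))" for X
  have T: "T (op_of x) = op_of (Tm \<mu> x)" for x
    by (simp add: T_def op_of_inverse)
  have "\<exists>U. Lp_bounded_operator G p U \<and> (\<forall>x\<in>op_of ` CW. U (Lp_embed G p x) = Lp_embed G p (T x))"
  proof (rule Lp.bounded_extension)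
    fix X Y :: "'a op" assume X: "X \<in> op_of ` CW"
    obtain x where x: "X = op_of x" "x \<in> CW"
      using X by (rule imageE)
    show "T X \<in> op_of ` CW"
      unfolding x(1) T by (intro imageI Tm_CW x(2))
    show "T (scaleC_op c X) = scaleC_op c (T X)" for c
      unfolding x(1) op_of_scaleC T Tm_cS[OF x(2)] ..
    show "lp_norm_vN G p (T X) \<le> C * lp_norm_vN G p X"
      unfolding x(1) T lp_norm_op_of[OF p0] using bdd x(2) by (simp add: Tm_bounded_def)
    assume Y: "Y \<in> op_of ` CW"
    obtain y where y: "Y = op_of y" "y \<in> CW"
      using Y by (rule imageE)
    show "T (X + Y) = T X + T Y"
      unfolding x(1) y(1) plus_cop.rep_eq[symmetric] T Tm_add[OF x(2) y(2)] ..
  qed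
  then obtain U where U: "Lp_bounded_operator G p U" "\<forall>x\<in>op_of ` CW. U (Lp_embed G p x) = Lp_embed G p (T x)"
    by (elim exE conjE)
  have "U (Lp_embed G p (\<Sum>g\<in>F. scaleC_op (f g) (left_reg G g))) =
      Lp_embed G p (\<Sum>g\<in>F. scaleC_op (m g * f g) (left_reg G g))" if F: "finite F" "F \<subseteq> carrier G" for F f
  proof -
    have sum: "(\<Sum>g\<in>F. scaleC_op (a g) (left_reg G g)) = op_of (\<Sum>g\<in>F. cS (a g) * lam G g)" for a
      unfolding op_of_sum using F(2) by (intro sum.cong) (auto simp: op_of_scaleC[symmetric] op_of_lam[OF is_group])
    have "U (Lp_embed G p (\<Sum>g\<in>F. scaleC_op (f g) (left_reg G g))) = Lp_embed G p (op_of (Tm \<mu> (\<Sum>g\<in>F. cS (f g) * lam G g)))"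
      unfolding sum using U(2) CW_I[OF F] by (simp add: T)
    also have "Tm \<mu> (\<Sum>g\<in>F. cS (f g) * lam G g) = (\<Sum>g\<in>F. cS (\<mu> g * f g) * lam G g)"
      using F(2) by (intro Tm_sum_lam) (auto simp: subset_iff)
    also have "\<dots> = (\<Sum>g\<in>F. cS (m g * f g) * lam G g)"
      using F(2) by (intro sum.cong) (auto simp: eq)
    finally show ?thesis
      unfolding sum .
  qed
  with U(1) show ?thesis
    unfolding multiplier_bounded_def by (intro exI[of _ U] conjI allI impI)
qed

end

section \<open>Signs on the subgroup, coset translates and the bound for all exponents\<close>

theorem theoremB:
  fixes W :: "('a, 'b) monoid_scheme"
    and S W0 :: "'a set"
    and M :: "'a \<Rightarrow> 'a \<Rightarrow> enat"
    and s :: 'a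
    and k :: nat
    and w :: "nat \<Rightarrow> 'a"
    and m :: "'a \<Rightarrow> complex"
  assumes "coxeter_system W S M"
    and "subgroup W0 W" and "torsion_free W W0"
    and "finite (lcosets\<^bsub>W\<^esub> W0)" and "card (lcosets\<^bsub>W\<^esub> W0) = k"
    and "s \<in> S" and "(s <#\<^bsub>W\<^esub> W0) #>\<^bsub>W\<^esub> s = W0"
    and "\<forall>i\<in>{1..k}. w i \<in> carrier W"
    and "carrier W = (\<Union>i\<in>{1..k}. w i <#\<^bsub>W\<^esub> W0)"
    and "disjoint_family_on (\<lambda>i. w i <#\<^bsub>W\<^esub> W0) {1..k}"
    and "\<forall>i\<in>{1..k}. \<forall>h\<in>W0. chamber W S h \<in> pos_root W S s \<longrightarrow> m (w i \<otimes>\<^bsub>W\<^esub> h) = 1"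
    and "\<forall>i\<in>{1..k}. \<forall>h\<in>W0. chamber W S h \<in> neg_root W S s \<longrightarrow> m (w i \<otimes>\<^bsub>W\<^esub> h) = -1"
  shows "\<forall>p::real. 1 < p \<longrightarrow> multiplier_bounded W p m"
proof (intro allI impI)
  fix p :: real assume p: "1 < p"
  interpret coxeter W S M
    using assms(1) by (simp add: coxeter_def coxeter_axioms_def coxeter_system_def presented_by_def)
  interpret W0: subgroup W0 W
    by (rule assms(2))
  have sc: "s \<in> carrier W"
    using assms(6) by (rule S_carrier)
  \<comment> \<open>The value 0 off the carrier gives the bound 1 everywhere, as \<open>Mop\<close>
    requires.\<close>
  define \<mu> where "\<mu> g = (if g \<in> carrier W then of_int (sep g s) else 0 :: complex)" for g
  have \<mu>: "cmod (\<mu> g) \<le> 1" "cnj (\<mu> g) = \<mu> g" for g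
    using sep_cases[of g s] by (auto simp: \<mu>_def)
  have \<mu>2: "\<mu> g * \<mu> g = 1" if "g \<in> W0" for g
    using sep_cases[of g s] that by (auto simp: \<mu>_def)
  define K where "K = {g \<in> carrier W. g \<otimes>\<^bsub>W\<^esub> s = s \<otimes>\<^bsub>W\<^esub> g}"
  have K: "subgroup K W"
  proof
    show "x \<otimes>\<^bsub>W\<^esub> y \<in> K" if "x \<in> K" "y \<in> K" for x y
    proof -
      have "x \<otimes>\<^bsub>W\<^esub> y \<otimes>\<^bsub>W\<^esub> s = x \<otimes>\<^bsub>W\<^esub> (s \<otimes>\<^bsub>W\<^esub> y)"
        using that sc by (simp add: K_def m_assoc)
      also have "\<dots> = s \<otimes>\<^bsub>W\<^esub> (x \<otimes>\<^bsub>W\<^esub> y)"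
        using that sc by (simp add: K_def m_assoc[symmetric])
      finally show ?thesis
        using that by (simp add: K_def)
    qed
    show "inv\<^bsub>W\<^esub> x \<in> K" if x: "x \<in> K" for x
    proof -
      have xc: "x \<in> carrier W" and xs: "x \<otimes>\<^bsub>W\<^esub> s = s \<otimes>\<^bsub>W\<^esub> x"
        using x by (auto simp: K_def)
      have "inv\<^bsub>W\<^esub> x \<otimes>\<^bsub>W\<^esub> s = inv\<^bsub>W\<^esub> x \<otimes>\<^bsub>W\<^esub> (s \<otimes>\<^bsub>W\<^esub> x) \<otimes>\<^bsub>W\<^esub> inv\<^bsub>W\<^esub> x"
        using xc sc by (simp add: m_assoc)
      also have "\<dots> = s \<otimes>\<^bsub>W\<^esub> inv\<^bsub>W\<^esub> x"
        unfolding xs[symmetric] using xc sc by (simp add: m_assoc[symmetric])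
      finally show ?thesis
        using xc by (simp add: K_def)
    qed
  qed (auto simp: K_def sc)
  have norm: "s \<otimes>\<^bsub>W\<^esub> h \<otimes>\<^bsub>W\<^esub> s \<in> W0" if "h \<in> W0" for h
  proof -
    have "s \<otimes>\<^bsub>W\<^esub> h \<otimes>\<^bsub>W\<^esub> s \<in> (s <#\<^bsub>W\<^esub> W0) #>\<^bsub>W\<^esub> s"
      using that by (auto simp: l_coset_def r_coset_def)
    then show ?thesis
      by (simp only: assms(7))
  qed
  have A: "(\<mu> (inv\<^bsub>W\<^esub> g) - \<mu> h) * (\<mu> (g \<otimes>\<^bsub>W\<^esub> h) - \<mu> g) = 0" if g: "g \<in> W0" and "g \<notin> K" and h: "h \<in> W0" for g h
  proof -
    have "g \<otimes>\<^bsub>W\<^esub> s \<noteq> s \<otimes>\<^bsub>W\<^esub> g"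
      using that by (simp add: K_def)
    from Cotlar_condition[OF assms(2,3,6) norm g this W0.mem_carrier[OF h]] show ?thesis
      using g h by (auto simp: \<mu>_def)
  qed
  have B: "\<mu> (g \<otimes>\<^bsub>W\<^esub> h) = \<mu> g * \<mu> h" if g: "g \<in> W0" "g \<in> K" and h: "h \<in> W0" for g h
  proof -
    have "inv\<^bsub>W\<^esub> g \<otimes>\<^bsub>W\<^esub> s \<otimes>\<^bsub>W\<^esub> g = inv\<^bsub>W\<^esub> g \<otimes>\<^bsub>W\<^esub> (g \<otimes>\<^bsub>W\<^esub> s)"
      using g sc by (simp add: K_def m_assoc)
    also have "\<dots> = s"
      using g sc by (simp add: m_assoc[symmetric])
    finally show ?thesis
      using sep_mult[of g h s] g h sc by (simp add: \<mu>_def)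
  qed
  have m_eq: "m (w i \<otimes>\<^bsub>W\<^esub> h) = \<mu> h" if i: "i \<in> {1..k}" and h: "h \<in> W0" for i h
  proof -
    have hc: "h \<in> carrier W"
      using h by simp
    show ?thesis
    proof (cases "sep h s = 1")
      case True
      then have "chamber W S h \<in> pos_root W S s"
        using word_length_greater[OF assms(6) hc] hc by (auto simp: pos_root_def)
      then show ?thesis
        using assms(11) i h hc True by (simp add: \<mu>_def)
    next
      case False
      then have sep: "sep h s = - 1"
        using sep_cases[of h s] by simp
      then have "chamber W S h \<in> neg_root W S s"
        using word_length_less[OF assms(6) hc] hc by (auto simp: neg_root_def)
      then show ?thesis
        using assms(12) i h hc sep by (simp add: \<mu>_def)
    qed
  qed
  have wc: "w i \<in> carrier W" if "i \<in> {1..k}" for i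
    using assms(8) that by blast
  have coset: "g \<in> w i <#\<^bsub>W\<^esub> W0 \<longleftrightarrow> inv\<^bsub>W\<^esub> (w i) \<otimes>\<^bsub>W\<^esub> g \<in> W0" if i: "i \<in> {1..k}" and g: "g \<in> carrier W" for i g
  proof
    assume "g \<in> w i <#\<^bsub>W\<^esub> W0"
    then obtain h where h: "h \<in> W0" "g = w i \<otimes>\<^bsub>W\<^esub> h"
      by (auto simp: l_coset_def)
    then show "inv\<^bsub>W\<^esub> (w i) \<otimes>\<^bsub>W\<^esub> g \<in> W0"
      using wc[OF i] by (simp add: inv_mult_cancel)
  next
    assume "inv\<^bsub>W\<^esub> (w i) \<otimes>\<^bsub>W\<^esub> g \<in> W0"
    moreover have "g = w i \<otimes>\<^bsub>W\<^esub> (inv\<^bsub>W\<^esub> (w i) \<otimes>\<^bsub>W\<^esub> g)"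
      using wc[OF i] g by (simp add: mult_inv_cancel)
    ultimately show "g \<in> w i <#\<^bsub>W\<^esub> W0"
      unfolding l_coset_def by blast
  qed
  have unique: "\<exists>!i. i \<in> {1..k} \<and> inv\<^bsub>W\<^esub> (w i) \<otimes>\<^bsub>W\<^esub> g \<in> W0" if g: "g \<in> carrier W" for g
  proof -
    have "g \<in> (\<Union>i\<in>{1..k}. w i <#\<^bsub>W\<^esub> W0)"
      using g assms(9) by simp
    then obtain i where i: "i \<in> {1..k}" "g \<in> w i <#\<^bsub>W\<^esub> W0"
      by (rule UN_E)
    show ?thesis
    proof (rule ex1I[of _ i])
      show "i \<in> {1..k} \<and> inv\<^bsub>W\<^esub> (w i) \<otimes>\<^bsub>W\<^esub> g \<in> W0"
        using i coset[OF i(1) g] by simp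
      fix j assume j: "j \<in> {1..k} \<and> inv\<^bsub>W\<^esub> (w j) \<otimes>\<^bsub>W\<^esub> g \<in> W0"
      then have "g \<in> w j <#\<^bsub>W\<^esub> W0"
        using coset[of j g] g by simp
      with i(2) have "(w i <#\<^bsub>W\<^esub> W0) \<inter> (w j <#\<^bsub>W\<^esub> W0) \<noteq> {}"
        by blast
      then show "j = i"
        using assms(10) i(1) j unfolding disjoint_family_on_def by blast
    qed
  qed
  \<comment> \<open>m is arbitrary off the carrier; setting it to 0 there makes it real and bounded
    by 1 everywhere, as interpolation and duality require.\<close>
  define m' where "m' g = (if g \<in> carrier W then m g else 0)" for g
  have m'_eq: "m' (w i \<otimes>\<^bsub>W\<^esub> h) = \<mu> h" if "i \<in> {1..k}" "h \<in> W0" for i h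
    using that wc[of i] m_eq by (simp add: m'_def)
  have m'_range: "m' g = 0 \<or> (\<exists>h. m' g = \<mu> h)" for g
  proof (cases "g \<in> carrier W")
    case True
    then obtain i where i: "i \<in> {1..k}" "inv\<^bsub>W\<^esub> (w i) \<otimes>\<^bsub>W\<^esub> g \<in> W0"
      using ex1_implies_ex[OF unique[OF True]] by (elim exE conjE)
    have "m' g = \<mu> (inv\<^bsub>W\<^esub> (w i) \<otimes>\<^bsub>W\<^esub> g)"
      using m'_eq[OF i] wc[OF i(1)] True by (simp add: mult_inv_cancel)
    then show ?thesis
      by blast
  qed (simp add: m'_def)
  have m'1: "cmod (m' g) \<le> 1" "cnj (m' g) = m' g" for g
    using m'_range[of g] \<mu> by auto
  have "\<exists>C. Tm_bounded UNIV m' C (2 ^ Suc n)" for n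
  proof -
    have "\<exists>C\<ge>0. Tm_bounded W0 \<mu> C (2 ^ Suc n)"
    proof (rule Cotlar_powers_of_2[OF assms(2) K \<mu>(1)])
      show "cnj (\<mu> g) = \<mu> g" for g
        by (rule \<mu>(2))
      show "\<mu> g * \<mu> g = 1" if "g \<in> W0" for g
        using \<mu>2 that by blast
    qed (use A B in blast)+
    then obtain C where C: "0 \<le> C" "Tm_bounded W0 \<mu> C (2 ^ Suc n)"
      by (elim exE conjE)
    have "(1::real) < 2 ^ Suc n"
      by (rule one_less_power) auto
    from Tm_bounded_cosets[OF assms(2) wc _ unique m'_eq C(2,1) this]
    show ?thesis
      by (intro exI) simp
  qed
  from Tm_bounded_of_powers_of_2[OF m'1 this p] obtain C where "Tm_bounded UNIV m' C p"
    by (rule exE)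
  then show "multiplier_bounded W p m"
    by (rule multiplier_bounded_of_Tm[OF p]) (simp add: m'_def)
qed

end
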